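(* Let $\mathbb{M}$ be a monster model of a complete $C$-minimal expansion of ACVF whose language contains a constant symbol $t$ with $v(t)>0$. Suppose $\mathbb{M}$ has characteristic $0$ and is definably complete. If $U\subseteq\mathbb{M}^n$ is definable and open and $f:U\to\mathbb{M}^m$ is definable, then there is a definable open subset $U_0\subseteq U$ such that $f$ is strictly differentiable on $U_0$ and $\dim(U\setminus U_0)<n$.
   Context: ACVF is the theory of algebraically closed non-trivially valued fields; $C$-minimal means every definable subset of the home sort is a finite boolean combination of balls and points. "Definable" means with parameters; $\mathbb{M}^n$ carries the product valuation topology, and for a tuple $c$, $v(c)=\min_i v(c_i)$. $\mathbb{M}$ is definably complete if every definable chain of balls whose radii approach $+\infty$ has non-empty intersection. $\dim$ of a definable set is its dp-rank (equivalently acl-dimension). $f$ is strictly differentiable at $a$ if there is a linear map $L:\mathbb{M}^n\to\mathbb{M}^m$ such that $v(f(x)-f(y)-L(x-y))-v(x-y)\to+\infty$ as $(x,y)\to(a,a)$ with $x\neq y$; strictly differentiable on $U_0$ means at every point of $U_0$. *)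

theory Defs
  imports
    "HOL-Analysis.Product_Topology"
    "HOL-Computational_Algebra.Polynomial"
    "HOL-Library.Extended"
    "HOL-Library.Extended_Real"
    "Jordan_Normal_Form.Matrix"
begin

text \<open>
  Conventions. A structure has a whole type \<open>'a\<close> as its (single) home sort. The language has one
  function symbol for each element of \<open>'f\<close> (constants being the symbols of arity 0) and one relation
  symbol for each element of \<open>'r\<close>. The complete theory under consideration is always
  the full theory of the given structure. The power \<open>M\<^sup>n\<close> is \<open>carrier_vec n\<close>.
\<close>

section \<open>First-order structures and definability\<close>

record ('f, 'r, 'a) fo_structure =
  farity :: "'f \<Rightarrow> nat"
  rarity :: "'r \<Rightarrow> nat"
  fint :: "'f \<Rightarrow> 'a list \<Rightarrow> 'a"
  rint :: "'r \<Rightarrow> 'a list \<Rightarrow> bool"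

datatype 'f trm = Var nat | App 'f "'f trm list"

datatype ('f, 'r) fm =
    Falsum
  | Equal "'f trm" "'f trm"
  | Atom 'r "'f trm list"
  | Imp "('f, 'r) fm" "('f, 'r) fm"
  | Exists nat "('f, 'r) fm"

primrec wf_trm :: "('f, 'r, 'a) fo_structure \<Rightarrow> 'f trm \<Rightarrow> bool" where
  "wf_trm M (Var i) = True"
| "wf_trm M (App g ts) = (length ts = farity M g \<and> (\<forall>b \<in> set (map (wf_trm M) ts). b))"

primrec wf_fm :: "('f, 'r, 'a) fo_structure \<Rightarrow> ('f, 'r) fm \<Rightarrow> bool" where
  "wf_fm M Falsum = True"
| "wf_fm M (Equal s u) = (wf_trm M s \<and> wf_trm M u)"
| "wf_fm M (Atom r ts) = (length ts = rarity M r \<and> list_all (wf_trm M) ts)"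
| "wf_fm M (Imp \<phi> \<psi>) = (wf_fm M \<phi> \<and> wf_fm M \<psi>)"
| "wf_fm M (Exists i \<phi>) = wf_fm M \<phi>"

primrec eval_trm :: "('f, 'r, 'a) fo_structure \<Rightarrow> (nat \<Rightarrow> 'a) \<Rightarrow> 'f trm \<Rightarrow> 'a" where
  "eval_trm M e (Var i) = e i"
| "eval_trm M e (App g ts) = fint M g (map (eval_trm M e) ts)"

primrec sat :: "('f, 'r, 'a) fo_structure \<Rightarrow> (nat \<Rightarrow> 'a) \<Rightarrow> ('f, 'r) fm \<Rightarrow> bool" where
  "sat M e Falsum = False"
| "sat M e (Equal s u) = (eval_trm M e s = eval_trm M e u)"
| "sat M e (Atom r ts) = rint M r (map (eval_trm M e) ts)"
| "sat M e (Imp \<phi> \<psi>) = (sat M e \<phi> \<longrightarrow> sat M e \<psi>)"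
| "sat M e (Exists i \<phi>) = (\<exists>a. sat M (e(i := a)) \<phi>)"

text \<open>
  The first \<open>dim_vec x\<close> variables stand for the coordinates of \<open>x\<close>; the values of the remaining
  variables under \<open>e\<close> serve as parameters.
\<close>

definition assign :: "'a vec \<Rightarrow> (nat \<Rightarrow> 'a) \<Rightarrow> nat \<Rightarrow> 'a" where
  "assign x e = (\<lambda>i. if i < dim_vec x then x $ i else e i)"

definition definable :: "('f, 'r, 'a) fo_structure \<Rightarrow> nat \<Rightarrow> 'a vec set \<Rightarrow> bool" where
  "definable M n X \<longleftrightarrow>
     (\<exists>\<phi> e. wf_fm M \<phi> \<and> X = {x \<in> carrier_vec n. sat M (assign x e) \<phi>})"

definition definable_home :: "('f, 'r, 'a) fo_structure \<Rightarrow> 'a set \<Rightarrow> bool" where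
  "definable_home M X \<longleftrightarrow> definable M 1 {x \<in> carrier_vec 1. x $ 0 \<in> X}"

definition definable_map ::
    "('f, 'r, 'a::zero) fo_structure \<Rightarrow> nat \<Rightarrow> nat \<Rightarrow> 'a vec set \<Rightarrow> ('a vec \<Rightarrow> 'a vec) \<Rightarrow> bool" where
  "definable_map M n m U f \<longleftrightarrow>
     f \<in> U \<rightarrow> carrier_vec m \<and> definable M (n + m) ((\<lambda>x. x @\<^sub>v f x) ` U)"

text \<open>
  A set of subsets of the home sort is definable (interpretable) if it consists of the fibres of
  a definable relation over a definable index set.
\<close>

definition definable_family :: "('f, 'r, 'a) fo_structure \<Rightarrow> 'a set set \<Rightarrow> bool" where
  "definable_family M \<B> \<longleftrightarrow>
     (\<exists>k D R. definable M k D \<and> definable M (Suc k) R \<and> \<B> = (\<lambda>b. {a. vCons a b \<in> R}) ` D)"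


section \<open>Monster models\<close>

context includes cardinal_syntax
begin

text \<open>
  Assignments with range in \<open>A\<close> supply the parameters. For empty \<open>A\<close> there are none; nothing is
  lost by this, as one may always enlarge \<open>A\<close> by one point.
\<close>

definition kappa_saturated :: "'k rel \<Rightarrow> ('f, 'r, 'a) fo_structure \<Rightarrow> bool" where
  "kappa_saturated \<kappa> M \<longleftrightarrow>
     (\<forall>A :: 'a set. |A| <o \<kappa> \<longrightarrow>
       (\<forall>p \<subseteq> {(\<phi>, e). wf_fm M \<phi> \<and> range e \<subseteq> A}.
          (\<forall>q \<subseteq> p. finite q \<longrightarrow> (\<exists>a. \<forall>(\<phi>, e) \<in> q. sat M (e(0 := a)) \<phi>)) \<longrightarrow>
          (\<exists>a. \<forall>(\<phi>, e) \<in> p. sat M (e(0 := a)) \<phi>)))"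

definition partial_elementary ::
    "('f, 'r, 'a) fo_structure \<Rightarrow> 'a set \<Rightarrow> ('a \<Rightarrow> 'a) \<Rightarrow> bool" where
  "partial_elementary M A g \<longleftrightarrow>
     (\<forall>\<phi> e. wf_fm M \<phi> \<and> range e \<subseteq> A \<longrightarrow> (sat M (g \<circ> e) \<phi> \<longleftrightarrow> sat M e \<phi>))"

definition automorphism :: "('f, 'r, 'a) fo_structure \<Rightarrow> ('a \<Rightarrow> 'a) \<Rightarrow> bool" where
  "automorphism M \<sigma> \<longleftrightarrow> bij \<sigma> \<and>
     (\<forall>g xs. length xs = farity M g \<longrightarrow> \<sigma> (fint M g xs) = fint M g (map \<sigma> xs)) \<and>
     (\<forall>r xs. length xs = rarity M r \<longrightarrow> (rint M r (map \<sigma> xs) \<longleftrightarrow> rint M r xs))"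

definition strongly_kappa_homogeneous :: "'k rel \<Rightarrow> ('f, 'r, 'a) fo_structure \<Rightarrow> bool" where
  "strongly_kappa_homogeneous \<kappa> M \<longleftrightarrow>
     (\<forall>(A :: 'a set) g. |A| <o \<kappa> \<and> partial_elementary M A g \<longrightarrow>
        (\<exists>\<sigma>. automorphism M \<sigma> \<and> (\<forall>a\<in>A. \<sigma> a = g a)))"

text \<open>
  The cardinal \<open>\<kappa>\<close> is uncountable and larger than the language. It lives on \<open>'a\<close>
  without loss of generality, because an infinite \<open>\<kappa>\<close>-saturated structure has at least
  \<open>\<kappa>\<close> elements.
\<close>

definition monster_model :: "('f, 'r, 'a) fo_structure \<Rightarrow> bool" where
  "monster_model M \<longleftrightarrow>
     (\<exists>\<kappa> :: 'a rel. Card_order \<kappa> \<and> natLeq <o \<kappa> \<and>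
        |UNIV :: 'f set| <o \<kappa> \<and> |UNIV :: 'r set| <o \<kappa> \<and>
        kappa_saturated \<kappa> M \<and> strongly_kappa_homogeneous \<kappa> M)"

end


section \<open>Dimension\<close>

text \<open>
  An ict-pattern of depth \<open>k\<close> in \<open>X\<close> consists of formulas \<open>\<phi> 0, \<dots>, \<phi> (k - 1)\<close> and parameters
  \<open>b \<alpha> i\<close> such that for each path \<open>\<eta>\<close> the set of formulas
  \<open>{\<phi> \<alpha> (x, b \<alpha> (\<eta> \<alpha>))} \<union> {\<not> \<phi> \<alpha> (x, b \<alpha> i) | i \<noteq> \<eta> \<alpha>}\<close> is consistent with \<open>x \<in> X\<close>.
  In a monster model and for definable \<open>X\<close>, consistent means realized by some element of \<open>X\<close>.
\<close>

definition ict_pattern :: "('f, 'r, 'a) fo_structure \<Rightarrow> 'a vec set \<Rightarrow> nat \<Rightarrow> bool" where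
  "ict_pattern M X k \<longleftrightarrow>
     (\<exists>(\<phi> :: nat \<Rightarrow> ('f, 'r) fm) (b :: nat \<Rightarrow> nat \<Rightarrow> nat \<Rightarrow> 'a).
        (\<forall>\<alpha><k. wf_fm M (\<phi> \<alpha>)) \<and>
        (\<forall>\<eta> :: nat \<Rightarrow> nat. \<exists>x\<in>X. \<forall>\<alpha><k. \<forall>i. sat M (assign x (b \<alpha> i)) (\<phi> \<alpha>) \<longleftrightarrow> i = \<eta> \<alpha>))"

text \<open>
  The empty set has dp-rank \<open>-\<infinity>\<close>, since a pattern of depth 0 exists exactly in nonempty sets.
  All infinite dp-ranks are identified with \<open>\<infinity>\<close>.
\<close>

definition dp_rank :: "('f, 'r, 'a) fo_structure \<Rightarrow> 'a vec set \<Rightarrow> ereal" where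
  "dp_rank M X = Sup {ereal (real k) | k. ict_pattern M X k}"


section \<open>Valued fields\<close>

text \<open>
  Valuations are additive. The value group is all of \<open>'g\<close>, \<open>Pinf\<close> is the value of 0,
  and \<open>Minf\<close> is never attained.
\<close>

definition valuation :: "('a::field \<Rightarrow> 'g::linordered_ab_group_add extended) \<Rightarrow> bool" where
  "valuation v \<longleftrightarrow>
     (\<forall>x. v x = Pinf \<longleftrightarrow> x = 0) \<and>
     (\<forall>x y. v (x * y) = v x + v y) \<and>
     (\<forall>x y. min (v x) (v y) \<le> v (x + y)) \<and>
     range v = insert Pinf (range Fin)"

definition nontrivial_valuation ::
    "('a::field \<Rightarrow> 'g::linordered_ab_group_add extended) \<Rightarrow> bool" where
  "nontrivial_valuation v \<longleftrightarrow> (\<exists>x. x \<noteq> 0 \<and> v x \<noteq> 0)"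

text \<open>
  The structure is an expansion of an algebraically closed non-trivially valued field, in the
  one-sorted language of rings with a relation symbol for \<open>v x \<le> v y\<close>.
\<close>

definition acvf_expansion ::
    "('f, 'r, 'a::alg_closed_field) fo_structure \<Rightarrow> ('a \<Rightarrow> 'g::linordered_ab_group_add extended) \<Rightarrow> bool" where
  "acvf_expansion M v \<longleftrightarrow>
     valuation v \<and> nontrivial_valuation v \<and>
     (\<exists>c. farity M c = 0 \<and> fint M c [] = 0) \<and>
     (\<exists>c. farity M c = 0 \<and> fint M c [] = 1) \<and>
     (\<exists>g. farity M g = 2 \<and> (\<forall>x y. fint M g [x, y] = x + y)) \<and>
     (\<exists>g. farity M g = 1 \<and> (\<forall>x. fint M g [x] = - x)) \<and>
     (\<exists>g. farity M g = 2 \<and> (\<forall>x y. fint M g [x, y] = x * y)) \<and>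
     (\<exists>r. rarity M r = 2 \<and> (\<forall>x y. rint M r [x, y] \<longleftrightarrow> v x \<le> v y))"

definition closed_ball :: "('a::field \<Rightarrow> 'g::linordered_ab_group_add extended) \<Rightarrow> 'a \<Rightarrow> 'g \<Rightarrow> 'a set" where
  "closed_ball v c \<gamma> = {x. Fin \<gamma> \<le> v (x - c)}"

definition open_ball :: "('a::field \<Rightarrow> 'g::linordered_ab_group_add extended) \<Rightarrow> 'a \<Rightarrow> 'g \<Rightarrow> 'a set" where
  "open_ball v c \<gamma> = {x. Fin \<gamma> < v (x - c)}"

definition ball_of_radius ::
    "('a::field \<Rightarrow> 'g::linordered_ab_group_add extended) \<Rightarrow> 'g \<Rightarrow> 'a set \<Rightarrow> bool" where
  "ball_of_radius v \<gamma> B \<longleftrightarrow> (\<exists>c. B = closed_ball v c \<gamma> \<or> B = open_ball v c \<gamma>)"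

inductive_set boolean_combinations :: "'a set set \<Rightarrow> 'a set set" for \<G> where
  generator: "X \<in> \<G> \<Longrightarrow> X \<in> boolean_combinations \<G>"
| complement: "X \<in> boolean_combinations \<G> \<Longrightarrow> - X \<in> boolean_combinations \<G>"
| union: "X \<in> boolean_combinations \<G> \<Longrightarrow> Y \<in> boolean_combinations \<G> \<Longrightarrow>
    X \<union> Y \<in> boolean_combinations \<G>"

definition C_minimal ::
    "('f, 'r, 'a::field) fo_structure \<Rightarrow> ('a \<Rightarrow> 'g::linordered_ab_group_add extended) \<Rightarrow> bool" where
  "C_minimal M v \<longleftrightarrow>
     (\<forall>X. definable_home M X \<longrightarrow>
        X \<in> boolean_combinations ({B. \<exists>\<gamma>. ball_of_radius v \<gamma> B} \<union> {{a} | a. True}))"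

definition definably_complete ::
    "('f, 'r, 'a::field) fo_structure \<Rightarrow> ('a \<Rightarrow> 'g::linordered_ab_group_add extended) \<Rightarrow> bool" where
  "definably_complete M v \<longleftrightarrow>
     (\<forall>\<B>. definable_family M \<B> \<and> chain_subset \<B> \<and>
        (\<forall>B\<in>\<B>. \<exists>\<gamma>. ball_of_radius v \<gamma> B) \<and>
        (\<forall>\<delta>. \<exists>B\<in>\<B>. \<exists>\<gamma>>\<delta>. ball_of_radius v \<gamma> B) \<longrightarrow>
        \<Inter>\<B> \<noteq> {})"

definition valuation_topology ::
    "('a::field \<Rightarrow> 'g::linordered_ab_group_add extended) \<Rightarrow> 'a topology" where
  "valuation_topology v = topology (\<lambda>U. \<forall>a\<in>U. \<exists>\<gamma>. open_ball v a \<gamma> \<subseteq> U)"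

lemma openin_valuation_topology:
  "openin (valuation_topology v) U \<longleftrightarrow> (\<forall>a\<in>U. \<exists>\<gamma>. open_ball v a \<gamma> \<subseteq> U)"
proof -
  have "istopology (\<lambda>U. \<forall>a\<in>U. \<exists>\<gamma>. open_ball v a \<gamma> \<subseteq> U)"
    unfolding istopology_def
  proof (intro conjI allI impI ballI)
    fix S T a
    assume S: "\<forall>a\<in>S. \<exists>\<gamma>. open_ball v a \<gamma> \<subseteq> S" and T: "\<forall>a\<in>T. \<exists>\<gamma>. open_ball v a \<gamma> \<subseteq> T"
      and a: "a \<in> S \<inter> T"
    then obtain \<gamma> \<delta> where "open_ball v a \<gamma> \<subseteq> S" "open_ball v a \<delta> \<subseteq> T"
      by blast
    moreover have "open_ball v a (max \<gamma> \<delta>) \<subseteq> open_ball v a \<gamma> \<inter> open_ball v a \<delta>"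
      unfolding open_ball_def
      by (auto intro: le_less_trans[rotated] simp: less_eq_extended.simps)
    ultimately show "\<exists>\<gamma>. open_ball v a \<gamma> \<subseteq> S \<inter> T"
      by blast
  next
    fix \<K> a
    assume "\<forall>K\<in>\<K>. \<forall>a\<in>K. \<exists>\<gamma>. open_ball v a \<gamma> \<subseteq> K" and "a \<in> \<Union>\<K>"
    then show "\<exists>\<gamma>. open_ball v a \<gamma> \<subseteq> \<Union>\<K>"
      by (meson UnionE Union_upper subset_trans)
  qed
  then show ?thesis
    by (simp add: valuation_topology_def topology_inverse')
qed

definition open_vec ::
    "('a::field \<Rightarrow> 'g::linordered_ab_group_add extended) \<Rightarrow> nat \<Rightarrow> 'a vec set \<Rightarrow> bool" where
  "open_vec v n U \<longleftrightarrow> U \<subseteq> carrier_vec n \<and>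
     openin (product_topology (\<lambda>_. valuation_topology v) {..<n})
       ((\<lambda>x. restrict (vec_index x) {..<n}) ` U)"

text \<open>Inserting \<open>Pinf\<close> only matters for the empty tuple.\<close>

definition val_vec :: "('a::field \<Rightarrow> 'g::linordered_ab_group_add extended) \<Rightarrow> 'a vec \<Rightarrow> 'g extended" where
  "val_vec v c = Min (insert Pinf ((\<lambda>i. v (c $ i)) ` {..<dim_vec c}))"


section \<open>Strict differentiability\<close>

definition linear_vec_map :: "nat \<Rightarrow> nat \<Rightarrow> ('a::field vec \<Rightarrow> 'a vec) \<Rightarrow> bool" where
  "linear_vec_map n m L \<longleftrightarrow>
     L \<in> carrier_vec n \<rightarrow> carrier_vec m \<and>
     (\<forall>x\<in>carrier_vec n. \<forall>y\<in>carrier_vec n. L (x + y) = L x + L y) \<and>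
     (\<forall>c. \<forall>x\<in>carrier_vec n. L (c \<cdot>\<^sub>v x) = c \<cdot>\<^sub>v L x)"

text \<open>
  The map is defined on \<open>U\<close>, so \<open>x\<close> and \<open>y\<close> range over \<open>U\<close>. For \<open>x \<noteq> y\<close> the value
  \<open>val_vec v (x - y)\<close> lies in the value group, so the difference of values is meaningful
  (and \<open>Pinf\<close> if the minuend is).
\<close>

definition strictly_differentiable_at ::
    "('a::field \<Rightarrow> 'g::linordered_ab_group_add extended) \<Rightarrow> nat \<Rightarrow> nat \<Rightarrow> 'a vec set \<Rightarrow>
     ('a vec \<Rightarrow> 'a vec) \<Rightarrow> 'a vec \<Rightarrow> bool" where
  "strictly_differentiable_at v n m U f a \<longleftrightarrow>
     (\<exists>L. linear_vec_map n m L \<and>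
        (\<forall>\<gamma>. \<exists>\<delta>. \<forall>x\<in>U. \<forall>y\<in>U.
           x \<noteq> y \<and> Fin \<delta> < val_vec v (x - a) \<and> Fin \<delta> < val_vec v (y - a) \<longrightarrow>
           Fin \<gamma> < val_vec v (f x - f y - L (x - y)) - val_vec v (x - y)))"

end

theory Submission
  imports Defs "HOL-Library.Ramsey"
begin

text \<open>
  By C-minimality and saturation, the number of balls needed to describe a definable subset of the
  field is bounded in definable families. This makes definable functions into the value group
  locally constant at generic points and germs at 0 with values in the residue field constant.
  For a germ of leading terms (elements of the multiplicative group modulo principal units) the
  valuation is eventually constant or tends to plus or minus infinity; together with definable
  completeness, every definable unary germ has a limit in the projective line. It follows that
  definable functions are continuous at generic points, and that a limit for increments tending
  to 0 at a generic point is a joint limit in the base point and the increment.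

  If a difference quotient diverged at a generic point, then, in characteristic 0, the ratio of the
  increments of the function for \<open>n \<eta>\<close> and \<open>\<eta>\<close> would tend to \<open>n\<close>, so that the leading term of the
  quotient would not change if \<open>\<eta>\<close> is multiplied by a natural number. This forces its valuation to
  be constant. Hence the partial quotients converge jointly at generic points, which yields strict
  differentiability on the interior of a definable set that contains all of them.

  A definable set without generic points has dp-rank less than \<open>n\<close>: an ict-pattern of depth \<open>n\<close>
  gives \<open>n\<close> mutually indiscernible sequences; each of \<open>n - 1\<close> coordinates of a realization
  spoils the indiscernibility of at most one of them, and the last coordinate, being algebraic over
  the others, cannot separate two members of a remaining sequence.
\<close>

section \<open>Definable predicates on assignments\<close>

text \<open>The role of characteristic 0: in characteristic p, taking p-th roots is a definable
  additive map whose difference quotient diverges everywhere.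

  Neither the value group nor the residue field nor the group of leading terms is a sort. Functions
  into them are represented by field elements chosen freely in each class, and definability is asked
  only of the class.

  The main obstacle is a function into the value group that approaches a value without reaching it.
  What is available is that definable subsets of the field have finitely many critical radii around
  0. Such an approach is excluded because, on passing from \<open>x\<close> to
  \<open>\<pi> * x\<close>, the valuation of a germ of leading terms changes by an eventually
  constant amount.

  Genericity demands that each coordinate is not algebraic over all the others. In this symmetric
  form no exchange property is involved: coordinates can be moved to the parameters in any order,
  and a point that is not generic has one coordinate algebraic over the \<open>n - 1\<close> others,
  as the count for dp-rank requires.\<close>

primrec ren_trm :: "(nat \<Rightarrow> nat) \<Rightarrow> 'f trm \<Rightarrow> 'f trm" where
  "ren_trm r (Var i) = Var (r i)"
| "ren_trm r (App g ts) = App g (map (ren_trm r) ts)"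

lemma wf_ren_trm: "wf_trm M (ren_trm r t) = wf_trm M t"
  by (induction t) auto

lemma eval_ren_trm: "eval_trm M e (ren_trm r t) = eval_trm M (\<lambda>i. e (r i)) t"
  by (induction t) (auto simp: comp_def cong: map_cong)

lemma eval_trm_support: "\<exists>n. \<forall>e e'. (\<forall>i<n. e i = e' i) \<longrightarrow> eval_trm M e t = eval_trm M e' t"
proof (induction t)
  case (Var i)
  show ?case by (rule exI[of _ "Suc i"]) auto
next
  case (App g ts)
  then obtain n where n: "\<And>t e e'. t \<in> set ts \<Longrightarrow> \<forall>i<n t. e i = e' i \<Longrightarrow> eval_trm M e t = eval_trm M e' t"
    by metis
  have "eval_trm M e (App g ts) = eval_trm M e' (App g ts)"
    if "\<forall>i<Max (insert 0 (n ` set ts)). e i = e' i" for e e'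
  proof -
    have "eval_trm M e t = eval_trm M e' t" if t: "t \<in> set ts" for t
    proof (rule n[OF t])
      have "n t \<le> Max (insert 0 (n ` set ts))"
        using t by (intro Max_ge) auto
      then show "\<forall>i<n t. e i = e' i"
        using \<open>\<forall>i<Max (insert 0 (n ` set ts)). e i = e' i\<close> by auto
    qed
    then show ?thesis
      by (simp cong: map_cong)
  qed
  then show ?case
    by blast
qed

lemma eval_trms_support:
  fixes M :: "('f, 'r, 'a) fo_structure"
  shows "\<exists>n. \<forall>e e'. (\<forall>i<n. e i = e' i) \<longrightarrow> map (eval_trm M e) ts = map (eval_trm M e') ts"
proof (induction ts)
  case (Cons t ts)
  obtain n where n: "\<forall>e e'. (\<forall>i<n. e i = e' i) \<longrightarrow> eval_trm M e t = eval_trm M e' t"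
    using eval_trm_support by blast
  obtain m where m: "\<forall>e e'. (\<forall>i<m. e i = e' i) \<longrightarrow> map (eval_trm M e) ts = map (eval_trm M e') ts"
    using Cons by blast
  show ?case
  proof (rule exI[of _ "max n m"], intro allI impI)
    fix e e' :: "nat \<Rightarrow> 'a"
    assume "\<forall>i<max n m. e i = e' i"
    then show "map (eval_trm M e) (t # ts) = map (eval_trm M e') (t # ts)"
      using n m by auto
  qed
qed auto

lemma sat_support: "\<exists>n. \<forall>e e'. (\<forall>i<n. e i = e' i) \<longrightarrow> sat M e \<phi> = sat M e' \<phi>"
proof (induction \<phi>)
  case Falsum
  then show ?case by simp
next
  case (Equal s u)
  obtain n where n: "\<forall>e e'. (\<forall>i<n. e i = e' i) \<longrightarrow> map (eval_trm M e) [s, u] = map (eval_trm M e') [s, u]"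
    using eval_trms_support by blast
  then show ?case by (intro exI[of _ n]) (simp, metis)
next
  case (Atom r ts)
  obtain n where n: "\<forall>e e'. (\<forall>i<n. e i = e' i) \<longrightarrow> map (eval_trm M e) ts = map (eval_trm M e') ts"
    using eval_trms_support by blast
  then show ?case by (intro exI[of _ n]) (simp only: sat.simps, metis)
next
  case (Imp \<phi> \<psi>)
  then obtain n m where n: "\<And>e e'. (\<forall>i<n. e i = e' i) \<Longrightarrow> sat M e \<phi> = sat M e' \<phi>"
    and m: "\<And>e e'. (\<forall>i<m. e i = e' i) \<Longrightarrow> sat M e \<psi> = sat M e' \<psi>" by blast
  have "sat M e (Imp \<phi> \<psi>) = sat M e' (Imp \<phi> \<psi>)" if "\<forall>i<max n m. e i = e' i" for e e'
    using n[of e e'] m[of e e'] that by simp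
  then show ?case by blast
next
  case (Exists j \<phi>)
  then obtain n where n: "\<forall>e e'. (\<forall>i<n. e i = e' i) \<longrightarrow> sat M e \<phi> = sat M e' \<phi>" by blast
  have *: "sat M (e(j := a)) \<phi> = sat M (e'(j := a)) \<phi>" if "\<forall>i<n. e i = e' i" for e e' a
    using that by (intro n[rule_format]) auto
  have "sat M e (Exists j \<phi>) = sat M e' (Exists j \<phi>)" if "\<forall>i<n. e i = e' i" for e e'
    using *[OF that] by simp
  then show ?case by blast
qed

lemma sat_rename:
  "wf_fm M \<phi> \<Longrightarrow> \<exists>\<psi>. wf_fm M \<psi> \<and> (\<forall>e. sat M e \<psi> \<longleftrightarrow> sat M (\<lambda>i. e (r i)) \<phi>)"
proof (induction \<phi> arbitrary: r)
  case Falsum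
  then show ?case by (intro exI[of _ Falsum]) auto
next
  case (Equal s u)
  then show ?case
    by (intro exI[of _ "Equal (ren_trm r s) (ren_trm r u)"]) (auto simp: wf_ren_trm eval_ren_trm comp_def)
next
  case (Atom q ts)
  then show ?case
    by (intro exI[of _ "Atom q (map (ren_trm r) ts)"])
      (auto simp: wf_ren_trm eval_ren_trm list_all_iff comp_def)
next
  case (Imp \<phi> \<psi>)
  then obtain \<phi>' \<psi>' where "wf_fm M \<phi>'" "\<forall>e. sat M e \<phi>' \<longleftrightarrow> sat M (\<lambda>i. e (r i)) \<phi>"
    "wf_fm M \<psi>'" "\<forall>e. sat M e \<psi>' \<longleftrightarrow> sat M (\<lambda>i. e (r i)) \<psi>" by fastforce
  then show ?case by (intro exI[of _ "Imp \<phi>' \<psi>'"]) auto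
next
  case (Exists i \<phi>)
  obtain n where n: "\<And>e e'. (\<forall>i<n. e i = e' i) \<Longrightarrow> sat M e \<phi> = sat M e' \<phi>"
    using sat_support by blast
  \<comment> \<open>\<open>r\<close> need not be injective, so the bound variable gets a new name
    \<open>j\<close> to which no variable in the support of \<open>\<phi>\<close> is sent; otherwise
    it could capture one of them.\<close>
  obtain j where j: "j \<notin> r ` {..<n}"
    using ex_new_if_finite[of "r ` {..<n}"] by auto
  from Exists obtain \<psi> where \<psi>: "wf_fm M \<psi>" "\<forall>e. sat M e \<psi> \<longleftrightarrow> sat M (\<lambda>k. e ((r(i := j)) k)) \<phi>"
    by (metis wf_fm.simps(5))
  have "sat M (\<lambda>k. (e(j := a)) ((r(i := j)) k)) \<phi> = sat M ((\<lambda>i. e (r i))(i := a)) \<phi>" for e a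
    by (rule n) (use j in auto)
  with \<psi> show ?case
    by (intro exI[of _ "Exists j \<psi>"]) auto
qed

text \<open>Both halves are infinite, so neither the number of free variables nor that of parameters
  has to be fixed in advance.\<close>

definition ilv :: "(nat \<Rightarrow> 'a) \<Rightarrow> (nat \<Rightarrow> 'a) \<Rightarrow> nat \<Rightarrow> 'a" where
  "ilv e p k = (if even k then e (k div 2) else p (k div 2))"

lemma ilv_even [simp]: "ilv e p (2 * i) = e i"
  and ilv_odd [simp]: "ilv e p (Suc (2 * i)) = p i"
  by (simp_all add: ilv_def)

lemma ilv_four [simp]: "ilv e p (Suc (4 * i)) = p (2 * i)"
  "ilv e p (Suc (Suc (Suc (4 * i)))) = p (Suc (2 * i))"
  using ilv_odd[of e p "2 * i"] ilv_odd[of e p "Suc (2 * i)"] by simp_all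

lemma ilv_compI:
  assumes "\<And>i. h (r (2 * i)) = e i" "\<And>i. h (r (Suc (2 * i))) = p i"
  shows "(\<lambda>i. h (r i)) = ilv e p"
proof
  fix i
  show "h (r i) = ilv e p i"
    by (cases "even i"; elim evenE oddE) (simp_all add: assms)
qed

locale fo_language =
  fixes M :: "('f, 'r, 'a::zero) fo_structure" and \<pi> :: 'a
begin

text \<open>
  The even variables of the formula are free, the odd ones carry parameters from \<open>A\<close>. The
  elements \<open>0\<close> and \<open>\<pi>\<close> are always allowed; \<open>\<pi>\<close> will be an element of positive valuation.
\<close>

definition D :: "'a set \<Rightarrow> ((nat \<Rightarrow> 'a) \<Rightarrow> bool) \<Rightarrow> bool" where
  "D A P \<longleftrightarrow> (\<exists>\<phi> p. wf_fm M \<phi> \<and> range p \<subseteq> insert 0 (insert \<pi> A) \<and> (\<forall>e. P e \<longleftrightarrow> sat M (ilv e p) \<phi>))"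

lemma D_mono: "D A P \<Longrightarrow> A \<subseteq> B \<Longrightarrow> D B P"
  unfolding D_def by blast

lemma D_support:
  assumes "D A P"
  obtains n where "\<And>e e'. (\<And>i. i < n \<Longrightarrow> e i = e' i) \<Longrightarrow> P e = P e'"
proof -
  obtain \<phi> p where P: "\<And>e. P e \<longleftrightarrow> sat M (ilv e p) \<phi>"
    using assms unfolding D_def by blast
  obtain n where n: "\<And>e e'. (\<forall>i<n. e i = e' i) \<Longrightarrow> sat M e \<phi> = sat M e' \<phi>"
    using sat_support by blast
  have "P e = P e'" if "\<And>i. i < n \<Longrightarrow> e i = e' i" for e e'
    unfolding P by (rule n) (use that in \<open>auto simp: ilv_def\<close>)
  then show thesis
    by (rule that)
qed

lemma D_subst_atomic:
  assumes "D A P"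
    and \<sigma>: "\<And>i. (\<exists>k. \<sigma> i = (\<lambda>e. e k)) \<or> (\<exists>a \<in> insert 0 (insert \<pi> A). \<sigma> i = (\<lambda>e. a))"
  shows "D A (\<lambda>e. P (\<lambda>i. \<sigma> i e))"
proof -
  obtain \<phi> p where \<phi>: "wf_fm M \<phi>" "range p \<subseteq> insert 0 (insert \<pi> A)" and P: "\<And>e. P e \<longleftrightarrow> sat M (ilv e p) \<phi>"
    using assms unfolding D_def by blast
  define V where "V i \<longleftrightarrow> (\<exists>k. \<sigma> i = (\<lambda>e. e k))" for i
  have "\<exists>k. V i \<longrightarrow> \<sigma> i = (\<lambda>e. e k)" for i by (auto simp: V_def)
  then obtain kk where kk: "\<And>i. V i \<Longrightarrow> \<sigma> i = (\<lambda>e. e (kk i))" by metis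
  have "\<exists>a. a \<in> insert 0 (insert \<pi> A) \<and> (\<not> V i \<longrightarrow> \<sigma> i = (\<lambda>e. a))" for i
    using \<sigma>[of i] unfolding V_def by blast
  then obtain c where c: "\<And>i. c i \<in> insert 0 (insert \<pi> A)" "\<And>i. \<not> V i \<Longrightarrow> \<sigma> i = (\<lambda>e. c i)" by metis
  \<comment> \<open>The new constants join the old parameters by a second interleaving: the old ones
    end up at positions \<open>4 * i + 1\<close>, the new ones at \<open>4 * i + 3\<close>.\<close>
  define q where "q = ilv p c"
  define r where "r k = (if even k then (if V (k div 2) then 2 * kk (k div 2) else Suc (2 * Suc (2 * (k div 2))))
    else Suc (2 * (2 * (k div 2))))" for k
  obtain \<psi> where \<psi>: "wf_fm M \<psi>" "\<And>e. sat M e \<psi> \<longleftrightarrow> sat M (\<lambda>i. e (r i)) \<phi>"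
    using sat_rename[OF \<phi>(1)] by blast
  have "(\<lambda>i. ilv e q (r i)) = ilv (\<lambda>i. \<sigma> i e) p" for e
    by (rule ilv_compI) (auto simp: r_def q_def kk c(2))
  moreover have "range q \<subseteq> insert 0 (insert \<pi> A)"
    using \<phi>(2) c(1) unfolding q_def ilv_def by auto
  ultimately show ?thesis
    unfolding D_def using \<psi> P by (intro exI[of _ \<psi>] exI[of _ q]) auto
qed

lemma D_rename: "D A P \<Longrightarrow> D A (\<lambda>e. P (\<lambda>i. e (r i)))"
  by (rule D_subst_atomic[where \<sigma> = "\<lambda>i e. e (r i)"]) auto

lemma D_False [intro!, simp]: "D A (\<lambda>e. False)"
  unfolding D_def by (intro exI[of _ Falsum] exI[of _ "\<lambda>_. 0"]) auto

lemma D_imp: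
  assumes "D A P" "D A Q"
  shows "D A (\<lambda>e. P e \<longrightarrow> Q e)"
proof -
  obtain \<phi> p where \<phi>: "wf_fm M \<phi>" "range p \<subseteq> insert 0 (insert \<pi> A)" and P: "\<And>e. P e \<longleftrightarrow> sat M (ilv e p) \<phi>"
    using assms(1) unfolding D_def by blast
  obtain \<psi> q where \<psi>: "wf_fm M \<psi>" "range q \<subseteq> insert 0 (insert \<pi> A)" and Q: "\<And>e. Q e \<longleftrightarrow> sat M (ilv e q) \<psi>"
    using assms(2) unfolding D_def by blast
  define r where "r k = (if even k then k else Suc (2 * (2 * (k div 2))))" for k :: nat
  define s where "s k = (if even k then k else Suc (2 * Suc (2 * (k div 2))))" for k :: nat
  obtain \<phi>' where \<phi>': "wf_fm M \<phi>'" "\<And>e. sat M e \<phi>' \<longleftrightarrow> sat M (\<lambda>i. e (r i)) \<phi>"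
    using sat_rename[OF \<phi>(1)] by blast
  obtain \<psi>' where \<psi>': "wf_fm M \<psi>'" "\<And>e. sat M e \<psi>' \<longleftrightarrow> sat M (\<lambda>i. e (s i)) \<psi>"
    using sat_rename[OF \<psi>(1)] by blast
  have "(\<lambda>i. ilv e (ilv p q) (r i)) = ilv e p" "(\<lambda>i. ilv e (ilv p q) (s i)) = ilv e q" for e :: "nat \<Rightarrow> 'a"
    by (auto intro!: ilv_compI simp: r_def s_def)
  moreover have "range (ilv p q) \<subseteq> insert 0 (insert \<pi> A)"
    using \<phi>(2) \<psi>(2) by (auto simp: ilv_def)
  ultimately show ?thesis
    unfolding D_def using \<phi>' \<psi>' P Q
    by (intro exI[of _ "Imp \<phi>' \<psi>'"] exI[of _ "ilv p q"]) auto
qed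

lemma D_not: "D A P \<Longrightarrow> D A (\<lambda>e. \<not> P e)"
  using D_imp[of A P "\<lambda>e. False"] by simp

lemma D_True [intro!, simp]: "D A (\<lambda>e. True)"
  using D_not[OF D_False] by simp

lemma D_disj: "D A P \<Longrightarrow> D A Q \<Longrightarrow> D A (\<lambda>e. P e \<or> Q e)"
  using D_imp[OF D_not, of A P Q] by (simp add: imp_conv_disj)

lemma D_conj: "D A P \<Longrightarrow> D A Q \<Longrightarrow> D A (\<lambda>e. P e \<and> Q e)"
  using D_not[OF D_imp[OF _ D_not], of A P Q] by simp

lemma D_iff: "D A P \<Longrightarrow> D A Q \<Longrightarrow> D A (\<lambda>e. P e \<longleftrightarrow> Q e)"
  unfolding iff_conv_conj_imp by (simp add: D_conj D_imp)

lemma D_const: "D A (\<lambda>e. b)"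
  by (cases b) auto

lemma D_ex_upd:
  assumes "D A P"
  shows "D A (\<lambda>e. \<exists>y. P (e(j := y)))"
proof -
  obtain \<phi> p where \<phi>: "wf_fm M \<phi>" "range p \<subseteq> insert 0 (insert \<pi> A)" and P: "\<And>e. P e \<longleftrightarrow> sat M (ilv e p) \<phi>"
    using assms unfolding D_def by blast
  have "ilv (e(j := y)) p = (ilv e p)(2 * j := y)" for e y
    by (auto simp: ilv_def fun_eq_iff)
  then show ?thesis
    unfolding D_def using \<phi> P by (intro exI[of _ "Exists (2 * j) \<phi>"] exI[of _ p]) auto
qed

text \<open>Binders are handled in the style of de Bruijn: the bound variable sits at position 0 and
  the outer assignment is shifted by one. Renaming by \<open>i - 1\<close> removes the shift once
  position 0 has become irrelevant.\<close>

lemma D_ex: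
  assumes "D A (\<lambda>e. P (\<lambda>i. e (Suc i)) (e 0))"
  shows "D A (\<lambda>e. \<exists>y. P e y)"
  using D_rename[OF D_ex_upd[OF assms, of 0], of "\<lambda>i. i - 1"] by simp

lemma D_all:
  assumes "D A (\<lambda>e. P (\<lambda>i. e (Suc i)) (e 0))"
  shows "D A (\<lambda>e. \<forall>y. P e y)"
  using D_not[OF D_ex[of A "\<lambda>e y. \<not> P e y"]] D_not[OF assms] by simp

lemma D_finite_all: "finite I \<Longrightarrow> (\<And>i. i \<in> I \<Longrightarrow> D A (P i)) \<Longrightarrow> D A (\<lambda>e. \<forall>i\<in>I. P i e)"
  by (induction I rule: finite_induct) (auto intro: D_conj)

lemma D_ex_finite_coords:
  assumes "finite I" "D A Q"
  shows "D A (\<lambda>e. \<exists>e'. (\<forall>i. i \<notin> I \<longrightarrow> e' i = e i) \<and> Q e')"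
  using assms
proof (induction I arbitrary: Q rule: finite_induct)
  case empty
  have "(\<exists>e'. (\<forall>i. i \<notin> {} \<longrightarrow> e' i = e i) \<and> Q e') = Q e" for e
    by (auto simp: fun_eq_iff[symmetric])
  with empty show ?case by simp
next
  case (insert j I)
  have "(\<exists>e'. (\<forall>i. i \<notin> insert j I \<longrightarrow> e' i = e i) \<and> Q e') =
      (\<exists>e'. (\<forall>i. i \<notin> I \<longrightarrow> e' i = e i) \<and> (\<exists>y. Q (e'(j := y))))" for e
  proof (intro iffI; elim exE conjE)
    fix e' assume e': "\<forall>i. i \<notin> insert j I \<longrightarrow> e' i = e i" "Q e'"
    then show "\<exists>e'. (\<forall>i. i \<notin> I \<longrightarrow> e' i = e i) \<and> (\<exists>y. Q (e'(j := y)))"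
      by (intro exI[of _ "e'(j := e j)"]) (auto intro!: exI[of _ "e' j"])
  next
    fix e' y assume "\<forall>i. i \<notin> I \<longrightarrow> e' i = e i" "Q (e'(j := y))"
    then show "\<exists>e'. (\<forall>i. i \<notin> insert j I \<longrightarrow> e' i = e i) \<and> Q e'"
      by (intro exI[of _ "e'(j := y)"]) auto
  qed
  then show ?case
    using insert.IH[OF D_ex_upd[OF insert.prems, of j]] by (simp only:)
qed

text \<open>Quantifying over infinitely many coordinates stays first-order, because \<open>Q\<close>
  has finite support and all but finitely many of them can be left alone.\<close>

lemma D_ex_coords:
  assumes "D A Q"
  shows "D A (\<lambda>e. \<exists>e'. (\<forall>i\<in>S. e' i = e i) \<and> Q e')"
proof -
  obtain n where n: "\<And>e e'. (\<And>i. i < n \<Longrightarrow> e i = e' i) \<Longrightarrow> Q e = Q e'"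
    using D_support[OF assms] by blast
  have "(\<exists>e'. (\<forall>i\<in>S. e' i = e i) \<and> Q e') =
    (\<exists>e'. (\<forall>i. i \<notin> {i. i < n \<and> i \<notin> S} \<longrightarrow> e' i = e i) \<and> Q e')" for e
  proof (intro iffI; elim exE conjE)
    fix e' assume e': "\<forall>i\<in>S. e' i = e i" "Q e'"
    have "Q (\<lambda>i. if i < n then e' i else e i) = Q e'" by (rule n) auto
    with e' show "\<exists>e'. (\<forall>i. i \<notin> {i. i < n \<and> i \<notin> S} \<longrightarrow> e' i = e i) \<and> Q e'"
      by (intro exI[of _ "\<lambda>i. if i < n then e' i else e i"]) auto
  next
    fix e' assume "\<forall>i. i \<notin> {i. i < n \<and> i \<notin> S} \<longrightarrow> e' i = e i" "Q e'"
    then show "\<exists>e'. (\<forall>i\<in>S. e' i = e i) \<and> Q e'" by auto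
  qed
  then show ?thesis
    using D_ex_finite_coords[OF _ assms, of "{i. i < n \<and> i \<notin> S}"] by simp
qed

section \<open>Definable functions and substitution\<close>

definition kfun :: "'a set \<Rightarrow> ((nat \<Rightarrow> 'a) \<Rightarrow> 'a) \<Rightarrow> bool" where
  "kfun A F \<longleftrightarrow> D A (\<lambda>e. e 0 = F (\<lambda>i. e (Suc i)))"

lemma kfun_mono: "kfun A F \<Longrightarrow> A \<subseteq> B \<Longrightarrow> kfun B F"
  unfolding kfun_def by (rule D_mono)

text \<open>All substitutions are carried out at once: an auxiliary assignment keeps the old
  variables at even and the substituted values at odd positions, and its odd half is projected away.
  Only the first \<open>n\<close> values need to be tied down, where \<open>n\<close> bounds the
  support of \<open>P\<close>.\<close>

lemma D_subst:
  assumes P: "D A P" and \<sigma>: "\<And>i. kfun A (\<sigma> i)"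
  shows "D A (\<lambda>e. P (\<lambda>i. \<sigma> i e))"
proof -
  obtain n where n: "\<And>e e'. (\<And>i. i < n \<Longrightarrow> e i = e' i) \<Longrightarrow> P e = P e'"
    using D_support[OF P] by blast
  define Q where "Q e \<longleftrightarrow> (\<forall>i\<in>{..<n}. e (2 * i + 1) = \<sigma> i (\<lambda>k. e (2 * k))) \<and> P (\<lambda>i. e (2 * i + 1))" for e
  have "D A (\<lambda>e. e (2 * i + 1) = \<sigma> i (\<lambda>k. e (2 * k)))" for i
    using D_rename[OF \<sigma>[unfolded kfun_def, of i], of "\<lambda>k. case k of 0 \<Rightarrow> 2 * i + 1 | Suc k \<Rightarrow> 2 * k"] by simp
  then have "D A Q"
    unfolding Q_def by (intro D_conj D_finite_all D_rename[OF P]) auto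
  from D_rename[OF D_ex_coords[OF this, of "Collect even"], of "\<lambda>k. k div 2"]
  have *: "D A (\<lambda>e. \<exists>e'. (\<forall>i\<in>Collect even. e' i = e (i div 2)) \<and> Q e')" .
  have "(\<exists>e'. (\<forall>i\<in>Collect even. e' i = e (i div 2)) \<and> Q e') = P (\<lambda>i. \<sigma> i e)" for e
  proof (intro iffI; (elim exE conjE)?)
    fix e' assume e': "\<forall>i\<in>Collect even. e' i = e (i div 2)" "Q e'"
    then have "(\<lambda>k. e' (2 * k)) = e" by auto
    with e'(2) have "P (\<lambda>i. e' (2 * i + 1))" "\<And>i. i < n \<Longrightarrow> e' (2 * i + 1) = \<sigma> i e"
      unfolding Q_def by auto
    moreover from this have "P (\<lambda>i. e' (2 * i + 1)) = P (\<lambda>i. \<sigma> i e)"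
      by (intro n) blast
    ultimately show "P (\<lambda>i. \<sigma> i e)" by blast
  next
    assume "P (\<lambda>i. \<sigma> i e)"
    then show "\<exists>e'. (\<forall>i\<in>Collect even. e' i = e (i div 2)) \<and> Q e'"
      by (intro exI[of _ "ilv e (\<lambda>i. \<sigma> i e)"]) (auto simp: Q_def ilv_def)
  qed
  with * show ?thesis by simp
qed

lemma D_eq_vars: "D A (\<lambda>e. e i = e j)"
  unfolding D_def
  by (intro exI[of _ "Equal (Var (2 * i)) (Var (2 * j))"] exI[of _ "\<lambda>_. 0"]) (auto simp: ilv_def)

lemma kfun_var: "kfun A (\<lambda>e. e i)"
  unfolding kfun_def by (rule D_eq_vars)

lemma kfun_const:
  assumes "c \<in> insert 0 (insert \<pi> A)"
  shows "kfun A (\<lambda>e. c)"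
proof -
  have "(\<exists>k. (if i = 0 then (\<lambda>e. e 0) else (\<lambda>e. c)) = (\<lambda>e. e k)) \<or>
      (\<exists>a\<in>insert 0 (insert \<pi> A). (if i = 0 then (\<lambda>e. e 0) else (\<lambda>e. c)) = (\<lambda>e. a))" for i :: nat
    using assms by (cases "i = 0") auto
  from D_subst_atomic[OF D_eq_vars[of A 0 1], of "\<lambda>i. if i = 0 then (\<lambda>e. e 0) else (\<lambda>e. c)", OF this]
  show ?thesis
    unfolding kfun_def by simp
qed

lemma kfun_subst:
  assumes "kfun A F" "\<And>i. kfun A (\<sigma> i)"
  shows "kfun A (\<lambda>e. F (\<lambda>i. \<sigma> i e))"
proof -
  have "kfun A (\<lambda>e. case_nat (e 0) (\<lambda>j. \<sigma> j (\<lambda>k. e (Suc k))) i)" for i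
  proof (cases i)
    case (Suc j)
    have "kfun A (\<lambda>e. \<sigma> j (\<lambda>k. e (Suc k)))"
      using D_rename[OF assms(2)[unfolded kfun_def, of j], of "case_nat 0 (\<lambda>k. Suc (Suc k))"]
      unfolding kfun_def by simp
    then show ?thesis using Suc by simp
  qed (simp add: kfun_var)
  from D_subst[OF assms(1)[unfolded kfun_def], of "\<lambda>i e. case_nat (e 0) (\<lambda>j. \<sigma> j (\<lambda>k. e (Suc k))) i", OF this]
  show ?thesis unfolding kfun_def by simp
qed

lemma kfun_shift: "kfun A F \<Longrightarrow> kfun A (\<lambda>e. F (\<lambda>i. e (r i)))"
  using kfun_subst[of A F "\<lambda>i e. e (r i)"] by (simp add: kfun_var)

lemma D_subst_two:
  assumes "D A P" "kfun A F" "kfun A G" "kfun A H"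
  shows "D A (\<lambda>e. P (\<lambda>i. if i = 0 then F e else if i = 1 then G e else H e))"
proof -
  have "kfun A (\<lambda>e. if i = 0 then F e else if i = 1 then G e else H e)" for i :: nat
    using assms by (cases "i = 0"; cases "i = 1") simp_all
  from D_subst[OF assms(1), of "\<lambda>i e. if i = 0 then F e else if i = 1 then G e else H e", OF this] show ?thesis .
qed

lemma D_eq: "kfun A F \<Longrightarrow> kfun A G \<Longrightarrow> D A (\<lambda>e. F e = G e)"
  using D_subst_two[OF D_eq_vars[of A 0 1], of F G G] by simp

lemma D_fun2: "D A (\<lambda>e. P (e 0) (e 1)) \<Longrightarrow> kfun A F \<Longrightarrow> kfun A G \<Longrightarrow> D A (\<lambda>e. P (F e) (G e))"
  using D_subst_two[of A "\<lambda>e. P (e 0) (e 1)" F G G] by simp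

lemma kfun_fun1: "kfun A (\<lambda>e. f (e 0)) \<Longrightarrow> kfun A F \<Longrightarrow> kfun A (\<lambda>e. f (F e))"
  using kfun_subst[of A "\<lambda>e. f (e 0)" "\<lambda>_. F"] by simp

lemma kfun_fun2:
  assumes "kfun A (\<lambda>e. f (e 0) (e 1))" "kfun A F" "kfun A G"
  shows "kfun A (\<lambda>e. f (F e) (G e))"
proof -
  have "kfun A (\<lambda>e. if i = 0 then F e else G e)" for i :: nat
    using assms by (cases "i = 0") simp_all
  from kfun_subst[OF assms(1), of "\<lambda>i e. if i = 0 then F e else G e", OF this] show ?thesis by simp
qed

lemma kfun_if: "D A P \<Longrightarrow> kfun A F \<Longrightarrow> kfun A G \<Longrightarrow> kfun A (\<lambda>e. if P e then F e else G e)"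
proof -
  assume a: "D A P" "kfun A F" "kfun A G"
  have "D A (\<lambda>e. (P (\<lambda>i. e (Suc i)) \<longrightarrow> e 0 = F (\<lambda>i. e (Suc i))) \<and>
      (\<not> P (\<lambda>i. e (Suc i)) \<longrightarrow> e 0 = G (\<lambda>i. e (Suc i))))"
    using a(2,3) unfolding kfun_def by (intro D_conj D_imp D_not D_rename[OF a(1)])
  moreover have "(\<lambda>e. (P (\<lambda>i. e (Suc i)) \<longrightarrow> e 0 = F (\<lambda>i. e (Suc i))) \<and>
      (\<not> P (\<lambda>i. e (Suc i)) \<longrightarrow> e 0 = G (\<lambda>i. e (Suc i)))) =
      (\<lambda>e. e 0 = (if P (\<lambda>i. e (Suc i)) then F (\<lambda>i. e (Suc i)) else G (\<lambda>i. e (Suc i))))"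
    by auto
  ultimately show ?thesis unfolding kfun_def by simp
qed

lemma kfun_the:
  assumes "D A (\<lambda>e. P (\<lambda>i. e (Suc i)) (e 0))" "\<And>e. \<exists>!y. P e y"
  shows "kfun A (\<lambda>e. THE y. P e y)"
proof -
  have "(e 0 = (THE y. P (\<lambda>i. e (Suc i)) y)) = P (\<lambda>i. e (Suc i)) (e 0)" for e
    using assms(2)[of "\<lambda>i. e (Suc i)"] by (metis the1_equality theI')
  with assms(1) show ?thesis unfolding kfun_def by simp
qed

text \<open>The form in which a predicate of an assignment and one further element is instantiated
  below binders, where the outer variables have been shifted.\<close>

lemma D_env1:
  assumes "D A (\<lambda>e. P (\<lambda>i. e (Suc i)) (e 0))" "kfun A F" "\<And>i. kfun A (\<sigma> i)"
  shows "D A (\<lambda>e. P (\<lambda>i. \<sigma> i e) (F e))"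
proof -
  have "kfun A (\<lambda>e. case_nat (F e) (\<lambda>i. \<sigma> i e) i)" for i
    by (cases i) (simp_all add: assms)
  from D_subst[OF assms(1), of "\<lambda>i e. case_nat (F e) (\<lambda>i. \<sigma> i e) i", OF this] show ?thesis by simp
qed

lemma D_env2:
  assumes "D A (\<lambda>e. P (\<lambda>i. e (Suc (Suc i))) (e 1) (e 0))" "kfun A F" "kfun A G" "\<And>i. kfun A (\<sigma> i)"
  shows "D A (\<lambda>e. P (\<lambda>i. \<sigma> i e) (F e) (G e))"
proof -
  have "kfun A (\<lambda>e. case_nat (G e) (case_nat (F e) (\<lambda>i. \<sigma> i e)) i)" for i
    by (cases i; cases "i - 1") (simp_all add: assms)
  from D_subst[OF assms(1), of "\<lambda>i e. case_nat (G e) (case_nat (F e) (\<lambda>i. \<sigma> i e)) i", OF this]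
  show ?thesis by simp
qed

lemma kfun_env1:
  assumes "kfun A (\<lambda>e. P (\<lambda>i. e (Suc i)) (e 0))" "kfun A F" "\<And>i. kfun A (\<sigma> i)"
  shows "kfun A (\<lambda>e. P (\<lambda>i. \<sigma> i e) (F e))"
proof -
  have "kfun A (\<lambda>e. case_nat (F e) (\<lambda>i. \<sigma> i e) i)" for i
    by (cases i) (simp_all add: assms)
  from kfun_subst[OF assms(1), of "\<lambda>i e. case_nat (F e) (\<lambda>i. \<sigma> i e) i", OF this] show ?thesis by simp
qed

text \<open>A formula comes with one sequence of parameters, hence with countably many. This is why
  saturation is only ever applied over countable sets.\<close>

lemma D_countable:
  assumes "D A P"
  obtains B where "B \<subseteq> A" "countable B" "D B P"
proof -
  obtain \<phi> p where p: "wf_fm M \<phi>" "range p \<subseteq> insert 0 (insert \<pi> A)" "\<forall>e. P e \<longleftrightarrow> sat M (ilv e p) \<phi>"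
    using assms unfolding D_def by blast
  then have "range p \<subseteq> insert 0 (insert \<pi> (range p \<inter> A))" by auto
  with p have "D (range p \<inter> A) P"
    unfolding D_def by blast
  then show thesis
    by (intro that[of "range p \<inter> A"]) auto
qed

end

section \<open>Valued fields and C-minimality\<close>

locale acvf = fo_language M \<pi>
  for M :: "('f, 'r, 'a::alg_closed_field) fo_structure" and \<pi> :: 'a +
  fixes v :: "'a \<Rightarrow> 'g::linordered_ab_group_add extended"
  assumes acvf: "acvf_expansion M v"
    and C_min: "C_minimal M v"
    and monster: "monster_model M"
    and \<pi>_nonzero [simp]: "\<pi> \<noteq> 0" and v_\<pi>: "0 < v \<pi>"
begin

section \<open>Arithmetic of the valuation\<close>

lemma valuation: "valuation v"
  using acvf unfolding acvf_expansion_def by blast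

lemma v_eq_Pinf [simp]: "v x = Pinf \<longleftrightarrow> x = 0"
  using valuation unfolding valuation_def by blast

lemma v_0 [simp]: "v 0 = Pinf"
  by simp

lemma v_mult: "v (x * y) = v x + v y"
  using valuation unfolding valuation_def by blast

lemma v_add: "min (v x) (v y) \<le> v (x + y)"
  using valuation unfolding valuation_def by blast

lemma v_range: "range v = insert Pinf (range Fin)"
  using valuation unfolding valuation_def by blast

lemma v_cases:
  assumes "x \<noteq> 0" obtains \<gamma> where "v x = Fin \<gamma>"
  using assms v_range v_eq_Pinf[of x] by (metis insertE rangeE rangeI)

lemma v_surj: obtains d where "d \<noteq> 0" "v d = Fin \<gamma>"
proof -
  have "Fin \<gamma> \<in> range v" using v_range by simp
  then obtain d where "v d = Fin \<gamma>" by (metis rangeE)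
  then show thesis using that[of d] v_eq_Pinf[of d] by force
qed

lemma v_less_Pinf: "x \<noteq> 0 \<Longrightarrow> v x < Pinf"
  by (elim v_cases) simp

lemma v_1 [simp]: "v 1 = 0"
proof -
  obtain \<gamma> where \<gamma>: "v 1 = Fin \<gamma>" by (rule v_cases[of 1]) auto
  with v_mult[of 1 1] have "Fin (\<gamma> + \<gamma>) = Fin \<gamma>" by simp
  with \<gamma> show ?thesis by (simp add: zero_extended_def)
qed

lemma v_minus [simp]: "v (- x) = v x"
proof (cases "x = 0")
  case False
  obtain \<gamma> where \<gamma>: "v (- 1) = Fin \<gamma>" by (rule v_cases[of "- 1"]) auto
  with v_mult[of "- 1" "- 1"] have "\<gamma> + \<gamma> = 0" by (simp add: zero_extended_def)
  then have "\<gamma> = 0" by (simp add: linordered_ab_group_add_class.double_zero)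
  with \<gamma> have "v (- 1) = 0" by (simp add: zero_extended_def)
  with v_mult[of "- 1" x] show ?thesis by simp
qed simp

lemma v_minus_commute: "v (x - y) = v (y - x)"
  using v_minus[of "x - y"] by simp

lemma v_add_less: "d < v x \<Longrightarrow> d < v y \<Longrightarrow> d < v (x + y)"
  using v_add[of x y] by (auto simp: min_def split: if_splits intro: less_le_trans)

lemma v_add_le: "d \<le> v x \<Longrightarrow> d \<le> v y \<Longrightarrow> d \<le> v (x + y)"
  using v_add[of x y] by (auto simp: min_def split: if_splits intro: order_trans)

lemma v_diff_less: "d < v x \<Longrightarrow> d < v y \<Longrightarrow> d < v (x - y)"
  using v_add_less[of d x "- y"] by simp

lemma v_diff_le: "d \<le> v x \<Longrightarrow> d \<le> v y \<Longrightarrow> d \<le> v (x - y)"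
  using v_add_le[of d x "- y"] by simp

lemma v_add_eq: "v x < v y \<Longrightarrow> v (x + y) = v x"
proof -
  assume *: "v x < v y"
  then have "v x \<le> v (x + y)" by (intro v_add_le) auto
  moreover have "\<not> v x < v (x + y)"
    using v_diff_less[of "v x" "x + y" y] * by auto
  ultimately show ?thesis by simp
qed

lemma v_diff_eq: "v x < v y \<Longrightarrow> v (x - y) = v x"
  using v_add_eq[of x "- y"] by simp

lemma v_diff_eq': "v y < v x \<Longrightarrow> v (x - y) = v y"
  using v_diff_eq[of y x] v_minus_commute[of x y] by simp

lemma v_trans_less: "d < v (x - y) \<Longrightarrow> d < v (y - z) \<Longrightarrow> d < v (x - z)"
  using v_add_less[of d "x - y" "y - z"] by simp

lemma v_trans_le: "d \<le> v (x - y) \<Longrightarrow> d \<le> v (y - z) \<Longrightarrow> d \<le> v (x - z)"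
  using v_add_le[of d "x - y" "y - z"] by simp

lemma v_mult_less_iff: "z \<noteq> 0 \<Longrightarrow> v (x * z) < v (y * z) \<longleftrightarrow> v x < v y"
  by (elim v_cases; cases "v x"; cases "v y") (simp_all add: v_mult)

lemma v_mult_le_iff: "z \<noteq> 0 \<Longrightarrow> v (x * z) \<le> v (y * z) \<longleftrightarrow> v x \<le> v y"
  using v_mult_less_iff[of z y x] by (simp add: not_less[symmetric])

lemma v_mult_eq_iff: "z \<noteq> 0 \<Longrightarrow> v (x * z) = v (y * z) \<longleftrightarrow> v x = v y"
  using v_mult_le_iff[of z y x] v_mult_le_iff[of z x y] by auto

lemma v_mult_less_iff': "z \<noteq> 0 \<Longrightarrow> v (z * x) < v (z * y) \<longleftrightarrow> v x < v y"
  using v_mult_less_iff[of z x y] by (simp add: mult.commute)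

lemma v_mult_le_iff': "z \<noteq> 0 \<Longrightarrow> v (z * x) \<le> v (z * y) \<longleftrightarrow> v x \<le> v y"
  using v_mult_le_iff[of z x y] by (simp add: mult.commute)

lemma v_less_divide: "z \<noteq> 0 \<Longrightarrow> v x < v (y / z) \<longleftrightarrow> v (x * z) < v y"
  using v_mult_less_iff[of z x "y / z"] by simp

lemma v_divide_less: "z \<noteq> 0 \<Longrightarrow> v (y / z) < v x \<longleftrightarrow> v y < v (x * z)"
  using v_mult_less_iff[of z "y / z" x] by simp

lemma v_le_divide: "z \<noteq> 0 \<Longrightarrow> v x \<le> v (y / z) \<longleftrightarrow> v (x * z) \<le> v y"
  using v_mult_le_iff[of z x "y / z"] by simp

lemma v_divide_eq: "z \<noteq> 0 \<Longrightarrow> v (y / z) = v x \<longleftrightarrow> v y = v (x * z)"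
  using v_mult_eq_iff[of z "y / z" x] by simp

lemma v_unit_mult [simp]: "v u = 0 \<Longrightarrow> v (u * x) = v x" "v u = 0 \<Longrightarrow> v (x * u) = v x"
  by (simp_all add: v_mult)

lemma v_unit_nonzero: "v u = 0 \<Longrightarrow> u \<noteq> 0"
  by (auto simp: zero_extended_def)

lemma v_unit_divide [simp]: "v u = 0 \<Longrightarrow> v (x / u) = v x"
  by (simp add: v_divide_eq v_unit_nonzero)

lemma v_divide_self: "x \<noteq> 0 \<Longrightarrow> v x = v y \<Longrightarrow> v (x / y) = 0"
  by (metis mult_1 v_1 v_divide_eq v_eq_Pinf)

lemma v_less_mult_\<pi>: "x \<noteq> 0 \<Longrightarrow> v x < v (x * \<pi>)"
  using v_mult_less_iff'[of x 1 \<pi>] v_\<pi> by simp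

lemma v_divide_\<pi>_less: "x \<noteq> 0 \<Longrightarrow> v (x / \<pi>) < v x"
  using v_less_mult_\<pi>[of "x / \<pi>"] by simp

lemma root_ex: "n > 0 \<Longrightarrow> \<exists>s::'a. s ^ n = r"
  by (metis nth_root_exists)

text \<open>The field has square roots, so a root \<open>s\<close> of \<open>b / a\<close> leads
  halfway from \<open>a\<close> to \<open>b\<close>. For \<open>b = 0\<close> a step by
  \<open>\<pi>\<close> is enough.\<close>

lemma v_dense:
  assumes "a \<noteq> 0" "v a < v b"
  obtains c where "c \<noteq> 0" "v a < v c" "v c < v b"
proof (cases "b = 0")
  case True
  then show thesis
    using that[of "a * \<pi>"] assms v_less_mult_\<pi> v_less_Pinf[of "a * \<pi>"] by simp
next
  case False
  obtain s where s: "s ^ 2 = b / a" using root_ex[of 2] by auto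
  with assms False have s0: "s \<noteq> 0" by auto
  have "0 < v (s * s)"
    using v_less_divide[of a 1 b] assms s by (simp add: power2_eq_square)
  with s0 obtain \<gamma> where \<gamma>: "v s = Fin \<gamma>" by (elim v_cases)
  with \<open>0 < v (s * s)\<close> have "0 < \<gamma>"
    by (simp add: v_mult zero_extended_def)
  then have "0 < v s" "v s < v (s * s)" using \<gamma> by (simp_all add: v_mult zero_extended_def)
  moreover have "a * (s * s) = b" using s assms by (simp add: power2_eq_square)
  ultimately show thesis
    using that[of "a * s"] s0 assms v_mult_less_iff'[of a 1 s] v_mult_less_iff'[of a s "s * s"] by simp
qed

lemma v_above:
  assumes "b \<noteq> 0"
  obtains c where "c \<noteq> 0" "v b < v c"
  using that[of "b * \<pi>"] v_less_mult_\<pi> assms by simp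

lemma v_max_ex:
  assumes "a \<noteq> 0" "b \<noteq> 0"
  obtains c where "c \<noteq> 0" "v a \<le> v c" "v b \<le> v c"
  using assms that linear by (metis order_refl)

subsection \<open>Definability in the language of valued fields\<close>

lemma D_fint1:
  assumes "farity M g = 1"
  shows "kfun A (\<lambda>e. fint M g [e 0])"
  unfolding kfun_def D_def
  by (rule exI[of _ "Equal (Var (2 * 0)) (App g [Var (2 * Suc 0)])"], rule exI[of _ "\<lambda>_. 0"])
    (simp add: assms ilv_def)

lemma D_fint2:
  assumes "farity M g = 2"
  shows "kfun A (\<lambda>e. fint M g [e 0, e 1])"
  unfolding kfun_def D_def
  by (rule exI[of _ "Equal (Var (2 * 0)) (App g [Var (2 * Suc 0), Var (2 * Suc (Suc 0))])"], rule exI[of _ "\<lambda>_. 0"])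
    (simp add: assms ilv_def flip: numeral_2_eq_2)

lemma kfun_add: "kfun A F \<Longrightarrow> kfun A G \<Longrightarrow> kfun A (\<lambda>e. F e + G e)"
proof -
  obtain g where "farity M g = 2" "\<forall>x y. fint M g [x, y] = x + y"
    using acvf unfolding acvf_expansion_def by blast
  with D_fint2[of g A] have "kfun A (\<lambda>e. e 0 + e 1)" by simp
  then show "kfun A F \<Longrightarrow> kfun A G \<Longrightarrow> kfun A (\<lambda>e. F e + G e)" by (rule kfun_fun2)
qed

lemma kfun_mult: "kfun A F \<Longrightarrow> kfun A G \<Longrightarrow> kfun A (\<lambda>e. F e * G e)"
proof -
  obtain g where "farity M g = 2" "\<forall>x y. fint M g [x, y] = x * y"
    using acvf unfolding acvf_expansion_def by blast
  with D_fint2[of g A] have "kfun A (\<lambda>e. e 0 * e 1)" by simp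
  then show "kfun A F \<Longrightarrow> kfun A G \<Longrightarrow> kfun A (\<lambda>e. F e * G e)" by (rule kfun_fun2)
qed

lemma kfun_minus: "kfun A F \<Longrightarrow> kfun A (\<lambda>e. - F e)"
proof -
  obtain g where "farity M g = 1" "\<forall>x. fint M g [x] = - x"
    using acvf unfolding acvf_expansion_def by blast
  with D_fint1[of g A] have "kfun A (\<lambda>e. - e 0)" by simp
  then show "kfun A F \<Longrightarrow> kfun A (\<lambda>e. - F e)" by (rule kfun_fun1)
qed

lemma kfun_diff: "kfun A F \<Longrightarrow> kfun A G \<Longrightarrow> kfun A (\<lambda>e. F e - G e)"
  using kfun_add[of A F "\<lambda>e. - G e"] kfun_minus by simp

lemma kfun_0: "kfun A (\<lambda>e. 0)" and kfun_\<pi>: "kfun A (\<lambda>e. \<pi>)"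
  by (simp_all add: kfun_const)

lemma kfun_1: "kfun A (\<lambda>e. 1)"
proof -
  have "D A (\<lambda>e. e 0 * \<pi> = \<pi>)"
    by (intro D_eq kfun_mult kfun_var kfun_\<pi>)
  then show ?thesis unfolding kfun_def by simp
qed

lemma kfun_of_nat: "kfun A (\<lambda>e. of_nat n)"
  by (induction n) (simp_all add: kfun_0 kfun_1 kfun_add)

lemma kfun_of_int: "kfun A (\<lambda>e. of_int n)"
  by (cases n rule: int_cases2) (simp_all add: kfun_of_nat kfun_minus)

lemma kfun_divide: "kfun A F \<Longrightarrow> kfun A G \<Longrightarrow> kfun A (\<lambda>e. F e / G e)"
proof -
  have "D A (\<lambda>e. (e 2 = 0 \<and> e 0 = 0) \<or> (\<not> e 2 = 0 \<and> e 0 * e 2 = e 1))"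
    by (intro D_disj D_conj D_not D_eq kfun_mult kfun_var kfun_0)
  moreover have "((y = 0 \<and> z = 0) \<or> (y \<noteq> 0 \<and> z * y = x)) = (z = x / y)" for x y z :: 'a
    by (cases "y = 0") (auto simp: field_simps)
  ultimately have "kfun A (\<lambda>e. e 0 / e 1)" unfolding kfun_def by (simp add: numeral_2_eq_2)
  then show "kfun A F \<Longrightarrow> kfun A G \<Longrightarrow> kfun A (\<lambda>e. F e / G e)" by (rule kfun_fun2)
qed

lemma D_le: "kfun A F \<Longrightarrow> kfun A G \<Longrightarrow> D A (\<lambda>e. v (F e) \<le> v (G e))"
proof -
  obtain r where "rarity M r = 2" "\<forall>x y. rint M r [x, y] \<longleftrightarrow> v x \<le> v y"
    using acvf unfolding acvf_expansion_def by blast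
  then have "D A (\<lambda>e. v (e 0) \<le> v (e 1))"
    unfolding D_def
    by (intro exI[of _ "Atom r [Var (2 * 0), Var (2 * Suc 0)]"] exI[of _ "\<lambda>_. 0"]) (simp add: ilv_def)
  then show "kfun A F \<Longrightarrow> kfun A G \<Longrightarrow> D A (\<lambda>e. v (F e) \<le> v (G e))" by (rule D_fun2)
qed

lemma D_less: "kfun A F \<Longrightarrow> kfun A G \<Longrightarrow> D A (\<lambda>e. v (F e) < v (G e))"
  using D_not[OF D_le[of A G F]] by (simp add: not_le)

lemma D_veq: "kfun A F \<Longrightarrow> kfun A G \<Longrightarrow> D A (\<lambda>e. v (F e) = v (G e))"
  using D_conj[OF D_le[of A F G] D_le[of A G F]] by (simp add: eq_iff)

lemma D_pos: "kfun A F \<Longrightarrow> D A (\<lambda>e. 0 < v (F e))"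
  using D_less[OF kfun_1, of A F] by simp

lemma D_nonneg: "kfun A F \<Longrightarrow> D A (\<lambda>e. 0 \<le> v (F e))"
  using D_le[OF kfun_1, of A F] by simp

lemma D_nonpos: "kfun A F \<Longrightarrow> D A (\<lambda>e. v (F e) \<le> 0)"
  using D_le[OF _ kfun_1, of A F] by simp

lemma D_unit: "kfun A F \<Longrightarrow> D A (\<lambda>e. v (F e) = 0)"
  using D_veq[OF _ kfun_1, of A F] by simp

lemmas kfun_intros = kfun_add kfun_mult kfun_minus kfun_diff kfun_divide kfun_0 kfun_1 kfun_\<pi> kfun_var kfun_of_nat
  kfun_of_int
lemmas D_intros = D_conj D_disj D_imp D_not D_iff D_ex D_all D_eq D_le D_less D_veq D_pos D_nonneg D_nonpos D_unit
  D_True D_False kfun_intros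

subsection \<open>The germ at zero and the generic point of the valuation ring\<close>

definition at0 :: "'a filter" where
  "at0 = (INF d\<in>-{0}. principal {x. x \<noteq> 0 \<and> v d < v x})"

lemma eventually_at0: "eventually P at0 \<longleftrightarrow> (\<exists>d. d \<noteq> 0 \<and> (\<forall>x. x \<noteq> 0 \<longrightarrow> v d < v x \<longrightarrow> P x))"
proof -
  have "eventually P at0 \<longleftrightarrow> (\<exists>d\<in>-{0}. eventually P (principal {x. x \<noteq> 0 \<and> v d < v x}))"
    unfolding at0_def
  proof (rule eventually_INF_base)
    fix a b :: 'a assume "a \<in> -{0}" "b \<in> -{0}"
    then obtain c where "c \<noteq> 0" "v a \<le> v c" "v b \<le> v c" using v_max_ex by auto
    then show "\<exists>x\<in>-{0}. principal {y. y \<noteq> 0 \<and> v x < v y} \<le>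
        inf (principal {y. y \<noteq> 0 \<and> v a < v y}) (principal {y. y \<noteq> 0 \<and> v b < v y})"
      by (intro bexI[of _ c]) (auto simp: le_less_trans)
  next
    have "1 \<in> - {0 :: 'a}" by simp
    then show "- {0 :: 'a} \<noteq> {}" by (metis empty_iff)
  qed
  then show ?thesis by (auto simp: eventually_principal)
qed

lemma eventually_at0I: "d \<noteq> 0 \<Longrightarrow> (\<And>x. x \<noteq> 0 \<Longrightarrow> v d < v x \<Longrightarrow> P x) \<Longrightarrow> eventually P at0"
  unfolding eventually_at0 by blast

lemma at0_neq_bot: "\<not> eventually (\<lambda>x. False) at0"
  unfolding eventually_at0 by (metis v_above)

lemma eventually_at0_ex: "eventually P at0 \<Longrightarrow> \<exists>x. P x"
  using at0_neq_bot by (metis (mono_tags, lifting) eventually_mono)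

lemma eventually_at0_nonzero: "eventually (\<lambda>x. x \<noteq> 0) at0"
  by (rule eventually_at0I[of 1]) auto

lemma eventually_at0_less: "d \<noteq> 0 \<Longrightarrow> eventually (\<lambda>x. v d < v x) at0"
  by (rule eventually_at0I[of d]) auto

lemma eventually_at0_mult:
  assumes "eventually P at0" "c \<noteq> 0"
  shows "eventually (\<lambda>x. P (c * x)) at0"
proof -
  obtain d where d: "d \<noteq> 0" "\<And>x. x \<noteq> 0 \<Longrightarrow> v d < v x \<Longrightarrow> P x"
    using assms unfolding eventually_at0 by blast
  show ?thesis
    by (rule eventually_at0I[of "d / c"]) (use d assms v_divide_less[of c d] in \<open>auto simp: mult.commute\<close>)
qed

lemma D_at0: "D A (\<lambda>e. P (\<lambda>i. e (Suc i)) (e 0)) \<Longrightarrow> D A (\<lambda>e. eventually (P e) at0)"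
  unfolding eventually_at0
  by (intro D_intros) (rule D_env1[where P = P], assumption, (intro D_intros)+)

text \<open>The integral elements whose residue differs from those of all integral
  \<open>f \<in> F\<close>; an \<open>f\<close> of negative valuation imposes no condition. Letting
  \<open>F\<close> grow yields the generic type of the valuation ring, the filter
  \<open>genO\<close>.\<close>

definition gen :: "'a set \<Rightarrow> 'a set" where
  "gen F = {x. 0 \<le> v x \<and> (\<forall>f\<in>F. v (x - f) \<le> 0)}"

lemma gen_Un: "gen (F \<union> G) = gen F \<inter> gen G"
  by (auto simp: gen_def)

lemma gen_mono: "F \<subseteq> G \<Longrightarrow> gen G \<subseteq> gen F"
  by (auto simp: gen_def)

lemma gen_unit: "x \<in> gen (insert 0 F) \<Longrightarrow> v x = 0"
  by (auto simp: gen_def intro: antisym)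

text \<open>The residue field is infinite, being algebraically closed.\<close>

lemma gen_nonempty:
  assumes "finite F" shows "gen F \<noteq> {}"
proof -
  define G where "G = insert 0 {f \<in> F. 0 \<le> v f}"
  have fin: "finite G" using assms by (simp add: G_def)
  \<comment> \<open>Euclid's trick: at a root \<open>x\<close> of \<open>p\<close> the product of
    all \<open>x - f\<close> is \<open>- 1\<close>. Once \<open>x\<close> is known to be integral,
    no factor can have positive valuation. That 0 belongs to \<open>G\<close> makes the degree
    positive.\<close>
  define p where "p = (\<Prod>f\<in>G. [:- f, 1:]) + 1"
  have "degree (\<Prod>f\<in>G. [:- f, 1:]) = card G"
    by (subst degree_prod_eq_sum_degree) simp_all
  moreover have "card G > 0" using fin by (auto simp: G_def card_gt_0_iff)
  ultimately have "degree p > 0"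
    unfolding p_def by (subst degree_add_eq_left) simp_all
  then obtain x where x: "poly p x = 0" using alg_closed_imp_poly_has_root by blast
  then have prod: "(\<Prod>f\<in>G. x - f) = - 1"
    by (simp add: p_def poly_prod eq_neg_iff_add_eq_0)
  have v_prod: "v (\<Prod>f\<in>H. x - f) = (\<Sum>f\<in>H. v (x - f))" if "finite H" for H
    using that by (induction H rule: finite_induct) (simp_all add: v_mult)
  then have sum0: "(\<Sum>f\<in>G. v (x - f)) = 0"
    using prod fin by (metis v_1 v_minus)
  have Gv: "0 \<le> v f" if "f \<in> G" for f using that by (auto simp: G_def)
  have xv: "0 \<le> v x"
  proof (rule ccontr)
    assume "\<not> 0 \<le> v x"
    then have neg: "v (x - f) < 0" if "f \<in> G" for f
      using Gv[OF that] v_diff_eq[of x f] by (auto simp: not_le)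
    have "(\<Sum>f\<in>H. v (x - f)) < 0 \<or> H = {}" if "H \<subseteq> G" "finite H" for H
      using that(2,1)
    proof (induction H rule: finite_induct)
      case (insert f H)
      then have "v (x - f) < 0" using neg by auto
      moreover have "(\<Sum>f\<in>H. v (x - f)) \<le> 0" using insert by (cases "H = {}") auto
      moreover from this have "v (x - f) + (\<Sum>f\<in>H. v (x - f)) \<le> v (x - f) + 0"
        by (intro add_left_mono)
      ultimately have "v (x - f) + (\<Sum>f\<in>H. v (x - f)) < 0" by (metis add.right_neutral le_less_trans)
      with insert show ?case by simp
    qed simp
    from this[of G] sum0 fin show False by (auto simp: G_def)
  qed
  have nonneg: "0 \<le> v (x - f)" if "f \<in> G" for f
    using xv Gv[OF that] by (rule v_diff_le)
  have "v (x - f) \<le> 0" if f: "f \<in> G" for f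
  proof -
    have "(\<Sum>f\<in>G. v (x - f)) = v (x - f) + (\<Sum>f\<in>G - {f}. v (x - f))"
      using f fin by (simp add: sum.remove)
    moreover have "0 \<le> (\<Sum>f\<in>H. v (x - f))" if "finite H" "H \<subseteq> G" for H
      using that
    proof (induction H rule: finite_induct)
      case (insert f H)
      then have "0 + 0 \<le> v (x - f) + (\<Sum>f\<in>H. v (x - f))" using nonneg by (intro add_mono) auto
      with insert show ?case by simp
    qed simp
    from this[of "G - {f}"] fin have "0 \<le> (\<Sum>f\<in>G - {f}. v (x - f))" by simp
    then have "v (x - f) + 0 \<le> v (x - f) + (\<Sum>f\<in>G - {f}. v (x - f))"
      by (rule add_left_mono)
    ultimately show ?thesis using sum0 by simp
  qed
  moreover have "v (x - f) \<le> 0" if "f \<in> F" "f \<notin> G" for f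
    using that xv v_diff_eq'[of f x] by (auto simp: G_def not_le)
  ultimately have "x \<in> gen F" using xv by (auto simp: gen_def)
  then show ?thesis by blast
qed

definition genO :: "'a filter" where
  "genO = (INF F\<in>Collect finite. principal (gen F))"

lemma eventually_genO: "eventually P genO \<longleftrightarrow> (\<exists>F. finite F \<and> (\<forall>x\<in>gen F. P x))"
proof -
  have "eventually P genO \<longleftrightarrow> (\<exists>F\<in>Collect finite. eventually P (principal (gen F)))"
    unfolding genO_def
  proof (rule eventually_INF_base)
    fix F G :: "'a set" assume "F \<in> Collect finite" "G \<in> Collect finite"
    then show "\<exists>H\<in>Collect finite. principal (gen H) \<le> inf (principal (gen F)) (principal (gen G))"
      by (intro bexI[of _ "F \<union> G"]) (auto simp: gen_Un)
  qed auto
  then show ?thesis by (auto simp: eventually_principal)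
qed

lemma gen_divide:
  assumes "v u = 0" "x \<in> gen (insert 0 ((\<lambda>f. u / f) ` {f \<in> F. v f = 0}))"
  shows "u / x \<in> gen (insert 0 F)"
proof -
  have x: "v x = 0" using assms gen_unit by blast
  have "v (u / x - f) \<le> 0" if "f \<in> F" for f
  proof (cases "v f = 0")
    case True
    then have "v (x - u / f) \<le> 0" using assms that by (auto simp: gen_def)
    moreover have "u / x - f = - (f / x) * (x - u / f)"
      using x True v_unit_nonzero by (simp add: field_simps)
    moreover have "v (- (f / x)) = 0" using x True by simp
    ultimately show ?thesis by (simp only: v_unit_mult)
  next
    case False
    have "v (u / x) = 0" using x assms by simp
    with False show ?thesis
      using v_diff_eq[of "u / x" f] v_diff_eq'[of f "u / x"] by (cases "v f < 0") auto
  qed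
  moreover have "v (u / x) = 0" using x assms by simp
  ultimately show ?thesis by (auto simp: gen_def)
qed

text \<open>A generic \<open>x\<close> that also avoids the residues of the \<open>u / f\<close> has
  a generic cofactor \<open>u / x\<close>. Hence a property that is closed under products and holds
  at generic units holds at all units.\<close>

lemma genO_product:
  assumes "eventually P genO" "v u = 0"
  obtains x y where "v x = 0" "v y = 0" "P x" "P y" "u = x * y"
proof -
  obtain F where F: "finite F" "\<And>x. x \<in> gen F \<Longrightarrow> P x" using assms unfolding eventually_genO by blast
  obtain x where x: "x \<in> gen (insert 0 ((\<lambda>f. u / f) ` {f \<in> F. v f = 0}) \<union> F)"
    using gen_nonempty[of "insert 0 ((\<lambda>f. u / f) ` {f \<in> F. v f = 0}) \<union> F"] F(1) by auto
  then have "u / x \<in> gen (insert 0 F)" "v x = 0"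
    using gen_divide[OF assms(2), of x F] gen_unit unfolding gen_Un by blast+
  then show thesis
    using that[of x "u / x"] x F(2) gen_unit[of "u / x" F] gen_mono[of F "insert 0 F"] v_unit_nonzero[of x]
    unfolding gen_Un by auto
qed

lemma genO_inverse:
  assumes "eventually P genO"
  obtains x where "v x = 0" "P x" "P (1 / x)"
  using genO_product[OF assms, of 1] by (metis mult.commute nonzero_eq_divide_eq v_1 v_unit_nonzero)

lemma gen_many:
  assumes "finite F"
  shows "\<exists>S. S \<subseteq> gen F \<and> card S = n \<and> finite S \<and> (\<forall>x\<in>S. \<forall>y\<in>S. x \<noteq> y \<longrightarrow> v (x - y) \<le> 0)"
proof (induction n)
  case 0
  then show ?case by (intro exI[of _ "{}"]) auto
next
  case (Suc n)
  then obtain S where S: "S \<subseteq> gen F" "card S = n" "finite S" "\<forall>x\<in>S. \<forall>y\<in>S. x \<noteq> y \<longrightarrow> v (x - y) \<le> 0"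
    by blast
  obtain x where x: "x \<in> gen (F \<union> S)" using gen_nonempty[of "F \<union> S"] S(3) assms by auto
  then have "v (x - y) \<le> 0" if "y \<in> S" for y using that by (auto simp: gen_def)
  moreover from this[of x] have "x \<notin> S" by (auto simp: zero_extended_def)
  moreover have "x \<in> gen F" using x by (auto simp: gen_Un)
  ultimately show ?case
    using S by (intro exI[of _ "insert x S"]) (auto simp: v_minus_commute)
qed

subsection \<open>Codes for balls\<close>

text \<open>The flag tells closed from open balls. With \<open>d = 0\<close> the closed ball is the
  point \<open>c\<close>, so points need no codes of their own.\<close>

fun inb :: "'a \<times> 'a \<times> bool \<Rightarrow> 'a \<Rightarrow> bool" where
  "inb (c, d, True) x \<longleftrightarrow> v d \<le> v (x - c)"
| "inb (c, d, False) x \<longleftrightarrow> v d < v (x - c)"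

text \<open>\<open>X\<close> is a union of atoms of the Boolean algebra generated by
  \<open>N\<close> balls. Unlike the shape of a Boolean combination, this can be written as one
  formula for each \<open>N\<close>.\<close>

definition cpx :: "nat \<Rightarrow> ('a \<Rightarrow> bool) \<Rightarrow> bool" where
  "cpx N X \<longleftrightarrow> (\<exists>l. length l = N \<and> (\<forall>x y. (\<forall>k\<in>set l. inb k x = inb k y) \<longrightarrow> X x = X y))"

lemma cpx_mono: "cpx N X \<Longrightarrow> N \<le> N' \<Longrightarrow> cpx N' X"
  unfolding cpx_def
proof (elim exE conjE)
  fix l assume l: "length l = N" "\<forall>x y. (\<forall>k\<in>set l. inb k x = inb k y) \<longrightarrow> X x = X y" "N \<le> N'"
  then show "\<exists>l. length l = N' \<and> (\<forall>x y. (\<forall>k\<in>set l. inb k x = inb k y) \<longrightarrow> X x = X y)"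
    by (intro exI[of _ "l @ replicate (N' - N) (0, 0, True)"]) auto
qed

lemma cpx_not: "cpx N X \<Longrightarrow> cpx N (\<lambda>x. \<not> X x)"
  unfolding cpx_def by blast

lemma cpx_combine:
  assumes "cpx N X" "cpx N' Y"
  shows "cpx (N + N') (\<lambda>x. f (X x) (Y x))"
proof -
  obtain l l' where "length l = N" "\<forall>x y. (\<forall>k\<in>set l. inb k x = inb k y) \<longrightarrow> X x = X y"
    "length l' = N'" "\<forall>x y. (\<forall>k\<in>set l'. inb k x = inb k y) \<longrightarrow> Y x = Y y"
    using assms unfolding cpx_def by blast
  note l = this
  have "f (X x) (Y x) = f (X y) (Y y)" if "\<forall>k\<in>set (l @ l'). inb k x = inb k y" for x y
  proof -
    have "X x = X y" using that by (intro l(2)[rule_format]) simp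
    moreover have "Y x = Y y" using that by (intro l(4)[rule_format]) simp
    ultimately show ?thesis by simp
  qed
  moreover have "length (l @ l') = N + N'" using l(1,3) by simp
  ultimately show ?thesis
    unfolding cpx_def by blast
qed

lemma cpx_ball: "ball_of_radius v \<gamma> B \<Longrightarrow> cpx 1 (\<lambda>x. x \<in> B)"
proof -
  assume "ball_of_radius v \<gamma> B"
  then obtain c where c: "B = closed_ball v c \<gamma> \<or> B = open_ball v c \<gamma>" unfolding ball_of_radius_def by blast
  obtain d where "v d = Fin \<gamma>" by (rule v_surj)
  with c have "(\<lambda>x. x \<in> B) = inb (c, d, True) \<or> (\<lambda>x. x \<in> B) = inb (c, d, False)"
    by (auto simp: closed_ball_def open_ball_def fun_eq_iff)
  then obtain b where "\<And>x. x \<in> B \<longleftrightarrow> inb (c, d, b) x" by metis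
  then show ?thesis
    unfolding cpx_def by (intro exI[of _ "[(c, d, b)]"]) auto
qed

section \<open>Descriptions by finitely many balls and critical radii\<close>

lemma D_imp_definable_home:
  assumes "D A (\<lambda>e. X (e 0))"
  obtains \<phi> e where "wf_fm M \<phi>" "range e \<subseteq> insert 0 (insert \<pi> A)" "\<And>a. X a \<longleftrightarrow> sat M (e(0 := a)) \<phi>"
proof -
  obtain \<phi> p where \<phi>: "wf_fm M \<phi>" "range p \<subseteq> insert 0 (insert \<pi> A)" "\<And>e. X (e 0) \<longleftrightarrow> sat M (ilv e p) \<phi>"
    using assms unfolding D_def by blast
  define r where "r k = (if even k then 0 else Suc (k div 2))" for k :: nat
  obtain \<psi> where \<psi>: "wf_fm M \<psi>" "\<And>e. sat M e \<psi> \<longleftrightarrow> sat M (\<lambda>i. e (r i)) \<phi>"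
    using sat_rename[OF \<phi>(1)] by blast
  define e where "e = case_nat 0 p"
  have "(\<lambda>i. (e(0 := a)) (r i)) = ilv (\<lambda>_. a) p" for a
    by (rule ilv_compI) (auto simp: r_def e_def)
  then have "X a \<longleftrightarrow> sat M (e(0 := a)) \<psi>" for a
    using \<phi>(3)[of "\<lambda>_. a"] \<psi>(2) by simp
  moreover have "range e \<subseteq> insert 0 (insert \<pi> A)"
    using \<phi>(2) unfolding e_def by (fastforce split: nat.splits)
  ultimately show thesis using that \<psi>(1) by blast
qed

lemma definable_cpx:
  assumes "D A (\<lambda>e. X (e 0))"
  shows "\<exists>N. cpx N X"
proof -
  obtain \<phi> e where \<phi>: "wf_fm M \<phi>" "\<And>a. X a \<longleftrightarrow> sat M (e(0 := a)) \<phi>"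
    using D_imp_definable_home[OF assms] by metis
  have "assign x e = e(0 := x $ 0)" if "x \<in> carrier_vec 1" for x
    using that by (auto simp: assign_def fun_eq_iff)
  then have "definable_home M (Collect X)"
    unfolding definable_home_def definable_def
    by (intro exI[of _ \<phi>] exI[of _ e]) (auto simp: \<phi>)
  then have "Collect X \<in> boolean_combinations ({B. \<exists>\<gamma>. ball_of_radius v \<gamma> B} \<union> {{a} | a. True})"
    using C_min unfolding C_minimal_def by blast
  then have "\<exists>N. cpx N (\<lambda>x. x \<in> Collect X)"
  proof (induction rule: boolean_combinations.induct)
    case (generator Y)
    then show ?case
    proof
      assume "Y \<in> {{a} | a. True}"
      then obtain a where "Y = {a}" by blast
      then have "cpx 1 (\<lambda>x. x \<in> Y)"
        unfolding cpx_def by (intro exI[of _ "[(a, 0, True)]"]) simp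
      then show ?thesis by blast
    qed (use cpx_ball in blast)
  next
    case (complement Y)
    then show ?case using cpx_not by auto
  next
    case (union Y Z)
    then show ?case using cpx_combine[of _ "\<lambda>x. x \<in> Y" _ "\<lambda>x. x \<in> Z" "(\<or>)"] by auto
  qed
  then show ?thesis by simp
qed

text \<open>As seen from 0, \<open>x\<close> and \<open>y\<close> lie in the same open gap between
  the radii given by \<open>C\<close>.\<close>

definition comp :: "'a set \<Rightarrow> 'a \<Rightarrow> 'a \<Rightarrow> bool" where
  "comp C x y \<longleftrightarrow> x \<noteq> 0 \<and> y \<noteq> 0 \<and> (\<forall>c\<in>C. v x \<noteq> v c \<and> v y \<noteq> v c \<and> (v x < v c \<longleftrightarrow> v y < v c))"

lemma inb_comp:
  assumes "comp ({c, d} - {0}) x y"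
  shows "inb (c, d, b) x = inb (c, d, b) y"
proof (cases "c = 0")
  case True
  with assms show ?thesis
    by (cases b; cases "d = 0") (auto simp: comp_def not_le not_less)
next
  case False
  with assms have c: "v x \<noteq> v c" "v y \<noteq> v c" "v x < v c \<longleftrightarrow> v y < v c"
    unfolding comp_def by blast+
  have d: "v d \<le> v x \<longleftrightarrow> v d \<le> v y" "v d < v x \<longleftrightarrow> v d < v y"
  proof -
    have "x \<noteq> 0" "y \<noteq> 0" using assms unfolding comp_def by blast+
    moreover have "d \<noteq> 0 \<Longrightarrow> v x \<noteq> v d \<and> v y \<noteq> v d \<and> (v x < v d \<longleftrightarrow> v y < v d)"
      using assms unfolding comp_def by blast
    ultimately have "(v x < v d \<longleftrightarrow> v y < v d) \<and> v x \<noteq> v d \<and> v y \<noteq> v d"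
      using v_less_Pinf by (cases "d = 0") auto
    then show "v d \<le> v x \<longleftrightarrow> v d \<le> v y" "v d < v x \<longleftrightarrow> v d < v y"
      by (auto simp: not_less[symmetric])
  qed
  show ?thesis
  proof (cases "v x < v c")
    case True
    then have "v (x - c) = v x" "v (y - c) = v y" using c by (simp_all add: v_diff_eq)
    with d show ?thesis by (cases b) simp_all
  next
    case False
    then have "v (x - c) = v c" "v (y - c) = v c" using c by (simp_all add: v_diff_eq')
    then show ?thesis by (cases b) simp_all
  qed
qed

lemma comp_mono: "comp C x y \<Longrightarrow> C' \<subseteq> C \<Longrightarrow> comp C' x y"
  unfolding comp_def by blast

text \<open>Seen from 0, membership in the ball with code \<open>(c, d, b)\<close> can change only
  at the radii \<open>v c\<close> and \<open>v d\<close>. So a definable set has finitely many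
  critical radii and is constant on each gap between them.\<close>

lemma critical_radii:
  assumes "D A (\<lambda>e. X (e 0))"
  obtains C where "finite C" "0 \<notin> C" "\<And>x y. comp C x y \<Longrightarrow> X x = X y"
proof -
  obtain l where l: "\<forall>x y. (\<forall>k\<in>set l. inb k x = inb k y) \<longrightarrow> X x = X y"
    using definable_cpx[OF assms] unfolding cpx_def by blast
  define C where "C = (\<Union>(c, d, b)\<in>set l. {c, d}) - {0}"
  have "X x = X y" if "comp C x y" for x y
  proof (rule l[rule_format])
    fix k assume k: "k \<in> set l"
    obtain c d b where kk: "k = (c, d, b)" by (cases k)
    have "{c, d} - {0} \<subseteq> C" using k kk unfolding C_def by force
    then have "comp ({c, d} - {0}) x y" using that comp_mono by blast
    then show "inb k x = inb k y" using inb_comp kk by blast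
  qed
  then show thesis by (intro that[of C]) (auto simp: C_def)
qed

text \<open>Beyond the largest critical radius nothing changes any more, so the punctured germ at 0
  is a complete type.\<close>

lemma at0_complete:
  assumes "D A (\<lambda>e. X (e 0))"
  shows "eventually X at0 \<or> eventually (\<lambda>x. \<not> X x) at0"
proof -
  obtain C where C: "finite C" "0 \<notin> C" "\<And>x y. comp C x y \<Longrightarrow> X x = X y"
    using critical_radii[OF assms] by blast
  have "\<exists>m. m \<noteq> 0 \<and> (\<forall>c\<in>C. v c \<le> v m)"
    using C(1,2)
  proof (induction C rule: finite_induct)
    case (insert c C)
    then obtain m where "m \<noteq> 0" "\<forall>c\<in>C. v c \<le> v m" by auto
    moreover obtain m' where "m' \<noteq> 0" "v m \<le> v m'" "v c \<le> v m'"
      using v_max_ex[of m c] insert \<open>m \<noteq> 0\<close> by auto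
    ultimately show ?case by (intro exI[of _ m']) auto
  qed (auto intro: exI[of _ 1])
  then obtain m where m: "m \<noteq> 0" "\<forall>c\<in>C. v c \<le> v m" by blast
  have "X x = X (m * \<pi>)" if "x \<noteq> 0" "v m < v x" for x
    using m that v_less_mult_\<pi>[of m] by (intro C(3)) (force simp: comp_def)
  then have "eventually (\<lambda>x. X x = X (m * \<pi>)) at0"
    by (intro eventually_at0I[of m]) (use m in auto)
  then show ?thesis by (cases "X (m * \<pi>)") auto
qed

text \<open>If the residue of an integral \<open>z\<close> avoids the centre \<open>c\<close>, then
  \<open>v (z - c) = min 0 (v c)\<close> does not depend on \<open>z\<close>. So a ball cannot
  separate two points that are generic with respect to its centre.\<close>

lemma cpx_gen:
  assumes "cpx N X"
  obtains F where "finite F" "card F \<le> N" "\<And>x y. x \<in> gen F \<Longrightarrow> y \<in> gen F \<Longrightarrow> X x = X y"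
proof -
  obtain l where l: "length l = N" "\<forall>x y. (\<forall>k\<in>set l. inb k x = inb k y) \<longrightarrow> X x = X y"
    using assms unfolding cpx_def by blast
  have "X x = X y" if x: "x \<in> gen (fst ` set l)" and y: "y \<in> gen (fst ` set l)" for x y
  proof (rule l(2)[rule_format])
    fix k assume k: "k \<in> set l"
    obtain c d b where kk: "k = (c, d, b)" by (cases k)
    have c: "v (z - c) = min 0 (v c)" if "z \<in> gen (fst ` set l)" for z
    proof -
      have z: "0 \<le> v z" "v (z - c) \<le> 0" using that k kk by (force simp: gen_def)+
      show ?thesis
      proof (cases "v c < 0")
        case True
        then show ?thesis using z v_diff_eq'[of c z] by (auto simp: min_def)
      next
        case False
        then have "0 \<le> v (z - c)" using z(1) by (intro v_diff_le) auto
        with z(2) have "v (z - c) = 0" by simp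
        with False show ?thesis by (simp add: min_def not_less)
      qed
    qed
    show "inb k x = inb k y" using c[OF x] c[OF y] kk by (cases b) auto
  qed
  moreover have "card (fst ` set l) \<le> N"
    using l(1) by (metis List.finite_set card_image_le card_length le_trans)
  ultimately show thesis by (intro that[of "fst ` set l"]) blast+
qed

lemma genO_complete:
  assumes "D A (\<lambda>e. X (e 0))"
  shows "eventually X genO \<or> eventually (\<lambda>x. \<not> X x) genO"
proof -
  obtain F where F: "finite F" "\<And>x y. x \<in> gen F \<Longrightarrow> y \<in> gen F \<Longrightarrow> X x = X y"
    using definable_cpx[OF assms] cpx_gen by metis
  obtain z where z: "z \<in> gen F" using gen_nonempty[OF F(1)] by blast
  have "eventually (\<lambda>x. X x = X z) genO" unfolding eventually_genO using F z by blast
  then show ?thesis by (cases "X z") auto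
qed

text \<open>Off the residues of the at most \<open>N\<close> centres a set that is not generic is
  empty, so points of it in distinct residue classes inject into the centres. A set that meets more
  than \<open>N\<close> classes must therefore be generic.\<close>

lemma cpx_few_residues:
  assumes "cpx N X" "\<not> eventually X genO"
    and S: "finite S" "\<And>x. x \<in> S \<Longrightarrow> X x" "\<And>x. x \<in> S \<Longrightarrow> 0 \<le> v x"
      "\<And>x y. x \<in> S \<Longrightarrow> y \<in> S \<Longrightarrow> x \<noteq> y \<Longrightarrow> v (x - y) \<le> 0"
  shows "card S \<le> N"
proof -
  obtain F where F: "finite F" "card F \<le> N" "\<And>x y. x \<in> gen F \<Longrightarrow> y \<in> gen F \<Longrightarrow> X x = X y"
    using cpx_gen[OF assms(1)] by blast
  have "\<not> X x" if "x \<in> gen F" for x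
    using F(1,3) that assms(2) unfolding eventually_genO by blast
  then have "\<forall>x\<in>S. \<exists>f\<in>F. 0 < v (x - f)"
    using S(2,3) by (force simp: gen_def not_le)
  then obtain g where g: "\<And>x. x \<in> S \<Longrightarrow> g x \<in> F" "\<And>x. x \<in> S \<Longrightarrow> 0 < v (x - g x)" by metis
  have "inj_on g S"
  proof (rule inj_onI, rule ccontr)
    fix x y assume xy: "x \<in> S" "y \<in> S" "g x = g y" "x \<noteq> y"
    then have "0 < v (x - y)"
      using g(2)[of x] g(2)[of y] v_trans_less[of 0 x "g x" y] v_minus_commute[of y "g y"] by simp
    with S(4)[OF xy(1,2,4)] show False by simp
  qed
  then have "card S \<le> card F" using F(1) g(1) by (intro card_inj_on_le) auto
  with F(2) show ?thesis by simp
qed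

end

context fo_language
begin

subsection \<open>Saturation\<close>

lemma countable_less_kappa:
  fixes \<kappa> :: "'k rel"
  assumes "countable A" "ordLess2 natLeq \<kappa>"
  shows "ordLess2 (card_of A) \<kappa>"
proof -
  have "ordLeq2 (card_of A) (card_of (UNIV :: nat set))"
    using assms(1) unfolding countable_def by (auto simp: card_of_ordLeq[symmetric])
  then show ?thesis
    using assms(2) card_of_nat ordLeq_ordIso_trans ordLeq_ordLess_trans by blast
qed

end

context acvf
begin

lemma saturated_one:
  assumes "countable A" "\<And>S. S \<in> \<Sigma> \<Longrightarrow> D A (\<lambda>e. S (e 0))"
    and fin: "\<And>T. T \<subseteq> \<Sigma> \<Longrightarrow> finite T \<Longrightarrow> \<exists>a. \<forall>S\<in>T. S a"
  shows "\<exists>a. \<forall>S\<in>\<Sigma>. S a"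
proof -
  let ?A = "insert 0 (insert \<pi> A)"
  obtain \<kappa> :: "'a rel" where \<kappa>: "ordLess2 natLeq \<kappa>" "kappa_saturated \<kappa> M"
    using monster unfolding monster_model_def by blast
  have card: "ordLess2 (card_of ?A) \<kappa>"
    using assms(1) \<kappa>(1) by (intro countable_less_kappa) auto
  define p where "p = {(\<phi>, e). wf_fm M \<phi> \<and> range e \<subseteq> ?A \<and> (\<exists>S\<in>\<Sigma>. \<forall>a. S a \<longleftrightarrow> sat M (e(0 := a)) \<phi>)}"
  have "\<exists>a. \<forall>(\<phi>, e) \<in> q. sat M (e(0 := a)) \<phi>" if q: "q \<subseteq> p" "finite q" for q
  proof -
    have "\<forall>k\<in>q. \<exists>S\<in>\<Sigma>. \<forall>a. S a \<longleftrightarrow> sat M ((snd k)(0 := a)) (fst k)"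
      using q(1) unfolding p_def by auto
    then obtain s where s: "\<And>k. k \<in> q \<Longrightarrow> s k \<in> \<Sigma>"
      "\<And>k a. k \<in> q \<Longrightarrow> s k a \<longleftrightarrow> sat M ((snd k)(0 := a)) (fst k)"
      by (metis (full_types))
    then obtain a where "\<forall>S\<in>s ` q. S a" using fin[of "s ` q"] q(2) by blast
    with s(2) have "\<forall>k\<in>q. sat M ((snd k)(0 := a)) (fst k)" by blast
    then show ?thesis by (intro exI[of _ a]) force
  qed
  then obtain a where a: "\<forall>(\<phi>, e) \<in> p. sat M (e(0 := a)) \<phi>"
  proof -
    assume ass: "\<And>q. q \<subseteq> p \<Longrightarrow> finite q \<Longrightarrow> \<exists>a. \<forall>(\<phi>, e) \<in> q. sat M (e(0 := a)) \<phi>"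
      and th: "\<And>a. \<forall>(\<phi>, e) \<in> p. sat M (e(0 := a)) \<phi> \<Longrightarrow> thesis"
    have "p \<subseteq> {(\<phi>, e). wf_fm M \<phi> \<and> range e \<subseteq> ?A}" unfolding p_def by auto
    moreover have "\<forall>q\<subseteq>p. finite q \<longrightarrow> (\<exists>a. \<forall>(\<phi>, e) \<in> q. sat M (e(0 := a)) \<phi>)" using ass by blast
    ultimately have "\<exists>a. \<forall>(\<phi>, e) \<in> p. sat M (e(0 := a)) \<phi>"
      using \<kappa>(2)[unfolded kappa_saturated_def, THEN spec, THEN mp, OF card, THEN spec] by blast
    with th show thesis by blast
  qed
  have "S a" if S: "S \<in> \<Sigma>" for S
  proof -
    obtain \<phi> e where "wf_fm M \<phi>" "range e \<subseteq> ?A" "\<And>a. S a \<longleftrightarrow> sat M (e(0 := a)) \<phi>"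
      using D_imp_definable_home[OF assms(2)[OF S]] by metis
    with S a show ?thesis unfolding p_def by blast
  qed
  then show ?thesis by blast
qed

text \<open>Saturation speaks about one element. Here the coordinates of an assignment are found one
  after the other, while \<open>Inv\<close> keeps every finite part of \<open>\<Sigma>\<close>
  satisfiable together with the coordinates already fixed. The limit works because each predicate
  has finite support.\<close>

lemma saturated_countable:
  assumes A: "countable A" "\<And>P. P \<in> \<Sigma> \<Longrightarrow> D A P"
    and fin: "\<And>T. T \<subseteq> \<Sigma> \<Longrightarrow> finite T \<Longrightarrow> \<exists>e. \<forall>P\<in>T. P e"
  shows "\<exists>e. \<forall>P\<in>\<Sigma>. P e"
proof -
  define Inv where "Inv k g \<longleftrightarrow> (\<forall>T. T \<subseteq> \<Sigma> \<longrightarrow> finite T \<longrightarrow> (\<exists>e. (\<forall>i<k. e i = g i) \<and> (\<forall>P\<in>T. P e)))"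
    for k :: nat and g
  have step: "\<exists>a. Inv (Suc k) (g(k := a))" if "Inv k g" for k g
  proof -
    define S where "S T = (\<lambda>a. \<exists>e. (\<forall>i\<in>{..k}. e i = (if i < k then g i else a)) \<and> (\<forall>P\<in>T. P e))" for T
    let ?B = "A \<union> g ` {..<k}"
    have "D ?B (\<lambda>e. S T (e 0))" if "T \<subseteq> \<Sigma>" "finite T" for T
    proof -
      have "D A (\<lambda>e. \<forall>P\<in>T. P e)" using D_finite_all[of T A "\<lambda>P. P"] that A(2) by blast
      from D_mono[OF D_ex_coords[OF this, of "{..k}"], of ?B]
      have D: "D ?B (\<lambda>g. \<exists>e. (\<forall>i\<in>{..k}. e i = g i) \<and> (\<forall>P\<in>T. P e))" by simp
      have "kfun ?B (\<lambda>e. if i < k then g i else e 0)" for i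
        by (cases "i < k") (simp_all add: kfun_const kfun_var)
      from D_subst[OF D, of "\<lambda>i e. if i < k then g i else e 0", OF this]
      show ?thesis unfolding S_def .
    qed
    moreover have "\<exists>a. \<forall>s\<in>U. s a" if U: "U \<subseteq> S ` {T. T \<subseteq> \<Sigma> \<and> finite T}" "finite U" for U
    proof -
      obtain TT where TT: "TT \<subseteq> {T. T \<subseteq> \<Sigma> \<and> finite T}" "finite TT" "U = S ` TT"
        using finite_subset_image[OF U(2,1)] by blast
      then have "\<Union>TT \<subseteq> \<Sigma>" "finite (\<Union>TT)" by blast+
      then obtain e where "\<forall>i<k. e i = g i" "\<forall>P\<in>\<Union>TT. P e"
        using \<open>Inv k g\<close> unfolding Inv_def by blast
      then have "\<forall>T\<in>TT. S T (e k)"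
        unfolding S_def by (intro ballI exI[of _ e]) auto
      with TT(3) show ?thesis by blast
    qed
    ultimately have "\<exists>a. \<forall>s\<in>S ` {T. T \<subseteq> \<Sigma> \<and> finite T}. s a"
      using A(1) by (intro saturated_one[of ?B "S ` {T. T \<subseteq> \<Sigma> \<and> finite T}"]) auto
    then obtain a where a: "\<And>T. T \<subseteq> \<Sigma> \<Longrightarrow> finite T \<Longrightarrow> S T a" by blast
    have "Inv (Suc k) (g(k := a))"
      unfolding Inv_def
    proof (intro allI impI)
      fix T assume "T \<subseteq> \<Sigma>" "finite T"
      from a[OF this] obtain e where "\<forall>i\<in>{..k}. e i = (if i < k then g i else a)" "\<forall>P\<in>T. P e"
        unfolding S_def by blast
      then show "\<exists>e. (\<forall>i<Suc k. e i = (g(k := a)) i) \<and> (\<forall>P\<in>T. P e)"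
        by (intro exI[of _ e]) auto
    qed
    then show ?thesis by blast
  qed
  have "Inv 0 (\<lambda>_. 0)" unfolding Inv_def using fin by simp
  from dependent_nat_choice[of Inv "\<lambda>k g g'. \<exists>a. g' = g(k := a)"] this step
  obtain G where G: "\<And>k. Inv k (G k)" "\<And>k. \<exists>a. G (Suc k) = (G k)(k := a)" by metis
  have agree: "G k i = G (Suc i) i" if "i < k" for i k
    using that
  proof (induction k)
    case (Suc k)
    then show ?case using G(2)[of k] by (cases "i = k") auto
  qed simp
  define e where "e i = G (Suc i) i" for i
  have "P e" if P: "P \<in> \<Sigma>" for P
  proof -
    obtain n where n: "\<And>e e'. (\<And>i. i < n \<Longrightarrow> e i = e' i) \<Longrightarrow> P e = P e'"
      using D_support[OF A(2)[OF P]] by blast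
    obtain e' where e': "\<forall>i<n. e' i = G n i" "P e'"
      using G(1)[of n] P unfolding Inv_def by (metis empty_subsetI finite.simps insert_subset singletonI)
    have "P e = P e'" by (rule n) (metis e'(1) e_def agree)
    with e'(2) show ?thesis by simp
  qed
  then show ?thesis by blast
qed

section \<open>Uniform bounds in definable families\<close>

fun sep :: "nat \<Rightarrow> ('a \<Rightarrow> 'a \<Rightarrow> bool) \<Rightarrow> ('a \<Rightarrow> bool) \<Rightarrow> bool" where
  "sep 0 R X \<longleftrightarrow> (\<forall>x y. R x y \<longrightarrow> (X x \<longleftrightarrow> X y))"
| "sep (Suc N) R X \<longleftrightarrow> (\<exists>c d.
    sep N (\<lambda>x y. R x y \<and> (v d \<le> v (x - c) \<longleftrightarrow> v d \<le> v (y - c))) X \<or>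
    sep N (\<lambda>x y. R x y \<and> (v d < v (x - c) \<longleftrightarrow> v d < v (y - c))) X)"

text \<open>\<open>sep\<close> unfolds the quantifier over lists of \<open>N\<close> codes into
  \<open>N\<close> quantifiers over centres and radii, and \<open>R\<close> collects the agreement
  required so far. This makes bounded complexity definable.\<close>

lemma sep_iff:
  "sep N R X \<longleftrightarrow> (\<exists>l. length l = N \<and> (\<forall>x y. R x y \<and> (\<forall>k\<in>set l. inb k x = inb k y) \<longrightarrow> X x = X y))"
proof (induction N arbitrary: R)
  case (Suc N)
  have "sep (Suc N) R X \<longleftrightarrow> (\<exists>k l. length l = N \<and>
      (\<forall>x y. R x y \<and> inb k x = inb k y \<and> (\<forall>k\<in>set l. inb k x = inb k y) \<longrightarrow> X x = X y))"
    unfolding sep.simps Suc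
  proof (intro iffI; (elim exE disjE)?)
    fix c d l assume "length l = N \<and> (\<forall>x y. (R x y \<and> (v d \<le> v (x - c)) = (v d \<le> v (y - c))) \<and>
      (\<forall>k\<in>set l. inb k x = inb k y) \<longrightarrow> X x = X y)"
    then show "\<exists>k l. length l = N \<and>
      (\<forall>x y. R x y \<and> inb k x = inb k y \<and> (\<forall>k\<in>set l. inb k x = inb k y) \<longrightarrow> X x = X y)"
      by (intro exI[of _ "(c, d, True)"] exI[of _ l]) simp
  next
    fix c d l assume "length l = N \<and> (\<forall>x y. (R x y \<and> (v d < v (x - c)) = (v d < v (y - c))) \<and>
      (\<forall>k\<in>set l. inb k x = inb k y) \<longrightarrow> X x = X y)"
    then show "\<exists>k l. length l = N \<and>
      (\<forall>x y. R x y \<and> inb k x = inb k y \<and> (\<forall>k\<in>set l. inb k x = inb k y) \<longrightarrow> X x = X y)"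
      by (intro exI[of _ "(c, d, False)"] exI[of _ l]) simp
  next
    fix k l assume *: "length l = N \<and>
      (\<forall>x y. R x y \<and> inb k x = inb k y \<and> (\<forall>k\<in>set l. inb k x = inb k y) \<longrightarrow> X x = X y)"
    obtain c d b where k: "k = (c, d, b)" by (cases k)
    show "\<exists>c d. (\<exists>l. length l = N \<and> (\<forall>x y. (R x y \<and> (v d \<le> v (x - c)) = (v d \<le> v (y - c))) \<and>
        (\<forall>k\<in>set l. inb k x = inb k y) \<longrightarrow> X x = X y)) \<or>
      (\<exists>l. length l = N \<and> (\<forall>x y. (R x y \<and> (v d < v (x - c)) = (v d < v (y - c))) \<and>
        (\<forall>k\<in>set l. inb k x = inb k y) \<longrightarrow> X x = X y))"
    proof (cases b)
      case True
      with * k show ?thesis by (intro exI[of _ c] exI[of _ d] disjI1 exI[of _ l]) simp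
    next
      case False
      with * k show ?thesis by (intro exI[of _ c] exI[of _ d] disjI2 exI[of _ l]) simp
    qed
  qed
  also have "\<dots> \<longleftrightarrow> (\<exists>l. length l = Suc N \<and> (\<forall>x y. R x y \<and> (\<forall>k\<in>set l. inb k x = inb k y) \<longrightarrow> X x = X y))"
  proof (intro iffI; elim exE conjE)
    fix k l assume "length l = N"
      "\<forall>x y. R x y \<and> inb k x = inb k y \<and> (\<forall>k\<in>set l. inb k x = inb k y) \<longrightarrow> X x = X y"
    then show "\<exists>l. length l = Suc N \<and> (\<forall>x y. R x y \<and> (\<forall>k\<in>set l. inb k x = inb k y) \<longrightarrow> X x = X y)"
      by (intro exI[of _ "k # l"]) simp
  next
    fix l assume l: "length l = Suc N" "\<forall>x y. R x y \<and> (\<forall>k\<in>set l. inb k x = inb k y) \<longrightarrow> X x = X y"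
    then obtain k l' where "l = k # l'" by (cases l) auto
    with l show "\<exists>k l. length l = N \<and>
      (\<forall>x y. R x y \<and> inb k x = inb k y \<and> (\<forall>k\<in>set l. inb k x = inb k y) \<longrightarrow> X x = X y)"
      by (intro exI[of _ k] exI[of _ l']) simp
  qed
  finally show ?case .
qed simp

lemma sep_cpx: "sep N (\<lambda>x y. True) X \<longleftrightarrow> cpx N X"
  by (simp add: sep_iff cpx_def)

lemma D_sep:
  assumes "D A (\<lambda>e. R (\<lambda>i. e (Suc (Suc i))) (e 1) (e 0))" "D A (\<lambda>e. X (\<lambda>i. e (Suc i)) (e 0))"
  shows "D A (\<lambda>e. sep N (R e) (X e))"
  using assms
proof (induction N arbitrary: R X)
  case 0
  show ?case
    by (auto intro!: D_intros D_env2[where P = R, OF 0(1)] D_env1[where P = X, OF 0(2)])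
next
  case (Suc N)
  note R = D_env2[where P = R, OF Suc.prems(1)] and X = D_env1[where P = X, OF Suc.prems(2)]
  have "D A (\<lambda>e. sep N (\<lambda>x y. R (\<lambda>i. e (Suc (Suc i))) x y \<and>
      (v (e 0) \<le> v (x - e 1) \<longleftrightarrow> v (e 0) \<le> v (y - e 1))) (X (\<lambda>i. e (Suc (Suc i)))))"
    by (rule Suc.IH[where R = "\<lambda>e x y. R (\<lambda>i. e (Suc (Suc i))) x y \<and> (v (e 0) \<le> v (x - e 1) \<longleftrightarrow> v (e 0) \<le> v (y - e 1))"
          and X = "\<lambda>e. X (\<lambda>i. e (Suc (Suc i)))"]) (intro D_intros R X)+
  moreover have "D A (\<lambda>e. sep N (\<lambda>x y. R (\<lambda>i. e (Suc (Suc i))) x y \<and>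
      (v (e 0) < v (x - e 1) \<longleftrightarrow> v (e 0) < v (y - e 1))) (X (\<lambda>i. e (Suc (Suc i)))))"
    by (rule Suc.IH[where R = "\<lambda>e x y. R (\<lambda>i. e (Suc (Suc i))) x y \<and> (v (e 0) < v (x - e 1) \<longleftrightarrow> v (e 0) < v (y - e 1))"
          and X = "\<lambda>e. X (\<lambda>i. e (Suc (Suc i)))"]) (intro D_intros R X)+
  ultimately show ?case
    unfolding sep.simps by (intro D_ex D_disj) simp_all
qed

text \<open>Compactness: if no bound worked for all \<open>e\<close>, saturation would produce one
  \<open>e\<close> whose fibre exceeds every bound, against C-minimality.\<close>

lemma uniform_cpx:
  assumes "D A (\<lambda>e. X (\<lambda>i. e (Suc i)) (e 0))"
  shows "\<exists>N. \<forall>e. cpx N (X e)"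
proof (rule ccontr)
  assume *: "\<nexists>N. \<forall>e. cpx N (X e)"
  obtain B where B: "countable B" "D B (\<lambda>e. X (\<lambda>i. e (Suc i)) (e 0))"
    using D_countable[OF assms] by blast
  have D: "D B (\<lambda>e. \<not> cpx N (X e))" for N
    unfolding sep_cpx[symmetric] by (intro D_not D_sep[where R = "\<lambda>e x y. True"] B(2)) simp
  have "\<exists>e. \<forall>P\<in>T. P e" if T: "T \<subseteq> range (\<lambda>N e. \<not> cpx N (X e))" "finite T" for T
  proof -
    obtain I where I: "finite I" "T = (\<lambda>N e. \<not> cpx N (X e)) ` I"
      using finite_subset_image[OF T(2,1)] by blast
    obtain e where e: "\<not> cpx (Max (insert 0 I)) (X e)" using * by metis
    have "\<not> cpx N (X e)" if "N \<in> I" for N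
      using e cpx_mono[of N "X e" "Max (insert 0 I)"] I(1) that by auto
    with I(2) show ?thesis by blast
  qed
  then have "\<exists>e. \<forall>P\<in>range (\<lambda>N e. \<not> cpx N (X e)). P e"
    using B(1) D by (intro saturated_countable[of B "range (\<lambda>N e. \<not> cpx N (X e))"]) auto
  then obtain e where e: "\<forall>P\<in>range (\<lambda>N e. \<not> cpx N (X e)). P e" by (rule exE)
  have "\<not> cpx N (X e)" for N using bspec[OF e rangeI, of N] by simp
  moreover have "D UNIV (\<lambda>e'. X e (e' 0))"
    by (rule D_env1[where P = X, OF D_mono[OF B(2)]]) (auto intro: kfun_var kfun_const)
  ultimately show False using definable_cpx by blast
qed

subsection \<open>Functions into the value group\<close>

text \<open>Elements of the value group are represented by non-zero field elements.\<close>

lemma infimum: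
  assumes "D A (\<lambda>e. U (e 0))"
    and up: "\<forall>d d'. d \<noteq> 0 \<longrightarrow> d' \<noteq> 0 \<longrightarrow> v d \<le> v d' \<longrightarrow> U d \<longrightarrow> U d'"
    and ex: "d0 \<noteq> 0" "U d0" "d1 \<noteq> 0" "\<not> U d1"
  shows "\<exists>a. a \<noteq> 0 \<and> (\<forall>d. d \<noteq> 0 \<longrightarrow> v a < v d \<longrightarrow> U d) \<and> (\<forall>d. d \<noteq> 0 \<longrightarrow> v d < v a \<longrightarrow> \<not> U d)"
proof -
  obtain C where C: "finite C" "0 \<notin> C" "\<And>x y. comp C x y \<Longrightarrow> U x = U y"
    using critical_radii[OF assms(1)] by blast
  define Q where "Q = {c \<in> C. \<forall>d. d \<noteq> 0 \<longrightarrow> v c < v d \<longrightarrow> U d}"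
  have claim: "\<exists>c\<in>Q. v c \<le> v s" if s: "s \<noteq> 0" "U s" for s
  proof (cases "\<exists>c\<in>C. v c \<le> v s")
    case False
    have "v d1 < v s" using up s ex(3,4) by (meson not_le)
    then have "comp C d1 s" using False ex s by (force simp: comp_def not_le)
    then show ?thesis using C(3) s ex by blast
  next
    case True
    define Cs where "Cs = {c \<in> C. v c \<le> v s}"
    have "finite (v ` Cs)" "v ` Cs \<noteq> {}" using C(1) True by (auto simp: Cs_def)
    then obtain c where c: "c \<in> Cs" "v c = Max (v ` Cs)" using Max_in[of "v ` Cs"] by (metis imageE)
    have max: "v c' \<le> v c" if "c' \<in> C" "v c' \<le> v s" for c'
      using c(2) \<open>finite (v ` Cs)\<close> that by (auto simp: Cs_def)
    have "U d" if d: "d \<noteq> 0" "v c < v d" for d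
    proof (cases "v s \<le> v d")
      case True
      then show ?thesis using up s d by blast
    next
      case False
      have "comp C d s"
        unfolding comp_def
      proof (intro conjI ballI d s)
        fix c' assume c': "c' \<in> C"
        have "v c' \<le> v c \<or> v s < v c'" using max[OF c'] by (meson not_le)
        then show "v d \<noteq> v c'" "v s \<noteq> v c'" "(v d < v c') = (v s < v c')" using False d(2) by auto
      qed
      then show ?thesis using C(3) s by blast
    qed
    then have "c \<in> Q" using c(1) by (auto simp: Q_def Cs_def)
    then show ?thesis using c(1) unfolding Cs_def by blast
  qed
  have "finite (v ` Q)" "v ` Q \<noteq> {}" using C(1) claim[OF ex(1,2)] by (auto simp: Q_def)
  then obtain a where a: "a \<in> Q" "v a = Min (v ` Q)" using Min_in[of "v ` Q"] by (metis imageE)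
  have min: "v a \<le> v c" if "c \<in> Q" for c using a(2) \<open>finite (v ` Q)\<close> that by auto
  show ?thesis
  proof (intro exI[of _ a] conjI allI impI)
    show "a \<noteq> 0" using a(1) C(2) by (auto simp: Q_def)
    show "U d" if "d \<noteq> 0" "v a < v d" for d using a(1) that by (auto simp: Q_def)
    show "\<not> U d" if "d \<noteq> 0" "v d < v a" for d
      using claim[OF that(1)] min that(2) by fastforce
  qed
qed

text \<open>Only the valuation of \<open>g\<close> is definable.\<close>

definition gdef :: "'a set \<Rightarrow> ((nat \<Rightarrow> 'a) \<Rightarrow> 'a) \<Rightarrow> bool" where
  "gdef A g \<longleftrightarrow> (\<forall>e. g e \<noteq> 0) \<and> D A (\<lambda>e. v (e 0) = v (g (\<lambda>i. e (Suc i))))"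

lemma gdef_nonzero: "gdef A g \<Longrightarrow> g e \<noteq> 0"
  unfolding gdef_def by blast

lemma gdef_mono: "gdef A g \<Longrightarrow> A \<subseteq> B \<Longrightarrow> gdef B g"
  unfolding gdef_def using D_mono by blast

text \<open>\<open>g\<close> itself need not be definable. As \<open>R\<close> sees only its
  valuation, an arbitrary representative \<open>z\<close> can be quantified instead.\<close>

lemma D_gdef:
  assumes "gdef A g" "D A (\<lambda>e. R (v (e 0)) (\<lambda>i. e (Suc i)))" "\<And>i. kfun A (\<sigma> i)"
  shows "D A (\<lambda>e. R (v (g (\<lambda>i. \<sigma> i e))) e)"
proof -
  have "D A (\<lambda>e. \<exists>z. v z = v (g (\<lambda>i. \<sigma> i e)) \<and> R (v z) e)"
  proof (intro D_ex D_conj)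
    show "D A (\<lambda>e. v (e 0) = v (g (\<lambda>i. \<sigma> i (\<lambda>i. e (Suc i)))))"
      by (rule D_env1[where P = "\<lambda>e z. v z = v (g e)"])
        (use assms kfun_shift in \<open>auto simp: gdef_def intro: kfun_var\<close>)
    show "D A (\<lambda>e. R (v (e 0)) (\<lambda>i. e (Suc i)))" by (rule assms)
  qed
  moreover have "(\<exists>z. v z = v (g (\<lambda>i. \<sigma> i e)) \<and> R (v z) e) = R (v (g (\<lambda>i. \<sigma> i e))) e" for e
    by auto
  ultimately show ?thesis by simp
qed

lemma gdef_kfun: "kfun A F \<Longrightarrow> (\<And>e. F e \<noteq> 0) \<Longrightarrow> gdef A F"
proof -
  assume F: "kfun A F" "\<And>e. F e \<noteq> 0"
  have "D A (\<lambda>e. v (e 0) = v (F (\<lambda>i. e (Suc i))))"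
    using kfun_shift[OF F(1)] by (intro D_veq kfun_var)
  with F(2) show ?thesis unfolding gdef_def by blast
qed

text \<open>The representative \<open>g e\<close> is an arbitrary choice, but by density the
  valuation of an infimum is unique, hence definable in \<open>e\<close>.\<close>

lemma definable_infimum:
  assumes DU: "D A (\<lambda>e. U (\<lambda>i. e (Suc i)) (e 0))"
    and up: "\<forall>e d d'. d \<noteq> 0 \<longrightarrow> d' \<noteq> 0 \<longrightarrow> v d \<le> v d' \<longrightarrow> U e d \<longrightarrow> U e d'"
  shows "\<exists>g. gdef A g \<and>
    (\<forall>e. (\<exists>d. d \<noteq> 0 \<and> U e d) \<longrightarrow> (\<forall>d. d \<noteq> 0 \<longrightarrow> v (g e) < v d \<longrightarrow> U e d)) \<and>
    (\<forall>e. (\<exists>d. d \<noteq> 0 \<and> \<not> U e d) \<longrightarrow> (\<forall>d. d \<noteq> 0 \<longrightarrow> v d < v (g e) \<longrightarrow> \<not> U e d))"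
proof -
  define B where "B e \<longleftrightarrow> (\<exists>d. d \<noteq> 0 \<and> U e d) \<and> (\<exists>d. d \<noteq> 0 \<and> \<not> U e d)" for e
  \<comment> \<open>Where \<open>U e\<close> is constant on the non-zero elements there is no
    infimum. The default valuation 0 is prescribed there, because otherwise the valuation of
    \<open>g e\<close> would depend on the choice.\<close>
  define I where "I e a \<longleftrightarrow> a \<noteq> 0 \<and> (\<not> B e \<longrightarrow> v a = 0) \<and>
    (B e \<longrightarrow> (\<forall>d. d \<noteq> 0 \<and> v a < v d \<longrightarrow> U e d) \<and> (\<forall>d. d \<noteq> 0 \<and> v d < v a \<longrightarrow> \<not> U e d))" for e a
  have ex: "\<exists>a. I e a" for e
  proof (cases "B e")
    case True
    have "D UNIV (\<lambda>e'. U e (e' 0))"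
      by (rule D_env1[where P = U, OF D_mono[OF DU]]) (auto intro: kfun_var kfun_const)
    moreover obtain d0 d1 where "d0 \<noteq> 0" "U e d0" "d1 \<noteq> 0" "\<not> U e d1" using True unfolding B_def by blast
    ultimately have "\<exists>a. a \<noteq> 0 \<and> (\<forall>d. d \<noteq> 0 \<longrightarrow> v a < v d \<longrightarrow> U e d) \<and> (\<forall>d. d \<noteq> 0 \<longrightarrow> v d < v a \<longrightarrow> \<not> U e d)"
      using up by (intro infimum[of UNIV "U e" d0 d1]) blast+
    with True show ?thesis unfolding I_def by blast
  qed (auto simp: I_def intro: exI[of _ 1])
  have uniq: "\<not> v a < v b" if "I e a" "I e b" for e a b
  proof
    assume "v a < v b"
    with that obtain c where "c \<noteq> 0" "v a < v c" "v c < v b" unfolding I_def by (metis v_dense)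
    with that \<open>v a < v b\<close> show False unfolding I_def by (metis less_irrefl)
  qed
  define g where "g e = (SOME a. I e a)" for e
  have g: "I e (g e)" for e unfolding g_def by (rule someI_ex) (rule ex)
  have "v a = v (g e) \<longleftrightarrow> I e a" for e a
  proof
    assume "v a = v (g e)"
    moreover from this have "a \<noteq> 0" using g[of e] v_eq_Pinf[of a] v_eq_Pinf[of "g e"] unfolding I_def by metis
    ultimately show "I e a" using g[of e] unfolding I_def by simp
  next
    assume "I e a"
    then show "v a = v (g e)" using uniq[OF _ g, of e a] uniq[OF g, of e a] by (meson linorder_neqE)
  qed
  moreover have "D A (\<lambda>e. I (\<lambda>i. e (Suc i)) (e 0))"
    unfolding I_def B_def by (intro D_intros D_env1[where P = U, OF DU])
  ultimately have "gdef A g"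
    unfolding gdef_def using g unfolding I_def by auto
  moreover have "\<forall>e. (\<exists>d. d \<noteq> 0 \<and> U e d) \<longrightarrow> (\<forall>d. d \<noteq> 0 \<longrightarrow> v (g e) < v d \<longrightarrow> U e d)"
    "\<forall>e. (\<exists>d. d \<noteq> 0 \<and> \<not> U e d) \<longrightarrow> (\<forall>d. d \<noteq> 0 \<longrightarrow> v d < v (g e) \<longrightarrow> \<not> U e d)"
    using g unfolding I_def B_def by blast+
  ultimately show ?thesis by blast
qed

text \<open>Definable choice of a radius. The infimum may itself violate \<open>U\<close>, so it is
  multiplied by \<open>\<pi>\<close> to get strictly above it.\<close>

lemma definable_radius:
  assumes DU: "D A (\<lambda>e. U (\<lambda>i. e (Suc i)) (e 0))"
    and up: "\<forall>e d d'. d \<noteq> 0 \<longrightarrow> d' \<noteq> 0 \<longrightarrow> v d \<le> v d' \<longrightarrow> U e d \<longrightarrow> U e d'"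
  shows "\<exists>g. gdef A g \<and> (\<forall>e. (\<exists>d. d \<noteq> 0 \<and> U e d) \<longrightarrow> U e (g e))"
proof -
  obtain g where g: "gdef A g"
    "\<forall>e. (\<exists>d. d \<noteq> 0 \<and> U e d) \<longrightarrow> (\<forall>d. d \<noteq> 0 \<longrightarrow> v (g e) < v d \<longrightarrow> U e d)"
    using definable_infimum[of A U, OF assms] by blast
  have "D A (\<lambda>e. v (e 0 / \<pi>) = v (g (\<lambda>i. e (Suc i))))"
    by (rule D_env1[where P = "\<lambda>e z. v z = v (g e)"])
      (use g(1) in \<open>auto simp: gdef_def intro: kfun_intros\<close>)
  moreover have "v (a / \<pi>) = v b \<longleftrightarrow> v a = v (b * \<pi>)" for a b
    using v_divide_eq[of \<pi> a b] by simp
  ultimately have "gdef A (\<lambda>e. g e * \<pi>)"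
    using gdef_nonzero[OF g(1)] unfolding gdef_def by simp
  moreover have "\<forall>e. (\<exists>d. d \<noteq> 0 \<and> U e d) \<longrightarrow> U e (g e * \<pi>)"
    using g(2) v_less_mult_\<pi> gdef_nonzero[OF g(1)] by (metis \<pi>_nonzero mult_eq_0_iff)
  ultimately show ?thesis by (intro exI[of _ "\<lambda>e. g e * \<pi>"]) simp
qed

definition gdef1 :: "('a \<Rightarrow> 'a) \<Rightarrow> bool" where
  "gdef1 g \<longleftrightarrow> (\<forall>x. g x \<noteq> 0) \<and> D UNIV (\<lambda>e. v (e 1) = v (g (e 0)))"

lemma gdef1_gdef: "gdef1 g \<longleftrightarrow> gdef UNIV (\<lambda>e. g (e 0))"
proof
  assume "gdef1 g"
  then show "gdef UNIV (\<lambda>e. g (e 0))"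
    unfolding gdef1_def gdef_def using D_rename[of UNIV "\<lambda>e. v (e 1) = v (g (e 0))" "\<lambda>i. 1 - i"] by simp
next
  assume *: "gdef UNIV (\<lambda>e. g (e 0))"
  then have "g x \<noteq> 0" for x using gdef_nonzero[of UNIV "\<lambda>e. g (e 0)" "\<lambda>_. x"] by simp
  with * show "gdef1 g"
    unfolding gdef1_def gdef_def using D_rename[of UNIV "\<lambda>e. v (e 0) = v (g (e (Suc 0)))" "\<lambda>i. 1 - i"] by simp
qed

lemma D_gdef1:
  assumes "gdef1 g" "D UNIV (\<lambda>e. R (v (e 0)) (\<lambda>i. e (Suc i)))" "kfun UNIV F"
  shows "D UNIV (\<lambda>e. R (v (g (F e))) e)"
  using D_gdef[of UNIV "\<lambda>e. g (e 0)" R "\<lambda>_. F"] assms gdef1_gdef by simp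

lemma gdef_diag: "gdef UNIV g \<Longrightarrow> gdef1 (\<lambda>x. g (\<lambda>_. x))"
  unfolding gdef1_def
  using D_rename[of UNIV "\<lambda>e. v (e 0) = v (g (\<lambda>i. e (Suc i)))" "\<lambda>i. 1 - i"] gdef_nonzero
  by (auto simp: gdef_def)

lemma definable_radius1:
  assumes DU: "D UNIV (\<lambda>e. U (e 1) (e 0))"
    and up: "\<forall>x d d'. d \<noteq> 0 \<longrightarrow> d' \<noteq> 0 \<longrightarrow> v d \<le> v d' \<longrightarrow> U x d \<longrightarrow> U x d'"
  shows "\<exists>g. gdef1 g \<and> (\<forall>x. (\<exists>d. d \<noteq> 0 \<and> U x d) \<longrightarrow> U x (g x))"
proof -
  have "\<exists>g. gdef UNIV g \<and> (\<forall>e. (\<exists>d. d \<noteq> 0 \<and> U (e 0) d) \<longrightarrow> U (e 0) (g e))"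
    using DU up by (intro definable_radius[of UNIV "\<lambda>e. U (e 0)"]) simp_all
  then obtain g where g: "gdef UNIV g" "\<And>e. (\<exists>d. d \<noteq> 0 \<and> U (e 0) d) \<longrightarrow> U (e 0) (g e)" by blast
  show ?thesis
    by (rule exI[of _ "\<lambda>x. g (\<lambda>_. x)"], intro conjI allI) (rule gdef_diag[OF g(1)] g(2)[of "\<lambda>_. x" for x])+
qed

lemma definable_infimum1:
  assumes DU: "D UNIV (\<lambda>e. U (e 1) (e 0))"
    and up: "\<forall>x d d'. d \<noteq> 0 \<longrightarrow> d' \<noteq> 0 \<longrightarrow> v d \<le> v d' \<longrightarrow> U x d \<longrightarrow> U x d'"
  shows "\<exists>g. gdef1 g \<and>
    (\<forall>x. (\<exists>d. d \<noteq> 0 \<and> U x d) \<longrightarrow> (\<forall>d. d \<noteq> 0 \<longrightarrow> v (g x) < v d \<longrightarrow> U x d)) \<and>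
    (\<forall>x. (\<exists>d. d \<noteq> 0 \<and> \<not> U x d) \<longrightarrow> (\<forall>d. d \<noteq> 0 \<longrightarrow> v d < v (g x) \<longrightarrow> \<not> U x d))"
proof -
  have "\<exists>g. gdef UNIV g \<and>
    (\<forall>e. (\<exists>d. d \<noteq> 0 \<and> U (e 0) d) \<longrightarrow> (\<forall>d. d \<noteq> 0 \<longrightarrow> v (g e) < v d \<longrightarrow> U (e 0) d)) \<and>
    (\<forall>e. (\<exists>d. d \<noteq> 0 \<and> \<not> U (e 0) d) \<longrightarrow> (\<forall>d. d \<noteq> 0 \<longrightarrow> v d < v (g e) \<longrightarrow> \<not> U (e 0) d))"
    using DU up by (intro definable_infimum[of UNIV "\<lambda>e. U (e 0)"]) simp_all
  then obtain g where g: "gdef UNIV g"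
    "\<And>e. (\<exists>d. d \<noteq> 0 \<and> U (e 0) d) \<longrightarrow> (\<forall>d. d \<noteq> 0 \<longrightarrow> v (g e) < v d \<longrightarrow> U (e 0) d)"
    "\<And>e. (\<exists>d. d \<noteq> 0 \<and> \<not> U (e 0) d) \<longrightarrow> (\<forall>d. d \<noteq> 0 \<longrightarrow> v d < v (g e) \<longrightarrow> \<not> U (e 0) d)" by blast
  show ?thesis
    by (rule exI[of _ "\<lambda>x. g (\<lambda>_. x)"], rule conjI[OF gdef_diag[OF g(1)]])
      (use g(2,3)[of "\<lambda>_. x" for x] in blast)
qed

text \<open>
  Otherwise among many points in distinct residue classes, all lying below (or all lying above)
  generic values, the extremal one bounds a definable set that meets too many residue classes.
\<close>

lemma generically_constant:
  assumes g: "gdef1 g"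
  obtains d where "d \<noteq> 0" "eventually (\<lambda>x. v (g x) = v d) genO"
proof (rule ccontr)
  assume *: "\<not> thesis"
  have D1: "D UNIV (\<lambda>e. v (g (e 0)) \<le> v (e (Suc 0)))"
    by (rule D_gdef1[where R = "\<lambda>z e. z \<le> v (e (Suc 0))", OF g]) (intro D_intros)+
  have D2: "D UNIV (\<lambda>e. v (e (Suc 0)) \<le> v (g (e 0)))"
    by (rule D_gdef1[where R = "\<lambda>z e. v (e (Suc 0)) \<le> z", OF g]) (intro D_intros)+
  obtain N1 where N1': "\<forall>e :: nat \<Rightarrow> 'a. cpx N1 (\<lambda>x. v (g x) \<le> v (e 0))"
    using uniform_cpx[of UNIV "\<lambda>e x. v (g x) \<le> v (e 0)", OF D1] by (rule exE)
  note N1 = N1'[THEN spec, of "\<lambda>_. c" for c]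
  obtain N2 where N2': "\<forall>e :: nat \<Rightarrow> 'a. cpx N2 (\<lambda>x. v (e 0) \<le> v (g x))"
    using uniform_cpx[of UNIV "\<lambda>e x. v (e 0) \<le> v (g x)", OF D2] by (rule exE)
  note N2 = N2'[THEN spec, of "\<lambda>_. c" for c]
  have ne: "\<not> eventually (\<lambda>x. v (g x) \<le> v (g y)) genO \<or> \<not> eventually (\<lambda>x. v (g y) \<le> v (g x)) genO" for y
  proof (rule ccontr)
    assume "\<not> ?thesis"
    then have "eventually (\<lambda>x. v (g x) \<le> v (g y)) genO" "eventually (\<lambda>x. v (g y) \<le> v (g x)) genO" by auto
    then have "eventually (\<lambda>x. v (g x) = v (g y)) genO" by eventually_elim simp
    moreover have "g y \<noteq> 0" using g unfolding gdef1_def by blast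
    ultimately show False using * that by blast
  qed
  \<comment> \<open>More residue classes than the two bounds allow together. Each
    \<open>y \<in> S\<close> fails one of the two generic inequalities, since both together would
    make \<open>v (g x)\<close> generically constant; so \<open>S\<close> splits into two parts, one
    of which is too large.\<close>
  obtain S where S: "S \<subseteq> gen {}" "card S = N1 + N2 + 2" "finite S"
    "\<forall>x\<in>S. \<forall>y\<in>S. x \<noteq> y \<longrightarrow> v (x - y) \<le> 0"
    using gen_many[of "{}" "N1 + N2 + 2"] by blast
  define S1 where "S1 = {y \<in> S. \<not> eventually (\<lambda>x. v (g x) \<le> v (g y)) genO}"
  define S2 where "S2 = {y \<in> S. \<not> eventually (\<lambda>x. v (g y) \<le> v (g x)) genO}"
  have "S = S1 \<union> S2" using ne by (auto simp: S1_def S2_def)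
  then have "card S \<le> card S1 + card S2" by (simp add: card_Un_le)
  moreover have "card S1 \<le> N1"
  proof (cases "S1 = {}")
    case False
    have fin: "finite (v ` g ` S1)" using S(3) by (auto simp: S1_def)
    have "Max (v ` g ` S1) \<in> v ` g ` S1" using Max_in[OF fin] False by simp
    then obtain y where y: "y \<in> S1" "v (g y) = Max (v ` g ` S1)" by (elim imageE) simp
    have "v (g x) \<le> v (g y)" if "x \<in> S1" for x using fin that y(2) by simp
    with y(1) S show ?thesis
      by (intro cpx_few_residues[OF N1[of "g y"]]) (auto simp: S1_def gen_def)
  qed simp
  moreover have "card S2 \<le> N2"
  proof (cases "S2 = {}")
    case False
    have fin: "finite (v ` g ` S2)" using S(3) by (auto simp: S2_def)
    have "Min (v ` g ` S2) \<in> v ` g ` S2" using Min_in[OF fin] False by simp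
    then obtain y where y: "y \<in> S2" "v (g y) = Min (v ` g ` S2)" by (elim imageE) simp
    have "v (g y) \<le> v (g x)" if "x \<in> S2" for x using fin that y(2) by simp
    with y(1) S show ?thesis
      by (intro cpx_few_residues[OF N2[of "g y"]]) (auto simp: S2_def gen_def)
  qed simp
  ultimately show False using S(2) by simp
qed

text \<open>Finitely many balls describe \<open>X\<close>. A point of \<open>X\<close> that is none
  of their centres has a neighbourhood on which the distances to all centres, and hence membership
  in \<open>X\<close>, do not change.\<close>

lemma infinite_contains_ball:
  assumes "D A (\<lambda>e. X (e 0))" "infinite {x. X x}"
  obtains a d where "d \<noteq> 0" "\<And>x. v d \<le> v (x - a) \<Longrightarrow> X x"
proof -
  obtain l where l: "\<forall>x y. (\<forall>k\<in>set l. inb k x = inb k y) \<longrightarrow> X x = X y"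
    using definable_cpx[OF assms(1)] unfolding cpx_def by blast
  have "finite (fst ` set l)" by simp
  then obtain a where a: "X a" "a \<notin> fst ` set l"
    using assms(2) by (metis (mono_tags, lifting) finite_subset mem_Collect_eq subsetI)
  have "\<exists>m. m \<noteq> 0 \<and> (\<forall>c\<in>C. v (a - c) < v m)" if "finite C" "a \<notin> C" for C
    using that
  proof (induction C rule: finite_induct)
    case (insert c C)
    then obtain m where m: "m \<noteq> 0" "\<forall>c\<in>C. v (a - c) < v m" by auto
    obtain m' where m': "m' \<noteq> 0" "v (a - c) < v m'" using v_above[of "a - c"] insert by auto
    obtain k where "k \<noteq> 0" "v m \<le> v k" "v m' \<le> v k" using v_max_ex m m' by blast
    with m m' show ?case by (intro exI[of _ k]) (auto intro: less_le_trans)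
  qed (auto intro: exI[of _ 1])
  then obtain m where m: "m \<noteq> 0" "\<forall>c\<in>fst ` set l. v (a - c) < v m"
    using a(2) \<open>finite (fst ` set l)\<close> by meson
  have "X x" if x: "v m \<le> v (x - a)" for x
  proof -
    have "\<forall>k\<in>set l. inb k x = inb k a"
    proof
      fix k assume k: "k \<in> set l"
      obtain c d b where kk: "k = (c, d, b)" by (cases k)
      have "v (a - c) < v m" using m(2) k kk by force
      then have "v ((a - c) + (x - a)) = v (a - c)" using x by (intro v_add_eq) (rule less_le_trans)
      then have "v (x - c) = v (a - c)" by simp
      then show "inb k x = inb k a" using kk by (cases b) simp_all
    qed
    then show ?thesis using l a(1) by blast
  qed
  with m(1) that show thesis by blast
qed

text \<open>An infinite set of exceptional points would contain a ball. Rescaled to the valuation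
  ring, the function is generically constant there, and since \<open>gen F\<close> is open, a
  generic point of the ball is not exceptional.\<close>

lemma locally_constant_cofinite:
  assumes g: "gdef1 g"
  shows "finite {y. \<not> (\<exists>d. d \<noteq> 0 \<and> (\<forall>x. v d < v (x - y) \<longrightarrow> v (g x) = v (g y)))}"
proof (rule ccontr)
  define E where "E y \<longleftrightarrow> \<not> (\<exists>d. d \<noteq> 0 \<and> (\<forall>x. v d < v (x - y) \<longrightarrow> v (g x) = v (g y)))" for y
  assume "infinite {y. \<not> (\<exists>d. d \<noteq> 0 \<and> (\<forall>x. v d < v (x - y) \<longrightarrow> v (g x) = v (g y)))}"
  then have inf: "infinite {y. E y}" by (simp add: E_def)
  have Dv: "D UNIV (\<lambda>e. v (g (F e)) = v (g (G e)))" if FG: "kfun UNIV F" "kfun UNIV G" for F G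
  proof (rule D_gdef1[where R = "\<lambda>z e. z = v (g (G e))", OF g _ FG(1)])
    show "D UNIV (\<lambda>e. v (e 0) = v (g (G (\<lambda>i. e (Suc i)))))"
      using D_gdef1[where R = "\<lambda>z e. v (e 0) = z", OF g _ kfun_shift[OF FG(2)]] by (simp add: D_intros)
  qed
  have "D UNIV (\<lambda>e. E (e 0))" unfolding E_def by (intro D_intros Dv)
  from infinite_contains_ball[OF this inf] obtain a d where ad: "d \<noteq> 0" "\<And>x. v d \<le> v (x - a) \<Longrightarrow> E x"
    by metis
  have "gdef1 (\<lambda>x. g (a + d * x))"
    unfolding gdef1_def
  proof (intro conjI allI)
    show "g (a + d * x) \<noteq> 0" for x using g unfolding gdef1_def by blast
    show "D UNIV (\<lambda>e. v (e 1) = v (g (a + d * e 0)))"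
      using D_gdef1[where R = "\<lambda>z e. v (e 1) = z", OF g, of "\<lambda>e. a + d * e 0"]
      by (simp add: D_intros kfun_const)
  qed
  from generically_constant[OF this] obtain c where "eventually (\<lambda>x. v (g (a + d * x)) = v c) genO" by blast
  then obtain F where F: "finite F" "\<And>x. x \<in> gen F \<Longrightarrow> v (g (a + d * x)) = v c"
    unfolding eventually_genO by blast
  obtain x0 where x0: "x0 \<in> gen F" using gen_nonempty[OF F(1)] by blast
  let ?y = "a + d * x0"
  have "v (g x) = v (g ?y)" if x: "v d < v (x - ?y)" for x
  proof -
    define z where "z = (x - a) / d"
    have xz: "x = a + d * z" using ad(1) by (simp add: z_def)
    have "v (d * 1) < v (d * (z - x0))" using x xz by (simp add: algebra_simps)
    then have zx: "0 < v (z - x0)" unfolding v_mult_less_iff'[OF ad(1)] by simp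
    have "z \<in> gen F"
      unfolding gen_def
    proof (intro CollectI conjI ballI)
      have x0v: "0 \<le> v x0" using x0 by (simp add: gen_def)
      show "0 \<le> v z" using v_add_le[of 0 "z - x0" x0] zx x0v by simp
      fix f assume "f \<in> F"
      then have "v (x0 - f) \<le> 0" using x0 by (simp add: gen_def)
      then have "v ((x0 - f) + (z - x0)) = v (x0 - f)" using zx by (intro v_add_eq) simp
      with \<open>v (x0 - f) \<le> 0\<close> show "v (z - f) \<le> 0" by simp
    qed
    then show ?thesis using F(2) x0 xz by simp
  qed
  with ad(1) have "\<not> E ?y" unfolding E_def by blast
  moreover have "v (d * 1) \<le> v (d * x0)" using x0 ad(1) unfolding v_mult_le_iff'[OF ad(1)] by (simp add: gen_def)
  then have "E ?y" using ad(2)[of ?y] by simp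
  ultimately show False by blast
qed

text \<open>A germ with values in the residue field is encoded by its relation \<open>S\<close> to representatives.\<close>

lemma residue_germ:
  assumes DS: "D UNIV (\<lambda>e. S (e 1) (e 0))"
    and ev: "eventually (\<lambda>x. \<exists>c. 0 \<le> v c \<and> S x c) at0"
    and inv: "\<And>x c c'. S x c \<Longrightarrow> 0 < v (c - c') \<Longrightarrow> S x c'"
  shows "\<exists>c. 0 \<le> v c \<and> eventually (\<lambda>x. S x c) at0"
proof (rule ccontr)
  assume *: "\<nexists>c. 0 \<le> v c \<and> eventually (\<lambda>x. S x c) at0"
  have none: "eventually (\<lambda>x. \<not> S x c) at0" if "0 \<le> v c" for c
  proof -
    have "D UNIV (\<lambda>e. S (e 0) c)"
      by (rule D_env2[where P = "\<lambda>e. S" and \<sigma> = "\<lambda>i e. e i", OF DS[folded One_nat_def]])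
        (auto intro: kfun_var kfun_const)
    from at0_complete[OF this] * that show ?thesis by blast
  qed
  define U where "U c d \<longleftrightarrow> (\<forall>x. x \<noteq> 0 \<longrightarrow> v d < v x \<longrightarrow> \<not> S x c)" for c d
  have "D UNIV (\<lambda>e. S (e 0) (e 2))"
    using D_rename[OF DS, of "\<lambda>i. if i = 0 then 2 else 0"] by simp
  then have "D UNIV (\<lambda>e. U (e 1) (e 0))"
    unfolding U_def by (intro D_intros) (simp add: numeral_2_eq_2)
  moreover have "\<forall>c d d'. d \<noteq> 0 \<longrightarrow> d' \<noteq> 0 \<longrightarrow> v d \<le> v d' \<longrightarrow> U c d \<longrightarrow> U c d'"
    unfolding U_def by (meson le_less_trans)
  ultimately have "\<exists>g. gdef1 g \<and> (\<forall>x. (\<exists>d. d \<noteq> 0 \<and> U x d) \<longrightarrow> U x (g x))" by (rule definable_radius1)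
  then obtain \<kappa> where \<kappa>: "gdef1 \<kappa>" "\<And>c. \<exists>d. d \<noteq> 0 \<and> U c d \<Longrightarrow> U c (\<kappa> c)" by blast
  have U: "U c (\<kappa> c)" if "0 \<le> v c" for c
    using none[OF that] \<kappa>(2)[of c] unfolding U_def eventually_at0 by blast
  \<comment> \<open>All generic residues are left by the germ beyond one common radius
    \<open>v d\<close>. Only the residues of the finite set \<open>F\<close> remain, and each of
    them is avoided eventually.\<close>
  obtain d where d: "d \<noteq> 0" "eventually (\<lambda>c. v (\<kappa> c) = v d) genO"
    using generically_constant[OF \<kappa>(1)] by blast
  then obtain F where F: "finite F" "\<And>c. c \<in> gen F \<Longrightarrow> v (\<kappa> c) = v d"
    unfolding eventually_genO by blast
  have "eventually (\<lambda>x. \<forall>f\<in>F. 0 \<le> v f \<longrightarrow> \<not> S x f) at0"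
    using F(1) none by (intro eventually_ball_finite) auto
  with ev eventually_at0_nonzero eventually_at0_less[OF d(1)]
  have "eventually (\<lambda>x. False) at0"
  proof eventually_elim
    case (elim x)
    then obtain c where c: "0 \<le> v c" "S x c" by blast
    have "c \<notin> gen F" using U[OF c(1)] F(2)[of c] elim c(2) unfolding U_def by auto
    then obtain f where f: "f \<in> F" "0 < v (c - f)" using c(1) by (auto simp: gen_def not_le)
    then have "0 \<le> v f" using v_diff_le[of 0 c "c - f"] c(1) by simp
    with f elim inv[OF c(2) f(2)] show False by blast
  qed
  then show False using at0_neq_bot by blast
qed

subsection \<open>Germs with values in the group of leading terms\<close>

text \<open>Equality modulo the principal units: \<open>x / y\<close> lies in 1 plus the maximal
  ideal.\<close>

definition rveq :: "'a \<Rightarrow> 'a \<Rightarrow> bool" where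
  "rveq x y \<longleftrightarrow> x \<noteq> 0 \<and> y \<noteq> 0 \<and> v y < v (x - y)"

lemma rveq_v: "rveq x y \<Longrightarrow> v x = v y"
  using v_add_eq[of y "x - y"] by (simp add: rveq_def)

lemma rveq_refl: "x \<noteq> 0 \<Longrightarrow> rveq x x"
  by (simp add: rveq_def v_less_Pinf)

lemma rveq_sym: "rveq x y \<Longrightarrow> rveq y x"
  using rveq_v[of x y] by (simp add: rveq_def v_minus_commute)

lemma rveq_trans: "rveq x y \<Longrightarrow> rveq y z \<Longrightarrow> rveq x z"
  using rveq_v[of y z] v_trans_less[of "v z" x y z] by (simp add: rveq_def)

lemma rveq_mult_left: "rveq x y \<Longrightarrow> z \<noteq> 0 \<Longrightarrow> rveq (z * x) (z * y)"
  using v_mult_less_iff'[of z y "x - y"] by (simp add: rveq_def right_diff_distrib)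

lemma rveq_mult: "rveq x y \<Longrightarrow> rveq x' y' \<Longrightarrow> rveq (x * x') (y * y')"
  using rveq_mult_left[of x' y' x] rveq_mult_left[of x y y'] rveq_trans
  by (metis mult.commute rveq_def)

lemma rveq_inverse: "rveq x y \<Longrightarrow> rveq (1 / x) (1 / y)"
  using rveq_mult_left[OF rveq_sym, of x y "1 / (x * y)"] by (auto simp: rveq_def field_simps)

lemma rveq_divide: "rveq x y \<Longrightarrow> rveq x' y' \<Longrightarrow> rveq (x / x') (y / y')"
  using rveq_mult[OF _ rveq_inverse, of x y x' y'] by simp

lemma rveq_cancel: "rveq (z * x) (z * y) \<Longrightarrow> rveq x y"
  using rveq_mult_left[of "z * x" "z * y" "1 / z"] by (cases "z = 0") (auto simp: rveq_def)

lemma rveq_unit: "rveq c c' \<Longrightarrow> v c' = 0 \<Longrightarrow> 0 < v (c - c')"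
  by (simp add: rveq_def)

lemma rveq_unitI: "0 < v (c - c') \<Longrightarrow> v c' = 0 \<Longrightarrow> rveq c c'"
  using v_unit_nonzero[of c'] by (auto simp: rveq_def)

lemma rveq_cong: "rveq y y' \<Longrightarrow> rveq x y \<longleftrightarrow> rveq x y'"
  by (blast intro: rveq_trans rveq_sym)

lemma D_rveq: "kfun A F \<Longrightarrow> kfun A G \<Longrightarrow> D A (\<lambda>e. rveq (F e) (G e))"
  unfolding rveq_def by (intro D_intros)

text \<open>
  A germ with values in the quotient of the multiplicative group by the principal units is
  represented by an arbitrary choice of representatives.
\<close>

definition rvf :: "('a \<Rightarrow> 'a) \<Rightarrow> bool" where
  "rvf e \<longleftrightarrow> (\<forall>x. e x \<noteq> 0) \<and> D UNIV (\<lambda>E. rveq (E 0) (e (E 1)))"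

lemma rvf_nonzero: "rvf e \<Longrightarrow> e x \<noteq> 0"
  unfolding rvf_def by blast

lemma D_rvf: "rvf e \<Longrightarrow> kfun UNIV F \<Longrightarrow> kfun UNIV G \<Longrightarrow> D UNIV (\<lambda>E. rveq (F E) (e (G E)))"
  unfolding rvf_def by (elim conjE) (rule D_fun2[where P = "\<lambda>x y. rveq x (e y)"])

lemma kfun_rvf: "kfun UNIV (\<lambda>E. f (E 0)) \<Longrightarrow> (\<And>x. f x \<noteq> 0) \<Longrightarrow> rvf f"
proof -
  assume f: "kfun UNIV (\<lambda>E. f (E 0))" "\<And>x. f x \<noteq> 0"
  have "kfun UNIV (\<lambda>E. f (E 1))" by (rule kfun_fun1[OF f(1) kfun_var])
  then show "rvf f" unfolding rvf_def using f(2) by (auto intro: D_rveq kfun_var)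
qed

lemma D_rvf_fun:
  assumes e: "rvf e" and D: "D UNIV (\<lambda>E. R (E 0) (\<lambda>i. E (Suc i)))" and F: "kfun UNIV F"
    and R: "\<And>z z' E. rveq z z' \<Longrightarrow> R z E = R z' E"
  shows "D UNIV (\<lambda>E. R (e (F E)) E)"
proof -
  have "D UNIV (\<lambda>E. \<exists>z. rveq z (e (F E)) \<and> R z E)"
    by (intro D_ex D_conj D_rvf[OF e] D kfun_var kfun_shift[OF F])
  moreover have "(\<exists>z. rveq z (e (F E)) \<and> R z E) = R (e (F E)) E" for E
    using R rveq_refl[OF rvf_nonzero[OF e]] by blast
  ultimately show ?thesis by simp
qed

lemma rvf_gdef1: "rvf e \<Longrightarrow> gdef1 e"
  unfolding gdef1_def
  using D_rvf_fun[of e "\<lambda>z E. v (E 1) = v z" "\<lambda>E. E 0"] rvf_nonzero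
  by (auto simp: D_intros rveq_v)

lemma D_g2:
  assumes "gdef1 g" "kfun UNIV F" "kfun UNIV G"
    and "D UNIV (\<lambda>e. R (v (e 0)) (v (e 1)))"
  shows "D UNIV (\<lambda>e. R (v (g (F e))) (v (g (G e))))"
proof (rule D_gdef1[where R = "\<lambda>z e. R z (v (g (G e)))", OF assms(1) _ assms(2)])
  show "D UNIV (\<lambda>e. R (v (e 0)) (v (g (G (\<lambda>i. e (Suc i))))))"
  proof (rule D_gdef1[where R = "\<lambda>z e. R (v (e 0)) z", OF assms(1) _ kfun_shift[OF assms(3)]])
    show "D UNIV (\<lambda>e. R (v (e (Suc 0))) (v (e 0)))"
      using D_rename[OF assms(4), of "\<lambda>i. 1 - i"] by simp
  qed
qed

lemma D_g_less: "gdef1 g \<Longrightarrow> kfun UNIV F \<Longrightarrow> kfun UNIV G \<Longrightarrow> D UNIV (\<lambda>e. v (g (F e)) < v (g (G e)))"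
  and D_g_le: "gdef1 g \<Longrightarrow> kfun UNIV F \<Longrightarrow> kfun UNIV G \<Longrightarrow> D UNIV (\<lambda>e. v (g (F e)) \<le> v (g (G e)))"
  and D_g_eq: "gdef1 g \<Longrightarrow> kfun UNIV F \<Longrightarrow> kfun UNIV G \<Longrightarrow> D UNIV (\<lambda>e. v (g (F e)) = v (g (G e)))"
  by (rule D_g2; (assumption | intro D_intros))+

lemma D_g1_less: "gdef1 g \<Longrightarrow> kfun UNIV F \<Longrightarrow> kfun UNIV G \<Longrightarrow> D UNIV (\<lambda>e. v (g (F e)) < v (G e))"
  using D_gdef1[where R = "\<lambda>z e. z < v (G e)"] kfun_shift[of UNIV G Suc] by (simp add: D_intros)

lemma D_g1_le: "gdef1 g \<Longrightarrow> kfun UNIV F \<Longrightarrow> kfun UNIV G \<Longrightarrow> D UNIV (\<lambda>e. v (g (F e)) \<le> v (G e))"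
  using D_gdef1[where R = "\<lambda>z e. z \<le> v (G e)"] kfun_shift[of UNIV G Suc] by (simp add: D_intros)

lemma D_rvf_ratio:
  assumes e: "rvf e" and F: "kfun UNIV F" and G: "kfun UNIV G" and H: "kfun UNIV H"
  shows "D UNIV (\<lambda>E. rveq (F E) (e (G E) / e (H E)))"
proof (rule D_rvf_fun[where R = "\<lambda>z E. rveq (F E) (z / e (H E))", OF e _ G])
  show "D UNIV (\<lambda>E. rveq (F (\<lambda>i. E (Suc i))) (E 0 / e (H (\<lambda>i. E (Suc i)))))"
  proof (rule D_rvf_fun[where R = "\<lambda>z E. rveq (F (\<lambda>i. E (Suc i))) (E 0 / z)", OF e _ kfun_shift[OF H]])
    show "D UNIV (\<lambda>E. rveq (F (\<lambda>i. E (Suc (Suc i)))) (E (Suc 0) / E 0))"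
      by (intro D_rveq kfun_intros kfun_shift[OF F])
    show "rveq (F (\<lambda>i. E (Suc i))) (E 0 / z) = rveq (F (\<lambda>i. E (Suc i))) (E 0 / z')" if z: "rveq z z'" for z z' E
    proof (cases "E 0 = 0")
      case False
      then show ?thesis by (intro rveq_cong rveq_divide rveq_refl z)
    qed (simp add: rveq_def)
  qed
  show "rveq (F E) (z / e (H E)) = rveq (F E) (z' / e (H E))" if "rveq z z'" for z z' E
    by (intro rveq_cong rveq_divide rveq_refl that rvf_nonzero[OF e])
qed

lemma rvf_ratio: "rvf e \<Longrightarrow> s \<noteq> 0 \<Longrightarrow> rvf (\<lambda>x. e (s * x) / e x)"
  using D_rvf_ratio[of e "\<lambda>E. E 0" "\<lambda>E. s * E 1" "\<lambda>E. E 1"]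
  unfolding rvf_def by (simp add: D_intros kfun_const)

text \<open>If \<open>v (e (u * x))\<close> were eventually larger than \<open>v (e x)\<close> for
  generic \<open>u\<close>, this would hold for some \<open>u\<close> together with its inverse, and
  the two inequalities contradict each other; likewise for smaller. So equality holds for generic
  units, and it passes to products of two of them.\<close>

lemma rvf_v_unit:
  assumes e: "rvf e" and u: "v u = 0"
  shows "eventually (\<lambda>x. v (e (u * x)) = v (e x)) at0"
proof -
  note g = rvf_gdef1[OF e]
  define H1 where "H1 u \<longleftrightarrow> eventually (\<lambda>x. v (e x) < v (e (u * x))) at0" for u
  define H2 where "H2 u \<longleftrightarrow> eventually (\<lambda>x. v (e (u * x)) < v (e x)) at0" for u
  have D1: "D UNIV (\<lambda>E. v (e (E 0)) < v (e (E (Suc 0) * E 0)))"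
    and D2: "D UNIV (\<lambda>E. v (e (E (Suc 0) * E 0)) < v (e (E 0)))"
    by (intro D_g_less[OF g] kfun_intros)+
  have "D UNIV (\<lambda>E. H1 (E 0))" unfolding H1_def by (rule D_at0) (rule D1)
  moreover have "\<not> eventually H1 genO"
  proof
    assume "eventually H1 genO"
    then obtain x where x: "v x = 0" "H1 x" "H1 (1 / x)" by (rule genO_inverse)
    from x(1) have "x \<noteq> 0" by (rule v_unit_nonzero)
    with x have "eventually (\<lambda>y. v (e (x * y)) < v (e y)) at0"
      using eventually_at0_mult[of "\<lambda>y. v (e y) < v (e (1 / x * y))" x] unfolding H1_def by simp
    with x(2) have "eventually (\<lambda>y. False) at0" unfolding H1_def by eventually_elim simp
    then show False using at0_neq_bot by blast
  qed
  ultimately have n1: "eventually (\<lambda>u. \<not> H1 u) genO" using genO_complete by blast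
  have "D UNIV (\<lambda>E. H2 (E 0))" unfolding H2_def by (rule D_at0) (rule D2)
  moreover have "\<not> eventually H2 genO"
  proof
    assume "eventually H2 genO"
    then obtain x where x: "v x = 0" "H2 x" "H2 (1 / x)" by (rule genO_inverse)
    from x(1) have "x \<noteq> 0" by (rule v_unit_nonzero)
    with x have "eventually (\<lambda>y. v (e y) < v (e (x * y))) at0"
      using eventually_at0_mult[of "\<lambda>y. v (e (1 / x * y)) < v (e y)" x] unfolding H2_def by simp
    with x(2) have "eventually (\<lambda>y. False) at0" unfolding H2_def by eventually_elim simp
    then show False using at0_neq_bot by blast
  qed
  ultimately have n2: "eventually (\<lambda>u. \<not> H2 u) genO" using genO_complete by blast
  define H0 where "H0 u \<longleftrightarrow> eventually (\<lambda>x. v (e (u * x)) = v (e x)) at0" for u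
  have "eventually H0 genO"
    using n1 n2
  proof eventually_elim
    case (elim u)
    have "D UNIV (\<lambda>E. v (e (E 0)) < v (e (u * E 0)))" "D UNIV (\<lambda>E. v (e (u * E 0)) < v (e (E 0)))"
      by (intro D_g_less[OF g] kfun_intros kfun_const; simp)+
    from this[THEN at0_complete] elim have "eventually (\<lambda>x. \<not> v (e x) < v (e (u * x))) at0"
      "eventually (\<lambda>x. \<not> v (e (u * x)) < v (e x)) at0"
      unfolding H1_def H2_def by simp_all
    then show ?case unfolding H0_def by eventually_elim simp
  qed
  then obtain x y where xy: "v x = 0" "v y = 0" "H0 x" "H0 y" "u = x * y"
    using u by (rule genO_product)
  then have "eventually (\<lambda>z. v (e (x * (y * z))) = v (e (y * z))) at0" "eventually (\<lambda>z. v (e (y * z)) = v (e z)) at0"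
    using eventually_at0_mult[of "\<lambda>z. v (e (x * z)) = v (e z)" y] v_unit_nonzero[of y] unfolding H0_def by simp_all
  then show ?thesis by eventually_elim (simp add: xy(5) mult.assoc)
qed

text \<open>The ratio of \<open>e (u * x)\<close> and \<open>e x\<close> eventually has valuation 0,
  so it has a residue, and a germ in the residue field is constant. \<open>S x c\<close> says that
  \<open>c\<close> represents this residue.\<close>

lemma rvf_unit:
  assumes e: "rvf e" and u: "v u = 0"
  shows "\<exists>c. v c = 0 \<and> eventually (\<lambda>x. rveq (e (u * x)) (c * e x)) at0"
proof -
  define S where "S x c \<longleftrightarrow> (\<exists>z. rveq z (e (u * x) / e x) \<and> 0 \<le> v z \<and> 0 < v (c - z))" for x c
  have "D UNIV (\<lambda>E. S (E 1) (E 0))"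
    unfolding S_def by (intro D_intros D_rvf_ratio[OF e] kfun_const) simp_all
  moreover have ev: "eventually (\<lambda>x. v (e (u * x) / e x) = 0) at0"
    using rvf_v_unit[OF e u] by eventually_elim (simp add: v_divide_self rvf_nonzero[OF e])
  then have "eventually (\<lambda>x. \<exists>c. 0 \<le> v c \<and> S x c) at0"
  proof eventually_elim
    case (elim x)
    then show ?case unfolding S_def
      using rveq_refl[of "e (u * x) / e x"] rvf_nonzero[OF e]
      by (intro exI[of _ "e (u * x) / e x"] conjI) (auto simp: zero_extended_def)
  qed
  moreover have "S x c'" if "S x c" "0 < v (c - c')" for x c c'
    using that v_trans_less[of 0 c' c] unfolding S_def by (metis v_minus_commute)
  ultimately obtain c where c: "0 \<le> v c" "eventually (\<lambda>x. S x c) at0"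
    using residue_germ[of S] by blast
  have "eventually (\<lambda>x. v c = 0 \<and> rveq (e (u * x)) (c * e x)) at0"
    using c(2) ev
  proof eventually_elim
    case (elim x)
    then obtain z where z: "rveq z (e (u * x) / e x)" "0 < v (c - z)" unfolding S_def by blast
    then have vz: "v z = 0" using rveq_v elim by metis
    then have cz: "rveq c z" using z(2) by (intro rveq_unitI)
    then have "rveq c (e (u * x) / e x)" using z(1) rveq_trans by blast
    then have "rveq (e x * c) (e (u * x))"
      using rveq_mult_left[of c "e (u * x) / e x" "e x"] rvf_nonzero[OF e, of x] by simp
    then show ?case using cz vz rveq_v rveq_sym by (simp add: mult.commute)
  qed
  moreover from this have "v c = 0" using eventually_at0_ex by fastforce
  ultimately show ?thesis by (auto elim: eventually_mono)
qed

text \<open>The radius from which the equivariance holds is a function of \<open>u\<close> into the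
  value group, hence constant for generic \<open>u\<close>. Writing a unit as a product of two
  generic ones makes the radius independent of \<open>u\<close>; the factors \<open>c\<close>
  multiply.\<close>

lemma rvf_unit_uniform:
  assumes e: "rvf e"
  shows "\<exists>d. d \<noteq> 0 \<and> (\<forall>u. v u = 0 \<longrightarrow> (\<exists>c. v c = 0 \<and> (\<forall>x. x \<noteq> 0 \<longrightarrow> v d < v x \<longrightarrow> rveq (e (u * x)) (c * e x))))"
proof -
  define U where "U u d \<longleftrightarrow> (\<exists>c. v c = 0 \<and> (\<forall>x. x \<noteq> 0 \<longrightarrow> v d < v x \<longrightarrow> rveq c (e (u * x) / e x)))" for u d
  have Ui: "rveq c (e (u * x) / e x) \<longleftrightarrow> rveq (e (u * x)) (c * e x)" for c u x
  proof -
    have e0: "e x \<noteq> 0" by (rule rvf_nonzero[OF e])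
    then have *: "e x * (e (u * x) / e x) = e (u * x)" by simp
    have "rveq c (e (u * x) / e x) \<longleftrightarrow> rveq (e x * c) (e (u * x))"
      using rveq_mult_left[of c "e (u * x) / e x" "e x"] rveq_cancel[of "e x" c "e (u * x) / e x"] e0
      unfolding * by blast
    then show ?thesis using rveq_sym[of "e x * c"] rveq_sym[of "e (u * x)"] by (auto simp: mult.commute)
  qed
  have "D UNIV (\<lambda>E. U (E 1) (E 0))"
    unfolding U_def by (intro D_intros D_rvf_ratio[OF e])
  moreover have "\<forall>u d d'. d \<noteq> 0 \<longrightarrow> d' \<noteq> 0 \<longrightarrow> v d \<le> v d' \<longrightarrow> U u d \<longrightarrow> U u d'"
    unfolding U_def by (meson le_less_trans)
  ultimately have "\<exists>g. gdef1 g \<and> (\<forall>u. (\<exists>d. d \<noteq> 0 \<and> U u d) \<longrightarrow> U u (g u))" by (rule definable_radius1)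
  then obtain g where g: "gdef1 g" "\<And>u. (\<exists>d. d \<noteq> 0 \<and> U u d) \<Longrightarrow> U u (g u)" by blast
  have Ug: "U u (g u)" if u: "v u = 0" for u
  proof (rule g(2))
    obtain c where "v c = 0" "eventually (\<lambda>x. rveq (e (u * x)) (c * e x)) at0" using rvf_unit[OF e u] by blast
    then show "\<exists>d. d \<noteq> 0 \<and> U u d" unfolding U_def Ui eventually_at0 by blast
  qed
  obtain d where d: "d \<noteq> 0" "eventually (\<lambda>u. v (g u) = v d) genO"
    using generically_constant[OF g(1)] by blast
  have "\<exists>c. v c = 0 \<and> (\<forall>x. x \<noteq> 0 \<longrightarrow> v d < v x \<longrightarrow> rveq (e (u * x)) (c * e x))" if u: "v u = 0" for u
  proof -
    obtain a b where ab: "v a = 0" "v b = 0" "v (g a) = v d" "v (g b) = v d" "u = a * b"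
      using d(2) u by (rule genO_product)
    obtain c where c: "v c = 0" "\<And>x. x \<noteq> 0 \<Longrightarrow> v d < v x \<Longrightarrow> rveq (e (a * x)) (c * e x)"
      using Ug[OF ab(1)] ab(3) unfolding U_def Ui by auto
    obtain c' where c': "v c' = 0" "\<And>x. x \<noteq> 0 \<Longrightarrow> v d < v x \<Longrightarrow> rveq (e (b * x)) (c' * e x)"
      using Ug[OF ab(2)] ab(4) unfolding U_def Ui by auto
    have "rveq (e (u * x)) (c * c' * e x)" if x: "x \<noteq> 0" "v d < v x" for x
    proof -
      have "rveq (e (a * (b * x))) (c * e (b * x))"
        using x ab(2) v_unit_nonzero[of b] by (intro c(2)) auto
      moreover have "rveq (c * e (b * x)) (c * (c' * e x))"
        using x c(1) v_unit_nonzero by (intro rveq_mult_left c'(2)) auto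
      ultimately show ?thesis using rveq_trans ab(5) by (simp add: mult.assoc)
    qed
    moreover have "v (c * c') = 0" using c(1) c'(1) by simp
    ultimately show ?thesis by blast
  qed
  with d(1) show ?thesis by blast
qed

section \<open>Valuations of germs of leading terms\<close>

lemma gap_above:
  assumes "finite C" "d \<noteq> 0"
  shows "\<exists>d'. d' \<noteq> 0 \<and> v d < v d' \<and> (\<forall>c\<in>C. \<not> (v d < v c \<and> v c < v d'))"
  using assms(1)
proof (induction C rule: finite_induct)
  case empty
  then show ?case using v_above[OF assms(2)] by auto
next
  case (insert c C)
  then obtain d' where d': "d' \<noteq> 0" "v d < v d'" "\<forall>c\<in>C. \<not> (v d < v c \<and> v c < v d')" by blast
  show ?case
  proof (cases "v d < v c \<and> v c < v d'")
    case True
    then have "c \<noteq> 0" by auto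
    moreover have "\<forall>c'\<in>C. \<not> (v d < v c' \<and> v c' < v c)"
      using d'(3) True by (meson less_trans)
    ultimately show ?thesis using True by (intro exI[of _ c]) auto
  next
    case False
    with d' show ?thesis by (intro exI[of _ d']) auto
  qed
qed

text \<open>\<open>S\<close> consists of full spheres around 0, and \<open>v a\<close> is the
  infimum of their radii. Either it is attained, or \<open>S\<close> has points in the gap between
  \<open>v a\<close> and the next critical radius and then contains the whole gap.\<close>

lemma S_near:
  assumes D: "D A (\<lambda>e. S (e 0))"
    and unit: "\<And>x u. S x \<Longrightarrow> v u = 0 \<Longrightarrow> S (u * x)"
    and a: "a \<noteq> 0" "\<And>d. d \<noteq> 0 \<Longrightarrow> v a < v d \<Longrightarrow> \<exists>x. S x \<and> v x \<le> v d"
      "\<And>x. S x \<Longrightarrow> x \<noteq> 0 \<and> v a \<le> v x"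
  shows "(\<forall>x. v x = v a \<longrightarrow> S x) \<or> (\<exists>b. b \<noteq> 0 \<and> v a < v b \<and> (\<forall>x. v a < v x \<longrightarrow> v x < v b \<longrightarrow> S x))"
proof (cases "\<exists>x. S x \<and> v x = v a")
  case True
  then obtain x where x: "S x" "v x = v a" by blast
  then have "x \<noteq> 0" using a(3) by blast
  have "S y" if "v y = v a" for y
    using unit[OF x(1), of "y / x"] v_divide_self[of y x] that x(2) \<open>x \<noteq> 0\<close> v_eq_Pinf[of y] a(1) by auto
  then show ?thesis by blast
next
  case False
  obtain C where C: "finite C" "0 \<notin> C" "\<And>x y. comp C x y \<Longrightarrow> S x = S y"
    using critical_radii[OF D] by blast
  obtain b where b: "b \<noteq> 0" "v a < v b" "\<forall>c\<in>C. \<not> (v a < v c \<and> v c < v b)"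
    using gap_above[OF C(1) a(1)] by blast
  obtain d where d: "d \<noteq> 0" "v a < v d" "v d < v b" using v_dense[OF a(1) b(2)] by blast
  obtain x where x: "S x" "v x \<le> v d" using a(2)[OF d(1,2)] by blast
  then have xa: "x \<noteq> 0" "v a < v x" "v x < v b"
    using a(3)[OF x(1)] False d(3) by (auto simp: less_le intro: order.trans)
  have "S y" if y: "v a < v y" "v y < v b" for y
  proof -
    have "y \<noteq> 0" using y(2) by auto
    have "comp C x y"
      unfolding comp_def
    proof (intro conjI ballI xa(1) \<open>y \<noteq> 0\<close>)
      fix c assume "c \<in> C"
      then have "v c \<le> v a \<or> v b \<le> v c" using b(3) by (meson not_le)
      then show "v x \<noteq> v c" "v y \<noteq> v c" "(v x < v c) = (v y < v c)" using xa y by auto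
    qed
    then show ?thesis using C(3) x(1) by blast
  qed
  with b show ?thesis by blast
qed

text \<open>
  Otherwise there is \<open>z0\<close> such that \<open>c * z0\<close> is a leading term \<open>e x\<close> for every unit \<open>c\<close>. The sets
  \<open>S c\<close> of these \<open>x\<close> are disjoint unions of annuli \<open>v x = \<gamma>\<close>, and the infimum of these \<open>\<gamma>\<close> does
  not depend on \<open>c\<close> generically. But only one \<open>S c\<close> can contain the annulus at the infimum, and
  only one can contain those that follow it immediately.
\<close>

lemma rvf_spine:
  assumes e: "rvf e" and d0: "d0 \<noteq> 0"
    and inv: "\<And>u x. v u = 0 \<Longrightarrow> x \<noteq> 0 \<Longrightarrow> v d0 < v x \<Longrightarrow> rveq (e (u * x)) (e x)"
  shows "\<exists>d. d \<noteq> 0 \<and> eventually (\<lambda>x. v (e x) = v d) at0"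
proof (rule ccontr)
  assume *: "\<nexists>d. d \<noteq> 0 \<and> eventually (\<lambda>x. v (e x) = v d) at0"
  note g = rvf_gdef1[OF e]
  have ne: "eventually (\<lambda>x. v (e x) \<noteq> v c) at0" if "c \<noteq> 0" for c
  proof -
    have "D UNIV (\<lambda>E. v (e (E 0)) = v c)"
      using D_gdef1[where R = "\<lambda>z E. z = v c", OF g _ kfun_var] by (simp add: D_intros kfun_const)
    from at0_complete[OF this] show ?thesis using * that by blast
  qed
  define Z where "Z z \<longleftrightarrow> (\<exists>x. x \<noteq> 0 \<and> v d0 < v x \<and> rveq z (e x))" for z
  have "D UNIV (\<lambda>E. Z (E 0))" unfolding Z_def by (intro D_intros D_rvf[OF e] kfun_const) simp
  then obtain C where C: "finite C" "0 \<notin> C" "\<And>x y. comp C x y \<Longrightarrow> Z x = Z y"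
    using critical_radii by blast
  \<comment> \<open>As \<open>v (e x)\<close> eventually avoids every fixed value, some
    \<open>z0 = e x0\<close> lies off the critical radii of \<open>Z\<close>. Then \<open>Z\<close>
    contains the whole sphere through \<open>z0\<close>.\<close>
  have "eventually (\<lambda>x. (\<forall>c\<in>C. v (e x) \<noteq> v c) \<and> x \<noteq> 0 \<and> v d0 < v x) at0"
  proof (intro eventually_conj eventually_ball_finite C(1) eventually_at0_nonzero eventually_at0_less d0 ballI ne)
    show "c \<noteq> 0" if "c \<in> C" for c using that C(2) by metis
  qed
  then obtain x0 where x0: "\<forall>c\<in>C. v (e x0) \<noteq> v c" "x0 \<noteq> 0" "v d0 < v x0" using eventually_at0_ex by blast
  define z0 where "z0 = e x0"
  have z0: "z0 \<noteq> 0" unfolding z0_def by (rule rvf_nonzero[OF e])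
  have "Z z0" unfolding Z_def z0_def using x0 rveq_refl rvf_nonzero[OF e] by blast
  have Zc: "Z (c * z0)" if "v c = 0" for c
  proof -
    have "comp C z0 (c * z0)"
      using x0(1) z0 that v_unit_nonzero[OF that] unfolding comp_def z0_def by auto
    then show ?thesis using C(3) \<open>Z z0\<close> by blast
  qed
  define S where "S c x \<longleftrightarrow> x \<noteq> 0 \<and> v d0 < v x \<and> rveq (c * z0) (e x)" for c x
  have S_ex: "\<exists>x. S c x" if "v c = 0" for c using Zc[OF that] unfolding Z_def S_def by blast
  have S_unit: "S c (u * x)" if "S c x" "v u = 0" for c x u
    using that inv[of u x] v_unit_nonzero[of u] rveq_trans[OF _ rveq_sym] unfolding S_def by auto
  have S_disj: "0 < v (c - c')" if "S c x" "S c' x" "v c' = 0" for c c' x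
  proof -
    have "rveq (c * z0) (c' * z0)" using that rveq_trans rveq_sym unfolding S_def by blast
    then have "rveq c c'" using rveq_cancel[of z0 c c'] by (simp add: mult.commute)
    then show ?thesis using that(3) by (rule rveq_unit)
  qed
  have DS: "D UNIV (\<lambda>E. S (F E) (G E))" if "kfun UNIV F" "kfun UNIV G" for F G
    unfolding S_def by (intro D_intros D_rvf[OF e] that kfun_const) simp_all
  define R where "R c d \<longleftrightarrow> (\<exists>x. S c x \<and> v x \<le> v d)" for c d
  have "D UNIV (\<lambda>E. R (E 1) (E 0))" unfolding R_def by (intro D_intros DS)
  moreover have "\<forall>c d d'. d \<noteq> 0 \<longrightarrow> d' \<noteq> 0 \<longrightarrow> v d \<le> v d' \<longrightarrow> R c d \<longrightarrow> R c d'"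
    unfolding R_def by (meson order_trans)
  ultimately have "\<exists>g. gdef1 g \<and>
    (\<forall>x. (\<exists>d. d \<noteq> 0 \<and> R x d) \<longrightarrow> (\<forall>d. d \<noteq> 0 \<longrightarrow> v (g x) < v d \<longrightarrow> R x d)) \<and>
    (\<forall>x. (\<exists>d. d \<noteq> 0 \<and> \<not> R x d) \<longrightarrow> (\<forall>d. d \<noteq> 0 \<longrightarrow> v d < v (g x) \<longrightarrow> \<not> R x d))"
    by (rule definable_infimum1)
  then obtain h where h: "gdef1 h"
    "\<And>c d. \<exists>d. d \<noteq> 0 \<and> R c d \<Longrightarrow> d \<noteq> 0 \<Longrightarrow> v (h c) < v d \<Longrightarrow> R c d"
    "\<And>c d. \<exists>d. d \<noteq> 0 \<and> \<not> R c d \<Longrightarrow> d \<noteq> 0 \<Longrightarrow> v d < v (h c) \<Longrightarrow> \<not> R c d" by blast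
  obtain a where a: "a \<noteq> 0" "eventually (\<lambda>c. v (h c) = v a) genO"
    using generically_constant[OF h(1)] by blast
  obtain F where F: "finite F" "\<And>c. c \<in> gen F \<Longrightarrow> v (h c) = v a"
    using a(2) unfolding eventually_genO by blast
  define P where "P c \<longleftrightarrow> (\<forall>x. v x = v a \<longrightarrow> S c x)" for c
  define Q where "Q c \<longleftrightarrow> (\<exists>b. b \<noteq> 0 \<and> v a < v b \<and> (\<forall>x. v a < v x \<longrightarrow> v x < v b \<longrightarrow> S c x))" for c
  have PQ: "P c \<or> Q c" if c: "c \<in> gen (insert 0 F)" for c
    unfolding P_def Q_def
  proof (rule S_near[where A = UNIV])
    have vc: "v c = 0" using c by (rule gen_unit)
    have hc: "v (h c) = v a" using F(2) c gen_mono[of F "insert 0 F"] by blast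
    have ex: "\<exists>d. d \<noteq> 0 \<and> R c d" using S_ex[OF vc] unfolding R_def S_def by blast
    have nex: "\<exists>d. d \<noteq> 0 \<and> \<not> R c d"
      using d0 unfolding R_def S_def by (intro exI[of _ d0]) (auto simp: not_le)
    show "D UNIV (\<lambda>E. S c (E 0))" by (intro DS kfun_var kfun_const) simp
    show "S c (u * x)" if "S c x" "v u = 0" for x u using S_unit that by blast
    show "a \<noteq> 0" by (rule a)
    show "\<exists>x. S c x \<and> v x \<le> v d" if "d \<noteq> 0" "v a < v d" for d
      using h(2)[OF ex that(1)] that(2) hc unfolding R_def by simp
    show "x \<noteq> 0 \<and> v a \<le> v x" if x: "S c x" for x
    proof
      show "x \<noteq> 0" using x unfolding S_def by blast
      show "v a \<le> v x"
      proof (rule ccontr)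
        assume "\<not> v a \<le> v x"
        then have "\<not> R c x" using h(3)[OF nex \<open>x \<noteq> 0\<close>] hc by simp
        then show False using x unfolding R_def by blast
      qed
    qed
  qed
  \<comment> \<open>Three residue classes suffice: two of them share \<open>P\<close> or two share
    \<open>Q\<close>, and either contradicts the disjointness of the sets
    \<open>S c\<close>.\<close>
  obtain T where T: "T \<subseteq> gen (insert 0 F)" "card T = 3" "finite T"
    "\<forall>x\<in>T. \<forall>y\<in>T. x \<noteq> y \<longrightarrow> v (x - y) \<le> 0"
    using gen_many[of "insert 0 F" 3] F(1) by blast
  obtain x y z where xyz: "T = {x, y, z}" "x \<noteq> y" "x \<noteq> z" "y \<noteq> z"
    using T(2) by (auto simp: card_3_iff)
  have no: "\<not> (P c \<and> P c')" "\<not> (Q c \<and> Q c')" if "c \<in> T" "c' \<in> T" "c \<noteq> c'" for c c'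
  proof -
    have c': "v c' = 0" using that T(1) gen_unit by blast
    have n: "\<not> (S c s \<and> S c' s)" for s using S_disj[OF _ _ c', of c s] T(4) that by fastforce
    show "\<not> (P c \<and> P c')" using n[of a] unfolding P_def by blast
    show "\<not> (Q c \<and> Q c')"
    proof
      assume "Q c \<and> Q c'"
      then obtain b b' where b: "v a < v b" "\<And>x. v a < v x \<Longrightarrow> v x < v b \<Longrightarrow> S c x"
        "v a < v b'" "\<And>x. v a < v x \<Longrightarrow> v x < v b' \<Longrightarrow> S c' x" unfolding Q_def by blast
      then obtain d where "v a < v d" "v d < v b" "v d < v b'"
      proof (cases "v b \<le> v b'")
        case True
        obtain w where w: "v a < v w" "v w < v b" using v_dense[OF a(1) b(1)] by blast
        have "v w < v b'" using w(2) True by (rule less_le_trans)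
        with w show thesis by (rule that)
      next
        case False
        then have *: "v b' \<le> v b" by simp
        obtain w where w: "v a < v w" "v w < v b'" using v_dense[OF a(1) b(3)] by blast
        have "v w < v b" using w(2) * by (rule less_le_trans)
        from w(1) this w(2) show thesis by (rule that)
      qed
      then show False using b n by blast
    qed
  qed
  have "P x \<or> Q x" "P y \<or> Q y" "P z \<or> Q z" using PQ T(1) xyz(1) by auto
  moreover have "x \<in> T" "y \<in> T" "z \<in> T" using xyz(1) by auto
  ultimately show False using no xyz(2-4) by metis
qed

text \<open>Multiplying \<open>x\<close> by a unit changes \<open>e (s * x)\<close> and
  \<open>e x\<close> by the same factor \<open>c\<close>, which cancels in the ratio. So the ratio
  is invariant under units and \<open>rvf_spine\<close> applies.\<close>

lemma rvf_ratio_const: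
  assumes e: "rvf e" and s: "s \<noteq> 0"
  shows "\<exists>d. d \<noteq> 0 \<and> eventually (\<lambda>x. v (e (s * x) / e x) = v d) at0"
proof -
  obtain d where d: "d \<noteq> 0"
    "\<And>u. v u = 0 \<Longrightarrow> \<exists>c. v c = 0 \<and> (\<forall>x. x \<noteq> 0 \<longrightarrow> v d < v x \<longrightarrow> rveq (e (u * x)) (c * e x))"
    using rvf_unit_uniform[OF e] by blast
  obtain d0 where d0: "d0 \<noteq> 0" "v d \<le> v d0" "v (d / s) \<le> v d0"
    using v_max_ex[of d "d / s"] d(1) s by auto
  show ?thesis
  proof (rule rvf_spine[OF rvf_ratio[OF e s] d0(1)])
    fix u x assume u: "v u = 0" and x: "x \<noteq> 0" "v d0 < v x"
    obtain c where c: "v c = 0" "\<And>x. x \<noteq> 0 \<Longrightarrow> v d < v x \<Longrightarrow> rveq (e (u * x)) (c * e x)"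
      using d(2)[OF u] by blast
    have "v d < v x" "v (d / s) < v x" using d0 x by auto
    then have "v d < v (s * x)" using s v_divide_less[of s d x] by (simp add: mult.commute)
    then have "rveq (e (u * (s * x)) / e (u * x)) ((c * e (s * x)) / (c * e x))"
      using x s \<open>v d < v x\<close> by (intro rveq_divide c(2)) auto
    then show "rveq (e (s * (u * x)) / e (u * x)) (e (s * x) / e x)"
      using v_unit_nonzero[OF c(1)] by (simp add: mult.left_commute)
  qed
qed

text \<open>The set \<open>T\<close> of periods contains all powers of \<open>s\<close>. Their
  valuations increase strictly, so some interval from \<open>v (s ^ n)\<close> to
  \<open>v (s ^ Suc n)\<close> contains no critical radius of \<open>T\<close>. Then all
  \<open>s ^ n * t\<close> with \<open>0 \<le> v t \<le> v s\<close> are periods, and so is, closer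
  to 0, every such \<open>t\<close> itself. Thus the valuation is constant on windows of width
  \<open>v s\<close>.\<close>

lemma rvf_periodic_const:
  assumes e: "rvf e" and s: "s \<noteq> 0" "0 < v s" and per: "eventually (\<lambda>x. v (e (s * x)) = v (e x)) at0"
  shows "\<exists>d. d \<noteq> 0 \<and> eventually (\<lambda>x. v (e x) = v d) at0"
proof -
  note g = rvf_gdef1[OF e]
  obtain d1 where d1: "d1 \<noteq> 0"
    "\<And>u. v u = 0 \<Longrightarrow> \<exists>c. v c = 0 \<and> (\<forall>x. x \<noteq> 0 \<longrightarrow> v d1 < v x \<longrightarrow> rveq (e (u * x)) (c * e x))"
    using rvf_unit_uniform[OF e] by blast
  obtain d2 where d2: "d2 \<noteq> 0" "\<And>x. x \<noteq> 0 \<Longrightarrow> v d2 < v x \<Longrightarrow> v (e (s * x)) = v (e x)"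
    using per unfolding eventually_at0 by blast
  obtain \<tau> where \<tau>: "\<tau> \<noteq> 0" "v d1 \<le> v \<tau>" "v d2 \<le> v \<tau>" using v_max_ex d1(1) d2(1) by blast
  define T where "T t \<longleftrightarrow> t \<noteq> 0 \<and> 0 \<le> v t \<and> (\<forall>x. x \<noteq> 0 \<longrightarrow> v \<tau> < v x \<longrightarrow> v (e (t * x)) = v (e x))" for t
  have vs: "0 \<le> v (s ^ n)" "v (s ^ n) < v (s ^ Suc n)" "s ^ n \<noteq> 0" for n
  proof -
    show "s ^ n \<noteq> 0" using s by simp
    then show "v (s ^ n) < v (s ^ Suc n)"
      using v_mult_less_iff[of "s ^ n" 1 s] s(2) by simp
    show "0 \<le> v (s ^ n)"
    proof (induction n)
      case (Suc n)
      have "0 + 0 \<le> v s + v (s ^ n)" using Suc s(2) by (intro add_mono) auto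
      then show ?case by (simp add: v_mult)
    qed simp
  qed
  have Ts: "T (s ^ n)" for n
  proof (induction n)
    case (Suc n)
    have "v (e (s ^ Suc n * x)) = v (e x)" if x: "x \<noteq> 0" "v \<tau> < v x" for x
    proof -
      have "v 1 \<le> v (s ^ n)" using vs(1) by simp
      then have "v x \<le> v (s ^ n * x)" using x(1) v_mult_le_iff[of x 1 "s ^ n"] by simp
      then have "v d2 < v (s ^ n * x)" using x(2) \<tau>(3) by simp
      then have "v (e (s * (s ^ n * x))) = v (e (s ^ n * x))" using x(1) s(1) by (intro d2(2)) auto
      with Suc x show ?thesis unfolding T_def by (simp add: mult.assoc)
    qed
    then show ?case using vs unfolding T_def by blast
  qed (simp add: T_def)
  have DT: "D UNIV (\<lambda>E. T (E 0))"
    unfolding T_def by (intro D_intros D_g_eq[OF g] kfun_const) simp_all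
  obtain C where C: "finite C" "0 \<notin> C" "\<And>x y. comp C x y \<Longrightarrow> T x = T y"
    using critical_radii[OF DT] by blast
  have mono: "v (s ^ n) < v (s ^ m)" if "n < m" for n m
    using lift_Suc_mono_less[of "\<lambda>n. v (s ^ n)" n m, OF vs(2) that] .
  have "finite {n. v (s ^ n) \<le> v c \<and> v c \<le> v (s ^ Suc n)}" for c
  proof (cases "\<exists>n. v (s ^ n) \<le> v c \<and> v c \<le> v (s ^ Suc n)")
    case True
    then obtain n where n: "v (s ^ n) \<le> v c" "v c \<le> v (s ^ Suc n)" by blast
    have "{n. v (s ^ n) \<le> v c \<and> v c \<le> v (s ^ Suc n)} \<subseteq> {..Suc n}"
      using n mono[of "Suc n"] by (auto simp: not_less[symmetric]) (meson leD le_less_trans not_less)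
    then show ?thesis using finite_subset by blast
  qed (simp add: finite_subset[OF _ finite.emptyI])
  then have "finite (\<Union>c\<in>C. {n. v (s ^ n) \<le> v c \<and> v c \<le> v (s ^ Suc n)})" using C(1) by blast
  then obtain n where "n \<notin> (\<Union>c\<in>C. {n. v (s ^ n) \<le> v c \<and> v c \<le> v (s ^ Suc n)})"
    using ex_new_if_finite[OF infinite_UNIV_nat] by blast
  then have n: "v c < v (s ^ n) \<or> v (s ^ Suc n) < v c" if "c \<in> C" for c using that by (auto simp: not_le)
  define \<sigma> where "\<sigma> = s ^ n"
  have \<sigma>: "\<sigma> \<noteq> 0" "0 \<le> v \<sigma>" "T \<sigma>" using vs Ts unfolding \<sigma>_def by auto
  have T\<sigma>: "T (\<sigma> * t)" if t: "t \<noteq> 0" "0 \<le> v t" "v t \<le> v s" for t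
  proof -
    have "v (\<sigma> * 1) \<le> v (\<sigma> * t)" "v (\<sigma> * t) \<le> v (\<sigma> * s)"
      unfolding v_mult_le_iff'[OF \<sigma>(1)] using t by simp_all
    then have "v (s ^ n) \<le> v (\<sigma> * t)" "v (\<sigma> * t) \<le> v (s ^ Suc n)" by (simp_all add: \<sigma>_def mult.commute)
    then have "comp C \<sigma> (\<sigma> * t)"
      unfolding comp_def using n \<sigma>(1) t(1) vs(2)[of n] unfolding \<sigma>_def[symmetric]
      by (force dest: n simp: \<sigma>_def[symmetric])
    then show ?thesis using C(3) \<sigma>(3) by blast
  qed
  have loc: "v (e (t * y)) = v (e y)" if t: "t \<noteq> 0" "0 \<le> v t" "v t \<le> v s" and y: "y \<noteq> 0" "v (\<tau> * \<sigma>) < v y" for t y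
  proof -
    have x: "y / \<sigma> \<noteq> 0" "v \<tau> < v (y / \<sigma>)" using y \<sigma>(1) by (simp_all add: v_less_divide)
    have "v (e (\<sigma> * t * (y / \<sigma>))) = v (e (y / \<sigma>))" "v (e (\<sigma> * (y / \<sigma>))) = v (e (y / \<sigma>))"
      using T\<sigma>[OF t] \<sigma>(3) x unfolding T_def by blast+
    then show ?thesis using \<sigma>(1) by simp
  qed
  define y0 where "y0 = \<tau> * \<sigma> * \<pi>"
  have y0: "y0 \<noteq> 0" "v (\<tau> * \<sigma>) < v y0" unfolding y0_def using \<tau>(1) \<sigma>(1) v_less_mult_\<pi> by auto
  \<comment> \<open>The value group need not be archimedean, so finitely many windows may fail to
    reach a given radius. Instead one takes the infimum \<open>v a\<close> of the radii with a
    different value; a single window across it gives the contradiction.\<close>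
  define U where "U d \<longleftrightarrow> (\<exists>y. y \<noteq> 0 \<and> v y0 \<le> v y \<and> v y \<le> v d \<and> v (e y) \<noteq> v (e y0))" for d
  show ?thesis
  proof (cases "\<exists>d. d \<noteq> 0 \<and> U d")
    case False
    then have "v (e y) = v (e y0)" if "y \<noteq> 0" "v y0 < v y" for y using that unfolding U_def by force
    then have "eventually (\<lambda>y. v (e y) = v (e y0)) at0" using y0(1) by (intro eventually_at0I[of y0]) auto
    then show ?thesis using rvf_nonzero[OF e] by blast
  next
    case True
    have "\<not> U (y0 / \<pi>)" unfolding U_def using v_divide_\<pi>_less[OF y0(1)] by auto
    moreover have "D UNIV (\<lambda>E. U (E 0))"
      unfolding U_def by (intro D_intros D_g_eq[OF g] kfun_const) simp_all
    moreover have "\<forall>d d'. d \<noteq> 0 \<longrightarrow> d' \<noteq> 0 \<longrightarrow> v d \<le> v d' \<longrightarrow> U d \<longrightarrow> U d'"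
      unfolding U_def by (meson order_trans)
    moreover have "y0 / \<pi> \<noteq> 0" using y0(1) by simp
    moreover obtain d0 where "d0 \<noteq> 0" "U d0" using True by blast
    ultimately have "\<exists>a. a \<noteq> 0 \<and> (\<forall>d. d \<noteq> 0 \<longrightarrow> v a < v d \<longrightarrow> U d) \<and> (\<forall>d. d \<noteq> 0 \<longrightarrow> v d < v a \<longrightarrow> \<not> U d)"
      by (intro infimum[of UNIV U])
    then obtain a where a: "a \<noteq> 0" "\<And>d. d \<noteq> 0 \<Longrightarrow> v a < v d \<Longrightarrow> U d" "\<And>d. d \<noteq> 0 \<Longrightarrow> v d < v a \<Longrightarrow> \<not> U d"
      by blast
    have ya: "v y0 \<le> v a"
    proof (rule ccontr)
      assume "\<not> v y0 \<le> v a"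
      then have *: "v a < v y0" by simp
      obtain d where "d \<noteq> 0" "v a < v d" "v d < v y0" using v_dense[OF a(1) *] by blast
      then show False using a(2)[of d] unfolding U_def by auto
    qed
    obtain y1 where y1: "y1 \<noteq> 0" "v y0 \<le> v y1" "v y1 \<le> v a" "v a < v (y1 * s)" "v (e y1) = v (e y0)"
    proof (cases "v a < v (y0 * s)")
      case True
      then show thesis using that[of y0] y0(1) ya by auto
    next
      case False
      have "v 1 < v s" using s(2) by simp
      then obtain w where w: "w \<noteq> 0" "v 1 < v w" "v w < v s" using v_dense[of 1 s] by auto
      have "v (a / w) < v a" using w v_divide_less[of w a a] v_mult_less_iff'[of a 1 w] a(1) by simp
      moreover have "v y0 \<le> v (a / w)"
      proof -
        have "v (y0 * w) \<le> v (y0 * s)" using w(3) v_mult_le_iff'[OF y0(1)] by simp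
        then show ?thesis using False w(1) by (simp add: v_le_divide not_less)
      qed
      moreover have "v a < v (a / w * s)"
        using w a(1) v_mult_less_iff'[of "a / w" w s] by simp
      moreover have "v (e (a / w)) = v (e y0)"
        using a(3)[of "a / w"] calculation(1,2) w(1) a(1) unfolding U_def by auto
      ultimately show thesis using that[of "a / w"] w(1) a(1) by auto
    qed
    obtain d where d: "d \<noteq> 0" "v a < v d" "v d < v (y1 * s)" using v_dense[OF a(1) y1(4)] by blast
    obtain y where y: "y \<noteq> 0" "v y0 \<le> v y" "v y \<le> v d" "v (e y) \<noteq> v (e y0)"
      using a(2)[OF d(1,2)] unfolding U_def by blast
    have "v a \<le> v y" using a(3)[OF y(1)] y unfolding U_def by (meson not_le order_refl)
    then have "v (y1 * 1) \<le> v (y1 * (y / y1))" "v (y1 * (y / y1)) \<le> v (y1 * s)"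
      using y1(1,3) y(3) d(3) by simp_all
    then have "0 \<le> v (y / y1)" "v (y / y1) \<le> v s" unfolding v_mult_le_iff'[OF y1(1)] by simp_all
    then have "v (e (y / y1 * y1)) = v (e y1)"
      using y(1) y1(1,2) y0(2) by (intro loc) auto
    then show ?thesis using y1(1,5) y(4) by simp
  qed
qed

text \<open>Otherwise \<open>v (e x)\<close> is eventually confined to every neighbourhood of some
  \<open>v a\<close>. But from \<open>x\<close> to \<open>\<pi> * x\<close> it changes by an
  eventually constant amount \<open>v m\<close>. For \<open>v m = 0\<close> the germ is periodic and
  hence of constant valuation. If not, after replacing \<open>\<pi>\<close> by
  \<open>1 / \<pi>\<close> where necessary, the valuation grows by a positive amount, too much to
  stay near \<open>v a\<close>.\<close>

lemma rvf_trichotomy: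
  assumes e: "rvf e"
  shows "(\<exists>d. d \<noteq> 0 \<and> eventually (\<lambda>x. v (e x) = v d) at0) \<or>
    (\<forall>d. d \<noteq> 0 \<longrightarrow> eventually (\<lambda>x. v d < v (e x)) at0) \<or>
    (\<forall>d. d \<noteq> 0 \<longrightarrow> eventually (\<lambda>x. v (e x) < v d) at0)"
proof (rule ccontr)
  assume "\<not> ?thesis"
  then have n1: "\<nexists>d. d \<noteq> 0 \<and> eventually (\<lambda>x. v (e x) = v d) at0"
    and n2: "\<exists>d. d \<noteq> 0 \<and> \<not> eventually (\<lambda>x. v d < v (e x)) at0"
    and n3: "\<exists>d. d \<noteq> 0 \<and> \<not> eventually (\<lambda>x. v (e x) < v d) at0" by auto
  note g = rvf_gdef1[OF e]
  define B where "B d \<longleftrightarrow> eventually (\<lambda>x. v (e x) \<le> v d) at0" for d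
  have DB: "D UNIV (\<lambda>E. B (E 0))" unfolding B_def by (intro D_at0 D_g1_le[OF g] kfun_intros)
  have up: "\<forall>d d'. d \<noteq> 0 \<longrightarrow> d' \<noteq> 0 \<longrightarrow> v d \<le> v d' \<longrightarrow> B d \<longrightarrow> B d'"
    unfolding B_def by (auto elim: eventually_mono)
  have compl: "eventually (\<lambda>x. v (e x) < v d) at0 \<or> eventually (\<lambda>x. v d \<le> v (e x)) at0"
    "B d \<or> eventually (\<lambda>x. v d < v (e x)) at0" for d
  proof -
    have "D UNIV (\<lambda>E. v (e (E 0)) < v d)" by (intro D_g1_less[OF g] kfun_intros kfun_const) simp
    from at0_complete[OF this] show "eventually (\<lambda>x. v (e x) < v d) at0 \<or> eventually (\<lambda>x. v d \<le> v (e x)) at0"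
      by (simp add: not_less)
    have "D UNIV (\<lambda>E. v (e (E 0)) \<le> v d)" by (intro D_g1_le[OF g] kfun_intros kfun_const) simp
    from at0_complete[OF this] show "B d \<or> eventually (\<lambda>x. v d < v (e x)) at0"
      unfolding B_def by (simp add: not_le)
  qed
  obtain d where "d \<noteq> 0" "B d" using n2 compl by blast
  moreover obtain d' where d': "d' \<noteq> 0" "eventually (\<lambda>x. v d' \<le> v (e x)) at0" using n3 compl by blast
  have "\<not> B (d' / \<pi>)"
  proof
    assume "B (d' / \<pi>)"
    with d'(2) have "eventually (\<lambda>x. False) at0" unfolding B_def
      by eventually_elim (use v_divide_\<pi>_less[OF d'(1)] in auto)
    then show False using at0_neq_bot by blast
  qed
  ultimately obtain a where a: "a \<noteq> 0" "\<And>d. d \<noteq> 0 \<Longrightarrow> v a < v d \<Longrightarrow> B d" "\<And>d. d \<noteq> 0 \<Longrightarrow> v d < v a \<Longrightarrow> \<not> B d"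
    using infimum[OF DB up, of d "d' / \<pi>"] d'(1) by auto
  have "\<exists>s m. s \<noteq> 0 \<and> m \<noteq> 0 \<and> 0 < v m \<and> eventually (\<lambda>x. v (e (s * x)) = v (m * e x)) at0"
  proof -
    obtain m where m: "m \<noteq> 0" "eventually (\<lambda>x. v (e (\<pi> * x) / e x) = v m) at0"
      using rvf_ratio_const[OF e \<pi>_nonzero] by blast
    have ev: "eventually (\<lambda>x. v (e (\<pi> * x)) = v (m * e x)) at0"
      using m(2) by eventually_elim (simp add: v_divide_eq rvf_nonzero[OF e])
    consider "0 < v m" | "v m = 0" | "v m < 0" by fastforce
    then show ?thesis
    proof cases
      case 1
      with m(1) ev show ?thesis by (intro exI[of _ \<pi>] exI[of _ m]) auto
    next
      case 2
      then have "eventually (\<lambda>x. v (e (\<pi> * x)) = v (e x)) at0" using ev by simp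
      then show ?thesis using rvf_periodic_const[OF e \<pi>_nonzero v_\<pi>] n1 by blast
    next
      case 3
      have "eventually (\<lambda>x. v (e x) = v (m * e (1 / \<pi> * x))) at0"
        using eventually_at0_mult[OF ev, of "1 / \<pi>"] by simp
      then have "eventually (\<lambda>x. v (e (1 / \<pi> * x)) = v (1 / m * e x)) at0"
      proof eventually_elim
        case (elim x)
        have "v (e x / m) = v (e (1 / \<pi> * x))" using elim v_divide_eq[OF m(1)] by (simp add: mult.commute)
        then show ?case by simp
      qed
      moreover have "0 < v (1 / m)" using 3 m(1) v_less_divide[of m 1 1] by simp
      ultimately show ?thesis using m(1) by (intro exI[of _ "1 / \<pi>"] exI[of _ "1 / m"]) auto
    qed
  qed
  then obtain s m where sm: "s \<noteq> 0" "m \<noteq> 0" "0 < v m" "eventually (\<lambda>x. v (e (s * x)) = v (m * e x)) at0" by blast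
  \<comment> \<open>The valuation of \<open>d\<close> lies below \<open>v a\<close> and that of
    \<open>c\<close> above it, less than \<open>v m\<close> apart.\<close>
  have "v (a / m) < v a" using sm(2,3) a(1) v_divide_less[of m a a] v_mult_less_iff'[of a 1 m] by simp
  then obtain d where d: "d \<noteq> 0" "v (a / m) < v d" "v d < v a" using v_dense[of "a / m" a] a(1) sm(2) by auto
  then have "v a < v (d * m)" using sm(2) by (simp add: v_divide_less)
  then obtain c where c: "c \<noteq> 0" "v a < v c" "v c < v (d * m)" using v_dense[OF a(1)] by blast
  have "eventually (\<lambda>x. v d < v (e x)) at0" using a(3)[OF d(1,3)] compl by blast
  moreover have "eventually (\<lambda>x. v (e (s * x)) \<le> v c) at0"
    using eventually_at0_mult[OF a(2)[OF c(1,2), unfolded B_def] sm(1)] .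
  ultimately have "eventually (\<lambda>x. False) at0" using sm(4)
  proof eventually_elim
    case (elim x)
    have "v (m * d) < v (m * e x)" using elim(1) v_mult_less_iff'[OF sm(2)] by blast
    with elim c(3) show False by (simp add: mult.commute)
  qed
  then show False using at0_neq_bot by blast
qed

end

section \<open>Limits of unary germs\<close>

context fo_language
begin

lemma D_definable:
  assumes "D A P"
  shows "definable M n {x \<in> carrier_vec n. P (assign x (\<lambda>_. 0))}"
proof -
  obtain \<phi> p where \<phi>: "wf_fm M \<phi>" "\<And>e. P e \<longleftrightarrow> sat M (ilv e p) \<phi>"
    using assms unfolding D_def by auto
  \<comment> \<open>Position \<open>n\<close> holds the value 0 of all free variables from
    \<open>n\<close> on; the parameters follow from \<open>n + 1\<close>.\<close>
  define r where "r k = (if even k then if k div 2 < n then k div 2 else n else n + 1 + k div 2)" for k :: nat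
  obtain \<psi> where \<psi>: "wf_fm M \<psi>" "\<And>e. sat M e \<psi> \<longleftrightarrow> sat M (\<lambda>i. e (r i)) \<phi>"
    using sat_rename[OF \<phi>(1)] by blast
  define e where "e k = (if k \<le> n then 0 else p (k - n - 1))" for k
  have "(\<lambda>i. assign x e (r i)) = ilv (assign x (\<lambda>_. 0)) p" if "x \<in> carrier_vec n" for x
    using that by (intro ilv_compI) (auto simp: assign_def r_def e_def)
  then have "{x \<in> carrier_vec n. P (assign x (\<lambda>_. 0))} = {x \<in> carrier_vec n. sat M (assign x e) \<psi>}"
    unfolding \<psi>(2) \<phi>(2) by (metis (no_types, lifting))
  with \<psi>(1) show ?thesis unfolding definable_def by blast
qed

lemma definable_D:
  assumes "definable M n X"
  obtains P where "D UNIV P" "X = {x \<in> carrier_vec n. P (assign x (\<lambda>_. 0))}"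
proof -
  obtain \<phi> e where \<phi>: "wf_fm M \<phi>" "X = {x \<in> carrier_vec n. sat M (assign x e) \<phi>}"
    using assms unfolding definable_def by blast
  define r where "r k = (if k < n then 2 * k else Suc (2 * k))" for k :: nat
  obtain \<psi> where \<psi>: "wf_fm M \<psi>" "\<And>e. sat M e \<psi> \<longleftrightarrow> sat M (\<lambda>i. e (r i)) \<phi>"
    using sat_rename[OF \<phi>(1)] by blast
  have "(\<lambda>i. ilv (assign x (\<lambda>_. 0)) e (r i)) = assign x e" if "x \<in> carrier_vec n" for x
    using that by (auto simp: assign_def r_def)
  then have "X = {x \<in> carrier_vec n. sat M (ilv (assign x (\<lambda>_. 0)) e) \<psi>}"
    unfolding \<psi>(2) \<phi>(2) by (metis (no_types, lifting))
  moreover have "D UNIV (\<lambda>E. sat M (ilv E e) \<psi>)"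
    unfolding D_def using \<psi>(1) by (intro exI[of _ \<psi>] exI[of _ e]) auto
  ultimately show thesis by (rule that[rotated])
qed

end

locale complete_acvf = acvf M \<pi> v
  for M :: "('f, 'r, 'a::alg_closed_field) fo_structure" and \<pi> :: 'a
    and v :: "'a \<Rightarrow> 'g::linordered_ab_group_add extended" +
  assumes complete: "definably_complete M v"
begin

text \<open>By \<open>near\<close>, of any two balls the bigger contains the centre of the smaller.
  So the balls form a chain, to which definable completeness applies.\<close>

lemma ball_chain:
  assumes R: "D UNIV (\<lambda>E. R (E 0) (E 1))"
    and l: "\<And>s. l s \<noteq> 0" "\<And>s z. R z s \<longleftrightarrow> v (l s) \<le> v (z - s)"
    and near: "\<And>s s'. min (v (l s)) (v (l s')) \<le> v (s - s')"
    and unb: "\<And>d. d \<noteq> 0 \<Longrightarrow> \<exists>s. v d < v (l s)"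
  obtains z where "\<And>s. R z s"
proof -
  define B where "B s = {z. R z s}" for s
  have rad: "ball_of_radius v \<gamma> (B s)" if "v (l s) = Fin \<gamma>" for s \<gamma>
    using that unfolding ball_of_radius_def closed_ball_def B_def l(2) by (intro exI[of _ s] disjI1) simp
  have "definable_family M (range B)"
    unfolding definable_family_def
  proof (intro exI conjI)
    show "definable M 1 {x \<in> carrier_vec 1. True}"
      using D_definable[OF D_True, of 1] by simp
    show "definable M (Suc 1) {x \<in> carrier_vec (Suc 1). R (assign x (\<lambda>_. 0) 0) (assign x (\<lambda>_. 0) 1)}"
      by (rule D_definable[OF R])
    have "{a. vCons a b \<in> {x \<in> carrier_vec (Suc 1). R (assign x (\<lambda>_. 0) 0) (assign x (\<lambda>_. 0) 1)}} = B (b $ 0)"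
      if "b \<in> carrier_vec 1" for b
      using that unfolding B_def by (auto simp: assign_def vec_index_vCons)
    moreover have "(\<lambda>b. B (b $ 0)) ` {x \<in> carrier_vec 1. True} = range B"
    proof -
      have "B s \<in> (\<lambda>b. B (b $ 0)) ` {x \<in> carrier_vec 1. True}" for s
        by (rule image_eqI[of _ _ "vec 1 (\<lambda>_. s)"]) auto
      then show ?thesis by blast
    qed
    ultimately show "range B = (\<lambda>b. {a. vCons a b \<in>
        {x \<in> carrier_vec (Suc 1). R (assign x (\<lambda>_. 0) 0) (assign x (\<lambda>_. 0) 1)}}) ` {x \<in> carrier_vec 1. True}"
      by (metis (no_types, lifting) image_cong mem_Collect_eq)
  qed
  moreover have sub: "B s' \<subseteq> B s" if "v (l s) \<le> v (l s')" for s s'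
  proof
    fix z assume "z \<in> B s'"
    then have "v (l s) \<le> v (z - s')" using that unfolding B_def l(2) by (auto intro: order_trans)
    moreover have "v (l s) \<le> v (s' - s)" using near[of s s'] that v_minus_commute by (metis min.absorb1)
    ultimately have "v (l s) \<le> v (z - s)" by (rule v_trans_le)
    then show "z \<in> B s" unfolding B_def l(2) by simp
  qed
  have "chain_subset (range B)"
    unfolding chain_subset_def
  proof (intro ballI)
    fix X Y assume "X \<in> range B" "Y \<in> range B"
    then obtain s s' where "X = B s" "Y = B s'" by auto
    then show "X \<subseteq> Y \<or> Y \<subseteq> X" using sub[of s s'] sub[of s' s] linear[of "v (l s)" "v (l s')"] by metis
  qed
  moreover have "\<exists>\<gamma>. ball_of_radius v \<gamma> (B s)" for s using rad v_cases[OF l(1), of s] by metis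
  moreover have "\<exists>s. \<exists>\<gamma>>\<delta>. ball_of_radius v \<gamma> (B s)" for \<delta>
  proof -
    obtain d where d: "d \<noteq> 0" "v d = Fin \<delta>" by (rule v_surj)
    then obtain s where s: "v d < v (l s)" using unb by blast
    obtain \<gamma> where \<gamma>: "v (l s) = Fin \<gamma>" using v_cases[OF l(1), of s] by blast
    then have "\<delta> < \<gamma>" using s d(2) by simp
    with rad[OF \<gamma>] show ?thesis by blast
  qed
  ultimately have "\<Inter> (range B) \<noteq> {}"
    using complete unfolding definably_complete_def by (metis (no_types, lifting) rangeE rangeI)
  then show thesis using that unfolding B_def by blast
qed

text \<open>Without a limit, every \<open>f x - s\<close> eventually has a constant valuation
  \<open>v (l s)\<close> and even a constant leading term \<open>c\<close>, so \<open>s + c\<close>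
  approximates \<open>f\<close> better than \<open>s\<close>, and the approximation never ends. If
  the \<open>v (l s)\<close> are unbounded, definable completeness yields a point in all the balls,
  which could not be improved. If they are bounded, they have a supremum that is not attained, and
  this is refuted by the trichotomy.\<close>

lemma limit_exists:
  assumes f: "kfun UNIV (\<lambda>E. f (E 0))"
  shows "(\<exists>s. \<forall>d. d \<noteq> 0 \<longrightarrow> eventually (\<lambda>x. v d < v (f x - s)) at0) \<or>
    (\<forall>d. d \<noteq> 0 \<longrightarrow> eventually (\<lambda>x. v (f x) < v d) at0)"
proof (rule ccontr)
  assume "\<not> ?thesis"
  then have A: "\<And>s. \<exists>d. d \<noteq> 0 \<and> \<not> eventually (\<lambda>x. v d < v (f x - s)) at0"
    and B: "\<exists>d. d \<noteq> 0 \<and> \<not> eventually (\<lambda>x. v (f x) < v d) at0" by blast+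
  note f_intros = kfun_fun1[OF f]
  have "\<exists>l. l \<noteq> 0 \<and> eventually (\<lambda>x. v (f x - s) = v l) at0" for s
  proof -
    define e where "e x = (if f x = s then 1 else f x - s)" for x
    have "D UNIV (\<lambda>E. f (E 0) = s)" by (intro D_intros f kfun_const) simp
    then have ne: "eventually (\<lambda>x. f x \<noteq> s) at0"
    proof (rule disjE[OF at0_complete])
      assume *: "eventually (\<lambda>x. f x = s) at0"
      obtain d where d: "d \<noteq> 0" "\<not> eventually (\<lambda>x. v d < v (f x - s)) at0" using A by blast
      have "eventually (\<lambda>x. v d < v (f x - s)) at0"
        using * by eventually_elim (simp add: v_less_Pinf d(1))
      with d(2) show ?thesis by blast
    qed
    have e: "rvf e"
    proof (rule kfun_rvf)
      show "kfun UNIV (\<lambda>E. e (E 0))"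
        unfolding e_def by (intro kfun_if D_intros f kfun_const) simp_all
      show "e x \<noteq> 0" for x unfolding e_def by simp
    qed
    have ev: "eventually (\<lambda>x. e x = f x - s) at0" using ne by eventually_elim (simp add: e_def)
    from rvf_trichotomy[OF e] show ?thesis
    proof (elim disjE)
      assume "\<exists>d. d \<noteq> 0 \<and> eventually (\<lambda>x. v (e x) = v d) at0"
      then obtain d where "d \<noteq> 0" "eventually (\<lambda>x. v (e x) = v d) at0" by blast
      then show ?thesis using eventually_elim2[OF ev, of "\<lambda>x. v (e x) = v d" "\<lambda>x. v (f x - s) = v d"] by auto
    next
      assume *: "\<forall>d. d \<noteq> 0 \<longrightarrow> eventually (\<lambda>x. v d < v (e x)) at0"
      obtain d where d: "d \<noteq> 0" "\<not> eventually (\<lambda>x. v d < v (f x - s)) at0" using A by blast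
      have "eventually (\<lambda>x. v d < v (e x)) at0" using * d(1) by blast
      then have "eventually (\<lambda>x. v d < v (f x - s)) at0" using ev by eventually_elim simp
      with d(2) show ?thesis by blast
    next
      assume *: "\<forall>d. d \<noteq> 0 \<longrightarrow> eventually (\<lambda>x. v (e x) < v d) at0"
      obtain d where d: "d \<noteq> 0" "\<not> eventually (\<lambda>x. v (f x) < v d) at0" using B by blast
      have "\<exists>d'. d' \<noteq> 0 \<and> v d' \<le> v d \<and> v d' \<le> v s"
      proof (cases "v d \<le> v s")
        case True
        then show ?thesis using d(1) by blast
      next
        case False
        then have "v s < v d" by simp
        then have "s \<noteq> 0" using v_less_Pinf[OF d(1)] by auto
        then show ?thesis using \<open>v s < v d\<close> by (intro exI[of _ s]) simp
      qed
      then obtain d' where d': "d' \<noteq> 0" "v d' \<le> v d" "v d' \<le> v s" by blast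
      have "eventually (\<lambda>x. v (e x) < v d') at0" using * d'(1) by blast
      then have "eventually (\<lambda>x. v (f x) < v d) at0" using ev
      proof eventually_elim
        case (elim x)
        then have "v (f x - s) < v s" using d'(3) by (auto intro: less_le_trans)
        then have "v (f x) = v (f x - s)" using v_add_eq[of "f x - s" s] by simp
        then show ?case using elim d'(2) by (auto intro: less_le_trans)
      qed
      with d(2) show ?thesis by blast
    qed
  qed
  then have "\<exists>l. \<forall>s. l s \<noteq> 0 \<and> eventually (\<lambda>x. v (f x - s) = v (l s)) at0" by (intro choice allI)
  then obtain l where l: "\<And>s. l s \<noteq> 0" "\<And>s. eventually (\<lambda>x. v (f x - s) = v (l s)) at0" by blast
  have appr: "\<exists>c. eventually (\<lambda>x. rveq c (f x - s)) at0" for s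
  proof -
    define S where "S x c \<longleftrightarrow> 0 < v ((f x - s) / l s - c)" for x c
    have "D UNIV (\<lambda>E. S (E 1) (E 0))"
      unfolding S_def by (intro D_intros f_intros kfun_const) simp_all
    moreover have ev: "eventually (\<lambda>x. v ((f x - s) / l s) = 0) at0"
      using l(2)[of s] by eventually_elim (use l(1) v_divide_self v_eq_Pinf in metis)
    have "eventually (\<lambda>x. \<exists>c. 0 \<le> v c \<and> S x c) at0"
      using ev
    proof eventually_elim
      case (elim x)
      then show ?case by (intro exI[of _ "(f x - s) / l s"]) (simp add: S_def zero_extended_def)
    qed
    moreover have "S x c'" if "S x c" "0 < v (c - c')" for x c c'
      using that v_trans_less unfolding S_def by blast
    ultimately obtain c where c: "eventually (\<lambda>x. S x c) at0" using residue_germ[of S] by blast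
    have "eventually (\<lambda>x. rveq (c * l s) (f x - s)) at0"
      using c ev
    proof eventually_elim
      case (elim x)
      then have "rveq c ((f x - s) / l s)" unfolding S_def using v_minus_commute by (intro rveq_unitI) auto
      then have "rveq (l s * c) (l s * ((f x - s) / l s))" using l(1) by (rule rveq_mult_left)
      then show ?case using l(1) by (simp add: mult.commute)
    qed
    then show ?thesis by blast
  qed
  have near: "min (v (l s)) (v (l s')) \<le> v (s - s')" for s s'
  proof -
    have "eventually (\<lambda>x. min (v (l s)) (v (l s')) \<le> v (s - s')) at0"
      using l(2)[of s] l(2)[of s']
    proof eventually_elim
      case (elim x)
      then have "min (v (l s)) (v (l s')) \<le> v (s - f x)" "min (v (l s)) (v (l s')) \<le> v (f x - s')"
        using v_minus_commute[of s "f x"] by (auto simp: min.coboundedI1 min.coboundedI2)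
      then show ?case by (rule v_trans_le)
    qed
    then show ?thesis using eventually_at0_ex by blast
  qed
  have better: "\<exists>s'. v (l s) < v (l s')" for s
  proof -
    obtain c where "eventually (\<lambda>x. rveq c (f x - s)) at0" using appr by blast
    then have "eventually (\<lambda>x. v (l s) < v (l (s + c))) at0"
      using l(2)[of s] l(2)[of "s + c"]
    proof eventually_elim
      case (elim x)
      have "v (f x - s) < v (f x - (s + c))"
        using elim(1) v_minus_commute[of c "f x - s"] unfolding rveq_def by (simp add: diff_diff_eq)
      with elim show ?case by simp
    qed
    then show ?thesis using eventually_at0_ex by blast
  qed
  define U where "U d \<longleftrightarrow> (\<forall>s. eventually (\<lambda>x. v (f x - s) \<le> v d) at0)" for d
  have evl: "eventually (\<lambda>x. Q (v (f x - s))) at0 \<longleftrightarrow> Q (v (l s))" for Q s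
  proof
    assume "eventually (\<lambda>x. Q (v (f x - s))) at0"
    then have "eventually (\<lambda>x. Q (v (l s))) at0" using l(2)[of s] by eventually_elim simp
    then show "Q (v (l s))" using eventually_at0_ex by blast
  next
    assume "Q (v (l s))"
    with l(2)[of s] show "eventually (\<lambda>x. Q (v (f x - s))) at0" by (auto elim: eventually_mono)
  qed
  have Ul: "U d \<longleftrightarrow> (\<forall>s. v (l s) \<le> v d)" for d unfolding U_def using evl[of "\<lambda>z. z \<le> v d"] by simp
  show False
  proof (cases "\<exists>d. d \<noteq> 0 \<and> U d")
    case False
    define R where "R z s \<longleftrightarrow> eventually (\<lambda>x. v (f x - s) \<le> v (z - s)) at0" for z s
    have DR: "D UNIV (\<lambda>E. R (E 0) (E 1))" unfolding R_def by (intro D_at0 D_intros f_intros)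
    have Rl: "R z s \<longleftrightarrow> v (l s) \<le> v (z - s)" for z s
      unfolding R_def by (rule evl[of "\<lambda>w. w \<le> v (z - s)"])
    have unb: "\<exists>s. v d < v (l s)" if "d \<noteq> 0" for d using False that unfolding Ul by (meson not_le)
    obtain z where z: "\<And>s. R z s" using ball_chain[of R l, OF DR l(1) Rl near unb] by blast
    obtain s where s: "v (l z) < v (l s)" using better by blast
    have "min (v (l z)) (v (l s)) \<le> v (z - s)" "v (l s) \<le> v (z - s)" using near z unfolding Rl by auto
    have "eventually (\<lambda>x. False) at0"
      using l(2)[of z] l(2)[of s]
    proof eventually_elim
      case (elim x)
      have "v (l s) \<le> v (s - z)" using z[of s] v_minus_commute unfolding Rl by metis
      then have "v (l s) \<le> v (f x - z)" using elim v_trans_le[of "v (l s)" "f x" s z] by simp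
      then show False using elim s by simp
    qed
    then show False using at0_neq_bot by blast
  next
    case True
    then obtain d where "d \<noteq> 0" "U d" by blast
    moreover have "D UNIV (\<lambda>E. U (E 0))" unfolding U_def by (intro D_intros D_at0 f_intros)
    moreover have "\<forall>d d'. d \<noteq> 0 \<longrightarrow> d' \<noteq> 0 \<longrightarrow> v d \<le> v d' \<longrightarrow> U d \<longrightarrow> U d'"
      unfolding Ul by (meson order_trans)
    moreover have "\<not> U (l s)" for s using better unfolding Ul by (meson not_le)
    ultimately have "\<exists>a. a \<noteq> 0 \<and> (\<forall>d. d \<noteq> 0 \<longrightarrow> v a < v d \<longrightarrow> U d) \<and> (\<forall>d. d \<noteq> 0 \<longrightarrow> v d < v a \<longrightarrow> \<not> U d)"
      using infimum[of UNIV U d "l 0"] l(1) by blast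
    then obtain a where a: "a \<noteq> 0" "\<And>d. d \<noteq> 0 \<Longrightarrow> v a < v d \<Longrightarrow> U d" "\<And>d. d \<noteq> 0 \<Longrightarrow> v d < v a \<Longrightarrow> \<not> U d"
      by blast
    have la: "v (l s) < v a" for s
    proof (rule ccontr)
      assume "\<not> v (l s) < v a"
      moreover obtain s' where "v (l s) < v (l s')" using better by blast
      ultimately have "v a < v (l s')" by simp
      then show False using a(2)[OF l(1)] \<open>\<And>s. \<not> U (l s)\<close> by blast
    qed
    \<comment> \<open>\<open>e x\<close> is the leading term of \<open>f y - f x\<close> for
      \<open>y\<close> tending to 0. Its valuation stays below the supremum \<open>v a\<close>, but
      eventually reaches each \<open>v (l s)\<close>, so it fits none of the three cases of the
      trichotomy.\<close>
    have "\<exists>e. \<forall>x. eventually (\<lambda>y. rveq (e x) (f y - f x)) at0" using appr by (intro choice allI)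
    then obtain e where e: "\<And>x. eventually (\<lambda>y. rveq (e x) (f y - f x)) at0" by blast
    have e0: "e x \<noteq> 0" for x using eventually_at0_ex[OF e[of x]] by (auto simp: rveq_def)
    have "rveq z (e x) \<longleftrightarrow> eventually (\<lambda>y. rveq z (f y - f x)) at0" for z x
    proof
      assume "rveq z (e x)"
      with e[of x] show "eventually (\<lambda>y. rveq z (f y - f x)) at0" by (auto elim!: eventually_mono intro: rveq_trans)
    next
      assume "eventually (\<lambda>y. rveq z (f y - f x)) at0"
      then have "eventually (\<lambda>y. rveq z (e x)) at0"
        using e[of x] by eventually_elim (auto intro: rveq_trans rveq_sym)
      then show "rveq z (e x)" using eventually_at0_ex by blast
    qed
    then have "D UNIV (\<lambda>E. rveq (E 0) (e (E 1))) = D UNIV (\<lambda>E. eventually (\<lambda>y. rveq (E 0) (f y - f (E 1))) at0)"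
      by simp
    moreover have "D UNIV (\<lambda>E. eventually (\<lambda>y. rveq (E 0) (f y - f (E 1))) at0)"
      by (intro D_at0 D_rveq kfun_intros f_intros)
    ultimately have rv: "rvf e" unfolding rvf_def using e0 by blast
    have ve: "v (e x) = v (l (f x))" for x
    proof -
      have "eventually (\<lambda>y. v (e x) = v (l (f x))) at0"
        using e[of x] l(2)[of "f x"] by eventually_elim (simp add: rveq_v)
      then show ?thesis using eventually_at0_ex by blast
    qed
    have lower: "eventually (\<lambda>x. v (l s) \<le> v (e x)) at0" for s
      using l(2)[of s]
    proof eventually_elim
      case (elim x)
      have "eventually (\<lambda>y. v (l s) \<le> v (f y - f x)) at0"
        using l(2)[of s]
      proof eventually_elim
        case (elim y)
        then show ?case
          using \<open>v (f x - s) = v (l s)\<close> v_trans_le[of "v (l s)" "f y" s "f x"] v_minus_commute[of s "f x"] by simp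
      qed
      then show ?case unfolding ve by (simp add: evl[of "\<lambda>w. v (l s) \<le> w"])
    qed
    from rvf_trichotomy[OF rv] show False
    proof (elim disjE)
      assume "\<exists>d. d \<noteq> 0 \<and> eventually (\<lambda>x. v (e x) = v d) at0"
      then obtain d where d: "d \<noteq> 0" "eventually (\<lambda>x. v (e x) = v d) at0" by blast
      obtain x where "v (e x) = v d" using eventually_at0_ex[OF d(2)] by blast
      then have "v d < v a" using la ve by metis
      then obtain s where s: "v d < v (l s)" using a(3)[OF d(1)] unfolding Ul by (meson not_le)
      have "eventually (\<lambda>x. False) at0" using lower[of s] d(2) by eventually_elim (use s in simp)
      then show False using at0_neq_bot by blast
    next
      assume "\<forall>d. d \<noteq> 0 \<longrightarrow> eventually (\<lambda>x. v d < v (e x)) at0"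
      then have "eventually (\<lambda>x. v a < v (e x)) at0" using a(1) by blast
      then obtain x where "v a < v (e x)" using eventually_at0_ex by blast
      then show False using la[of "f x"] ve by simp
    next
      assume "\<forall>d. d \<noteq> 0 \<longrightarrow> eventually (\<lambda>x. v (e x) < v d) at0"
      then have "eventually (\<lambda>x. v (e x) < v (l 0)) at0" using l(1) by blast
      then have "eventually (\<lambda>x. False) at0" using lower[of 0] by eventually_elim simp
      then show False using at0_neq_bot by blast
    qed
  qed
qed

end

section \<open>Generic points\<close>

context fo_language
begin

text \<open>A quantifier over a whole assignment: the bound one occupies the even positions, the
  outer one the odd positions.\<close>

lemma D_ex_env:
  assumes "D A (\<lambda>e. G (\<lambda>i. e (Suc (2 * i))) (\<lambda>i. e (2 * i)))"
  shows "D A (\<lambda>e. \<exists>w. G e w)"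
proof -
  let ?Q = "\<lambda>e. G (\<lambda>i. e (Suc (2 * i))) (\<lambda>i. e (2 * i))"
  have "D A (\<lambda>e. (\<lambda>e. \<exists>e'. (\<forall>i\<in>{i. odd i}. e' i = e i) \<and> ?Q e') (\<lambda>k. e (k div 2)))"
    by (rule D_rename[OF D_ex_coords[OF assms]])
  moreover have "(\<exists>e'. (\<forall>i\<in>{i. odd i}. e' i = e (i div 2)) \<and> ?Q e') = (\<exists>w. G e w)" for e
  proof
    assume "\<exists>e'. (\<forall>i\<in>{i. odd i}. e' i = e (i div 2)) \<and> ?Q e'"
    then obtain e' where e': "\<forall>i\<in>{i. odd i}. e' i = e (i div 2)" "?Q e'" by blast
    have "(\<lambda>i. e' (Suc (2 * i))) = e" using e'(1) by auto
    with e'(2) show "\<exists>w. G e w" by auto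
  next
    assume "\<exists>w. G e w"
    then obtain w where w: "G e w" by blast
    define e' where "e' k = (if odd k then e (k div 2) else w (k div 2))" for k
    have "(\<lambda>i. e' (Suc (2 * i))) = e" "(\<lambda>i. e' (2 * i)) = w" by (auto simp: e'_def)
    then have "?Q e'" using w by simp
    moreover have "\<forall>i\<in>{i. odd i}. e' i = e (i div 2)" by (simp add: e'_def)
    ultimately show "\<exists>e'. (\<forall>i\<in>{i. odd i}. e' i = e (i div 2)) \<and> ?Q e'" by blast
  qed
  ultimately show ?thesis by simp
qed

lemma D_all_env:
  assumes "D A (\<lambda>e. G (\<lambda>i. e (Suc (2 * i))) (\<lambda>i. e (2 * i)))"
  shows "D A (\<lambda>e. \<forall>w. G e w)"
  using D_not[OF D_ex_env[of A "\<lambda>e w. \<not> G e w", OF D_not[OF assms]]] by simp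

lemma kfun_upd:
  "(\<And>i. kfun A (\<lambda>e. X e i)) \<Longrightarrow> kfun A F \<Longrightarrow> kfun A (\<lambda>e. ((X e)(j := F e)) i)"
  by (cases "i = j") simp_all

definition acl :: "'a set \<Rightarrow> 'a set" where
  "acl A = {c. \<exists>X. D A (\<lambda>e. X (e 0)) \<and> finite {x. X x} \<and> X c}"

text \<open>The coordinates in \<open>I\<close> are generic, the others are parameters.\<close>

definition SG :: "'a set \<Rightarrow> nat set \<Rightarrow> (nat \<Rightarrow> 'a) \<Rightarrow> bool" where
  "SG A I a \<longleftrightarrow> finite I \<and> (\<forall>i. i \<notin> I \<longrightarrow> a i \<in> A) \<and> (\<forall>i\<in>I. a i \<notin> acl (A \<union> a ` (I - {i})))"

lemma SG_insert:
  assumes "SG A (insert j I) a" "j \<notin> I"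
  shows "SG (insert (a j) A) I a"
proof -
  have "insert (a j) A \<union> a ` (I - {i}) = A \<union> a ` (insert j I - {i})" if "i \<in> I" for i
    using that assms(2) by auto
  moreover have "a i \<in> insert (a j) A" if "i \<notin> I" for i
    using assms(1) that unfolding SG_def by (cases "i = j") auto
  ultimately show ?thesis using assms(1) unfolding SG_def by auto
qed

lemma SG_single:
  assumes "SG A I a" "j \<in> I"
  shows "SG (A \<union> a ` (I - {j})) {j} a"
  using assms unfolding SG_def by auto

end

context acvf
begin

lemma D_gdef_eq:
  assumes "gdef A g" "\<And>i. kfun A (\<sigma> i)" "\<And>i. kfun A (\<tau> i)"
  shows "D A (\<lambda>e. v (g (\<lambda>i. \<sigma> i e)) = v (g (\<lambda>i. \<tau> i e)))"
proof (rule D_gdef[where R = "\<lambda>z e. z = v (g (\<lambda>i. \<tau> i e))", OF assms(1) _ assms(2)])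
  show "D A (\<lambda>e. v (e 0) = v (g (\<lambda>i. \<tau> i (\<lambda>i. e (Suc i)))))"
    by (rule D_gdef[where R = "\<lambda>z e. v (e 0) = z", OF assms(1) _ kfun_shift[OF assms(3)]]) (intro D_intros)
qed

lemma D_gdef_ge:
  assumes "gdef A g" "\<And>i. kfun A (\<sigma> i)" "kfun A F"
  shows "D A (\<lambda>e. v (F e) \<le> v (g (\<lambda>i. \<sigma> i e)))"
  by (rule D_gdef[where R = "\<lambda>z e. v (F e) \<le> z", OF assms(1) _ assms(2)])
    (intro D_intros kfun_shift[OF assms(3)])

definition near :: "nat set \<Rightarrow> 'a \<Rightarrow> (nat \<Rightarrow> 'a) \<Rightarrow> (nat \<Rightarrow> 'a) \<Rightarrow> bool" where
  "near I d a x \<longleftrightarrow> (\<forall>i. if i \<in> I then v d < v (x i - a i) else x i = a i)"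

lemma near_mono: "near I d' a x \<Longrightarrow> v d \<le> v d' \<Longrightarrow> near I d a x"
  unfolding near_def by (metis le_less_trans)

lemma near_refl: "d \<noteq> 0 \<Longrightarrow> near I d a a"
  by (simp add: near_def v_less_Pinf)

lemma near_insert: "near (insert j I) d a x \<Longrightarrow> j \<notin> I \<Longrightarrow> near I d a (x(j := a j))"
  unfolding near_def by (auto split: if_splits)

text \<open>A point near \<open>a\<close> is determined by its coordinates in \<open>I\<close>. In
  this form the quantifier ranges over all assignments, as \<open>D_all_env\<close> expects.\<close>

lemma all_near: "(\<forall>x. near I d a x \<longrightarrow> P x) \<longleftrightarrow>
    (\<forall>w. (\<forall>i\<in>I. v d < v (w i - a i)) \<longrightarrow> P (\<lambda>i. if i \<in> I then w i else a i))"
proof (intro iffI allI impI)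
  fix w assume "\<forall>x. near I d a x \<longrightarrow> P x" "\<forall>i\<in>I. v d < v (w i - a i)"
  then show "P (\<lambda>i. if i \<in> I then w i else a i)" by (simp add: near_def)
next
  fix x assume *: "\<forall>w. (\<forall>i\<in>I. v d < v (w i - a i)) \<longrightarrow> P (\<lambda>i. if i \<in> I then w i else a i)" "near I d a x"
  then have "P (\<lambda>i. if i \<in> I then x i else a i)" by (auto simp: near_def)
  moreover have "(\<lambda>i. if i \<in> I then x i else a i) = x" using *(2) by (auto simp: near_def)
  ultimately show "P x" by simp
qed

lemma D_all_near:
  assumes "finite I" "kfun A F" "\<And>i. kfun A (\<sigma> i)"
    and "D A (\<lambda>e. P (\<lambda>i. e (Suc (2 * i))) (\<lambda>i. if i \<in> I then e (2 * i) else \<sigma> i (\<lambda>i. e (Suc (2 * i)))))"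
  shows "D A (\<lambda>e. \<forall>x. near I (F e) (\<lambda>i. \<sigma> i e) x \<longrightarrow> P e x)"
  unfolding all_near
  using assms(1,4) by (intro D_all_env D_imp D_finite_all D_less kfun_diff kfun_var kfun_shift[OF assms(2)] kfun_shift[OF assms(3)])

definition nhd :: "nat set \<Rightarrow> (nat \<Rightarrow> 'a) \<Rightarrow> (nat \<Rightarrow> 'a) filter" where
  "nhd I a = (INF d\<in>-{0}. principal {x. near I d a x})"

lemma eventually_nhd: "eventually P (nhd I a) \<longleftrightarrow> (\<exists>d. d \<noteq> 0 \<and> (\<forall>x. near I d a x \<longrightarrow> P x))"
proof -
  have "eventually P (nhd I a) \<longleftrightarrow> (\<exists>d\<in>-{0}. eventually P (principal {x. near I d a x}))"
    unfolding nhd_def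
  proof (rule eventually_INF_base)
    fix b c :: 'a assume "b \<in> -{0}" "c \<in> -{0}"
    then obtain d where "d \<noteq> 0" "v b \<le> v d" "v c \<le> v d" using v_max_ex by auto
    then show "\<exists>x\<in>-{0}. principal {y. near I x a y} \<le>
        inf (principal {y. near I b a y}) (principal {y. near I c a y})"
      by (intro bexI[of _ d]) (auto intro: near_mono)
  next
    show "- {0 :: 'a} \<noteq> {}" by (metis Compl_iff empty_iff singletonD zero_neq_one)
  qed
  then show ?thesis by (auto simp: eventually_principal)
qed

text \<open>A predicate is a function into the value group with the two values \<open>v 1\<close>
  and \<open>v \<pi>\<close>.\<close>

lemma eventually_of_locally_constant:
  assumes "\<And>g. gdef A g \<Longrightarrow> eventually (\<lambda>x. v (g x) = v (g a)) F" "D A P" "P a"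
  shows "eventually P F"
proof -
  have "gdef A (\<lambda>x. if P x then 1 else \<pi>)"
    using assms(2) by (intro gdef_kfun kfun_if kfun_intros) simp_all
  from assms(1)[OF this] show ?thesis
    using assms(3) v_\<pi> by (auto elim!: eventually_mono split: if_splits)
qed

text \<open>The points of the line through \<open>a\<close> at which local constancy fails form a
  finite set definable over \<open>A\<close>. Its members are algebraic, whereas \<open>a j\<close>
  is not.\<close>

lemma locally_constant_unary:
  assumes SG: "SG A {j} a" and g: "gdef A g"
  shows "\<exists>d. d \<noteq> 0 \<and> (\<forall>z. v d < v (z - a j) \<longrightarrow> v (g (a(j := z))) = v (g a))"
proof (rule ccontr)
  assume *: "\<not> ?thesis"
  define E where "E y \<longleftrightarrow> \<not> (\<exists>d. d \<noteq> 0 \<and> (\<forall>x. v d < v (x - y) \<longrightarrow> v (g (a(j := x))) = v (g (a(j := y)))))" for y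
  have a: "kfun A (\<lambda>e. (a(j := F e)) i)" if "kfun A F" for F i
    using SG that by (cases "i = j") (auto simp: SG_def intro: kfun_const)
  have "D UNIV (\<lambda>e. v (e 1) = v (g (\<lambda>i. (a(j := e 0)) i)))"
  proof (rule D_gdef[where R = "\<lambda>z e. v (e 1) = z", OF gdef_mono[OF g]])
    show "D UNIV (\<lambda>e. v (e (Suc 1)) = v (e 0))" by (intro D_intros)
    show "kfun UNIV (\<lambda>e. (a(j := e 0)) i)" for i by (intro kfun_upd kfun_const kfun_var UNIV_I insertI2)
  qed simp
  then have "gdef1 (\<lambda>y. g (a(j := y)))"
    unfolding gdef1_def using gdef_nonzero[OF g] by blast
  then have "finite {y. E y}" unfolding E_def by (rule locally_constant_cofinite)
  moreover have "D A (\<lambda>e. E (e 0))"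
    unfolding E_def by (intro D_intros D_gdef_eq[OF g] a)
  moreover have "E (a j)" using * unfolding E_def by simp
  ultimately show False using SG unfolding SG_def acl_def by auto
qed

text \<open>Induction on the coordinates: the radius \<open>r\<close> of local constancy in
  direction \<open>j\<close> is again a function into the value group, so it is constant near
  \<open>a\<close> in the other coordinates, and the one-dimensional neighbourhoods combine to a
  box.\<close>

lemma gdef_locally_constant:
  assumes "SG A I a" "gdef A g"
  shows "eventually (\<lambda>x. v (g x) = v (g a)) (nhd I a)"
proof -
  have "finite I" using assms(1) by (simp add: SG_def)
  then show ?thesis using assms
  proof (induction I arbitrary: A g rule: finite_induct)
    case empty
    have "x = a" if "near {} 1 a x" for x using that by (auto simp: near_def)
    then show ?case unfolding eventually_nhd by (intro exI[of _ 1]) auto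
  next
    case (insert j I)
    note g = insert.prems(2)
    let ?A = "insert (a j) A"
    have SG: "SG ?A I a" using insert.prems(1) insert.hyps(2) by (rule SG_insert)
    have const: "eventually (\<lambda>x. v (g x) = v (g a)) (nhd I a)" if "gdef A g" for g
      using insert.IH[OF SG] gdef_mono[OF that] by blast
    define U where "U x d \<longleftrightarrow> (\<forall>z. v d < v (z - x j) \<longrightarrow> v (g (x(j := z))) = v (g x))" for x d
    have DU: "D A (\<lambda>e. U (\<lambda>i. e (Suc i)) (e 0))"
      unfolding U_def by (intro D_intros D_gdef_eq[OF g] kfun_upd)
    have "\<forall>x d d'. d \<noteq> 0 \<longrightarrow> d' \<noteq> 0 \<longrightarrow> v d \<le> v d' \<longrightarrow> U x d \<longrightarrow> U x d'"
      unfolding U_def by (meson le_less_trans)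
    from definable_radius[OF DU this] obtain r where
      r: "gdef A r" "\<And>x. \<exists>d. d \<noteq> 0 \<and> U x d \<Longrightarrow> U x (r x)" by blast
    have "D A (\<lambda>e. \<exists>d. d \<noteq> 0 \<and> U e d)" by (intro D_intros DU)
    moreover have "\<exists>d. d \<noteq> 0 \<and> U a d"
      unfolding U_def by (rule locally_constant_unary[OF SG_single[OF insert.prems(1)] gdef_mono[OF g]]) auto
    ultimately have "eventually (\<lambda>x. \<exists>d. d \<noteq> 0 \<and> U x d) (nhd I a)"
      using eventually_of_locally_constant[OF const] by blast
    then have "eventually (\<lambda>x. U x (r x) \<and> v (r x) = v (r a) \<and> v (g x) = v (g a)) (nhd I a)"
      using const[OF r(1)] const[OF g] by eventually_elim (use r(2) in blast)
    then obtain d where d: "d \<noteq> 0" "\<And>x. near I d a x \<Longrightarrow> U x (r x) \<and> v (r x) = v (r a) \<and> v (g x) = v (g a)"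
      unfolding eventually_nhd by blast
    obtain d' where d': "d' \<noteq> 0" "v d \<le> v d'" "v (r a) \<le> v d'"
      using v_max_ex d(1) gdef_nonzero[OF r(1)] by blast
    have "v (g x) = v (g a)" if x: "near (insert j I) d' a x" for x
    proof -
      let ?x = "x(j := a j)"
      have "near I d a ?x" using near_insert[OF x insert.hyps(2)] d'(2) by (rule near_mono)
      then have *: "U ?x (r ?x)" "v (r ?x) = v (r a)" "v (g ?x) = v (g a)" using d(2) by blast+
      have "v (r a) < v (x j - a j)" using x d'(3) unfolding near_def by (metis insertI1 le_less_trans)
      then have "v (g (?x(j := x j))) = v (g ?x)"
        using *(1)[unfolded U_def, rule_format, of "x j"] *(2) by simp
      then show ?thesis using *(3) by simp
    qed
    with d'(1) show ?case unfolding eventually_nhd by blast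
  qed
qed

lemma eventually_generic: "SG A I a \<Longrightarrow> D A P \<Longrightarrow> P a \<Longrightarrow> eventually P (nhd I a)"
  by (rule eventually_of_locally_constant[OF gdef_locally_constant])

end

context complete_acvf
begin

section \<open>Continuity at generic points\<close>

definition lim0 :: "('a \<Rightarrow> 'a) \<Rightarrow> 'a \<Rightarrow> bool" where
  "lim0 f s \<longleftrightarrow> (\<forall>c. c \<noteq> 0 \<longrightarrow> eventually (\<lambda>x. v c < v (f x - s)) at0)"

text \<open>If continuity fails, then by completeness of the germ all small increments have
  valuation at most \<open>v c\<close>. By genericity the same happens at nearby points with a
  common bound \<open>v (\<gamma> a)\<close> and a common radius \<open>v (r a)\<close>, so nearby
  values of \<open>q\<close> keep a fixed distance from each other. This excludes a finite limit of
  the germ; an infinite one is excluded because the valuation of \<open>q\<close>, where non-zero,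
  is locally constant.\<close>

lemma continuous_unary:
  assumes SG: "SG A {j} a" and q: "kfun A q" and c: "c \<noteq> 0"
  shows "\<exists>d. d \<noteq> 0 \<and> (\<forall>z. v d < v (z - a j) \<longrightarrow> v c < v (q (a(j := z)) - q a))"
proof (rule ccontr)
  assume *: "\<not> ?thesis"
  note const = gdef_locally_constant[OF SG] and generic = eventually_generic[OF SG] and qs = kfun_subst[OF q]
  define G where "G x c \<longleftrightarrow> eventually (\<lambda>y. v (q (x(j := x j + y)) - q x) \<le> v c) at0" for x c
  have DG: "D A (\<lambda>e. G (\<lambda>i. e (Suc i)) (e 0))"
    unfolding G_def by (intro D_at0 D_intros qs kfun_upd)
  have "\<forall>x c c'. c \<noteq> 0 \<longrightarrow> c' \<noteq> 0 \<longrightarrow> v c \<le> v c' \<longrightarrow> G x c \<longrightarrow> G x c'"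
    unfolding G_def by (auto elim: eventually_mono)
  from definable_radius[OF DG this] obtain \<gamma> where
    \<gamma>: "gdef A \<gamma>" "\<And>x. \<exists>c. c \<noteq> 0 \<and> G x c \<Longrightarrow> G x (\<gamma> x)" by blast
  define U where "U x d \<longleftrightarrow> (\<forall>y. y \<noteq> 0 \<longrightarrow> v d < v y \<longrightarrow> v (q (x(j := x j + y)) - q x) \<le> v (\<gamma> x))" for x d
  have DU: "D A (\<lambda>e. U (\<lambda>i. e (Suc i)) (e 0))"
    unfolding U_def by (intro D_intros D_gdef_ge[OF \<gamma>(1)] qs kfun_upd)
  have "\<forall>x d d'. d \<noteq> 0 \<longrightarrow> d' \<noteq> 0 \<longrightarrow> v d \<le> v d' \<longrightarrow> U x d \<longrightarrow> U x d'"
    unfolding U_def by (meson le_less_trans)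
  from definable_radius[OF DU this] obtain r where
    r: "gdef A r" "\<And>x. \<exists>d. d \<noteq> 0 \<and> U x d \<Longrightarrow> U x (r x)" by blast
  have qa: "kfun UNIV (\<lambda>E. q (\<lambda>i. (a(j := F E)) i))" if "kfun UNIV F" for F
    using that by (intro kfun_subst[OF kfun_mono[OF q]] kfun_upd kfun_const) simp_all
  have "G a c"
  proof (rule ccontr)
    assume n: "\<not> G a c"
    have "D UNIV (\<lambda>E. v (q (\<lambda>i. (a(j := a j + E 0)) i) - q a) \<le> v c)"
      by (intro D_intros qa kfun_const) simp_all
    with n at0_complete have "eventually (\<lambda>y. \<not> v (q (a(j := a j + y)) - q a) \<le> v c) at0"
      unfolding G_def by fastforce
    then obtain d where d: "d \<noteq> 0" "\<And>y. y \<noteq> 0 \<Longrightarrow> v d < v y \<Longrightarrow> v c < v (q (a(j := a j + y)) - q a)"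
      unfolding eventually_at0 by (auto simp: not_le)
    have "v c < v (q (a(j := z)) - q a)" if "v d < v (z - a j)" for z
    proof (cases "z = a j")
      case True
      then show ?thesis using v_less_Pinf[OF c] by simp
    next
      case False
      then show ?thesis using d(2)[of "z - a j"] that by simp
    qed
    with d(1) * show False by blast
  qed
  with c have "\<exists>c. c \<noteq> 0 \<and> G a c" by blast
  moreover have "D A (\<lambda>e. \<exists>c. c \<noteq> 0 \<and> G e c)" by (intro D_intros DG)
  ultimately have ev: "eventually (\<lambda>x. \<exists>c. c \<noteq> 0 \<and> G x c) (nhd {j} a)" using generic by blast
  have "\<exists>d. d \<noteq> 0 \<and> U x d" if "G x (\<gamma> x)" for x
    using that unfolding G_def U_def eventually_at0 by blast
  then have rU: "U x (r x)" if "\<exists>c. c \<noteq> 0 \<and> G x c" for x using r(2) \<gamma>(2)[OF that] by blast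
  have "eventually (\<lambda>x. U x (r x) \<and> v (r x) = v (r a) \<and> v (\<gamma> x) = v (\<gamma> a)) (nhd {j} a)"
    using ev const[OF r(1)] const[OF \<gamma>(1)] by eventually_elim (use rU in blast)
  then obtain d where d: "d \<noteq> 0"
    "\<And>x. near {j} d a x \<Longrightarrow> U x (r x) \<and> v (r x) = v (r a) \<and> v (\<gamma> x) = v (\<gamma> a)"
    unfolding eventually_nhd by blast
  define f where "f y = q (a(j := a j + y))" for y
  have nr: "near {j} d a (a(j := a j + y))" if "v d < v y" for y using that by (simp add: near_def)
  have spread: "v (f y - f y') \<le> v (\<gamma> a)" if "y \<noteq> y'" "v d < v y" "v d < v y'" "v (r a) < v y" "v (r a) < v y'" for y y'
  proof -
    let ?x = "a(j := a j + y')"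
    have "U ?x (r a)" "v (\<gamma> ?x) = v (\<gamma> a)"
      using d(2)[OF nr[OF that(3)]] unfolding U_def by auto
    moreover have "v (r a) < v (y - y')" using that(4,5) v_diff_less by blast
    moreover have "?x(j := ?x j + (y - y')) = a(j := a j + y)" by (simp add: algebra_simps)
    ultimately show ?thesis using that(1) unfolding U_def f_def by (metis eq_iff_diff_eq_0)
  qed
  have fd: "kfun UNIV (\<lambda>E. f (E 0))" unfolding f_def by (intro qa kfun_intros kfun_const) simp
  from limit_exists[OF fd] show False
  proof (elim disjE exE)
    fix s assume s: "\<forall>d. d \<noteq> 0 \<longrightarrow> eventually (\<lambda>x. v d < v (f x - s)) at0"
    have "eventually (\<lambda>y. v (\<gamma> a) < v (f y - s)) at0" using s gdef_nonzero[OF \<gamma>(1)] by blast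
    then obtain d' where d': "d' \<noteq> 0" "\<And>y. y \<noteq> 0 \<Longrightarrow> v d' < v y \<Longrightarrow> v (\<gamma> a) < v (f y - s)"
      unfolding eventually_at0 by blast
    obtain d1 where d1: "d1 \<noteq> 0" "v d \<le> v d1" "v (r a) \<le> v d1"
      using v_max_ex d(1) gdef_nonzero[OF r(1)] by blast
    obtain d2 where d2: "d2 \<noteq> 0" "v d1 \<le> v d2" "v d' \<le> v d2" using v_max_ex d1(1) d'(1) by blast
    define y where "y = d2 * \<pi>"
    define y' where "y' = y * \<pi>"
    have y: "y \<noteq> 0" "v d2 < v y" "y' \<noteq> 0" "v y < v y'"
      using d2(1) v_less_mult_\<pi> by (simp_all add: y_def y'_def)
    then have "v (f y - f y') \<le> v (\<gamma> a)"
      using d1 d2 by (intro spread) (auto intro: le_less_trans less_trans order_trans)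
    moreover have "v (\<gamma> a) < v (f y - s)" "v (\<gamma> a) < v (s - f y')"
      using d'(2)[of y] d'(2)[of y'] y d2(3) v_minus_commute[of s "f y'"] by (auto intro: le_less_trans less_trans)
    ultimately show False using v_trans_less[of "v (\<gamma> a)" "f y" s "f y'"] by simp
  next
    assume s: "\<forall>d. d \<noteq> 0 \<longrightarrow> eventually (\<lambda>x. v (f x) < v d) at0"
    define g where "g x = (if q x = 0 then 1 else q x)" for x
    have g: "gdef A g"
    proof (rule gdef_kfun)
      show "kfun A g" unfolding g_def by (intro kfun_if D_intros q)
    qed (simp add: g_def)
    then obtain d' where d': "d' \<noteq> 0" "\<And>x. near {j} d' a x \<Longrightarrow> v (g x) = v (g a)"
      using const unfolding eventually_nhd by blast
    have "eventually (\<lambda>y. v (f y) < v (g a)) at0" using s gdef_nonzero[OF g] by blast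
    then have "eventually (\<lambda>y. False) at0"
      using eventually_at0_less[OF d'(1)]
    proof eventually_elim
      case (elim y)
      then have "v (g (a(j := a j + y))) = v (g a)" by (intro d'(2)) (simp add: near_def)
      moreover have "f y \<noteq> 0" using elim(1) by auto
      ultimately show False using elim(1) unfolding g_def f_def by simp
    qed
    then show False using at0_neq_bot by blast
  qed
qed

text \<open>Only one precision has to be reached: \<open>g\<close> picks one at which continuity
  fails if it fails at any, and as a function into the value group it is constant near
  \<open>a\<close>. The radius that achieves this precision in direction \<open>j\<close> is locally
  constant too, and the induction hypothesis takes care of the other coordinates.\<close>

lemma continuous_generic:
  assumes "SG A I a" "kfun A q" "c \<noteq> 0"
  shows "eventually (\<lambda>x. v c < v (q x - q a)) (nhd I a)"
proof -
  have "finite I" using assms(1) by (simp add: SG_def)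
  then show ?thesis using assms
  proof (induction I arbitrary: A c rule: finite_induct)
    case empty
    have "x = a" if "near {} 1 a x" for x using that by (auto simp: near_def)
    then have "v c < v (q x - q a)" if "near {} 1 a x" for x using that v_less_Pinf[OF empty(3)] by fastforce
    then show ?case unfolding eventually_nhd by (intro exI[of _ 1]) auto
  next
    case (insert j I)
    note q = insert.prems(2)
    have SG: "SG (insert (a j) A) I a" using insert.prems(1) insert.hyps(2) by (rule SG_insert)
    have const: "eventually (\<lambda>x. v (g x) = v (g a)) (nhd I a)" if "gdef A g" for g
      by (rule gdef_locally_constant[OF SG gdef_mono[OF that]]) blast
    have generic: "eventually P (nhd I a)" if "D A P" "P a" for P
      by (rule eventually_generic[OF SG D_mono[OF that(1)] that(2)]) blast
    define B where "B x c \<longleftrightarrow> \<not> (\<exists>d. d \<noteq> 0 \<and> (\<forall>y. near (insert j I) d x y \<longrightarrow> v c < v (q y - q x)))" for x c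
    have DB: "D A (\<lambda>e. B (\<lambda>i. e (Suc i)) (e 0))"
      unfolding B_def using insert.hyps(1)
      by (intro D_intros D_all_near kfun_subst[OF q] kfun_if D_const) simp_all
    have "\<forall>x d d'. d \<noteq> 0 \<longrightarrow> d' \<noteq> 0 \<longrightarrow> v d \<le> v d' \<longrightarrow> B x d \<longrightarrow> B x d'"
      unfolding B_def by (meson le_less_trans)
    from definable_radius[OF DB this] obtain g where
      g: "gdef A g" "\<And>x. \<exists>d. d \<noteq> 0 \<and> B x d \<Longrightarrow> B x (g x)" by blast
    define U where "U x d \<longleftrightarrow> (\<forall>z. v d < v (z - x j) \<longrightarrow> \<not> v (q (x(j := z)) - q x) \<le> v (g x))" for x d
    have DU: "D A (\<lambda>e. U (\<lambda>i. e (Suc i)) (e 0))"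
      unfolding U_def by (intro D_intros D_gdef_ge[OF g(1)] kfun_subst[OF q] kfun_upd)
    have "\<forall>x d d'. d \<noteq> 0 \<longrightarrow> d' \<noteq> 0 \<longrightarrow> v d \<le> v d' \<longrightarrow> U x d \<longrightarrow> U x d'"
      unfolding U_def by (meson le_less_trans)
    from definable_radius[OF DU this] obtain r where
      r: "gdef A r" "\<And>x. \<exists>d. d \<noteq> 0 \<and> U x d \<Longrightarrow> U x (r x)" by blast
    have "D A (\<lambda>e. \<exists>d. d \<noteq> 0 \<and> U e d)" by (intro D_intros DU)
    moreover have "\<exists>d. d \<noteq> 0 \<and> U a d"
      using continuous_unary[OF SG_single[OF insert.prems(1), of j] kfun_mono[OF q] gdef_nonzero[OF g(1)]]
      unfolding U_def not_le by blast
    ultimately have "eventually (\<lambda>x. \<exists>d. d \<noteq> 0 \<and> U x d) (nhd I a)" by (rule generic)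
    moreover have "eventually (\<lambda>x. v (g a) < v (q x - q a)) (nhd I a)"
      by (rule insert.IH[OF SG kfun_mono[OF q] gdef_nonzero[OF g(1)]]) blast
    ultimately have "eventually (\<lambda>x. U x (r x) \<and> v (r x) = v (r a) \<and> v (g x) = v (g a) \<and> v (g a) < v (q x - q a)) (nhd I a)"
      using const[OF r(1)] const[OF g(1)] by eventually_elim (use r(2) in blast)
    then obtain d where d: "d \<noteq> 0" "\<And>x. near I d a x \<Longrightarrow>
        U x (r x) \<and> v (r x) = v (r a) \<and> v (g x) = v (g a) \<and> v (g a) < v (q x - q a)"
      unfolding eventually_nhd by blast
    obtain d' where d': "d' \<noteq> 0" "v d \<le> v d'" "v (r a) \<le> v d'"
      using v_max_ex d(1) gdef_nonzero[OF r(1)] by blast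
    have "v (g a) < v (q x - q a)" if x: "near (insert j I) d' a x" for x
    proof -
      let ?x = "x(j := a j)"
      have "near I d a ?x" using near_insert[OF x insert.hyps(2)] d'(2) by (rule near_mono)
      then have *: "U ?x (r ?x)" "v (r ?x) = v (r a)" "v (g ?x) = v (g a)" "v (g a) < v (q ?x - q a)"
        using d(2) by blast+
      have "v (r a) < v (x j - a j)" using x d'(3) unfolding near_def by (metis insertI1 le_less_trans)
      then have "\<not> v (q (?x(j := x j)) - q ?x) \<le> v (g ?x)"
        using *(1)[unfolded U_def, rule_format, of "x j"] *(2) by simp
      then have "v (g a) < v (q x - q ?x)" using *(3) by simp
      then show ?thesis using *(4) by (rule v_trans_less)
    qed
    then have "\<not> B a (g a)" unfolding B_def using d'(1) by blast
    then have "\<not> B a c" using g(2) insert.prems(3) by blast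
    then show ?case unfolding B_def eventually_nhd by blast
  qed
qed

section \<open>Joint limits in base point and increment\<close>

definition joint :: "nat set \<Rightarrow> (nat \<Rightarrow> 'a) \<Rightarrow> ((nat \<Rightarrow> 'a) \<Rightarrow> 'a \<Rightarrow> 'a) \<Rightarrow> 'a \<Rightarrow> bool" where
  "joint I a Q s \<longleftrightarrow> (\<forall>c. c \<noteq> 0 \<longrightarrow> (\<exists>d. d \<noteq> 0 \<and>
    (\<forall>x. near I d a x \<longrightarrow> (\<forall>\<eta>. \<eta> \<noteq> 0 \<longrightarrow> v d < v \<eta> \<longrightarrow> v c < v (Q x \<eta> - s)))))"

text \<open>As for continuity, one critical precision \<open>g\<close> is enough. At this precision
  the radius for the increment is constant near \<open>a\<close>, and the presumed limit
  \<open>q x\<close> varies continuously with \<open>x\<close>.\<close>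

lemma joint_limit:
  assumes SG: "SG A I a" and Q: "kfun A (\<lambda>e. Q (\<lambda>i. e (Suc i)) (e 0))" and q: "kfun A q"
    and lim: "lim0 (Q a) (q a)"
  shows "joint I a Q (q a)"
proof -
  have fin: "finite I" using SG by (simp add: SG_def)
  note const = gdef_locally_constant[OF SG] and generic = eventually_generic[OF SG]
  note Qs = kfun_env1[where P = Q, OF Q]
  define B where "B x c \<longleftrightarrow> \<not> (\<exists>d. d \<noteq> 0 \<and> (\<forall>y. near I d x y \<longrightarrow>
    (\<forall>\<eta>. \<eta> \<noteq> 0 \<longrightarrow> v d < v \<eta> \<longrightarrow> v c < v (Q y \<eta> - q x))))" for x c
  have DB: "D A (\<lambda>e. B (\<lambda>i. e (Suc i)) (e 0))"
    unfolding B_def using fin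
    by (intro D_intros D_all_near kfun_subst[OF q] Qs kfun_if D_const) simp_all
  have "\<forall>x d d'. d \<noteq> 0 \<longrightarrow> d' \<noteq> 0 \<longrightarrow> v d \<le> v d' \<longrightarrow> B x d \<longrightarrow> B x d'"
    unfolding B_def by (meson le_less_trans)
  from definable_radius[OF DB this] obtain g where
    g: "gdef A g" "\<And>x. \<exists>d. d \<noteq> 0 \<and> B x d \<Longrightarrow> B x (g x)" by blast
  define U where "U x d \<longleftrightarrow> (\<forall>\<eta>. \<eta> \<noteq> 0 \<longrightarrow> v d < v \<eta> \<longrightarrow> \<not> v (Q x \<eta> - q x) \<le> v (g x))" for x d
  have DU: "D A (\<lambda>e. U (\<lambda>i. e (Suc i)) (e 0))"
    unfolding U_def by (intro D_intros D_gdef_ge[OF g(1)] kfun_subst[OF q] Qs)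
  have "\<forall>x d d'. d \<noteq> 0 \<longrightarrow> d' \<noteq> 0 \<longrightarrow> v d \<le> v d' \<longrightarrow> U x d \<longrightarrow> U x d'"
    unfolding U_def by (meson le_less_trans)
  from definable_radius[OF DU this] obtain r where
    r: "gdef A r" "\<And>x. \<exists>d. d \<noteq> 0 \<and> U x d \<Longrightarrow> U x (r x)" by blast
  have "D A (\<lambda>e. \<exists>d. d \<noteq> 0 \<and> U e d)" by (intro D_intros DU)
  moreover have "\<exists>d. d \<noteq> 0 \<and> U a d"
  proof -
    have "eventually (\<lambda>\<eta>. v (g a) < v (Q a \<eta> - q a)) at0"
      using lim gdef_nonzero[OF g(1)] unfolding lim0_def by blast
    then show ?thesis unfolding U_def eventually_at0 not_le by blast
  qed
  ultimately have "eventually (\<lambda>x. \<exists>d. d \<noteq> 0 \<and> U x d) (nhd I a)" by (rule generic)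
  moreover have "eventually (\<lambda>x. v (g a) < v (q x - q a)) (nhd I a)"
    by (rule continuous_generic[OF SG q gdef_nonzero[OF g(1)]])
  ultimately have "eventually (\<lambda>x. U x (r x) \<and> v (r x) = v (r a) \<and> v (g x) = v (g a) \<and> v (g a) < v (q x - q a)) (nhd I a)"
    using const[OF r(1)] const[OF g(1)] by eventually_elim (use r(2) in blast)
  then obtain d where d: "d \<noteq> 0" "\<And>x. near I d a x \<Longrightarrow>
      U x (r x) \<and> v (r x) = v (r a) \<and> v (g x) = v (g a) \<and> v (g a) < v (q x - q a)"
    unfolding eventually_nhd by blast
  obtain d' where d': "d' \<noteq> 0" "v d \<le> v d'" "v (r a) \<le> v d'"
    using v_max_ex d(1) gdef_nonzero[OF r(1)] by blast
  have "v (g a) < v (Q x \<eta> - q a)" if x: "near I d' a x" and \<eta>: "\<eta> \<noteq> 0" "v d' < v \<eta>" for x \<eta>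
  proof -
    have "near I d a x" using x d'(2) by (rule near_mono)
    then have *: "U x (r x)" "v (r x) = v (r a)" "v (g x) = v (g a)" "v (g a) < v (q x - q a)"
      using d(2) by blast+
    have "v (r x) < v \<eta>" using \<eta>(2) d'(3) *(2) by simp
    then have "v (g a) < v (Q x \<eta> - q x)" using *(1,3) \<eta>(1) unfolding U_def by (simp add: not_le)
    then show ?thesis using *(4) by (rule v_trans_less)
  qed
  then have "\<not> B a (g a)" unfolding B_def using d'(1) by blast
  then have "\<not> B a c" if "c \<noteq> 0" for c using g(2) that by blast
  then show ?thesis unfolding joint_def B_def by blast
qed

end

section \<open>Difference quotients\<close>

context acvf
begin

lemma v_of_nat: "0 \<le> v (of_nat n)"
proof (induction n)
  case (Suc n)
  have "min (v 1) (v (of_nat n)) \<le> v (1 + of_nat n)" by (rule v_add)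
  with Suc show ?case by (simp add: min_def split: if_splits)
qed (simp add: zero_extended_def)

text \<open>A positive integer of positive valuation is a period of the valuation of
  \<open>e\<close>. If there is none, the positive integers are units with distinct residues, so the
  set of \<open>u\<close> that leave the germ invariant meets infinitely many residue classes. It
  then contains all generic units, hence all units, and \<open>rvf_spine\<close> applies.\<close>

lemma rvf_nat_invariant:
  assumes e: "rvf e" and char: "CHAR('a) = 0"
    and inv: "\<And>n. n > 0 \<Longrightarrow> eventually (\<lambda>x. rveq (e (of_nat n * x)) (e x)) at0"
  shows "\<exists>d. d \<noteq> 0 \<and> eventually (\<lambda>x. v (e x) = v d) at0"
proof (cases "\<exists>n>0. 0 < v (of_nat n)")
  case True
  then obtain n :: nat where n: "n > 0" "0 < v (of_nat n)" by blast
  have "of_nat n \<noteq> (0 :: 'a)" using n(1) char by (simp add: of_nat_eq_0_iff_char_dvd)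
  moreover have "eventually (\<lambda>x. v (e (of_nat n * x)) = v (e x)) at0"
    using inv[OF n(1)] by eventually_elim (rule rveq_v)
  ultimately show ?thesis using n(2) by (intro rvf_periodic_const[OF e]) auto
next
  case False
  then have "\<not> 0 < v (of_nat n)" if "n > 0" for n using that by blast
  then have unit: "v (of_nat n) = 0" if "n > 0" for n using that v_of_nat[of n] by (metis antisym not_less)
  define X where "X u \<longleftrightarrow> eventually (\<lambda>x. rveq (e (u * x)) (e x)) at0" for u
  have DX: "D UNIV (\<lambda>E. X (E 0))"
    unfolding X_def
  proof (rule D_at0)
    show "D UNIV (\<lambda>E. rveq (e (E (Suc 0) * E 0)) (e (E 0)))"
    proof (rule D_rvf_fun[where R = "\<lambda>z E. rveq z (e (E 0))", OF e])
      show "D UNIV (\<lambda>E. rveq (E 0) (e (E (Suc 0))))" by (intro D_rvf[OF e] kfun_intros)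
      show "rveq z (e (E 0)) = rveq z' (e (E 0))" if "rveq z z'" for z z' E
        using that rveq_trans rveq_sym by blast
    qed (intro kfun_intros)
  qed
  have "eventually X genO"
  proof (rule ccontr)
    assume n: "\<not> eventually X genO"
    obtain N where N: "cpx N X" using definable_cpx[OF DX] by blast
    have diff: "v (of_nat m - of_nat n) = 0" if "m \<noteq> n" for m n
    proof (cases "m < n")
      case True
      then have "v (of_nat n - of_nat m) = 0" using unit[of "n - m"] by (simp add: of_nat_diff)
      then show ?thesis using v_minus_commute by metis
    next
      case False
      then show ?thesis using unit[of "m - n"] that by (simp add: of_nat_diff)
    qed
    have inj: "inj_on (of_nat :: nat \<Rightarrow> 'a) {1..Suc N}"
    proof (rule inj_onI)
      fix m n assume "(of_nat m :: 'a) = of_nat n"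
      then show "m = n" using diff[of m n] by (force simp: zero_extended_def)
    qed
    have "card (of_nat ` {1..Suc N} :: 'a set) \<le> N"
    proof (rule cpx_few_residues[OF N n])
      show "X x" if "x \<in> of_nat ` {1..Suc N}" for x using that inv unfolding X_def by force
      show "0 \<le> v x" if "x \<in> of_nat ` {1..Suc N}" for x using that v_of_nat by blast
      show "v (x - y) \<le> 0" if "x \<in> of_nat ` {1..Suc N}" "y \<in> of_nat ` {1..Suc N}" "x \<noteq> y" for x y
      proof -
        obtain m n where "x = of_nat m" "y = of_nat n" using \<open>x \<in> _\<close> \<open>y \<in> _\<close> by blast
        then show ?thesis using diff[of m n] \<open>x \<noteq> y\<close> by fastforce
      qed
    qed simp
    then show False using card_image[OF inj] by simp
  qed
  then have X: "X u" if u: "v u = 0" for u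
  proof -
    obtain a b where ab: "v a = 0" "v b = 0" "X a" "X b" "u = a * b"
      using \<open>eventually X genO\<close> u by (rule genO_product)
    have "eventually (\<lambda>x. rveq (e (a * (b * x))) (e (b * x))) at0"
      using eventually_at0_mult[OF ab(3)[unfolded X_def] v_unit_nonzero[OF ab(2)]] .
    then show ?thesis
      using ab(4) unfolding X_def ab(5) by eventually_elim (auto simp: mult.assoc intro: rveq_trans)
  qed
  obtain d where d: "d \<noteq> 0"
    "\<And>u. v u = 0 \<Longrightarrow> \<exists>c. v c = 0 \<and> (\<forall>x. x \<noteq> 0 \<longrightarrow> v d < v x \<longrightarrow> rveq (e (u * x)) (c * e x))"
    using rvf_unit_uniform[OF e] by blast
  show ?thesis
  proof (rule rvf_spine[OF e d(1)])
    fix u x assume u: "v u = 0" and x: "x \<noteq> 0" "v d < v x"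
    obtain c where c: "v c = 0" "\<And>x. x \<noteq> 0 \<Longrightarrow> v d < v x \<Longrightarrow> rveq (e (u * x)) (c * e x)"
      using d(2)[OF u] by blast
    have "eventually (\<lambda>x. rveq c 1) at0"
      using X[OF u, unfolded X_def] eventually_at0_nonzero eventually_at0_less[OF d(1)]
    proof eventually_elim
      case (elim x)
      then have "rveq (c * e x) (e x)" using rveq_trans[OF rveq_sym[OF c(2)[of x]] elim(1)] by blast
      then have "rveq (e x * c) (e x * 1)" by (simp add: mult.commute)
      then show ?case by (rule rveq_cancel)
    qed
    then have "rveq c 1" using eventually_at0_ex by blast
    then have "rveq (e x * c) (e x * 1)" using rvf_nonzero[OF e] by (rule rveq_mult_left)
    then have "rveq (c * e x) (e x)" by (simp add: mult.commute)
    with c(2)[OF x] show "rveq (e (u * x)) (e x)" by (rule rveq_trans)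
  qed
qed

end

context complete_acvf
begin

section \<open>Calculus of limits at 0\<close>

lemma lim0_cong: "lim0 f s \<Longrightarrow> eventually (\<lambda>x. f x = g x) at0 \<Longrightarrow> lim0 g s"
  unfolding lim0_def
proof (intro allI impI)
  fix c :: 'a assume *: "\<forall>c. c \<noteq> 0 \<longrightarrow> eventually (\<lambda>x. v c < v (f x - s)) at0" "c \<noteq> 0"
    and eq: "eventually (\<lambda>x. f x = g x) at0"
  from * have "eventually (\<lambda>x. v c < v (f x - s)) at0" by blast
  then show "eventually (\<lambda>x. v c < v (g x - s)) at0" using eq by eventually_elim simp
qed

lemma lim0_const: "lim0 (\<lambda>x. s) s"
  unfolding lim0_def by (simp add: v_less_Pinf)

lemma lim0_unique:
  assumes "lim0 f s" "lim0 f t" shows "s = t"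
proof (rule ccontr)
  assume "s \<noteq> t"
  then have "eventually (\<lambda>x. v (s - t) < v (f x - s)) at0" "eventually (\<lambda>x. v (s - t) < v (f x - t)) at0"
    using assms unfolding lim0_def by simp_all
  then have "eventually (\<lambda>x. False) at0"
  proof eventually_elim
    case (elim x)
    have "v (s - t) < v (s - f x)" using elim(1) v_minus_commute by metis
    then have "v (s - t) < v (s - t)" using elim(2) by (rule v_trans_less)
    then show False by simp
  qed
  then show False using at0_neq_bot by blast
qed

lemma lim0_diff:
  assumes "lim0 f s" "lim0 g t" shows "lim0 (\<lambda>x. f x - g x) (s - t)"
  unfolding lim0_def
proof (intro allI impI)
  fix c :: 'a assume "c \<noteq> 0"
  then have "eventually (\<lambda>x. v c < v (f x - s)) at0" "eventually (\<lambda>x. v c < v (g x - t)) at0"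
    using assms unfolding lim0_def by simp_all
  then show "eventually (\<lambda>x. v c < v (f x - g x - (s - t))) at0"
  proof eventually_elim
    case (elim x)
    have eq: "f x - g x - (s - t) = (f x - s) - (g x - t)" by simp
    show ?case unfolding eq by (rule v_diff_less[OF elim])
  qed
qed

lemma lim0_mult:
  assumes "lim0 f s" "lim0 g t" shows "lim0 (\<lambda>x. f x * g x) (s * t)"
  unfolding lim0_def
proof (intro allI impI)
  fix c :: 'a assume c: "c \<noteq> 0"
  have "\<exists>b. b \<noteq> 0 \<and> 0 \<le> v b \<and> (\<forall>x. v b < v x \<longrightarrow> v c < v (x * r))" for r
  proof (cases "r = 0")
    case True
    then show ?thesis using v_less_Pinf[OF c] by (intro exI[of _ 1]) auto
  next
    case False
    obtain b where "b \<noteq> 0" "v 1 \<le> v b" "v (c / r) \<le> v b" using v_max_ex[of 1 "c / r"] c False by auto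
    then show ?thesis using False by (intro exI[of _ b]) (auto simp flip: v_divide_less intro: le_less_trans)
  qed
  then obtain b1 b2 where b1: "b1 \<noteq> 0" "\<And>x. v b1 < v x \<Longrightarrow> v c < v (x * t)"
    and b2: "b2 \<noteq> 0" "\<And>x. v b2 < v x \<Longrightarrow> v c < v (x * s)" by metis
  obtain b where b: "b \<noteq> 0" "v 1 \<le> v b" "v c \<le> v b" using v_max_ex[of 1 c] c by auto
  have "eventually (\<lambda>x. v b < v (f x - s)) at0" "eventually (\<lambda>x. v b < v (g x - t)) at0"
    "eventually (\<lambda>x. v b1 < v (f x - s)) at0" "eventually (\<lambda>x. v b2 < v (g x - t)) at0"
    using assms b(1) b1(1) b2(1) unfolding lim0_def by simp_all
  then show "eventually (\<lambda>x. v c < v (f x * g x - s * t)) at0"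
  proof eventually_elim
    case (elim x)
    have nz: "v (b * 1) \<le> v (b * b)" using v_mult_le_iff'[OF b(1)] b(2) by blast
    have "v c < v ((f x - s) * (g x - t))"
    proof (cases "f x = s")
      case True
      then show ?thesis using v_less_Pinf[OF c] by simp
    next
      case False
      have "v (b * 1) < v ((f x - s) * 1)" using elim(1) by simp
      also have "\<dots> < v ((f x - s) * (g x - t))"
        using False elim(2) b(2) v_mult_less_iff'[of "f x - s" 1 "g x - t"] by (auto intro: le_less_trans)
      finally show ?thesis using b(3) by (auto intro: le_less_trans)
    qed
    moreover have "v c < v ((f x - s) * t)" "v c < v ((g x - t) * s)" using elim(3,4) b1(2) b2(2) by blast+
    ultimately have "v c < v ((f x - s) * (g x - t) + ((f x - s) * t + (g x - t) * s))"
      by (intro v_add_less)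
    moreover have "(f x - s) * (g x - t) + ((f x - s) * t + (g x - t) * s) = f x * g x - s * t"
      by (simp add: algebra_simps)
    ultimately show ?case by simp
  qed
qed

lemma lim0_scale: "lim0 f s \<Longrightarrow> c \<noteq> 0 \<Longrightarrow> lim0 (\<lambda>x. f (c * x)) s"
  unfolding lim0_def using eventually_at0_mult by blast

lemma lim0_nonzero: "lim0 f s \<Longrightarrow> s \<noteq> 0 \<Longrightarrow> eventually (\<lambda>x. rveq (f x) s) at0"
proof -
  assume "lim0 f s" "s \<noteq> 0"
  then have "eventually (\<lambda>x. v s < v (f x - s)) at0" unfolding lim0_def by blast
  then show ?thesis by eventually_elim (use \<open>s \<noteq> 0\<close> in \<open>auto simp: rveq_def\<close>)
qed

lemma D_lim0:
  assumes "kfun A (\<lambda>e. Q (\<lambda>i. e (Suc i)) (e 0))" "kfun A F" "\<And>i. kfun A (\<sigma> i)"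
  shows "D A (\<lambda>e. lim0 (Q (\<lambda>i. \<sigma> i e)) (F e))"
  unfolding lim0_def
  by (intro D_intros D_at0 kfun_env1[where P = Q, OF assms(1)] kfun_shift[OF assms(2)] kfun_shift[OF assms(3)]
    kfun_shift[OF kfun_shift[OF assms(2)]] kfun_shift[OF kfun_shift[OF assms(3)]])

text \<open>Where it exists, the limit is a definable function of the base point; the value 0
  elsewhere makes this function total.\<close>

lemma joint_limit':
  assumes SG: "SG A I a" and Q: "kfun A (\<lambda>e. Q (\<lambda>i. e (Suc i)) (e 0))" and lim: "lim0 (Q a) s"
  shows "joint I a Q s"
proof -
  define P where "P x y \<longleftrightarrow> lim0 (Q x) y \<or> \<not> (\<exists>l. lim0 (Q x) l) \<and> y = 0" for x y
  have "D A (\<lambda>e. P (\<lambda>i. e (Suc i)) (e 0))"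
    unfolding P_def by (intro D_intros D_lim0[OF Q])
  moreover have ex1: "\<exists>!y. P x y" for x unfolding P_def using lim0_unique by blast
  ultimately have q: "kfun A (\<lambda>e. THE y. P e y)" by (rule kfun_the)
  have "P a s" using lim unfolding P_def by blast
  then have "(THE y. P a y) = s" using ex1 by (simp add: the1_equality)
  with joint_limit[OF SG Q q] lim show ?thesis by simp
qed

text \<open>A joint limit allows the base point to move together with the increment.\<close>

lemma joint_along_line:
  assumes "joint {j} a Q s"
  shows "lim0 (\<lambda>\<eta>. Q (a(j := a j + u * \<eta>)) \<eta>) s"
  unfolding lim0_def
proof (intro allI impI)
  fix c :: 'a assume "c \<noteq> 0"
  then have "\<exists>d. d \<noteq> 0 \<and> (\<forall>x. near {j} d a x \<longrightarrow> (\<forall>\<eta>. \<eta> \<noteq> 0 \<longrightarrow> v d < v \<eta> \<longrightarrow> v c < v (Q x \<eta> - s)))"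
    using assms unfolding joint_def by (elim allE[of _ c]) (rule mp)
  then obtain d where d: "d \<noteq> 0"
    "\<forall>x. near {j} d a x \<longrightarrow> (\<forall>\<eta>. \<eta> \<noteq> 0 \<longrightarrow> v d < v \<eta> \<longrightarrow> v c < v (Q x \<eta> - s))" by (elim exE conjE)
  have "eventually (\<lambda>\<eta>. v d < v (u * \<eta>)) at0"
    using eventually_at0_mult[OF eventually_at0_less[OF d(1)]] v_less_Pinf[OF d(1)] by (cases "u = 0") auto
  then show "eventually (\<lambda>\<eta>. v c < v (Q (a(j := a j + u * \<eta>)) \<eta> - s)) at0"
    using eventually_at0_nonzero eventually_at0_less[OF d(1)]
    by eventually_elim (rule d(2)[rule_format], auto simp: near_def)
qed

text \<open>
  If the difference quotient of \<open>f\<close> diverged, then the germ of its leading term would be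
  invariant under multiplication of the increment with positive integers: the ratios of the
  increments for \<open>u \<eta>\<close> and \<open>\<eta>\<close> have limits \<open>l u\<close> even if the base point moves with \<open>\<eta>\<close>,
  and comparing the increments between \<open>a\<close>, \<open>a + u \<eta>\<close> and \<open>a + (u + 1) \<eta>\<close> yields
  \<open>l (u + 1) = l u + 1\<close>.
\<close>

lemma partial_quotient_converges:
  assumes SG: "SG A {j} a" and f: "kfun A f" and char: "CHAR('a) = 0"
  shows "\<exists>s. lim0 (\<lambda>\<eta>. (f (a(j := a j + \<eta>)) - f a) / \<eta>) s"
proof (rule ccontr)
  assume *: "\<not> ?thesis"
  define Df where "Df x \<eta> = f (x(j := x j + \<eta>)) - f x" for x \<eta>
  have Dfk: "kfun A (\<lambda>e. Df (\<lambda>i. \<sigma> i e) (F e))" if "\<And>i. kfun A (\<sigma> i)" "kfun A F" for \<sigma> F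
    unfolding Df_def by (intro kfun_intros kfun_subst[OF f] kfun_upd that)
  have Dfu: "kfun UNIV (\<lambda>E. Df a (F E))" if "kfun UNIV F" for F
    unfolding Df_def by (intro kfun_intros kfun_subst[OF kfun_mono[OF f]] kfun_upd that kfun_const) simp_all
  have "kfun UNIV (\<lambda>E. Df a (E 0) / E 0)" by (intro kfun_intros Dfu)
  from limit_exists[OF this] have "\<forall>d. d \<noteq> 0 \<longrightarrow> eventually (\<lambda>\<eta>. v (Df a \<eta> / \<eta>) < v d) at0"
    using * unfolding lim0_def[symmetric] Df_def by - (erule disjE, erule (1) notE, assumption)
  then have inf: "eventually (\<lambda>\<eta>. v (Df a \<eta> / \<eta>) < v d) at0" if "d \<noteq> 0" for d using that by blast
  have nz: "eventually (\<lambda>\<eta>. Df a \<eta> \<noteq> 0 \<and> \<eta> \<noteq> 0) at0"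
    using inf[of 1, OF one_neq_zero] eventually_at0_nonzero by eventually_elim auto
  define R where "R u x \<eta> = Df x (u * \<eta>) / Df x \<eta>" for u x \<eta>
  \<comment> \<open>The ratio of increments has an eventually constant valuation, so its limit can
    be neither 0 nor infinite.\<close>
  have "\<exists>l. l \<noteq> 0 \<and> lim0 (R u a) l" if u: "u \<noteq> 0" for u
  proof -
    define e where "e \<eta> = (if Df a \<eta> = 0 then 1 else Df a \<eta>)" for \<eta>
    have e: "rvf e"
    proof (rule kfun_rvf)
      show "kfun UNIV (\<lambda>E. e (E 0))" unfolding e_def by (intro kfun_if D_intros Dfu)
    qed (simp add: e_def)
    obtain d where d: "d \<noteq> 0" "eventually (\<lambda>x. v (e (u * x) / e x) = v d) at0"
      using rvf_ratio_const[OF e u] by blast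
    have ev: "eventually (\<lambda>x. v (R u a x) = v d) at0"
      using d(2) nz eventually_at0_mult[OF nz u] by eventually_elim (simp add: e_def R_def)
    have "kfun UNIV (\<lambda>E. R u a (E 0))" unfolding R_def by (intro kfun_intros Dfu kfun_const) simp
    from limit_exists[OF this] show ?thesis
    proof (elim disjE exE)
      fix s assume s: "\<forall>d. d \<noteq> 0 \<longrightarrow> eventually (\<lambda>x. v d < v (R u a x - s)) at0"
      have "s \<noteq> 0"
      proof
        assume "s = 0"
        with s d(1) have "eventually (\<lambda>x. v d < v (R u a x)) at0" by simp
        then have "eventually (\<lambda>x. False) at0" using ev by eventually_elim simp
        then show False using at0_neq_bot by blast
      qed
      with s show ?thesis unfolding lim0_def by blast
    next
      assume "\<forall>d. d \<noteq> 0 \<longrightarrow> eventually (\<lambda>x. v (R u a x) < v d) at0"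
      with d(1) have "eventually (\<lambda>x. v (R u a x) < v d) at0" by blast
      then have "eventually (\<lambda>x. False) at0" using ev by eventually_elim simp
      then show ?thesis using at0_neq_bot by blast
    qed
  qed
  then obtain l where l: "\<And>u. u \<noteq> 0 \<Longrightarrow> l u \<noteq> 0" "\<And>u. u \<noteq> 0 \<Longrightarrow> lim0 (R u a) (l u)" by metis
  have mult: "l (u * w) = l u * l w" if u: "u \<noteq> 0" and w: "w \<noteq> 0" for u w
  proof (rule lim0_unique)
    show "lim0 (R (u * w) a) (l (u * w))" using u w by (intro l(2)) simp
    have "lim0 (\<lambda>\<eta>. R u a (w * \<eta>) * R w a \<eta>) (l u * l w)"
      by (intro lim0_mult lim0_scale l(2) u w)
    moreover have "eventually (\<lambda>\<eta>. R u a (w * \<eta>) * R w a \<eta> = R (u * w) a \<eta>) at0"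
      using eventually_at0_mult[OF nz w] by eventually_elim (simp add: R_def mult.assoc)
    ultimately show "lim0 (R (u * w) a) (l u * l w)" by (rule lim0_cong)
  qed
  have l1: "l 1 = 1"
  proof (rule lim0_unique)
    show "lim0 (R 1 a) (l 1)" by (intro l(2)) simp
    show "lim0 (R 1 a) 1"
      by (rule lim0_cong[OF lim0_const]) (use nz in eventually_elim, simp add: R_def)
  qed
  \<comment> \<open>With the coordinate \<open>j\<close> of \<open>a\<close> moved by
    \<open>u * \<eta>\<close>, the increments for \<open>- u * \<eta>\<close> and
    \<open>\<eta>\<close> are \<open>- Df a (u * \<eta>)\<close> and
    \<open>Df a ((u + 1) * \<eta>) - Df a (u * \<eta>)\<close>. Their ratio still tends to
    \<open>l (- u)\<close>, because the limit at \<open>a\<close> is joint. The joint limit is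
    available for ratios definable over \<open>A\<close>, hence the condition on
    \<open>u\<close>.\<close>
  have step: "l (- u) * (l (u + 1) - l u) = - l u" if u: "u \<noteq> 0" "u + 1 \<noteq> 0" "kfun A (\<lambda>e. - u)" for u
  proof (rule lim0_unique)
    let ?a = "\<lambda>\<eta>. a(j := a j + u * \<eta>)"
    have "joint {j} a (R (- u)) (l (- u))"
    proof (rule joint_limit'[OF SG])
      show "kfun A (\<lambda>e. R (- u) (\<lambda>i. e (Suc i)) (e 0))"
        unfolding R_def by (intro kfun_divide Dfk kfun_mult kfun_var u)
      show "lim0 (R (- u) a) (l (- u))" using u(1) by (intro l(2)) simp
    qed
    then have lim: "lim0 (\<lambda>\<eta>. R (- u) (?a \<eta>) \<eta>) (l (- u))" by (rule joint_along_line)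
    then show "lim0 (\<lambda>\<eta>. R (- u) (?a \<eta>) \<eta> * (R (u + 1) a \<eta> - R u a \<eta>)) (l (- u) * (l (u + 1) - l u))"
      by (intro lim0_mult lim0_diff l(2) u)
    have "eventually (\<lambda>\<eta>. rveq (R (- u) (?a \<eta>) \<eta>) (l (- u))) at0"
      using lim0_nonzero[OF lim] l(1)[of "- u"] u(1) by simp
    then have "eventually (\<lambda>\<eta>. 0 - R u a \<eta> = R (- u) (?a \<eta>) \<eta> * (R (u + 1) a \<eta> - R u a \<eta>)) at0"
      using nz
    proof eventually_elim
      case (elim \<eta>)
      have 1: "Df (?a \<eta>) (- u * \<eta>) = - Df a (u * \<eta>)" unfolding Df_def by simp
      have 2: "Df (?a \<eta>) \<eta> = Df a ((u + 1) * \<eta>) - Df a (u * \<eta>)"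
        unfolding Df_def by (simp add: algebra_simps)
      have "R (- u) (?a \<eta>) \<eta> \<noteq> 0" using elim(1) by (simp add: rveq_def)
      then have "Df (?a \<eta>) \<eta> \<noteq> 0" unfolding R_def by auto
      moreover have "R (u + 1) a \<eta> - R u a \<eta> = Df (?a \<eta>) \<eta> / Df a \<eta>"
        unfolding R_def 2 by (simp add: diff_divide_distrib)
      moreover have "R (- u) (?a \<eta>) \<eta> = - Df a (u * \<eta>) / Df (?a \<eta>) \<eta>" unfolding R_def 1 ..
      ultimately show ?case by (simp add: R_def)
    qed
    moreover have "lim0 (\<lambda>\<eta>. 0 - R u a \<eta>) (0 - l u)" by (intro lim0_diff lim0_const l(2) u)
    ultimately show "lim0 (\<lambda>\<eta>. R (- u) (?a \<eta>) \<eta> * (R (u + 1) a \<eta> - R u a \<eta>)) (- l u)"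
      using lim0_cong by fastforce
  qed
  have nat_nz: "of_nat n \<noteq> (0 :: 'a)" if "n > 0" for n
    using that char by (simp add: of_nat_eq_0_iff_char_dvd)
  have m1: "l (- 1) * l (- 1) = 1" using mult[of "-1" "-1"] l1 by simp
  have step': "l (of_nat (Suc n)) = l (of_nat n) - l (- 1)" if n: "n > 0" for n
  proof -
    have "l (- of_nat n) = l (- 1) * l (of_nat n)" using mult[of "-1" "of_nat n"] nat_nz[OF n] by simp
    moreover have "l (- of_nat n) * (l (of_nat n + 1) - l (of_nat n)) = - l (of_nat n)"
      using nat_nz[OF n] nat_nz[of "Suc n"] by (intro step kfun_minus kfun_of_nat) (simp_all add: add.commute)
    ultimately have "l (of_nat n) * (l (- 1) * (l (of_nat n + 1) - l (of_nat n))) = l (of_nat n) * (- 1)"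
      by (simp add: mult_ac)
    then have "l (- 1) * (l (of_nat n + 1) - l (of_nat n)) = - 1"
      using l(1)[OF nat_nz[OF n]] mult_left_cancel by blast
    then have "l (- 1) * (l (- 1) * (l (of_nat n + 1) - l (of_nat n))) = - l (- 1)" by simp
    then have "l (of_nat n + 1) - l (of_nat n) = - l (- 1)" using m1 by (simp flip: mult.assoc)
    then show ?thesis by (simp add: algebra_simps)
  qed
  \<comment> \<open>\<open>l (- 1)\<close> is a square root of 1, and the root 1 would make
    \<open>l\<close> vanish at 2.\<close>
  have "l (- 1) \<noteq> 1"
  proof
    assume "l (- 1) = 1"
    then have "l (of_nat (Suc 1)) = 0" using step'[of 1] l1 by simp
    then show False using l(1)[OF nat_nz[of "Suc 1"]] by simp
  qed
  then have lm1: "l (- 1) = - 1" using m1 by (metis square_eq_1_iff)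
  have ln: "l (of_nat n) = of_nat n" if "n > 0" for n
    using that
  proof (induction n)
    case (Suc n)
    then show ?case using l1 step'[of n] lm1 by (cases "n = 0") (auto simp: add.commute)
  qed simp
  define e where "e \<eta> = (if Df a \<eta> / \<eta> = 0 then 1 else Df a \<eta> / \<eta>)" for \<eta>
  have e: "rvf e"
  proof (rule kfun_rvf)
    show "kfun UNIV (\<lambda>E. e (E 0))" unfolding e_def by (intro kfun_if D_intros Dfu)
  qed (simp add: e_def)
  have ev: "eventually (\<lambda>\<eta>. e \<eta> = Df a \<eta> / \<eta>) at0"
    using nz by eventually_elim (simp add: e_def)
  have "\<exists>d. d \<noteq> 0 \<and> eventually (\<lambda>x. v (e x) = v d) at0"
  proof (rule rvf_nat_invariant[OF e char])
    fix n :: nat assume n: "n > 0"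
    have "eventually (\<lambda>\<eta>. rveq (R (of_nat n) a \<eta>) (of_nat n)) at0"
      using lim0_nonzero[OF l(2)] nat_nz[OF n] ln[OF n] by metis
    then show "eventually (\<lambda>x. rveq (e (of_nat n * x)) (e x)) at0"
      using nz ev eventually_at0_mult[OF ev nat_nz[OF n]]
    proof eventually_elim
      case (elim \<eta>)
      let ?c = "Df a \<eta> / (of_nat n * \<eta>)"
      have "rveq (?c * R (of_nat n) a \<eta>) (?c * of_nat n)"
        using elim nat_nz[OF n] by (intro rveq_mult_left) auto
      moreover have "?c * R (of_nat n) a \<eta> = e (of_nat n * \<eta>)" "?c * of_nat n = e \<eta>"
        using elim(2-4) nat_nz[OF n] by (simp_all add: R_def)
      ultimately show ?case by simp
    qed
  qed
  then obtain d where d: "d \<noteq> 0" "eventually (\<lambda>x. v (e x) = v d) at0" by blast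
  have "eventually (\<lambda>x. False) at0"
    using d(2) ev inf[OF d(1)] by eventually_elim simp
  then show False using at0_neq_bot by blast
qed

end

section \<open>Indiscernible sequences and dp-rank\<close>

text \<open>Remove a minimal member \<open>X\<close> of the family. Every other member contains
  \<open>X\<close> or is disjoint from it, so \<open>X\<close> contains at most one of the pairwise
  separated points, and induction applies to the points outside.\<close>

lemma laminar_card:
  assumes "finite F" "\<forall>X\<in>F. \<forall>Y\<in>F. X \<subseteq> Y \<or> Y \<subseteq> X \<or> X \<inter> Y = {}"
    and "finite Z" "\<forall>x\<in>Z. \<forall>y\<in>Z. x \<noteq> y \<longrightarrow> (\<exists>X\<in>F. (x \<in> X) \<noteq> (y \<in> X))"
  shows "card Z \<le> card F + 1"
  using assms
proof (induction "card F" arbitrary: F Z)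
  case 0
  then have "F = {}" by simp
  with 0 show ?case using card_le_Suc0_iff_eq[of Z] by auto
next
  case (Suc k)
  then have "F \<noteq> {}" by auto
  then obtain X where X: "X \<in> F" "\<forall>Y\<in>F. Y \<subseteq> X \<longrightarrow> X = Y"
    using finite_has_minimal[OF Suc.prems(1)] by blast
  have "card (Z - X) \<le> card (F - {X}) + 1"
  proof (rule Suc.hyps(1))
    show "k = card (F - {X})" using Suc.hyps(2) X(1) Suc.prems(1) by simp
    show "\<forall>x\<in>Z - X. \<forall>y\<in>Z - X. x \<noteq> y \<longrightarrow> (\<exists>X\<in>F - {X}. (x \<in> X) \<noteq> (y \<in> X))"
    proof (intro ballI impI)
      fix x y assume xy: "x \<in> Z - X" "y \<in> Z - X" "x \<noteq> y"
      then obtain Y where "Y \<in> F" "(x \<in> Y) \<noteq> (y \<in> Y)" using Suc.prems(4) by blast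
      with xy show "\<exists>X\<in>F - {X}. (x \<in> X) \<noteq> (y \<in> X)" by (intro bexI[of _ Y]) auto
    qed
  qed (use Suc.prems in auto)
  moreover have "card (F - {X}) + 1 = card F" using Suc.hyps(2) X(1) Suc.prems(1) by simp
  moreover have "card (Z \<inter> X) \<le> 1"
  proof -
    have "x = y" if xy: "x \<in> Z \<inter> X" "y \<in> Z \<inter> X" for x y
    proof (rule ccontr)
      assume "x \<noteq> y"
      then obtain Y where Y: "Y \<in> F" "(x \<in> Y) \<noteq> (y \<in> Y)" using Suc.prems(4) xy by blast
      have "X \<subseteq> Y \<or> Y \<subseteq> X \<or> X \<inter> Y = {}" using Suc.prems(2) X(1) Y(1) by blast
      then show False
      proof (elim disjE)
        assume "Y \<subseteq> X"
        then have "X = Y" using X(2) Y(1) by blast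
        then show False using Y(2) xy by blast
      qed (use Y(2) xy in blast)+
    qed
    then show ?thesis using card_le_Suc0_iff_eq[of "Z \<inter> X"] Suc.prems(3) by auto
  qed
  moreover have "card Z = card (Z - X) + card (Z \<inter> X)"
    using card_Diff_subset_Int[of Z X] card_mono[of Z "Z \<inter> X"] Suc.prems(3) by simp
  ultimately show ?case by simp
qed

text \<open>One assignment stores several sequences: \<open>row\<close> is the sequence,
  \<open>pos\<close> the place in its list of indices, and \<open>crd\<close> the coordinate of the
  member standing there.\<close>

definition enc :: "nat \<Rightarrow> nat \<Rightarrow> nat \<Rightarrow> nat" where
  "enc \<alpha> k l = prod_encode (\<alpha>, prod_encode (k, l))"

definition row :: "nat \<Rightarrow> nat" where "row m = fst (prod_decode m)"
definition pos :: "nat \<Rightarrow> nat" where "pos m = fst (prod_decode (snd (prod_decode m)))"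
definition crd :: "nat \<Rightarrow> nat" where "crd m = snd (prod_decode (snd (prod_decode m)))"

lemma enc_simps [simp]: "row (enc \<alpha> k l) = \<alpha>" "pos (enc \<alpha> k l) = k" "crd (enc \<alpha> k l) = l"
  "enc (row m) (pos m) (crd m) = m"
  by (simp_all add: enc_def row_def pos_def crd_def)

lemma pos_le: "pos m \<le> m"
proof -
  have "pos m \<le> prod_encode (pos m, crd m)" by (rule le_prod_encode_1)
  also have "\<dots> \<le> enc (row m) (pos m) (crd m)" unfolding enc_def by (rule le_prod_encode_2)
  finally show ?thesis by simp
qed

text \<open>
  The environment that lists the members with indices \<open>\<iota> \<alpha> 0, \<iota> \<alpha> 1, \<dots>\<close> of
  the sequences \<open>b \<alpha>\<close> for \<open>\<alpha> \<in> R\<close>.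
\<close>

definition pb :: "nat set \<Rightarrow> (nat \<Rightarrow> 'i \<Rightarrow> nat \<Rightarrow> 'a::zero) \<Rightarrow> (nat \<Rightarrow> nat \<Rightarrow> 'i) \<Rightarrow> nat \<Rightarrow> 'a" where
  "pb R b \<iota> m = (if row m \<in> R then b (row m) (\<iota> (row m) (pos m)) (crd m) else 0)"

definition mask :: "nat set \<Rightarrow> (nat \<Rightarrow> 'a::zero) \<Rightarrow> nat \<Rightarrow> 'a" where
  "mask S e m = (if row m \<in> S then e m else 0)"

lemma mask_pb: "S \<subseteq> R \<Longrightarrow> mask S (pb R b \<iota>) = pb S b \<iota>"
  by (auto simp: mask_def pb_def fun_eq_iff)

lemma pb_cong: "(\<And>\<alpha> k. \<alpha> \<in> R \<Longrightarrow> \<iota> \<alpha> k = \<iota>' \<alpha> k) \<Longrightarrow> pb R b \<iota> = pb R b \<iota>'"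
  by (auto simp: pb_def fun_eq_iff)

context fo_language
begin

text \<open>Replaces the parameter \<open>c\<close> by a variable in front, so that it can be
  quantified over.\<close>

lemma D_insert:
  assumes "D (insert c B) P"
  obtains Q where "D B Q" "\<And>e. P e \<longleftrightarrow> Q (case_nat c e)"
proof -
  obtain \<phi> p where \<phi>: "wf_fm M \<phi>" "range p \<subseteq> insert 0 (insert \<pi> (insert c B))" "\<And>e. P e \<longleftrightarrow> sat M (ilv e p) \<phi>"
    using assms unfolding D_def by blast
  let ?B = "insert 0 (insert \<pi> B)"
  define p' where "p' i = (if p i \<in> ?B then p i else 0)" for i
  define r where "r k = (if even k then k + 2 else if p (k div 2) \<in> ?B then k else 0)" for k :: nat
  obtain \<psi> where \<psi>: "wf_fm M \<psi>" "\<And>e. sat M e \<psi> \<longleftrightarrow> sat M (\<lambda>i. e (r i)) \<phi>"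
    using sat_rename[OF \<phi>(1)] by blast
  have "(\<lambda>i. ilv (case_nat c e) p' (r i)) = ilv e p" for e
  proof (rule ilv_compI)
    fix i
    show "ilv (case_nat c e) p' (r (2 * i)) = e i"
      using ilv_even[of "case_nat c e" p' "Suc i"] by (simp add: r_def)
    show "ilv (case_nat c e) p' (r (Suc (2 * i))) = p i"
      using ilv_even[of "case_nat c e" p' 0] \<phi>(2) by (auto simp: r_def p'_def)
  qed
  then have "P e \<longleftrightarrow> sat M (ilv (case_nat c e) p') \<psi>" for e unfolding \<psi>(2) \<phi>(3) by simp
  moreover have "D B (\<lambda>e. sat M (ilv e p') \<psi>)"
    unfolding D_def using \<psi>(1) by (intro exI[of _ \<psi>] exI[of _ p']) (auto simp: p'_def)
  ultimately show thesis by (rule that[rotated])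
qed

lemma D_mask: "D B P \<Longrightarrow> D B (\<lambda>e. P (mask S e))"
proof -
  assume P: "D B P"
  have "kfun B (\<lambda>e. mask S e i)" for i
    unfolding mask_def by (cases "row i \<in> S") (simp_all add: kfun_var kfun_const)
  from D_subst[OF P, of "\<lambda>i e. mask S e i", OF this] show ?thesis .
qed

text \<open>Mutually indiscernible sequences.\<close>

definition MI :: "'a set \<Rightarrow> nat set \<Rightarrow> (nat \<Rightarrow> rat \<Rightarrow> nat \<Rightarrow> 'a) \<Rightarrow> bool" where
  "MI B R b \<longleftrightarrow> (\<forall>P \<iota> \<iota>'. D B P \<longrightarrow>
    (\<forall>\<alpha>\<in>R. \<forall>i k. \<iota> \<alpha> i < \<iota> \<alpha> k \<longleftrightarrow> \<iota>' \<alpha> i < \<iota>' \<alpha> k) \<longrightarrow> P (pb R b \<iota>) = P (pb R b \<iota>'))"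

lemma MI_D: "MI B R b \<Longrightarrow> D B P \<Longrightarrow>
    (\<And>\<alpha> i k. \<alpha> \<in> R \<Longrightarrow> \<iota> \<alpha> i < \<iota> \<alpha> k \<longleftrightarrow> \<iota>' \<alpha> i < \<iota>' \<alpha> k) \<Longrightarrow> P (pb R b \<iota>) = P (pb R b \<iota>')"
  unfolding MI_def by blast

text \<open>Indiscernibility for a condition on several environments at once: the pair of
  environment \<open>s\<close> and position \<open>k\<close> is coded as a single position, so only
  the relative order of all indices involved matters.\<close>

lemma MI_multi:
  assumes MI: "MI B R b" and D: "D B (\<lambda>e. \<Theta> (\<lambda>s m. e (prod_encode (s, m))))"
    and supp: "\<And>E E'. (\<forall>s<J. \<forall>m<N. E s m = E' s m) \<Longrightarrow> \<Theta> E = \<Theta> E'"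
    and iso: "\<And>\<alpha> s s' k k'. \<alpha> \<in> R \<Longrightarrow> s < J \<Longrightarrow> s' < J \<Longrightarrow> k < N \<Longrightarrow> k' < N \<Longrightarrow>
      \<iota> s \<alpha> k < \<iota> s' \<alpha> k' \<longleftrightarrow> \<iota>' s \<alpha> k < \<iota>' s' \<alpha> k'"
  shows "\<Theta> (\<lambda>s. pb R b (\<iota> s)) = \<Theta> (\<lambda>s. pb R b (\<iota>' s))"
proof (cases "J = 0 \<or> N = 0")
  case True
  then show ?thesis by (intro supp) auto
next
  case False
  \<comment> \<open>\<open>MI\<close> asks for agreement of the order at all positions, while
    \<open>iso\<close> grants it only below \<open>J\<close> and \<open>N\<close>; the positions
    beyond repeat the last index.\<close>
  define tr where "tr \<iota> \<alpha> j = (case prod_decode j of (s, k) \<Rightarrow> \<iota> (min s (J - 1)) \<alpha> (min k (N - 1)))"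
    for \<iota> :: "nat \<Rightarrow> nat \<Rightarrow> nat \<Rightarrow> rat" and \<alpha> :: nat and j
  define r where "r j = (case prod_decode j of (s, m) \<Rightarrow> enc (row m) (prod_encode (s, pos m)) (crd m))" for j
  have "D B (\<lambda>e. \<Theta> (\<lambda>s m. e (r (prod_encode (s, m)))))"
    by (rule D_rename[where P = "\<lambda>e. \<Theta> (\<lambda>s m. e (prod_encode (s, m)))", OF D])
  then have D': "D B (\<lambda>e. \<Theta> (\<lambda>s m. e (enc (row m) (prod_encode (s, pos m)) (crd m))))"
    by (simp add: r_def)
  have *: "\<Theta> (\<lambda>s m. pb R b (tr \<iota>) (enc (row m) (prod_encode (s, pos m)) (crd m))) = \<Theta> (\<lambda>s. pb R b (\<iota> s))" for \<iota>
  proof (rule supp, intro allI impI)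
    fix s m assume "s < J" "m < N"
    moreover have "min s (J - 1) = s" "min (pos m) (N - 1) = pos m"
      using \<open>s < J\<close> \<open>m < N\<close> pos_le[of m] by auto
    ultimately show "pb R b (tr \<iota>) (enc (row m) (prod_encode (s, pos m)) (crd m)) = pb R b (\<iota> s) m"
      by (simp add: pb_def tr_def)
  qed
  have "\<Theta> (\<lambda>s m. pb R b (tr \<iota>) (enc (row m) (prod_encode (s, pos m)) (crd m))) =
      \<Theta> (\<lambda>s m. pb R b (tr \<iota>') (enc (row m) (prod_encode (s, pos m)) (crd m)))"
  proof (rule MI_D[OF MI D'])
    fix \<alpha> i k assume "\<alpha> \<in> R"
    obtain s k' where i: "prod_decode i = (s, k')" by (cases "prod_decode i")
    obtain s' k'' where k: "prod_decode k = (s', k'')" by (cases "prod_decode k")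
    show "tr \<iota> \<alpha> i < tr \<iota> \<alpha> k \<longleftrightarrow> tr \<iota>' \<alpha> i < tr \<iota>' \<alpha> k"
      unfolding tr_def i k prod.case using False \<open>\<alpha> \<in> R\<close> by (intro iso) auto
  qed
  then show ?thesis unfolding * .
qed

lemma MI_subset:
  assumes "MI B R b" "S \<subseteq> R" shows "MI B S b"
  unfolding MI_def
proof (intro allI impI)
  fix P and \<iota> \<iota>' :: "nat \<Rightarrow> nat \<Rightarrow> rat"
  assume P: "D B P" and iso: "\<forall>\<alpha>\<in>S. \<forall>i k. \<iota> \<alpha> i < \<iota> \<alpha> k \<longleftrightarrow> \<iota>' \<alpha> i < \<iota>' \<alpha> k"
  define ex where "ex \<iota> \<alpha> = (if \<alpha> \<in> S then \<iota> \<alpha> else (\<lambda>_. 0 :: rat))" for \<iota> :: "nat \<Rightarrow> nat \<Rightarrow> rat" and \<alpha>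
  have "P (mask S (pb R b (ex \<iota>))) = P (mask S (pb R b (ex \<iota>')))"
    by (rule MI_D[OF assms(1) D_mask[OF P]]) (use iso in \<open>auto simp: ex_def\<close>)
  moreover have "pb S b (ex \<iota>) = pb S b \<iota>" for \<iota> by (rule pb_cong) (simp add: ex_def)
  ultimately show "P (pb S b \<iota>) = P (pb S b \<iota>')" using assms(2) by (simp add: mask_pb)
qed

text \<open>The sequence \<open>\<gamma>\<close> fails to be indiscernible over \<open>C\<close>
  together with the other sequences of \<open>S\<close>: only its own list of indices is
  exchanged.\<close>

definition broken :: "'a set \<Rightarrow> nat set \<Rightarrow> (nat \<Rightarrow> rat \<Rightarrow> nat \<Rightarrow> 'a) \<Rightarrow> nat \<Rightarrow> bool" where
  "broken C S b \<gamma> \<longleftrightarrow> (\<exists>P \<iota> u. D C P \<and> (\<forall>i k. \<iota> \<gamma> i < \<iota> \<gamma> k \<longleftrightarrow> u i < u k) \<and>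
    P (pb S b \<iota>) \<noteq> P (pb S b (\<iota>(\<gamma> := u))))"

text \<open>The lists of indices are exchanged for one sequence after the other.\<close>

lemma MI_not_broken:
  assumes "finite R" "\<And>\<gamma>. \<gamma> \<in> R \<Longrightarrow> \<not> broken C R b \<gamma>"
  shows "MI C R b"
  unfolding MI_def
proof (intro allI impI)
  fix P and \<iota> \<iota>' :: "nat \<Rightarrow> nat \<Rightarrow> rat"
  assume P: "D C P" and iso: "\<forall>\<alpha>\<in>R. \<forall>i k. \<iota> \<alpha> i < \<iota> \<alpha> k \<longleftrightarrow> \<iota>' \<alpha> i < \<iota>' \<alpha> k"
  have "P (pb R b \<iota>) = P (pb R b (\<lambda>\<alpha>. if \<alpha> \<in> T then \<iota>' \<alpha> else \<iota> \<alpha>))" if "finite T" "T \<subseteq> R" for T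
    using that
  proof (induction T rule: finite_induct)
    case (insert \<gamma> T)
    let ?\<iota> = "\<lambda>\<alpha>. if \<alpha> \<in> T then \<iota>' \<alpha> else \<iota> \<alpha>"
    have "P (pb R b ?\<iota>) = P (pb R b (?\<iota>(\<gamma> := \<iota>' \<gamma>)))"
    proof (rule ccontr)
      assume "P (pb R b ?\<iota>) \<noteq> P (pb R b (?\<iota>(\<gamma> := \<iota>' \<gamma>)))"
      moreover have "\<forall>i k. ?\<iota> \<gamma> i < ?\<iota> \<gamma> k \<longleftrightarrow> \<iota>' \<gamma> i < \<iota>' \<gamma> k" using iso insert.hyps(2) insert.prems by simp
      ultimately have "broken C R b \<gamma>" unfolding broken_def using P by (intro exI conjI)
      then show False using assms(2) insert.prems by blast
    qed
    moreover have "?\<iota>(\<gamma> := \<iota>' \<gamma>) = (\<lambda>\<alpha>. if \<alpha> \<in> insert \<gamma> T then \<iota>' \<alpha> else \<iota> \<alpha>)" by auto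
    ultimately show ?case using insert.IH insert.prems by simp
  qed simp
  from this[OF assms(1)] have "P (pb R b \<iota>) = P (pb R b (\<lambda>\<alpha>. if \<alpha> \<in> R then \<iota>' \<alpha> else \<iota> \<alpha>))" by simp
  also have "pb R b (\<lambda>\<alpha>. if \<alpha> \<in> R then \<iota>' \<alpha> else \<iota> \<alpha>) = pb R b \<iota>'" by (rule pb_cong) simp
  finally show "P (pb R b \<iota>) = P (pb R b \<iota>')" .
qed

end

text \<open>For \<open>i = 0, 1, \<dots>\<close> and large \<open>d\<close> these are copies of \<open>a\<close> each of which lies below the previous one.\<close>

definition blk :: "(nat \<Rightarrow> rat) \<Rightarrow> rat \<Rightarrow> nat \<Rightarrow> nat \<Rightarrow> rat" where
  "blk a d i k = a k - of_nat i * d"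

lemma blk_less_iff:
  assumes d: "\<And>i k. i < N \<Longrightarrow> k < N \<Longrightarrow> a i - a k < d" and k: "k < N" "k' < N"
  shows "blk a d i k < blk a d j k' \<longleftrightarrow> j < i \<or> i = j \<and> a k < a k'"
proof -
  have d0: "0 < d" using d[OF k(1) k(1)] by simp
  have lt: "blk a d i k < blk a d j k'" if "j < i" "k < N" "k' < N" for i j k k'
  proof -
    have "d * 1 \<le> d * of_nat (i - j)" using d0 that(1) by (intro mult_left_mono) auto
    also have "\<dots> = of_nat i * d - of_nat j * d" using that(1) by (simp add: of_nat_diff algebra_simps)
    finally show ?thesis using d[OF that(2,3)] unfolding blk_def by linarith
  qed
  show ?thesis
  proof (cases i j rule: linorder_cases)
    case less
    then show ?thesis using lt[of i j k' k] k by auto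
  next
    case equal
    then show ?thesis by (simp add: blk_def)
  next
    case greater
    then show ?thesis using lt[of j i k k'] k by auto
  qed
qed

lemma diff_bound: "\<exists>d :: rat. \<forall>i<N. \<forall>k<N. f (i :: nat) - g (k :: nat) < d"
proof -
  have fin: "finite ((\<lambda>(i, k). f i - g k) ` ({..<N} \<times> {..<N}))"
    by (intro finite_imageI finite_cartesian_product finite_lessThan)
  obtain d where "\<forall>x\<in>(\<lambda>(i, k). f i - g k) ` ({..<N} \<times> {..<N}). x \<le> d"
    by (rule bdd_above.E[OF bdd_above_finite[OF fin]]) (rule that, blast)
  then have d: "f i - g k \<le> d" if "i < N" "k < N" for i k using that by force
  have "f i - g k < d + 1" if "i < N" "k < N" for i k using d[OF that] by linarith
  then show ?thesis by blast
qed

context acvf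
begin

section \<open>Adding an element to mutually indiscernible sequences\<close>

lemma inb_centre: "inb (c, d, s) p \<Longrightarrow> inb (c, d, s) x \<longleftrightarrow> inb (p, d, s) x"
proof (cases s)
  case True
  moreover assume "inb (c, d, s) p"
  ultimately show ?thesis using v_trans_le[of "v d" x c p] v_trans_le[of "v d" x p c] v_minus_commute[of c p] by auto
next
  case False
  moreover assume "inb (c, d, s) p"
  ultimately show ?thesis using v_trans_less[of "v d" x c p] v_trans_less[of "v d" x p c] v_minus_commute[of c p] by auto
qed

lemma inb_laminar:
  "Collect (inb k) \<subseteq> Collect (inb k') \<or> Collect (inb k') \<subseteq> Collect (inb k) \<or> Collect (inb k) \<inter> Collect (inb k') = {}"
proof (cases "Collect (inb k) \<inter> Collect (inb k') = {}")
  case False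
  then obtain p where p: "inb k p" "inb k' p" by blast
  obtain c d s where k: "k = (c, d, s)" by (cases k)
  obtain c' d' s' where k': "k' = (c', d', s')" by (cases k')
  have "\<And>x. inb k x \<longleftrightarrow> inb (p, d, s) x" "\<And>x. inb k' x \<longleftrightarrow> inb (p, d', s') x"
    using inb_centre p unfolding k k' by blast+
  moreover have "(\<forall>x. inb (p, d, s) x \<longrightarrow> inb (p, d', s') x) \<or> (\<forall>x. inb (p, d', s') x \<longrightarrow> inb (p, d, s) x)"
    by (cases "v d" "v d'" rule: linorder_cases; cases s; cases s')
      (auto intro: less_imp_le le_less_trans less_le_trans less_trans order_trans)
  ultimately show ?thesis by auto
qed simp

text \<open>Two balls are nested or disjoint, so all balls involved form a laminar family with at
  most \<open>K * card I\<close> members. The number of truth patterns is therefore linear in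
  \<open>card I\<close>, not exponential.\<close>

lemma cpx_patterns:
  assumes "finite I" "\<And>i. i \<in> I \<Longrightarrow> cpx K (X i)" "finite Z"
    and Z: "\<And>x y. x \<in> Z \<Longrightarrow> y \<in> Z \<Longrightarrow> x \<noteq> y \<Longrightarrow> \<exists>i\<in>I. X i x \<noteq> X i y"
  shows "card Z \<le> K * card I + 1"
proof -
  have "\<exists>l. \<forall>i\<in>I. length (l i) = K \<and> (\<forall>x y. (\<forall>k\<in>set (l i). inb k x = inb k y) \<longrightarrow> X i x = X i y)"
    using assms(2) unfolding cpx_def by (intro bchoice ballI) blast
  then obtain l where l: "\<And>i. i \<in> I \<Longrightarrow> length (l i) = K"
    "\<And>i x y. i \<in> I \<Longrightarrow> \<forall>k\<in>set (l i). inb k x = inb k y \<Longrightarrow> X i x = X i y" by blast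
  define F where "F = (\<Union>i\<in>I. (\<lambda>k. Collect (inb k)) ` set (l i))"
  have "card Z \<le> card F + 1"
  proof (rule laminar_card)
    show "finite F" unfolding F_def using assms(1) by blast
    show "\<forall>X\<in>F. \<forall>Y\<in>F. X \<subseteq> Y \<or> Y \<subseteq> X \<or> X \<inter> Y = {}"
      unfolding F_def using inb_laminar by blast
    show "\<forall>x\<in>Z. \<forall>y\<in>Z. x \<noteq> y \<longrightarrow> (\<exists>X\<in>F. (x \<in> X) \<noteq> (y \<in> X))"
    proof (intro ballI impI)
      fix x y assume "x \<in> Z" "y \<in> Z" "x \<noteq> y"
      then obtain i where i: "i \<in> I" "X i x \<noteq> X i y" using Z by blast
      then obtain k where k: "k \<in> set (l i)" "inb k x \<noteq> inb k y" using l(2) by blast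
      then have "Collect (inb k) \<in> F" unfolding F_def using i(1) by blast
      with k(2) show "\<exists>X\<in>F. (x \<in> X) \<noteq> (y \<in> X)" by (intro bexI[of _ "Collect (inb k)"]) auto
    qed
  qed fact
  moreover have "card F \<le> (\<Sum>i\<in>I. K)"
  proof -
    have "card F \<le> (\<Sum>i\<in>I. card ((\<lambda>k. Collect (inb k)) ` set (l i)))"
      unfolding F_def by (rule card_UN_le[OF assms(1)])
    also have "\<dots> \<le> (\<Sum>i\<in>I. K)"
    proof (rule sum_mono)
      fix i assume "i \<in> I"
      then show "card ((\<lambda>k. Collect (inb k)) ` set (l i)) \<le> K"
        using card_image_le[of "set (l i)" "\<lambda>k. Collect (inb k)"] card_length[of "l i"] l(1) by auto
    qed
    finally show ?thesis .
  qed
  ultimately show ?thesis by (simp add: mult.commute)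
qed

text \<open>More than \<open>2 * m\<close> changes of truth along the blocks would allow every truth
  pattern on \<open>m\<close> blocks to be realised, because indiscernibility carries a suitable
  choice of blocks to the first \<open>m\<close>. These \<open>2 ^ m\<close> patterns exceed the
  linear bound.\<close>

lemma alternation_bound:
  assumes MI: "MI B R b" and P: "D B P"
    and supp: "\<And>z e e'. (\<forall>m<N. e m = e' m) \<Longrightarrow> P (case_nat z e) = P (case_nat z e')"
    and d: "\<And>i k. i < N \<Longrightarrow> k < N \<Longrightarrow> \<iota> \<gamma> i - \<iota> \<gamma> k < d"
    and F: "\<And>i z. F i z = P (case_nat z (pb R b (\<iota>(\<gamma> := blk (\<iota> \<gamma>) d i))))"
    and cpx: "\<And>i. cpx K (F i)"
  shows "\<exists>m. \<forall>z L. card {i. i < L \<and> F i z \<noteq> F (Suc i) z} \<le> m"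
proof -
  \<comment> \<open>With this value \<open>2 ^ m\<close> is the square of a number that is at least
    \<open>2 * K + 2\<close>, which beats \<open>K * m + 1\<close>.\<close>
  define m where "m = 2 * (2 * K + 1)"
  have m: "K * m + 1 < 2 ^ m"
  proof -
    have "2 * K + 2 = Suc (2 * K + 1)" by simp
    also have "\<dots> \<le> 2 ^ (2 * K + 1)" by (rule Suc_leI[OF less_exp])
    finally have *: "2 * K + 2 \<le> 2 ^ (2 * K + 1)" .
    have "(2 * K + 2) * (2 * K + 2) \<le> 2 ^ (2 * K + 1) * (2 ^ (2 * K + 1) :: nat)" by (rule mult_mono[OF * *]) auto
    also have "\<dots> = 2 ^ m" unfolding m_def by (simp only: power_add[symmetric] mult_2)
    finally show ?thesis unfolding m_def by (simp add: algebra_simps)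
  qed
  have "card {i. i < L \<and> F i z \<noteq> F (Suc i) z} \<le> 2 * m" for z L
  proof (rule ccontr)
    define S where "S = {i. i < L \<and> F i z \<noteq> F (Suc i) z}"
    assume "\<not> card {i. i < L \<and> F i z \<noteq> F (Suc i) z} \<le> 2 * m"
    then have cS: "2 * m < card S" unfolding S_def by simp
    have fS: "finite S" unfolding S_def by simp
    define s where "s = enumerate S"
    have s: "s k \<in> S" "Suc (s k) \<le> s (Suc k)" if "Suc k < card S" for k
      using that finite_enumerate_in_set[OF fS, of k] finite_enumerate_step[OF fS, of k] unfolding s_def by auto
    have "\<exists>y. \<forall>k<m. F k y \<longleftrightarrow> k \<in> T" for T
    proof -
      \<comment> \<open>At a change of truth one of the two adjacent blocks has the prescribed truth
        value. Only every second change is used, so that the chosen blocks are strictly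
        increasing.\<close>
      define idx where "idx k = (if F (s (2 * k)) z \<longleftrightarrow> k \<in> T then s (2 * k) else Suc (s (2 * k)))" for k
      have idxT: "F (idx k) z \<longleftrightarrow> k \<in> T" if "k < m" for k
        using s(1)[of "2 * k"] that cS unfolding idx_def S_def by auto
      have "idx k < idx k'" if "k < k'" "k' < m" for k k'
      proof -
        have "idx k < s (2 * k + 2)"
          using s(2)[of "2 * k"] s(2)[of "2 * k + 1"] that cS unfolding idx_def by (auto simp: numeral_2_eq_2)
        also have "s (2 * k + 2) \<le> s (2 * k')"
        proof (cases "k' = k + 1")
          case False
          then show ?thesis
            unfolding s_def using that cS by (intro less_imp_le finite_enumerate_mono fS) auto
        qed simp
        also have "\<dots> \<le> idx k'" unfolding idx_def by simp
        finally show ?thesis .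
      qed
      then have idx: "idx k < idx k' \<longleftrightarrow> k < k'" "idx k = idx k' \<longleftrightarrow> k = k'" if "k < m" "k' < m" for k k'
        using that by (metis less_asym linorder_neqE_nat)+
      define \<Theta> where "\<Theta> E \<longleftrightarrow> (\<exists>y. \<forall>k\<in>{..<m}. P (case_nat y (E k)) \<longleftrightarrow> k \<in> T)" for E
      have "\<Theta> (\<lambda>k. pb R b (\<iota>(\<gamma> := blk (\<iota> \<gamma>) d (idx k)))) = \<Theta> (\<lambda>k. pb R b (\<iota>(\<gamma> := blk (\<iota> \<gamma>) d k)))"
      proof (rule MI_multi[OF MI])
        have "kfun B (\<lambda>e. case_nat (e 0) (\<lambda>m. e (Suc (prod_encode (k, m)))) i)" for k i
          by (cases i) (simp_all add: kfun_var)
        from D_subst[OF P, of "\<lambda>i e. case_nat (e 0) (\<lambda>m. e (Suc (prod_encode (k, m)))) i" for k, OF this]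
        show "D B (\<lambda>e. \<Theta> (\<lambda>s m. e (prod_encode (s, m))))"
          unfolding \<Theta>_def by (intro D_ex D_finite_all D_iff D_const) simp_all
        show "\<Theta> E = \<Theta> E'" if "\<forall>s<m. \<forall>m<N. E s m = E' s m" for E E'
        proof -
          have "P (case_nat y (E k)) = P (case_nat y (E' k))" if "k < m" for y k
            using that \<open>\<forall>s<m. _\<close> by (intro supp) auto
          then show ?thesis unfolding \<Theta>_def by auto
        qed
      qed (auto simp: blk_less_iff[OF d] idx)
      moreover have "\<Theta> (\<lambda>k. pb R b (\<iota>(\<gamma> := blk (\<iota> \<gamma>) d (idx k))))"
        unfolding \<Theta>_def using idxT unfolding F by (intro exI[of _ z]) simp
      ultimately show ?thesis unfolding \<Theta>_def F by auto
    qed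
    then have "\<exists>y. \<forall>T. \<forall>k<m. F k (y T) \<longleftrightarrow> k \<in> T" by (intro choice allI)
    then obtain y where y: "\<And>T k. k < m \<Longrightarrow> F k (y T) \<longleftrightarrow> k \<in> T" by blast
    have "inj_on y (Pow {..<m})"
    proof (rule inj_onI)
      fix T T' assume T: "T \<in> Pow {..<m}" "T' \<in> Pow {..<m}" "y T = y T'"
      have "k \<in> T \<longleftrightarrow> k \<in> T'" if "k < m" for k using y[OF that, of T] y[OF that, of T'] T(3) by simp
      then show "T = T'" using T(1,2) by blast
    qed
    then have "card (y ` Pow {..<m}) = 2 ^ m" by (simp add: card_image card_Pow)
    moreover have "card (y ` Pow {..<m}) \<le> K * card {..<m} + 1"
    proof (rule cpx_patterns[where X = F])
      fix x x' assume x: "x \<in> y ` Pow {..<m}" "x' \<in> y ` Pow {..<m}" "x \<noteq> x'"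
      then obtain T T' where T: "T \<subseteq> {..<m}" "T' \<subseteq> {..<m}" "x = y T" "x' = y T'" by blast
      with x(3) have "T \<noteq> T'" by blast
      then obtain k where "k < m" "(k \<in> T) \<noteq> (k \<in> T')" using T(1,2) by blast
      then show "\<exists>i\<in>{..<m}. F i x \<noteq> F i x'" using y[of k] T(3,4) by (intro bexI[of _ k]) auto
    qed (use cpx in auto)
    ultimately show False using m by simp
  qed
  then show ?thesis by blast
qed

text \<open>
  A grid of \<open>L\<^sup>2\<close> elements, whose truth patterns for \<open>2 (L + 1)\<close> unions of balls change at
  prescribed places, cannot exist for large \<open>L\<close>, because the number of atoms of a Boolean algebra
  generated by balls is linear in their number.
\<close>

lemma no_grid:
  assumes "\<And>i. cpx K (F i)" "\<And>i. cpx K (G i)"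
    and mF: "\<And>z L. card {i. i < L \<and> F i z \<noteq> F (Suc i) z} \<le> m"
    and mG: "\<And>z L. card {i. i < L \<and> G i z \<noteq> G (Suc i) z} \<le> m"
    and grid: "\<And>i j. \<exists>z. F i z \<noteq> F (Suc i) z \<and> G j z \<noteq> G (Suc j) z"
  shows False
proof -
  obtain z where z: "\<And>i j. F i (z i j) \<noteq> F (Suc i) (z i j) \<and> G j (z i j) \<noteq> G (Suc j) (z i j)"
    using grid by metis
  \<comment> \<open>Each truth pattern accounts for at most \<open>m * m\<close> places of the grid,
    and there are at most \<open>(4 * K + 1) * L\<close> patterns, too few for \<open>L * L\<close>
    places.\<close>
  define L where "L = (4 * K + 1) * (m * m) + 1"
  define pat where "pat z = ({i. i \<le> L \<and> F i z}, {i. i \<le> L \<and> G i z})" for z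
  define Pat where "Pat = (\<lambda>(i, j). pat (z i j)) ` ({..<L} \<times> {..<L})"
  have fin: "finite Pat" unfolding Pat_def by simp
  have "\<exists>w. \<forall>p\<in>Pat. pat (w p) = p"
    unfolding Pat_def by (intro bchoice ballI) auto
  then obtain w where w: "\<And>p. p \<in> Pat \<Longrightarrow> pat (w p) = p" by blast
  then have "inj_on w Pat" by (metis inj_onI)
  then have "card Pat = card (w ` Pat)" by (simp add: card_image)
  also have "\<dots> \<le> K * card ((UNIV :: bool set) \<times> {..L}) + 1"
  proof (rule cpx_patterns[where X = "\<lambda>(b, i). if b then F i else G i"])
    show "cpx K (case i of (b, i) \<Rightarrow> if b then F i else G i)" for i using assms(1,2) by (cases i) auto
    fix x y assume "x \<in> w ` Pat" "y \<in> w ` Pat" "x \<noteq> y"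
    then have "pat x \<noteq> pat y" using w by auto
    then obtain i where "i \<le> L" "F i x \<noteq> F i y \<or> G i x \<noteq> G i y" unfolding pat_def by auto
    then show "\<exists>i\<in>UNIV \<times> {..L}. (case i of (b, i) \<Rightarrow> if b then F i else G i) x \<noteq> (case i of (b, i) \<Rightarrow> if b then F i else G i) y"
      by (auto intro: bexI[of _ "(True, i)"] bexI[of _ "(False, i)"])
  qed (use fin in auto)
  also have "\<dots> = K * (2 * (L + 1)) + 1" by (simp add: card_cartesian_product)
  finally have cPat: "card Pat \<le> K * (2 * (L + 1)) + 1" .
  define alt where "alt X = {i. i < L \<and> (i \<in> X) \<noteq> (Suc i \<in> X)}" for X
  have "{..<L} \<times> {..<L} \<subseteq> (\<Union>p\<in>Pat. alt (fst p) \<times> alt (snd p))"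
  proof (rule subsetI)
    fix x assume "x \<in> {..<L} \<times> {..<L}"
    then obtain i j where x: "x = (i, j)" "i < L" "j < L" by auto
    then have "pat (z i j) \<in> Pat" unfolding Pat_def by force
    moreover have "x \<in> alt (fst (pat (z i j))) \<times> alt (snd (pat (z i j)))"
      using z[of i j] x unfolding alt_def pat_def by auto
    ultimately show "x \<in> (\<Union>p\<in>Pat. alt (fst p) \<times> alt (snd p))" by blast
  qed
  moreover have finalt: "finite (alt X)" for X unfolding alt_def by simp
  ultimately have "card ({..<L} \<times> {..<L}) \<le> card (\<Union>p\<in>Pat. alt (fst p) \<times> alt (snd p))"
    using fin by (intro card_mono) auto
  also have "\<dots> \<le> (\<Sum>p\<in>Pat. card (alt (fst p) \<times> alt (snd p)))" by (rule card_UN_le[OF fin])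
  also have "\<dots> \<le> (\<Sum>p\<in>Pat. m * m)"
  proof (rule sum_mono)
    fix p assume "p \<in> Pat"
    then obtain i j where p: "p = pat (z i j)" unfolding Pat_def by auto
    have "alt (fst p) = {i'. i' < L \<and> F i' (z i j) \<noteq> F (Suc i') (z i j)}"
      "alt (snd p) = {i'. i' < L \<and> G i' (z i j) \<noteq> G (Suc i') (z i j)}"
      unfolding p alt_def pat_def by auto
    then show "card (alt (fst p) \<times> alt (snd p)) \<le> m * m"
      using mF[of L "z i j"] mG[of L "z i j"] by (simp add: card_cartesian_product mult_mono)
  qed
  also have "\<dots> = card Pat * (m * m)" by simp
  also have "\<dots> \<le> (K * (2 * (L + 1)) + 1) * (m * m)" by (rule mult_right_mono[OF cPat]) simp
  also have "\<dots> \<le> ((4 * K + 1) * L) * (m * m)"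
  proof (rule mult_right_mono)
    have "1 \<le> L" unfolding L_def by simp
    then show "K * (2 * (L + 1)) + 1 \<le> (4 * K + 1) * L" by (cases L) (simp_all add: algebra_simps)
  qed simp
  finally have "L * L \<le> (4 * K + 1) * L * (m * m)" by (simp only: card_cartesian_product card_lessThan)
  then have "L * L \<le> L * ((4 * K + 1) * (m * m))" by (simp only: mult_ac)
  moreover have "0 < L" unfolding L_def by simp
  ultimately have "L \<le> (4 * K + 1) * (m * m)" unfolding mult_le_cancel1 by blast
  then show False unfolding L_def by simp
qed

text \<open>
  Indiscernibility over \<open>B\<close> spreads a pair of breaks to all pairs of consecutive blocks in two
  long sequences of blocks; the members of the sequence \<open>\<delta>\<close> in \<open>P\<close> remain above all blocks.
\<close>

lemma not_both_broken:
  assumes MI: "MI B R b" and \<gamma>\<delta>: "\<gamma> \<in> R" "\<delta> \<in> R" "\<gamma> \<noteq> \<delta>"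
    and P: "D B P" "\<And>z e e'. (\<forall>m<N. e m = e' m) \<Longrightarrow> P (case_nat z e) = P (case_nat z e')"
    and Q: "D B Q" "\<And>z e e'. (\<forall>m<N. e m = e' m) \<Longrightarrow> Q (case_nat z e) = Q (case_nat z e')"
    and \<iota>: "\<And>i k. \<iota> \<gamma> i < \<iota> \<gamma> k \<longleftrightarrow> u i < u k"
      "P (case_nat c (pb R b \<iota>)) \<noteq> P (case_nat c (pb R b (\<iota>(\<gamma> := u))))"
    and \<kappa>: "\<And>i k. \<kappa> \<delta> i < \<kappa> \<delta> k \<longleftrightarrow> t i < t k"
      "Q (case_nat c (pb R b \<kappa>)) \<noteq> Q (case_nat c (pb R b (\<kappa>(\<delta> := t))))"
    and indep: "\<And>z \<kappa> w. Q (case_nat z (pb R b (\<kappa>(\<gamma> := w)))) = Q (case_nat z (pb R b \<kappa>))"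
    and below: "\<And>i k. i < N \<Longrightarrow> k < N \<Longrightarrow> \<kappa> \<delta> i < \<iota> \<delta> k" "\<And>i k. i < N \<Longrightarrow> k < N \<Longrightarrow> t i < \<iota> \<delta> k"
  shows False
proof -
  \<comment> \<open>A break between \<open>x\<close> and \<open>y\<close> is replaced by one between
    a list \<open>a'\<close> placed entirely below both and one of the two, so that the lists lie
    like two consecutive blocks.\<close>
  have "\<exists>a' a d. (\<forall>i<N. \<forall>k<N. x i - x k < d) \<and> (\<forall>i<N. \<forall>k<N. a' i < a k) \<and> (a = x \<or> a = y) \<and>
      (\<forall>i k. x i < x k \<longleftrightarrow> a i < a k) \<and> (\<forall>i k. x i < x k \<longleftrightarrow> a' i < a' k) \<and> h a' \<noteq> h a"
    if iso: "\<And>i k. x i < x k \<longleftrightarrow> y i < y k" and ne: "h x \<noteq> h y" for x y :: "nat \<Rightarrow> rat" and h :: "_ \<Rightarrow> bool"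
  proof -
    obtain d where d: "\<forall>i<N. \<forall>k<N. x i - x k < d" using diff_bound by blast
    obtain d' where d': "\<forall>i<N. \<forall>k<N. x i - y k < d'" using diff_bound by blast
    define a' where "a' i = x i - max d d'" for i
    have "a' i < x k" "a' i < y k" if "i < N" "k < N" for i k
    proof -
      have "x i - x k < d" "x i - y k < d'" using d d' that by blast+
      then show "a' i < x k" "a' i < y k" unfolding a'_def by linarith+
    qed
    moreover have "x i < x k \<longleftrightarrow> a' i < a' k" for i k by (simp add: a'_def)
    moreover have "h a' \<noteq> h x \<or> h a' \<noteq> h y" using ne by blast
    ultimately obtain a where a: "a = x \<or> a = y" "h a' \<noteq> h a" "\<forall>i<N. \<forall>k<N. a' i < a k" "\<forall>i k. x i < x k \<longleftrightarrow> a i < a k"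
      "\<forall>i k. x i < x k \<longleftrightarrow> a' i < a' k"
      using iso by blast
    show ?thesis by (rule exI[of _ a'], rule exI[of _ a], rule exI[of _ d]) (intro conjI d a)
  qed
  note norm = this
  obtain a' a d where a: "\<forall>i<N. \<forall>k<N. \<iota> \<gamma> i - \<iota> \<gamma> k < d" "\<forall>i<N. \<forall>k<N. a' i < a k" "a = \<iota> \<gamma> \<or> a = u"
    "\<forall>i k. \<iota> \<gamma> i < \<iota> \<gamma> k \<longleftrightarrow> a i < a k" "\<forall>i k. \<iota> \<gamma> i < \<iota> \<gamma> k \<longleftrightarrow> a' i < a' k"
    "P (case_nat c (pb R b (\<iota>(\<gamma> := a')))) \<noteq> P (case_nat c (pb R b (\<iota>(\<gamma> := a))))"
  proof -
    have "P (case_nat c (pb R b (\<iota>(\<gamma> := \<iota> \<gamma>)))) \<noteq> P (case_nat c (pb R b (\<iota>(\<gamma> := u))))" using \<iota>(2) by simp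
    from norm[of "\<iota> \<gamma>" u "\<lambda>x. P (case_nat c (pb R b (\<iota>(\<gamma> := x))))", OF \<iota>(1) this]
    show thesis by (elim exE conjE) (rule that)
  qed
  obtain s' s d' where s: "\<forall>i<N. \<forall>k<N. \<kappa> \<delta> i - \<kappa> \<delta> k < d'" "\<forall>i<N. \<forall>k<N. s' i < s k" "s = \<kappa> \<delta> \<or> s = t"
    "\<forall>i k. \<kappa> \<delta> i < \<kappa> \<delta> k \<longleftrightarrow> s i < s k" "\<forall>i k. \<kappa> \<delta> i < \<kappa> \<delta> k \<longleftrightarrow> s' i < s' k"
    "Q (case_nat c (pb R b (\<kappa>(\<delta> := s')))) \<noteq> Q (case_nat c (pb R b (\<kappa>(\<delta> := s))))"
  proof -
    have "Q (case_nat c (pb R b (\<kappa>(\<delta> := \<kappa> \<delta>)))) \<noteq> Q (case_nat c (pb R b (\<kappa>(\<delta> := t))))" using \<kappa>(2) by simp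
    from norm[of "\<kappa> \<delta>" t "\<lambda>x. Q (case_nat c (pb R b (\<kappa>(\<delta> := x))))", OF \<kappa>(1) this]
    show thesis by (elim exE conjE) (rule that)
  qed
  have s_below: "s i < \<iota> \<delta> k" "s' i < \<iota> \<delta> k" if "i < N" "k < N" for i k
  proof -
    show "s i < \<iota> \<delta> k" using s(3) below that by blast
    with s(2) that show "s' i < \<iota> \<delta> k" by (meson less_trans)
  qed
  define F where "F i z = P (case_nat z (pb R b (\<iota>(\<gamma> := blk (\<iota> \<gamma>) d i))))" for i z
  define G where "G i z = Q (case_nat z (pb R b (\<kappa>(\<delta> := blk (\<kappa> \<delta>) d' i))))" for i z
  have cp: "\<exists>K. \<forall>e. cpx K (\<lambda>z. P (case_nat z e))" if "D B P" for P
  proof (rule uniform_cpx)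
    have "case_nat (e 0) (\<lambda>i. e (Suc i)) = e" for e :: "nat \<Rightarrow> 'a" by (auto split: nat.split)
    with that show "D B (\<lambda>e. P (case_nat (e 0) (\<lambda>i. e (Suc i))))" by simp
  qed
  obtain K1 where K1: "\<forall>e. cpx K1 (\<lambda>z. P (case_nat z e))" using cp[OF P(1)] by blast
  obtain K2 where K2: "\<forall>e. cpx K2 (\<lambda>z. Q (case_nat z e))" using cp[OF Q(1)] by blast
  define K where "K = max K1 K2"
  have cF: "cpx K (F i)" and cG: "cpx K (G i)" for i
    unfolding F_def G_def K_def using K1 K2 by (auto intro: cpx_mono)
  have "\<exists>m. \<forall>z L. card {i. i < L \<and> F i z \<noteq> F (Suc i) z} \<le> m"
    by (rule alternation_bound[OF MI P _ F_def cF]) (use a(1) in auto)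
  then obtain m1 where m1: "\<And>z L. card {i. i < L \<and> F i z \<noteq> F (Suc i) z} \<le> m1" by blast
  have "\<exists>m. \<forall>z L. card {i. i < L \<and> G i z \<noteq> G (Suc i) z} \<le> m"
    by (rule alternation_bound[OF MI Q _ G_def cG]) (use s(1) in auto)
  then obtain m2 where m2: "\<And>z L. card {i. i < L \<and> G i z \<noteq> G (Suc i) z} \<le> m2" by blast
  have "\<exists>z. F i z \<noteq> F (Suc i) z \<and> G j z \<noteq> G (Suc j) z" for i j
  proof -
    define \<Theta> where "\<Theta> E \<longleftrightarrow> (\<exists>z. \<not> (P (case_nat z (E 0)) \<longleftrightarrow> P (case_nat z (E 1))) \<and>
      \<not> (Q (case_nat z (E 2)) \<longleftrightarrow> Q (case_nat z (E 3))))" for E :: "nat \<Rightarrow> nat \<Rightarrow> 'a"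
    \<comment> \<open>Four environments, two for \<open>P\<close> and two for \<open>Q\<close>.
      Since \<open>Q\<close> ignores the sequence \<open>\<gamma>\<close>, its indices can be set to
      \<open>x\<close> there, so that in row \<open>\<gamma>\<close> only \<open>x'\<close> and
      \<open>x\<close> have to be compared.\<close>
    define cfg where "cfg x' x y' y n = (if n = 0 then \<iota>(\<gamma> := x') else if n = 1 then \<iota>(\<gamma> := x)
      else if n = 2 then \<kappa>(\<delta> := y', \<gamma> := x) else \<kappa>(\<delta> := y, \<gamma> := x))"
      for x' x y' y :: "nat \<Rightarrow> rat" and n :: nat
    have "\<Theta> (\<lambda>n. pb R b (cfg a' a s' s n)) =
        \<Theta> (\<lambda>n. pb R b (cfg (blk (\<iota> \<gamma>) d (Suc i)) (blk (\<iota> \<gamma>) d i) (blk (\<kappa> \<delta>) d' (Suc j)) (blk (\<kappa> \<delta>) d' j) n))"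
    proof (rule MI_multi[OF MI])
      have k: "kfun B (\<lambda>e. case_nat (e 0) (\<lambda>m. e (Suc (prod_encode (k, m)))) i)" for k i
        by (cases i) (simp_all add: kfun_var)
      note DP = D_subst[OF P(1), of "\<lambda>i e. case_nat (e 0) (\<lambda>m. e (Suc (prod_encode (k, m)))) i" for k, OF k]
        and DQ = D_subst[OF Q(1), of "\<lambda>i e. case_nat (e 0) (\<lambda>m. e (Suc (prod_encode (k, m)))) i" for k, OF k]
      show "D B (\<lambda>e. \<Theta> (\<lambda>s m. e (prod_encode (s, m))))"
        unfolding \<Theta>_def by (intro D_ex D_conj D_not D_iff DP DQ)
      show "\<Theta> E = \<Theta> E'" if "\<forall>s<4. \<forall>m<N. E s m = E' s m" for E E'
      proof -
        have "P (case_nat y (E 0)) = P (case_nat y (E' 0))" "P (case_nat y (E 1)) = P (case_nat y (E' 1))"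
          "Q (case_nat y (E 2)) = Q (case_nat y (E' 2))" "Q (case_nat y (E 3)) = Q (case_nat y (E' 3))" for y
          using that by (intro P(2) Q(2); simp)+
        then show ?thesis unfolding \<Theta>_def by simp
      qed
      fix \<alpha> n n' k k' :: nat
      assume n: "n < 4" "n' < 4" and k: "k < N" "k' < N"
      have b1: "blk (\<iota> \<gamma>) d p k < blk (\<iota> \<gamma>) d q k' \<longleftrightarrow> q < p \<or> p = q \<and> \<iota> \<gamma> k < \<iota> \<gamma> k'" for p q
        by (rule blk_less_iff[OF _ k]) (use a(1) in blast)
      have b2: "blk (\<kappa> \<delta>) d' p k < blk (\<kappa> \<delta>) d' q k' \<longleftrightarrow> q < p \<or> p = q \<and> \<kappa> \<delta> k < \<kappa> \<delta> k'" for p q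
        by (rule blk_less_iff[OF _ k]) (use s(1) in blast)
      have d'0: "0 < d'" using s(1) k(1) by (metis diff_self)
      have b3: "blk (\<kappa> \<delta>) d' p l < \<iota> \<delta> l'" if l: "l < N" "l' < N" for p l l'
      proof -
        have "0 \<le> of_nat p * d'" using d'0 by simp
        then show ?thesis using below(1)[OF l] unfolding blk_def by linarith
      qed
      have c: "a' k < a k'" "\<not> a k < a' k'" "s' k < s k'" "\<not> s k < s' k'"
        "s k < \<iota> \<delta> k'" "s' k < \<iota> \<delta> k'" "\<not> \<iota> \<delta> k < s k'" "\<not> \<iota> \<delta> k < s' k'"
        "blk (\<kappa> \<delta>) d' p k < \<iota> \<delta> k'" "\<not> \<iota> \<delta> k < blk (\<kappa> \<delta>) d' p k'" for p
        using a(2) s(2) s_below k b3[OF k, of p] b3[OF k(2,1), of p] by (metis less_asym)+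
      show "cfg a' a s' s n \<alpha> k < cfg a' a s' s n' \<alpha> k' \<longleftrightarrow>
        cfg (blk (\<iota> \<gamma>) d (Suc i)) (blk (\<iota> \<gamma>) d i) (blk (\<kappa> \<delta>) d' (Suc j)) (blk (\<kappa> \<delta>) d' j) n \<alpha> k <
        cfg (blk (\<iota> \<gamma>) d (Suc i)) (blk (\<iota> \<gamma>) d i) (blk (\<kappa> \<delta>) d' (Suc j)) (blk (\<kappa> \<delta>) d' j) n' \<alpha> k'"
      proof -
        consider "\<alpha> = \<gamma>" | "\<alpha> = \<delta>" "\<alpha> \<noteq> \<gamma>" | "\<alpha> \<noteq> \<gamma>" "\<alpha> \<noteq> \<delta>" by blast
        then show ?thesis
        proof cases
          case 1
          have "cfg x' x y' y n \<alpha> = (if n = 0 then x' else x)" for x' x y' y n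
            unfolding cfg_def using 1 by simp
          then show ?thesis using b1 c(1,2) a(4,5) by auto
        next
          case 2
          have "cfg x' x y' y n \<alpha> = (if n \<le> 1 then \<iota> \<delta> else if n = 2 then y' else y)" for x' x y' y n
            unfolding cfg_def using 2 by auto
          then show ?thesis using b2 c(3-10) s(4,5) by auto
        next
          case 3
          then show ?thesis unfolding cfg_def by auto
        qed
      qed
    qed
    moreover have "\<Theta> (\<lambda>n. pb R b (cfg a' a s' s n))"
    proof -
      have "P (case_nat c (pb R b (cfg a' a s' s 0))) \<noteq> P (case_nat c (pb R b (cfg a' a s' s 1)))"
        using a(6) by (simp add: cfg_def)
      moreover have "Q (case_nat c (pb R b (cfg a' a s' s 2))) \<noteq> Q (case_nat c (pb R b (cfg a' a s' s 3)))"
        using s(6) by (simp add: cfg_def indep)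
      ultimately show ?thesis unfolding \<Theta>_def by blast
    qed
    ultimately obtain z where z:
      "P (case_nat z (pb R b (\<iota>(\<gamma> := blk (\<iota> \<gamma>) d (Suc i))))) \<noteq> P (case_nat z (pb R b (\<iota>(\<gamma> := blk (\<iota> \<gamma>) d i))))"
      "Q (case_nat z (pb R b (\<kappa>(\<delta> := blk (\<kappa> \<delta>) d' (Suc j))))) \<noteq> Q (case_nat z (pb R b (\<kappa>(\<delta> := blk (\<kappa> \<delta>) d' j))))"
      unfolding \<Theta>_def by (auto simp: cfg_def indep)
    then show ?thesis unfolding F_def G_def by metis
  qed
  moreover have "card {i. i < L \<and> F i z \<noteq> F (Suc i) z} \<le> max m1 m2"
    "card {i. i < L \<and> G i z \<noteq> G (Suc i) z} \<le> max m1 m2" for z L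
    using m1[of L z] m2[of L z] by auto
  ultimately show False using no_grid[of K F G "max m1 m2"] cF cG by blast
qed

text \<open>
  The extremal choice of \<open>\<gamma>\<close> makes it possible to move those members of the second sequence
  that occur in a witness for the first one beyond the witness for the second one.
\<close>

lemma MI_insert:
  assumes fin: "finite R" "R \<noteq> {}" and MI: "MI B R b"
  shows "\<exists>\<gamma>\<in>R. MI (insert c B) (R - {\<gamma>}) b"
proof (rule ccontr)
  let ?C = "insert c B"
  assume no: "\<not> ?thesis"
  have br: "\<exists>\<delta>\<in>R - {\<gamma>}. broken ?C (R - {\<gamma>}) b \<delta>" if "\<gamma> \<in> R" for \<gamma>
    using MI_not_broken[of "R - {\<gamma>}" ?C b] no that fin(1) by blast
  define U where "U \<gamma> = {\<zeta> \<in> R - {\<gamma>}. broken ?C (R - {\<zeta>}) b \<gamma>}" for \<gamma>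
  have finU: "finite (U \<gamma>)" for \<gamma> unfolding U_def using fin(1) by simp
  have "Max ((\<lambda>\<gamma>. card (U \<gamma>)) ` R) \<in> (\<lambda>\<gamma>. card (U \<gamma>)) ` R" using fin by (intro Max_in) auto
  then obtain \<gamma> where \<gamma>: "\<gamma> \<in> R" "card (U \<gamma>) = Max ((\<lambda>\<gamma>. card (U \<gamma>)) ` R)" by auto
  obtain \<delta> where \<delta>: "\<delta> \<in> R - {\<gamma>}" "broken ?C (R - {\<gamma>}) b \<delta>" using br[OF \<gamma>(1)] by blast
  have "card (U \<delta>) \<le> card (U \<gamma>)" unfolding \<gamma>(2) using fin(1) \<delta>(1) by (intro Max_ge) auto
  moreover have "\<gamma> \<in> U \<delta>" "\<gamma> \<notin> U \<gamma>" unfolding U_def using \<gamma>(1) \<delta> by auto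
  \<comment> \<open>\<open>\<gamma>\<close> lies in \<open>U \<delta>\<close> but not in
    \<open>U \<gamma>\<close>, so by maximality of \<open>card (U \<gamma>)\<close> some
    \<open>\<zeta>\<close> lies in \<open>U \<gamma>\<close> but not in \<open>U \<delta>\<close>:
    after omitting \<open>\<zeta>\<close>, \<open>\<gamma>\<close> is broken, while
    \<open>\<delta>\<close> is absent or not broken.\<close>
  ultimately have "\<not> U \<gamma> \<subseteq> U \<delta>" using psubset_card_mono[OF finU[of \<delta>], of "U \<gamma>"] by auto
  then obtain \<zeta> where \<zeta>: "\<zeta> \<in> U \<gamma>" "\<zeta> \<notin> U \<delta>" by blast
  obtain P \<iota> u where P: "D ?C P" "\<forall>i k. \<iota> \<gamma> i < \<iota> \<gamma> k \<longleftrightarrow> u i < u k"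
    "P (pb (R - {\<zeta>}) b \<iota>) \<noteq> P (pb (R - {\<zeta>}) b (\<iota>(\<gamma> := u)))"
    using \<zeta>(1) unfolding U_def broken_def by blast
  obtain Q \<kappa> t where Q: "D ?C Q" "\<forall>i k. \<kappa> \<delta> i < \<kappa> \<delta> k \<longleftrightarrow> t i < t k"
    "Q (pb (R - {\<gamma>}) b \<kappa>) \<noteq> Q (pb (R - {\<gamma>}) b (\<kappa>(\<delta> := t)))"
    using \<delta>(2) unfolding broken_def by blast
  define P' where "P' e \<longleftrightarrow> P (mask (R - {\<zeta>}) e)" for e
  define Q' where "Q' e \<longleftrightarrow> Q (mask (R - {\<gamma>}) e)" for e
  have P'pb: "P' (pb R b \<iota>) \<longleftrightarrow> P (pb (R - {\<zeta>}) b \<iota>)" for \<iota> unfolding P'_def by (simp add: mask_pb)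
  have Q'pb: "Q' (pb R b \<iota>) \<longleftrightarrow> Q (pb (R - {\<gamma>}) b \<iota>)" for \<iota> unfolding Q'_def by (simp add: mask_pb)
  obtain P0 where P0: "D B P0" "\<And>e. P' e \<longleftrightarrow> P0 (case_nat c e)"
    using D_insert[OF D_mask[OF P(1)], of "R - {\<zeta>}"] unfolding P'_def by blast
  obtain Q0 where Q0: "D B Q0" "\<And>e. Q' e \<longleftrightarrow> Q0 (case_nat c e)"
    using D_insert[OF D_mask[OF Q(1)], of "R - {\<gamma>}"] unfolding Q'_def by blast
  \<comment> \<open>\<open>Q0\<close> is tied to \<open>Q'\<close> only at \<open>c\<close>. Masking
    once more makes it independent of the sequence \<open>\<gamma>\<close> at every
    \<open>z\<close>.\<close>
  define Q1 where "Q1 e \<longleftrightarrow> Q0 (case_nat (e 0) (mask (R - {\<gamma>}) (\<lambda>i. e (Suc i))))" for e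
  have Q1: "D B Q1"
  proof -
    have "kfun B (\<lambda>e. case_nat (e 0) (mask (R - {\<gamma>}) (\<lambda>i. e (Suc i))) i)" for i
    proof (cases i)
      case (Suc m)
      then show ?thesis
        unfolding Suc nat.case mask_def by (intro kfun_if D_const kfun_var kfun_0)
    qed (simp add: kfun_var)
    from D_subst[OF Q0(1), of "\<lambda>i e. case_nat (e 0) (mask (R - {\<gamma>}) (\<lambda>i. e (Suc i))) i", OF this]
    show ?thesis unfolding Q1_def .
  qed
  have Q1c: "Q1 (case_nat c e) \<longleftrightarrow> Q' e" for e
    unfolding Q1_def by (simp add: Q0(2)[symmetric]) (simp add: Q'_def mask_def[abs_def] if_distrib cong: if_cong)
  obtain N1 where N1: "\<And>e e'. (\<And>i. i < N1 \<Longrightarrow> e i = e' i) \<Longrightarrow> P0 e = P0 e'" using D_support[OF P0(1)] by blast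
  obtain N2 where N2: "\<And>e e'. (\<And>i. i < N2 \<Longrightarrow> e i = e' i) \<Longrightarrow> Q1 e = Q1 e'" using D_support[OF Q1] by blast
  define N where "N = max N1 N2"
  have suppP: "P0 (case_nat z e) = P0 (case_nat z e')" if "\<forall>m<N. e m = e' m" for z e e'
    using that by (intro N1) (auto simp: N_def split: nat.split)
  have suppQ: "Q1 (case_nat z e) = Q1 (case_nat z e')" if "\<forall>m<N. e m = e' m" for z e e'
    using that by (intro N2) (auto simp: N_def split: nat.split)
  obtain d1 where d1: "\<forall>i<N. \<forall>k<N. \<kappa> \<delta> i - \<iota> \<delta> k < d1" using diff_bound by blast
  obtain d2 where d2: "\<forall>i<N. \<forall>k<N. t i - \<iota> \<delta> k < d2" using diff_bound by blast
  define sh where "sh k = \<iota> \<delta> k + max d1 d2" for k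
  have move: "P' (pb R b (\<iota>'(\<delta> := sh))) \<longleftrightarrow> P' (pb R b \<iota>')" if "\<iota>' \<delta> = \<iota> \<delta>" for \<iota>'
  proof (cases "\<zeta> = \<delta>")
    case True
    then have "pb (R - {\<zeta>}) b (\<iota>'(\<delta> := sh)) = pb (R - {\<zeta>}) b \<iota>'" by (intro pb_cong) auto
    then show ?thesis unfolding P'pb by simp
  next
    case False
    then have "\<not> broken ?C (R - {\<zeta>}) b \<delta>" using \<zeta> \<delta>(1) unfolding U_def by auto
    moreover have "\<forall>i k. \<iota>' \<delta> i < \<iota>' \<delta> k \<longleftrightarrow> sh i < sh k" using that by (simp add: sh_def)
    ultimately show ?thesis unfolding P'pb broken_def using P(1) by blast
  qed
  have \<gamma>\<delta>: "\<gamma> \<noteq> \<delta>" using \<delta>(1) by blast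
  show False
  proof (rule not_both_broken[OF MI \<gamma>(1) _ \<gamma>\<delta> P0(1) suppP Q1 suppQ])
    show "\<delta> \<in> R" using \<delta>(1) by blast
    show "(\<iota>(\<delta> := sh)) \<gamma> i < (\<iota>(\<delta> := sh)) \<gamma> k \<longleftrightarrow> u i < u k" for i k using P(2) \<gamma>\<delta> by simp
    have "\<iota>(\<delta> := sh, \<gamma> := u) = (\<iota>(\<gamma> := u))(\<delta> := sh)" using \<gamma>\<delta> by (simp add: fun_upd_twist)
    then have "P' (pb R b (\<iota>(\<delta> := sh))) \<noteq> P' (pb R b (\<iota>(\<delta> := sh, \<gamma> := u)))"
      using move[of \<iota>] move[of "\<iota>(\<gamma> := u)"] P(3) \<gamma>\<delta> by (simp add: P'pb)
    then show "P0 (case_nat c (pb R b (\<iota>(\<delta> := sh)))) \<noteq> P0 (case_nat c (pb R b (\<iota>(\<delta> := sh, \<gamma> := u))))"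
      unfolding P0(2) .
    show "\<kappa> \<delta> i < \<kappa> \<delta> k \<longleftrightarrow> t i < t k" for i k using Q(2) by blast
    show "Q1 (case_nat c (pb R b \<kappa>)) \<noteq> Q1 (case_nat c (pb R b (\<kappa>(\<delta> := t))))"
      unfolding Q1c Q'pb by (rule Q(3))
    show "Q1 (case_nat z (pb R b (\<kappa>(\<gamma> := w)))) = Q1 (case_nat z (pb R b \<kappa>))" for z \<kappa> w
    proof -
      have "mask (R - {\<gamma>}) (pb R b (\<kappa>(\<gamma> := w))) = mask (R - {\<gamma>}) (pb R b \<kappa>)"
        by (simp add: mask_pb) (intro pb_cong, simp)
      then show ?thesis unfolding Q1_def by simp
    qed
    fix i k assume "i < N" "k < N"
    then have "\<kappa> \<delta> i - \<iota> \<delta> k < d1" "t i - \<iota> \<delta> k < d2" using d1 d2 by blast+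
    then show "\<kappa> \<delta> i < (\<iota>(\<delta> := sh)) \<delta> k" "t i < (\<iota>(\<delta> := sh)) \<delta> k" unfolding sh_def fun_upd_same by linarith+
  qed
qed

lemma MI_finite:
  assumes "finite X" "finite R" "card X < card R" "MI B R b"
  shows "\<exists>\<alpha>\<in>R. MI (B \<union> X) {\<alpha>} b"
  using assms
proof (induction X arbitrary: B R rule: finite_induct)
  case empty
  then obtain \<alpha> where "\<alpha> \<in> R" by fastforce
  with empty(3) show ?case using MI_subset[of B R b "{\<alpha>}"] by auto
next
  case (insert c X)
  then have "R \<noteq> {}" by auto
  then obtain \<gamma> where \<gamma>: "\<gamma> \<in> R" "MI (insert c B) (R - {\<gamma>}) b"
    using MI_insert[OF insert.prems(1) _ insert.prems(3)] by blast
  have "card X < card (R - {\<gamma>})" using insert.prems(1,2) insert.hyps \<gamma>(1) by simp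
  then obtain \<alpha> where "\<alpha> \<in> R - {\<gamma>}" "MI (insert c B \<union> X) {\<alpha>} b"
    using insert.IH[OF _ _ \<gamma>(2)] insert.prems(1) by blast
  then show ?case by auto
qed

text \<open>If \<open>z\<close> separated the two members, then by indiscernibility any two members
  of the sequence would be separated by some element of a finite set \<open>X\<close>. But they can
  induce only finitely many subsets of \<open>X\<close>.\<close>

lemma MI_algebraic:
  assumes MI: "MI B {\<alpha>} b" and P: "D B P" and z: "z \<in> acl B"
  shows "P (case_nat z (b \<alpha> 0)) = P (case_nat z (b \<alpha> 1))"
proof (rule ccontr)
  assume ne: "P (case_nat z (b \<alpha> 0)) \<noteq> P (case_nat z (b \<alpha> 1))"
  obtain X where X: "D B (\<lambda>e. X (e 0))" "finite {x. X x}" "X z" using z unfolding acl_def by blast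
  define \<Theta> where "\<Theta> e \<longleftrightarrow> (\<exists>y. X y \<and> \<not> (P (case_nat y (\<lambda>l. e (enc \<alpha> 0 l))) \<longleftrightarrow> P (case_nat y (\<lambda>l. e (enc \<alpha> 1 l)))))" for e
  have \<Theta>: "D B \<Theta>"
  proof -
    have k: "kfun B (\<lambda>e. case_nat (e 0) (\<lambda>m. e (Suc (enc \<alpha> k m))) i)" for k i
      by (cases i) (simp_all add: kfun_var)
    note DP = D_subst[OF P, of "\<lambda>i e. case_nat (e 0) (\<lambda>m. e (Suc (enc \<alpha> k m))) i" for k, OF k]
    show ?thesis unfolding \<Theta>_def[abs_def] by (intro D_ex D_conj D_not D_iff DP X(1))
  qed
  define cfg where "cfg q q' \<beta> k = (if k = 0 then q else q' :: rat)" for q q' and \<beta> k :: nat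
  have \<Theta>pb: "\<Theta> (pb {\<alpha>} b (cfg q q')) \<longleftrightarrow> (\<exists>y. X y \<and> P (case_nat y (b \<alpha> q)) \<noteq> P (case_nat y (b \<alpha> q')))" for q q'
    unfolding \<Theta>_def by (simp add: pb_def cfg_def)
  have "\<Theta> (pb {\<alpha>} b (cfg 0 1))" unfolding \<Theta>pb using ne X(3) by blast
  then have sep: "\<exists>y. X y \<and> P (case_nat y (b \<alpha> q)) \<noteq> P (case_nat y (b \<alpha> q'))" if "q < q'" for q q'
    using MI_D[OF MI \<Theta>, of "cfg 0 1" "cfg q q'"] that unfolding \<Theta>pb by (auto simp: cfg_def)
  define S where "S q = {y. X y \<and> P (case_nat y (b \<alpha> q))}" for q
  have "inj S"
  proof (rule injI)
    fix q q' assume "S q = S q'"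
    then have "X y \<Longrightarrow> P (case_nat y (b \<alpha> q)) = P (case_nat y (b \<alpha> q'))" for y unfolding S_def by auto
    then show "q = q'" using sep[of q q'] sep[of q' q] by (metis linorder_neqE)
  qed
  moreover have "finite (range S)"
    by (rule finite_subset[of _ "Pow {x. X x}"]) (use X(2) in \<open>auto simp: S_def\<close>)
  ultimately have "finite (UNIV :: rat set)" by (metis finite_imageD)
  then show False using infinite_UNIV_char_0 by blast
qed

end

section \<open>Extraction of indiscernible sequences\<close>

lemma Ramsey_family:
  fixes c :: "'t \<Rightarrow> nat set \<Rightarrow> bool"
  assumes "finite T" "infinite Z"
  shows "\<exists>H. H \<subseteq> Z \<and> infinite H \<and> (\<forall>i\<in>T. \<exists>t. \<forall>X. X \<subseteq> H \<and> finite X \<and> card X = r \<longrightarrow> c i X = t)"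
  using assms(1)
proof (induction T rule: finite_induct)
  case empty
  with assms(2) show ?case by blast
next
  case (insert i T)
  then obtain H where H: "H \<subseteq> Z" "infinite H" "\<forall>i\<in>T. \<exists>t. \<forall>X. X \<subseteq> H \<and> finite X \<and> card X = r \<longrightarrow> c i X = t" by blast
  have "\<exists>Y t. Y \<subseteq> H \<and> infinite Y \<and> t < 2 \<and>
      (\<forall>X. X \<subseteq> Y \<and> finite X \<and> card X = r \<longrightarrow> (if c i X then 1 else 0) = (t :: nat))"
    by (rule Ramsey[OF H(2)]) auto
  then obtain Y t where Y: "Y \<subseteq> H" "infinite Y"
    "\<forall>X. X \<subseteq> Y \<and> finite X \<and> card X = r \<longrightarrow> (if c i X then 1 else 0) = (t :: nat)" by blast
  have "\<forall>X. X \<subseteq> Y \<and> finite X \<and> card X = r \<longrightarrow> c i X = (t = 1)"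
  proof (intro allI impI)
    fix X assume "X \<subseteq> Y \<and> finite X \<and> card X = r"
    with Y(3) have "(if c i X then 1 else 0) = t" by blast
    then show "c i X = (t = 1)" by (auto split: if_splits)
  qed
  moreover have "\<exists>t. \<forall>X. X \<subseteq> Y \<and> finite X \<and> card X = r \<longrightarrow> c j X = t" if "j \<in> T" for j
  proof -
    obtain t where "\<forall>X. X \<subseteq> H \<and> finite X \<and> card X = r \<longrightarrow> c j X = t" using H(3) \<open>j \<in> T\<close> by blast
    then show ?thesis using Y(1) by (intro exI[of _ t]) blast
  qed
  ultimately have "\<forall>j\<in>insert i T. \<exists>t. \<forall>X. X \<subseteq> Y \<and> finite X \<and> card X = r \<longrightarrow> c j X = t" by blast
  with H(1) Y(1,2) show ?case by blast
qed

lemma sorted_list_of_image: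
  fixes h :: "nat \<Rightarrow> nat"
  assumes "\<And>j k. j < k \<Longrightarrow> k < n \<Longrightarrow> h j < h k"
  shows "sorted_list_of_set (h ` {..<n}) = map h [0..<n]"
proof -
  have "sorted_wrt (<) (map h [0..<n])"
    using assms by (auto simp: sorted_wrt_map sorted_wrt_iff_nth_less)
  then have "sorted (map h [0..<n])" "distinct (map h [0..<n])" by (simp_all add: strict_sorted_iff)
  then have "sorted_list_of_set (set (map h [0..<n])) = map h [0..<n]"
    by (rule sorted_list_of_set.idem_if_sorted_distinct)
  then show ?thesis by (simp add: atLeast0LessThan)
qed

lemma extend_strict_mono:
  fixes h :: "nat \<Rightarrow> rat"
  assumes "finite T" "\<forall>s\<in>T. \<forall>t\<in>T. s < t \<longrightarrow> h s < h t"
  shows "\<exists>f. strict_mono f \<and> (\<forall>t\<in>T. f t = h t)"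
  using assms
proof (induction T rule: finite_linorder_max_induct)
  case empty
  have "strict_mono (of_nat :: nat \<Rightarrow> rat)" by (simp add: strict_mono_def)
  then show ?case by blast
next
  case (insert b T)
  then obtain f where f: "strict_mono f" "\<forall>t\<in>T. f t = h t" by blast
  show ?case
  proof (cases "T = {}")
    case True
    have "strict_mono (\<lambda>i. h b + of_nat i - of_nat b :: rat)" by (simp add: strict_mono_def)
    with True show ?thesis by (intro exI[of _ "\<lambda>i. h b + of_nat i - of_nat b"]) simp
  next
    case False
    define m where "m = Max T"
    have m: "m \<in> T" "m < b" "\<And>t. t \<in> T \<Longrightarrow> t \<le> m"
      using False insert.hyps unfolding m_def by (simp_all)
    define c where "c = (h b - f m) / (of_nat b - of_nat m)"
    have c: "0 < c" "f m + c * (of_nat b - of_nat m) = h b"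
      using m(1,2) insert.prems f(2) unfolding c_def by simp_all
    define f' where "f' i = (if i \<le> m then f i else f m + c * (of_nat i - of_nat m))" for i
    have "strict_mono f'"
    proof (rule strict_monoI)
      fix x y :: nat assume xy: "x < y"
      consider "y \<le> m" | "x \<le> m" "m < y" | "m < x" using xy by linarith
      then show "f' x < f' y"
      proof cases
        case 1
        then show ?thesis using xy f(1) by (simp add: f'_def strict_mono_def)
      next
        case 2
        have "f x \<le> f m" using f(1) 2(1) by (simp add: strict_mono_less_eq)
        moreover have "0 < c * (of_nat y - of_nat m)" using c(1) 2(2) by simp
        ultimately show ?thesis using 2 by (simp add: f'_def)
      next
        case 3
        then show ?thesis using xy c(1) by (simp add: f'_def)
      qed
    qed
    moreover have "\<forall>t\<in>insert b T. f' t = h t" using m(2,3) f(2) c(2) by (auto simp: f'_def)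
    ultimately show ?thesis by blast
  qed
qed

definition rank :: "(nat \<Rightarrow> rat) \<Rightarrow> nat \<Rightarrow> nat \<Rightarrow> nat" where
  "rank \<iota> N k = card {i. i < N \<and> \<iota> i < \<iota> k}"

lemma rank_less_iff:
  assumes "j < N" "k < N"
  shows "rank \<iota> N j < rank \<iota> N k \<longleftrightarrow> \<iota> j < \<iota> k"
proof
  assume "\<iota> j < \<iota> k"
  then have "{i. i < N \<and> \<iota> i < \<iota> j} \<subset> {i. i < N \<and> \<iota> i < \<iota> k}" using assms(1) by auto
  then show "rank \<iota> N j < rank \<iota> N k" unfolding rank_def by (intro psubset_card_mono) auto
next
  assume *: "rank \<iota> N j < rank \<iota> N k"
  show "\<iota> j < \<iota> k"
  proof (rule ccontr)
    assume "\<not> \<iota> j < \<iota> k"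
    then have "{i. i < N \<and> \<iota> i < \<iota> k} \<subseteq> {i. i < N \<and> \<iota> i < \<iota> j}" by auto
    then have "rank \<iota> N k \<le> rank \<iota> N j" unfolding rank_def by (intro card_mono) auto
    with * show False by simp
  qed
qed

lemma strict_mono_rank: "\<exists>f. strict_mono f \<and> (\<forall>k<N. f (rank \<iota> N k) = \<iota> k)"
proof -
  define h where "h t = \<iota> (SOME k. k < N \<and> rank \<iota> N k = t)" for t
  have h: "h (rank \<iota> N k) = \<iota> k" if k: "k < N" for k
  proof -
    define j where "j = (SOME j. j < N \<and> rank \<iota> N j = rank \<iota> N k)"
    have j: "j < N \<and> rank \<iota> N j = rank \<iota> N k" unfolding j_def by (rule someI[of _ k]) (simp add: k)
    then have "\<iota> j = \<iota> k"
      using rank_less_iff[of j N k \<iota>] rank_less_iff[of k N j \<iota>] k by (metis less_irrefl linorder_neqE)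
    then show ?thesis unfolding h_def j_def by simp
  qed
  have "\<exists>f. strict_mono f \<and> (\<forall>t\<in>rank \<iota> N ` {..<N}. f t = h t)"
    by (rule extend_strict_mono) (auto simp: h rank_less_iff)
  then show ?thesis using h by auto
qed

context fo_language
begin

text \<open>A finite list of indices arises from a strictly increasing one by composing with
  \<open>rank\<close>, which amounts to a renaming of variables. So increasing lists
  suffice.\<close>

lemma MI_strict:
  assumes *: "\<And>P \<iota> \<iota>'. D B P \<Longrightarrow> (\<forall>\<alpha>. strict_mono (\<iota> \<alpha>) \<and> strict_mono (\<iota>' \<alpha>)) \<Longrightarrow> P (pb R b \<iota>) = P (pb R b \<iota>')"
  shows "MI B R b"
  unfolding MI_def
proof (intro allI impI)
  fix P and \<iota> \<iota>' :: "nat \<Rightarrow> nat \<Rightarrow> rat"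
  assume P: "D B P" and iso: "\<forall>\<alpha>\<in>R. \<forall>i k. \<iota> \<alpha> i < \<iota> \<alpha> k \<longleftrightarrow> \<iota>' \<alpha> i < \<iota>' \<alpha> k"
  obtain N where N: "\<And>e e'. (\<And>i. i < N \<Longrightarrow> e i = e' i) \<Longrightarrow> P e = P e'" using D_support[OF P] by blast
  define r where "r m = enc (row m) (rank (\<iota> (row m)) N (pos m)) (crd m)" for m
  have rank: "rank (\<iota> \<alpha>) N k = rank (\<iota>' \<alpha>) N k" if "\<alpha> \<in> R" for \<alpha> k using iso that unfolding rank_def by simp
  have "\<exists>f. \<forall>\<alpha>. strict_mono (f \<alpha>) \<and> (\<forall>k<N. f \<alpha> (rank (\<iota> \<alpha>) N k) = \<iota> \<alpha> k)" for \<iota> :: "nat \<Rightarrow> nat \<Rightarrow> rat"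
    by (intro choice allI strict_mono_rank)
  then obtain f f' where f: "\<And>\<alpha>. strict_mono (f \<alpha>)" "\<And>\<alpha> k. k < N \<Longrightarrow> f \<alpha> (rank (\<iota> \<alpha>) N k) = \<iota> \<alpha> k"
    and f': "\<And>\<alpha>. strict_mono (f' \<alpha>)" "\<And>\<alpha> k. k < N \<Longrightarrow> f' \<alpha> (rank (\<iota>' \<alpha>) N k) = \<iota>' \<alpha> k" by metis
  have pos: "pos m < N" if "m < N" for m using pos_le[of m] that by simp
  have "P (pb R b \<iota>) = P (\<lambda>m. pb R b f (r m))"
    by (intro N) (auto simp: pb_def r_def f(2) pos)
  also have "\<dots> = P (\<lambda>m. pb R b f' (r m))"
    using *[OF D_rename[OF P, of r], of f f'] f(1) f'(1) by blast
  also have "\<dots> = P (pb R b \<iota>')"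
    by (intro N) (auto simp: pb_def r_def rank f'(2) pos)
  finally show "P (pb R b \<iota>) = P (pb R b \<iota>')" .
qed

end

context acvf
begin

text \<open>By saturation, finitely many instances of indiscernibility have to be satisfied inside
  the given pattern. Ramsey's theorem makes them hold along an infinite \<open>H\<close>, and each
  sequence takes its indices from an interval of \<open>H\<close> of its own, which turns
  homogeneity of a single set into mutual indiscernibility.\<close>

lemma indiscernible_pattern:
  fixes b0 :: "nat \<Rightarrow> nat \<Rightarrow> nat \<Rightarrow> 'a"
  assumes A: "countable A" and Y: "D A Y"
    and \<Phi>: "\<And>\<alpha>. \<alpha> < n \<Longrightarrow> D A (\<lambda>e. \<Phi> \<alpha> (\<lambda>i. e (2 * i)) (\<lambda>i. e (Suc (2 * i))))"
    and pat: "\<And>\<eta> :: nat \<Rightarrow> nat. \<exists>x. Y x \<and> (\<forall>\<alpha><n. \<forall>i. \<Phi> \<alpha> x (b0 \<alpha> i) \<longleftrightarrow> i = \<eta> \<alpha>)"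
  shows "\<exists>x b. Y x \<and> MI A {..<n} b \<and> (\<forall>\<alpha><n. \<Phi> \<alpha> x (b \<alpha> 0) \<and> \<not> \<Phi> \<alpha> x (b \<alpha> 1))"
proof -
  let ?R = "{..<n}"
  \<comment> \<open>The realization is stored in row \<open>n\<close>, which no sequence with index
    below \<open>n\<close> occupies; rational indices are coded by natural numbers.\<close>
  define xx where "xx e i = e (enc n 0 i)" for e :: "nat \<Rightarrow> 'a" and i
  define bb where "bb e \<alpha> q l = e (enc \<alpha> (to_nat q) l)" for e :: "nat \<Rightarrow> 'a" and \<alpha> and q :: rat and l
  define Tri :: "(((nat \<Rightarrow> 'a) \<Rightarrow> bool) \<times> (nat \<Rightarrow> nat \<Rightarrow> rat) \<times> (nat \<Rightarrow> nat \<Rightarrow> rat)) set" where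
    "Tri = {(P, \<iota>, \<iota>'). D A P \<and> (\<forall>\<alpha>. strict_mono (\<iota> \<alpha>) \<and> strict_mono (\<iota>' \<alpha>))}"
  define ax :: "((nat \<Rightarrow> 'a) \<Rightarrow> bool) \<times> (nat \<Rightarrow> nat \<Rightarrow> rat) \<times> (nat \<Rightarrow> nat \<Rightarrow> rat) \<Rightarrow> (nat \<Rightarrow> 'a) \<Rightarrow> bool" where
    "ax = (\<lambda>(P, \<iota>, \<iota>') e. P (pb ?R (bb e) \<iota>) = P (pb ?R (bb e) \<iota>'))"
  define \<Sigma>1 where "\<Sigma>1 = insert (\<lambda>e. Y (xx e)) ((\<lambda>\<alpha> e. \<Phi> \<alpha> (xx e) (bb e \<alpha> 0) \<and> \<not> \<Phi> \<alpha> (xx e) (bb e \<alpha> 1)) ` ?R)"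
  have "\<exists>e. \<forall>P\<in>\<Sigma>1 \<union> ax ` Tri. P e"
  proof (rule saturated_countable[OF A])
    fix S assume "S \<in> \<Sigma>1 \<union> ax ` Tri"
    then consider "S = (\<lambda>e. Y (xx e))"
      | \<alpha> where "\<alpha> < n" "S = (\<lambda>e. \<Phi> \<alpha> (xx e) (bb e \<alpha> 0) \<and> \<not> \<Phi> \<alpha> (xx e) (bb e \<alpha> 1))"
      | P \<iota> \<iota>' where "D A P" "S = ax (P, \<iota>, \<iota>')"
      unfolding \<Sigma>1_def Tri_def by blast
    then show "D A S"
    proof cases
      case 1
      show ?thesis unfolding 1 xx_def[abs_def] using D_rename[OF Y, of "\<lambda>i. enc n 0 i"] .
    next
      case 2
      have "D A (\<lambda>e. \<Phi> \<alpha> (xx e) (bb e \<alpha> q))" for q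
        using D_rename[OF \<Phi>[OF 2(1)], of "\<lambda>k. if even k then enc n 0 (k div 2) else enc \<alpha> (to_nat q) (k div 2)"]
        unfolding xx_def[abs_def] bb_def[abs_def] by simp
      then show ?thesis unfolding 2(2) by (intro D_conj D_not)
    next
      case 3
      have "kfun A (\<lambda>e. pb ?R (bb e) \<iota> m)" for \<iota> m
        by (cases "row m < n") (simp_all add: pb_def bb_def kfun_var kfun_const)
      from D_subst[OF 3(1), of "\<lambda>m e. pb ?R (bb e) \<iota> m" for \<iota>, OF this]
      show ?thesis unfolding 3(2) ax_def prod.case by (intro D_iff)
    qed
  next
    fix T assume T: "T \<subseteq> \<Sigma>1 \<union> ax ` Tri" "finite T"
    have "T - \<Sigma>1 \<subseteq> ax ` Tri" "finite (T - \<Sigma>1)" using T by auto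
    then obtain Tr where Tr: "Tr \<subseteq> Tri" "finite Tr" "T - \<Sigma>1 = ax ` Tr"
      using finite_subset_image[of "T - \<Sigma>1" ax Tri] by metis
    have "\<exists>N. \<forall>e e'. (\<forall>i<N. e i = e' i) \<longrightarrow> fst p e = fst p e'" if p: "p \<in> Tr" for p
    proof -
      have "D A (fst p)" using p Tr(1) unfolding Tri_def by auto
      then obtain N where N: "\<And>e e'. (\<And>i. i < N \<Longrightarrow> e i = e' i) \<Longrightarrow> fst p e = fst p e'" using D_support by blast
      show ?thesis by (intro exI[of _ N] allI impI, rule N) blast
    qed
    then have "\<exists>Nf. \<forall>p\<in>Tr. \<forall>e e'. (\<forall>i<Nf p. e i = e' i) \<longrightarrow> fst p e = fst p e'" by (intro bchoice ballI)
    then obtain Nf where Nf: "\<And>p e e'. p \<in> Tr \<Longrightarrow> \<forall>i<Nf p. e i = e' i \<Longrightarrow> fst p e = fst p e'" by blast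
    define N where "N = Max (insert 1 (Nf ` Tr))"
    have N0: "0 < N" and NN: "\<And>p. p \<in> Tr \<Longrightarrow> Nf p \<le> N" using Tr(2) unfolding N_def by (auto simp: Max_gr_iff)
    have N: "fst p e = fst p e'" if "p \<in> Tr" "\<forall>i<N. e i = e' i" for p e e'
      using that NN[OF that(1)] by (intro Nf) auto
    define F where "F = {0, 1} \<union> (\<Union>(P, \<iota>, \<iota>')\<in>Tr. \<Union>\<alpha><n. \<iota> \<alpha> ` {..<N} \<union> \<iota>' \<alpha> ` {..<N})"
    have finF: "finite F" unfolding F_def using Tr(2) by auto
    \<comment> \<open>A set of \<open>n * N\<close> elements is cut in increasing order into
      \<open>n\<close> pieces of length \<open>N\<close>, and the piece number
      \<open>\<alpha>\<close> lists the indices of the sequence \<open>\<alpha>\<close>.\<close>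
    define c where "c p X \<longleftrightarrow> fst p (pb ?R b0 (\<lambda>\<alpha> k. sorted_list_of_set X ! (\<alpha> * N + k)))"
      for p :: "((nat \<Rightarrow> 'a) \<Rightarrow> bool) \<times> (nat \<Rightarrow> nat \<Rightarrow> rat) \<times> (nat \<Rightarrow> nat \<Rightarrow> rat)" and X
    obtain H where H: "infinite H" "\<forall>p\<in>Tr. \<exists>t. \<forall>X. X \<subseteq> H \<and> finite X \<and> card X = n * N \<longrightarrow> c p X = t"
      using Ramsey_family[OF Tr(2) infinite_UNIV_nat, of "n * N" c] by auto
    define rk where "rk q = card {p \<in> F. p < q}" for q
    have rk_less: "rk q < rk q'" if "q \<in> F" "q < q'" for q q'
      unfolding rk_def using that finF by (intro psubset_card_mono) auto
    have rk_bound: "rk q < card F" if "q \<in> F" for q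
      unfolding rk_def using that finF by (intro psubset_card_mono) auto
    define g where "g \<alpha> q = enumerate H (\<alpha> * card F + rk q)" for \<alpha> q
    have gH: "g \<alpha> q \<in> H" for \<alpha> q unfolding g_def using H(1) by (rule enumerate_in_set)
    have g_less: "g \<alpha> q < g \<beta> q'" if "q \<in> F" "\<alpha> < \<beta> \<or> \<alpha> = \<beta> \<and> q < q'" for \<alpha> \<beta> q q'
      unfolding g_def
    proof (rule enumerate_mono[OF _ H(1)])
      show "\<alpha> * card F + rk q < \<beta> * card F + rk q'"
      proof (cases "\<alpha> < \<beta>")
        case True
        then have "Suc \<alpha> * card F \<le> \<beta> * card F" by (intro mult_le_mono1) simp
        then show ?thesis using rk_bound[OF that(1)] by simp
      next
        case False
        then show ?thesis using that rk_less by simp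
      qed
    qed
    \<comment> \<open>The path runs through \<open>g \<alpha> 0\<close> in row
      \<open>\<alpha>\<close>, so that index 0 satisfies \<open>\<Phi>\<close> and index 1 does
      not.\<close>
    obtain x where x: "Y x" "\<And>\<alpha> i. \<alpha> < n \<Longrightarrow> \<Phi> \<alpha> x (b0 \<alpha> i) \<longleftrightarrow> i = g \<alpha> 0"
      using pat[of "\<lambda>\<alpha>. g \<alpha> 0"] by blast
    define e where "e m = (if row m < n then b0 (row m) (g (row m) (from_nat (pos m))) (crd m) else x (crd m))" for m
    have xe: "xx e = x" unfolding xx_def[abs_def] e_def by simp
    have be: "bb e \<alpha> q = b0 \<alpha> (g \<alpha> q)" if "\<alpha> < n" for \<alpha> q
      unfolding bb_def[abs_def] e_def using that by simp
    have S1: "S e" if "S \<in> \<Sigma>1" for S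
    proof -
      have "\<Phi> \<alpha> (xx e) (bb e \<alpha> 0) \<and> \<not> \<Phi> \<alpha> (xx e) (bb e \<alpha> 1)" if "\<alpha> < n" for \<alpha>
        using g_less[of 0 \<alpha> \<alpha> 1] x(2)[OF that] unfolding xe be[OF that] by (auto simp: F_def)
      then show ?thesis using that x(1) unfolding \<Sigma>1_def by (auto simp: xe)
    qed
    have S2: "ax p e" if p: "p \<in> Tr" for p
    proof -
      obtain P \<iota> \<iota>' where pp: "p = (P, \<iota>, \<iota>')" by (cases p)
      have "\<exists>t. \<forall>X. X \<subseteq> H \<and> finite X \<and> card X = n * N \<longrightarrow> c p X = t" using H(2) p by (rule bspec)
      then obtain t where t: "\<forall>X. X \<subseteq> H \<and> finite X \<and> card X = n * N \<longrightarrow> c p X = t" by (rule exE)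
      have "P (pb ?R (bb e) \<kappa>) = t" if \<kappa>: "\<kappa> = \<iota> \<or> \<kappa> = \<iota>'" for \<kappa>
      proof -
        have mono: "strict_mono (\<kappa> \<alpha>)" for \<alpha> using p \<kappa> Tr(1) unfolding pp Tri_def by auto
        have inF: "\<kappa> \<alpha> k \<in> F" if "\<alpha> < n" "k < N" for \<alpha> k
          using p \<kappa> that unfolding pp F_def by fastforce
        define h where "h j = g (j div N) (\<kappa> (j div N) (j mod N))" for j
        have h: "h j < h k" if "j < k" "k < n * N" for j k
        proof -
          have "j div N < n" "j mod N < N" using that N0 by (auto simp: less_mult_imp_div_less)
          moreover have "j div N < k div N \<or> j div N = k div N \<and> j mod N < k mod N"
          proof (cases "j div N = k div N")
            case True
            then show ?thesis using that(1) by (metis add_less_cancel_left div_mult_mod_eq)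
          next
            case False
            then show ?thesis using div_le_mono[of j k N] that(1) by simp
          qed
          ultimately show ?thesis
            unfolding h_def using mono inF by (intro g_less) (auto simp: strict_mono_def)
        qed
        have sl: "sorted_list_of_set (h ` {..<n * N}) = map h [0..<n * N]" using h by (rule sorted_list_of_image)
        have "inj_on h {..<n * N}"
          by (rule linorder_inj_onI') (use h in \<open>force\<close>)
        then have "card (h ` {..<n * N}) = n * N" by (simp add: card_image)
        then have "c p (h ` {..<n * N}) = t" using gH by (intro t[rule_format]) (auto simp: h_def)
        moreover have "P (pb ?R (bb e) \<kappa>) = c p (h ` {..<n * N})"
        proof -
          have "pb ?R (bb e) \<kappa> m = pb ?R b0 (\<lambda>\<alpha> k. sorted_list_of_set (h ` {..<n * N}) ! (\<alpha> * N + k)) m" if m: "m < N" for m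
          proof (cases "row m < n")
            case True
            have k: "pos m < N" using pos_le[of m] m by simp
            have "row m * N + pos m < Suc (row m) * N" using k by simp
            also have "\<dots> \<le> n * N" using True by (intro mult_le_mono1) simp
            finally have "map h [0..<n * N] ! (row m * N + pos m) = h (row m * N + pos m)" by simp
            moreover have "h (row m * N + pos m) = g (row m) (\<kappa> (row m) (pos m))" unfolding h_def using k by simp
            ultimately show ?thesis unfolding pb_def sl using True be by simp
          qed (simp add: pb_def)
          then show ?thesis unfolding c_def using N[OF p] unfolding pp by simp
        qed
        ultimately show ?thesis by simp
      qed
      then show ?thesis unfolding ax_def pp by simp
    qed
    have "P e" if "P \<in> T" for P
    proof (cases "P \<in> \<Sigma>1")
      case True
      then show ?thesis by (rule S1)
    next
      case False
      then have "P \<in> ax ` Tr" using that Tr(3) by blast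
      then show ?thesis using S2 by blast
    qed
    then show "\<exists>e. \<forall>P\<in>T. P e" by blast
  qed
  then obtain e where e: "\<And>P. P \<in> \<Sigma>1 \<Longrightarrow> P e" "\<And>p. p \<in> Tri \<Longrightarrow> ax p e" by blast
  have "MI A ?R (bb e)"
  proof (rule MI_strict)
    fix P and \<iota> \<iota>' :: "nat \<Rightarrow> nat \<Rightarrow> rat"
    assume "D A P" "\<forall>\<alpha>. strict_mono (\<iota> \<alpha>) \<and> strict_mono (\<iota>' \<alpha>)"
    then have "(P, \<iota>, \<iota>') \<in> Tri" unfolding Tri_def by simp
    then show "P (pb ?R (bb e) \<iota>) = P (pb ?R (bb e) \<iota>')" using e(2) unfolding ax_def by fastforce
  qed
  moreover have "Y (xx e)" using e(1) unfolding \<Sigma>1_def by blast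
  moreover have "\<Phi> \<alpha> (xx e) (bb e \<alpha> 0) \<and> \<not> \<Phi> \<alpha> (xx e) (bb e \<alpha> 1)" if "\<alpha> < n" for \<alpha>
  proof -
    have "(\<lambda>e. \<Phi> \<alpha> (xx e) (bb e \<alpha> 0) \<and> \<not> \<Phi> \<alpha> (xx e) (bb e \<alpha> 1)) \<in> \<Sigma>1" using that unfolding \<Sigma>1_def by blast
    from e(1)[OF this] show ?thesis .
  qed
  ultimately show ?thesis by blast
qed

lemma no_pattern_algebraic:
  fixes b0 :: "nat \<Rightarrow> nat \<Rightarrow> nat \<Rightarrow> 'a"
  assumes A: "countable A" and Y: "D A Y"
    and \<Phi>: "\<And>\<alpha>. \<alpha> < n \<Longrightarrow> D A (\<lambda>e. \<Phi> \<alpha> (\<lambda>i. e (2 * i)) (\<lambda>i. e (Suc (2 * i))))"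
    and dep: "\<And>\<alpha> x x' b. (\<And>i. i < n \<Longrightarrow> x i = x' i) \<Longrightarrow> \<Phi> \<alpha> x b = \<Phi> \<alpha> x' b"
    and pat: "\<And>\<eta> :: nat \<Rightarrow> nat. \<exists>x. Y x \<and> (\<forall>\<alpha><n. \<forall>i. \<Phi> \<alpha> x (b0 \<alpha> i) \<longleftrightarrow> i = \<eta> \<alpha>)"
    and alg: "\<And>x. Y x \<Longrightarrow> \<exists>i<n. x i \<in> acl (A \<union> x ` ({..<n} - {i}))"
  shows False
proof -
  obtain x b where xb: "Y x" "MI A {..<n} b" "\<And>\<alpha>. \<alpha> < n \<Longrightarrow> \<Phi> \<alpha> x (b \<alpha> 0) \<and> \<not> \<Phi> \<alpha> x (b \<alpha> 1)"
    using indiscernible_pattern[OF A Y, of n \<Phi> b0, OF \<Phi> pat] by blast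
  obtain i where i: "i < n" "x i \<in> acl (A \<union> x ` ({..<n} - {i}))" using alg[OF xb(1)] by blast
  let ?X = "x ` ({..<n} - {i})"
  have "card ?X \<le> card ({..<n} - {i})" by (rule card_image_le) simp
  also have "\<dots> < card {..<n}" using i(1) by simp
  finally obtain \<alpha> where \<alpha>: "\<alpha> < n" "MI (A \<union> ?X) {\<alpha>} b"
    using MI_finite[of ?X "{..<n}" A b] xb(2) by auto
  define P where "P e \<longleftrightarrow> \<Phi> \<alpha> (\<lambda>j. if j = i then e 0 else if j < n then x j else 0) (\<lambda>l. e (Suc l))" for e
  have "kfun (A \<union> ?X) (\<lambda>e. if even k then if k div 2 = i then e 0 else if k div 2 < n then x (k div 2) else 0
      else e (Suc (k div 2)))" for k
    by (cases "even k"; cases "k div 2 = i"; cases "k div 2 < n") (auto intro!: kfun_var kfun_const)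
  from D_subst[OF D_mono[OF \<Phi>[OF \<alpha>(1)]], of "A \<union> ?X" "\<lambda>k e. if even k then if k div 2 = i then e 0
      else if k div 2 < n then x (k div 2) else 0 else e (Suc (k div 2))", OF _ this]
  have DP: "D (A \<union> ?X) P" unfolding P_def[abs_def] by (simp cong: if_cong)
  have "P (case_nat (x i) b) \<longleftrightarrow> \<Phi> \<alpha> x b" for b
    unfolding P_def by (simp, rule dep) simp
  then show False using MI_algebraic[OF \<alpha>(2) DP i(2)] xb(3)[OF \<alpha>(1)] by blast
qed

end

section \<open>Strict differentiability\<close>

context fo_language
begin

lemma D_sat:
  assumes "wf_fm M \<phi>" shows "D A (\<lambda>e. sat M e \<phi>)"
proof -
  obtain \<psi> where "wf_fm M \<psi>" "\<And>e. sat M e \<psi> \<longleftrightarrow> sat M (\<lambda>i. e (2 * i)) \<phi>"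
    using sat_rename[OF assms] by blast
  then show ?thesis unfolding D_def by (intro exI[of _ \<psi>] exI[of _ "\<lambda>_. 0"]) auto
qed

text \<open>The convention under which vectors are read as assignments: 0 from position
  \<open>n\<close> on.\<close>

definition trunc :: "nat \<Rightarrow> (nat \<Rightarrow> 'a) \<Rightarrow> nat \<Rightarrow> 'a" where
  "trunc n e i = (if i < n then e i else 0)"

lemma trunc_assign: "x \<in> carrier_vec n \<Longrightarrow> trunc n (assign x e) = assign x (\<lambda>_. 0)"
  by (auto simp: trunc_def assign_def)

lemma assign_vec: "assign (vec n e) (\<lambda>_. 0) = trunc n e"
  by (auto simp: trunc_def assign_def)

lemma D_trunc: "D A P \<Longrightarrow> D A (\<lambda>e. P (trunc n e))"
proof -
  assume P: "D A P"
  have "kfun A (\<lambda>e. trunc n e i)" for i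
    unfolding trunc_def by (intro kfun_if D_const kfun_var kfun_const) simp
  from D_subst[OF P, of "\<lambda>i e. trunc n e i", OF this] show ?thesis .
qed

text \<open>A coordinate of \<open>f\<close>, extended by 0 outside of \<open>U\<close>, is read off
  from the graph by quantifying over the values \<open>w\<close> of the last \<open>m\<close>
  entries.\<close>

lemma definable_map_kfun:
  assumes U: "D UNIV U" and f: "definable_map M n m {x \<in> carrier_vec n. U (assign x (\<lambda>_. 0))} f" and k: "k < m"
  shows "kfun UNIV (\<lambda>e. if U (trunc n e) then f (vec n e) $ k else 0)"
proof -
  let ?U = "{x \<in> carrier_vec n. U (assign x (\<lambda>_. 0))}"
  have fU: "f x \<in> carrier_vec m" if "x \<in> ?U" for x using f that unfolding definable_map_def by blast
  obtain G where G: "D UNIV G" "(\<lambda>x. x @\<^sub>v f x) ` ?U = {z \<in> carrier_vec (n + m). G (assign z (\<lambda>_. 0))}"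
    using definable_D f unfolding definable_map_def by blast
  define W where "W e w i = (if i < n then e (Suc i) else if i < n + m then w i else 0)" for e w :: "nat \<Rightarrow> 'a" and i
  define Q where "Q e w \<longleftrightarrow> G (W e w) \<and> w (n + k) = e 0" for e w
  have "kfun UNIV (\<lambda>e. W (\<lambda>i. e (Suc (2 * i))) (\<lambda>i. e (2 * i)) i)" for i
    unfolding W_def by (intro kfun_if D_const kfun_var kfun_const) simp
  from D_subst[OF G(1), of "\<lambda>i e. W (\<lambda>i. e (Suc (2 * i))) (\<lambda>i. e (2 * i)) i", OF this]
  have "D UNIV (\<lambda>e. Q (\<lambda>i. e (Suc (2 * i))) (\<lambda>i. e (2 * i)))"
    unfolding Q_def by (intro D_conj D_eq kfun_var)
  then have "D UNIV (\<lambda>e. \<exists>w. Q e w)" by (rule D_ex_env)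
  then have DQ: "D UNIV (\<lambda>e. (U (trunc n (\<lambda>i. e (Suc i))) \<and> (\<exists>w. Q e w)) \<or> (\<not> U (trunc n (\<lambda>i. e (Suc i))) \<and> e 0 = 0))"
    using D_rename[OF D_trunc[OF U, of n], where r = Suc] by (intro D_conj D_disj D_not D_eq kfun_var kfun_const) auto
  have "(\<exists>w. Q e w) \<longleftrightarrow> e 0 = f (vec n (\<lambda>i. e (Suc i))) $ k" if e: "U (trunc n (\<lambda>i. e (Suc i)))" for e
  proof -
    let ?x = "vec n (\<lambda>i. e (Suc i))"
    have x: "?x \<in> ?U" using e by (simp add: assign_vec)
    note fx = fU[OF x]
    show ?thesis
    proof
      assume "\<exists>w. Q e w"
      then obtain w where w: "G (W e w)" "w (n + k) = e 0" unfolding Q_def by blast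
      have "assign (vec (n + m) (W e w)) (\<lambda>_. 0) = W e w" by (auto simp: assign_def W_def)
      then have "vec (n + m) (W e w) \<in> (\<lambda>x. x @\<^sub>v f x) ` ?U" using w(1) unfolding G(2) by simp
      then obtain y where y: "y \<in> ?U" "vec (n + m) (W e w) = y @\<^sub>v f y" by blast
      then have yc: "y \<in> carrier_vec n" "f y \<in> carrier_vec m" using fU by auto
      have "y $ i = e (Suc i)" if "i < n" for i
      proof -
        have "vec (n + m) (W e w) $ i = (y @\<^sub>v f y) $ i" using y(2) by simp
        then show ?thesis using that yc by (simp add: W_def)
      qed
      then have "y = ?x" using yc by (intro eq_vecI) auto
      have "vec (n + m) (W e w) $ (n + k) = (y @\<^sub>v f y) $ (n + k)" using y(2) by simp
      then have "w (n + k) = f y $ k" using yc k by (simp add: W_def)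
      then show "e 0 = f ?x $ k" using w(2) \<open>y = ?x\<close> by simp
    next
      assume e0: "e 0 = f ?x $ k"
      define w where "w i = f ?x $ (i - n)" for i
      have "W e w = assign (?x @\<^sub>v f ?x) (\<lambda>_. 0)" using fx by (auto simp: W_def w_def assign_def)
      moreover have "G (assign (?x @\<^sub>v f ?x) (\<lambda>_. 0))"
      proof -
        have "?x @\<^sub>v f ?x \<in> (\<lambda>x. x @\<^sub>v f x) ` ?U" using x by (rule imageI)
        then show ?thesis unfolding G(2) by simp
      qed
      ultimately have "Q e w" unfolding Q_def using e0 by (simp add: w_def)
      then show "\<exists>w. Q e w" by blast
    qed
  qed
  then have "((U (trunc n (\<lambda>i. e (Suc i))) \<and> (\<exists>w. Q e w)) \<or> (\<not> U (trunc n (\<lambda>i. e (Suc i))) \<and> e 0 = 0)) =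
      (e 0 = (if U (trunc n (\<lambda>i. e (Suc i))) then f (vec n (\<lambda>i. e (Suc i))) $ k else 0))" for e
    by auto
  with DQ show ?thesis unfolding kfun_def by simp
qed

end

context acvf
begin

section \<open>Open sets of tuples and valuations of vectors\<close>

lemma openin_open_ball: "openin (valuation_topology v) (open_ball v c \<gamma>)"
  unfolding openin_valuation_topology
proof (intro ballI exI subsetI)
  fix a x assume "a \<in> open_ball v c \<gamma>" "x \<in> open_ball v a \<gamma>"
  then show "x \<in> open_ball v c \<gamma>" unfolding open_ball_def using v_trans_less by blast
qed

lemma open_vecI:
  assumes U: "U \<subseteq> carrier_vec n"
    and near: "\<And>x. x \<in> U \<Longrightarrow> \<exists>d. d \<noteq> 0 \<and> (\<forall>y\<in>carrier_vec n. (\<forall>i<n. v d < v (y $ i - x $ i)) \<longrightarrow> y \<in> U)"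
  shows "open_vec v n U"
  unfolding open_vec_def
proof (intro conjI U)
  let ?r = "\<lambda>x. restrict (vec_index x) {..<n}"
  have "\<exists>B. openin (product_topology (\<lambda>_. valuation_topology v) {..<n}) B \<and> p \<in> B \<and> B \<subseteq> ?r ` U" if p: "p \<in> ?r ` U" for p
  proof -
    obtain x where x: "x \<in> U" "p = ?r x" using p by blast
    obtain d where d: "d \<noteq> 0" "\<And>y. y \<in> carrier_vec n \<Longrightarrow> \<forall>i<n. v d < v (y $ i - x $ i) \<Longrightarrow> y \<in> U"
      using near[OF x(1)] by blast
    obtain \<gamma> where \<gamma>: "v d = Fin \<gamma>" using d(1) by (rule v_cases)
    define B where "B = Pi\<^sub>E {..<n} (\<lambda>i. open_ball v (x $ i) \<gamma>)"
    have "openin (product_topology (\<lambda>_. valuation_topology v) {..<n}) B"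
      unfolding B_def by (rule openin_PiE_gen[THEN iffD2]) (auto simp: openin_open_ball)
    moreover have "p \<in> B" unfolding B_def x(2) by (auto simp: open_ball_def)
    moreover have "B \<subseteq> ?r ` U"
    proof
      fix q assume q: "q \<in> B"
      have "vec n q \<in> U"
        using q unfolding B_def by (intro d(2)) (auto simp: \<gamma> open_ball_def PiE_iff)
      moreover have "q = ?r (vec n q)" using q unfolding B_def by (auto simp: PiE_iff extensional_def restrict_def)
      ultimately show "q \<in> ?r ` U" by blast
    qed
    ultimately show ?thesis by blast
  qed
  then show "openin (product_topology (\<lambda>_. valuation_topology v) {..<n}) (?r ` U)"
    by (subst openin_subopen) blast
qed

lemma less_val_vec_iff: "Fin \<gamma> < val_vec v x \<longleftrightarrow> (\<forall>i<dim_vec x. Fin \<gamma> < v (x $ i))"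
  unfolding val_vec_def by (subst Min_gr_iff) auto

lemma val_vec_attained:
  assumes "x \<noteq> 0\<^sub>v n" "x \<in> carrier_vec n"
  shows "\<exists>w. w \<noteq> 0 \<and> val_vec v x = v w \<and> (\<forall>i<n. v w \<le> v (x $ i))"
proof -
  let ?S = "insert Pinf ((\<lambda>i. v (x $ i)) ` {..<dim_vec x})"
  obtain j where j: "j < n" "x $ j \<noteq> 0" using assms by (metis carrier_vecD eq_vecI index_zero_vec)
  have fin: "finite ?S" by simp
  have le: "Min ?S \<le> v (x $ i)" if "i < n" for i using assms(2) that by (intro Min_le) auto
  have "Min ?S \<in> ?S" using fin by (intro Min_in) auto
  moreover have "Min ?S \<noteq> Pinf" using le[OF j(1)] v_less_Pinf[OF j(2)] by auto
  ultimately obtain i where "i < n" "Min ?S = v (x $ i)" using assms(2) by auto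
  then show ?thesis using le \<open>Min ?S \<noteq> Pinf\<close> unfolding val_vec_def by (intro exI[of _ "x $ i"]) auto
qed

lemma v_sum_less: "b \<noteq> 0 \<Longrightarrow> (\<And>j. j \<in> J \<Longrightarrow> v b < v (g j)) \<Longrightarrow> v b < v (sum g J)"
  by (induction J rule: infinite_finite_induct) (auto simp: v_less_Pinf intro: v_add_less)

end

context complete_acvf
begin

section \<open>Joint partial quotients and strict differentiability\<close>

definition partial_quotient :: "((nat \<Rightarrow> 'a) \<Rightarrow> 'a) \<Rightarrow> nat \<Rightarrow> (nat \<Rightarrow> 'a) \<Rightarrow> 'a \<Rightarrow> 'a" where
  "partial_quotient f j x \<eta> = (f (x(j := x j + \<eta>)) - f x) / \<eta>"

lemma kfun_partial_quotient:
  assumes "kfun A f" "\<And>i. kfun A (\<sigma> i)" "kfun A H"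
  shows "kfun A (\<lambda>e. partial_quotient f j (\<lambda>i. \<sigma> i e) (H e))"
  unfolding partial_quotient_def by (intro kfun_intros kfun_subst[OF assms(1)] kfun_upd assms(2,3))

lemma D_joint:
  assumes I: "finite I" and f: "kfun A f"
  shows "D A (\<lambda>e. \<exists>s. joint I e (partial_quotient f j) s)"
proof -
  define Q where "Q = partial_quotient f j"
  have "kfun A (\<lambda>e. Q (\<lambda>i. e (Suc i)) (e 0))"
    unfolding Q_def by (intro kfun_partial_quotient[OF f] kfun_var)
  note Qs = kfun_env1[where P = Q, OF this]
  show ?thesis
    unfolding joint_def Q_def[symmetric] using I
    by (intro D_intros D_all_near Qs kfun_if D_const) simp_all
qed

lemma joint_partial_quotient:
  assumes SG: "SG A I a" and j: "j \<in> I" and f: "kfun A f" and char: "CHAR('a) = 0"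
  shows "\<exists>s. joint I a (partial_quotient f j) s"
proof -
  obtain s where "lim0 (partial_quotient f j a) s"
    using partial_quotient_converges[OF SG_single[OF SG j] kfun_mono[OF f] char]
    unfolding partial_quotient_def[abs_def] by blast
  then have "joint I a (partial_quotient f j) s"
    by (intro joint_limit'[OF SG]) (intro kfun_partial_quotient[OF f] kfun_var)
  then show ?thesis by blast
qed

text \<open>
  Moving from \<open>y\<close> to \<open>x\<close> one coordinate at a time.
\<close>

lemma increment_bound:
  assumes J: "\<And>j. j < n \<Longrightarrow> joint {..<n} a (partial_quotient f j) (s j)" and c: "c \<noteq> 0"
  shows "\<exists>d. d \<noteq> 0 \<and> (\<forall>x y w. near {..<n} d a x \<longrightarrow> near {..<n} d a y \<longrightarrow> w \<noteq> 0 \<longrightarrow> (\<forall>i<n. v w \<le> v (x i - y i)) \<longrightarrow>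
    v (c * w) < v (f x - f y - (\<Sum>j<n. s j * (x j - y j))))"
proof -
  have "\<exists>d. \<forall>j\<in>{..<n}. d j \<noteq> 0 \<and> (\<forall>x. near {..<n} (d j) a x \<longrightarrow> (\<forall>\<eta>. \<eta> \<noteq> 0 \<longrightarrow> v (d j) < v \<eta> \<longrightarrow>
      v c < v (partial_quotient f j x \<eta> - s j)))"
    using J c unfolding joint_def by (intro bchoice) blast
  then obtain d where d: "\<And>j. j < n \<Longrightarrow> d j \<noteq> 0" "\<And>j x \<eta>. j < n \<Longrightarrow> near {..<n} (d j) a x \<Longrightarrow> \<eta> \<noteq> 0 \<Longrightarrow> v (d j) < v \<eta> \<Longrightarrow>
      v c < v (partial_quotient f j x \<eta> - s j)" by blast
  have "\<exists>D. D \<noteq> 0 \<and> (\<forall>j<k. v (d j) \<le> v D)" if "k \<le> n" for k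
    using that
  proof (induction k)
    case 0
    then show ?case by (intro exI[of _ 1]) simp
  next
    case (Suc k)
    then obtain D where D: "D \<noteq> 0" "\<forall>j<k. v (d j) \<le> v D" by auto
    obtain D' where "D' \<noteq> 0" "v D \<le> v D'" "v (d k) \<le> v D'" using v_max_ex[OF D(1) d(1)[of k]] Suc.prems by auto
    then show ?case using D(2) by (intro exI[of _ D']) (auto simp: less_Suc_eq intro: order_trans)
  qed
  then obtain D where D: "D \<noteq> 0" "\<And>j. j < n \<Longrightarrow> v (d j) \<le> v D" by blast
  have "v (c * w) < v (f x - f y - (\<Sum>j<n. s j * (x j - y j)))"
    if x: "near {..<n} D a x" and y: "near {..<n} D a y" and w: "w \<noteq> 0" "\<forall>i<n. v w \<le> v (x i - y i)" for x y w
  proof -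
    define z where "z j i = (if i < j then x i else y i)" for j i :: nat
    have z0: "z 0 = y" by (auto simp: z_def)
    have zn: "z n = x"
    proof
      show "z n i = x i" for i using x y unfolding z_def near_def by (cases "i < n") (auto split: if_splits)
    qed
    have znear: "near {..<n} D a (z j)" for j using x y unfolding near_def z_def by (auto split: if_splits)
    have zs: "z (Suc j) = (z j)(j := z j j + (x j - y j))" for j by (auto simp: z_def)
    have "(\<Sum>j<n. f (z (Suc j)) - f (z j)) = f x - f y"
      using sum_lessThan_telescope[of "\<lambda>j. f (z j)" n] zn z0 by simp
    then have "(\<Sum>j<n. f (z (Suc j)) - f (z j) - s j * (x j - y j)) = f x - f y - (\<Sum>j<n. s j * (x j - y j))"
      by (simp add: sum_subtractf)
    moreover have "v (c * w) < v (\<Sum>j<n. f (z (Suc j)) - f (z j) - s j * (x j - y j))"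
    proof (rule v_sum_less)
      show "c * w \<noteq> 0" using c w(1) by simp
      fix j assume "j \<in> {..<n}"
      then have j: "j < n" by simp
      let ?\<eta> = "x j - y j"
      show "v (c * w) < v (f (z (Suc j)) - f (z j) - s j * ?\<eta>)"
      proof (cases "?\<eta> = 0")
        case True
        then have "z (Suc j) = z j" unfolding zs by simp
        then show ?thesis using True v_less_Pinf[of "c * w"] c w(1) by simp
      next
        case False
        have "v D < v (x j - a j)" "v D < v (y j - a j)" using x y j unfolding near_def by (metis lessThan_iff)+
        then have "v D < v ?\<eta>" using v_trans_less[of "v D" "x j" "a j" "y j"] v_minus_commute[of "a j"] by simp
        then have "v c < v (partial_quotient f j (z j) ?\<eta> - s j)"
          using False D(2)[OF j] near_mono[OF znear D(2)[OF j]] by (intro d(2) j) (auto intro: le_less_trans)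
        then have "v (c * ?\<eta>) < v ((partial_quotient f j (z j) ?\<eta> - s j) * ?\<eta>)"
          using v_mult_less_iff[OF False] by blast
        moreover have "v (c * w) \<le> v (c * ?\<eta>)" using w(2) j v_mult_le_iff'[OF c] by blast
        moreover have "(partial_quotient f j (z j) ?\<eta> - s j) * ?\<eta> = f (z (Suc j)) - f (z j) - s j * ?\<eta>"
          unfolding partial_quotient_def zs using False by (simp add: left_diff_distrib[of _ "s j"])
        ultimately show ?thesis by simp
      qed
    qed
    ultimately show ?thesis by simp
  qed
  with D(1) show ?thesis by blast
qed

theorem generically_strictly_differentiable:
  fixes f :: "'a vec \<Rightarrow> 'a vec"
  assumes char: "CHAR('a) = 0" and U: "definable M n U" and f: "definable_map M n m U f"
  shows "\<exists>U\<^sub>0 \<subseteq> U. definable M n U\<^sub>0 \<and> open_vec v n U\<^sub>0 \<and>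
    (\<forall>a\<in>U\<^sub>0. strictly_differentiable_at v n m U f a) \<and> dp_rank M (U - U\<^sub>0) < ereal (real n)"
proof -
  obtain P where P: "D UNIV P" "U = {x \<in> carrier_vec n. P (assign x (\<lambda>_. 0))}"
    using definable_D[OF U] by blast
  define F where "F k e = (if P (trunc n e) then f (vec n e) $ k else 0)" for k e
  have Fk: "kfun UNIV (F k)" if "k < m" for k
    unfolding F_def[abs_def] using definable_map_kfun[OF P(1), of n m f k] f that unfolding P(2) by simp
  obtain A0 where A0: "countable A0" "D A0 P" using D_countable[OF P(1)] by blast
  have "\<exists>B. countable B \<and> kfun B (F k)" if "k < m" for k
    using D_countable[OF Fk[OF that, unfolded kfun_def]] unfolding kfun_def by blast
  then have "\<exists>B. \<forall>k\<in>{..<m}. countable (B k) \<and> kfun (B k) (F k)" by (intro bchoice ballI) simp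
  then obtain B where "\<forall>k\<in>{..<m}. countable (B k) \<and> kfun (B k) (F k)" by (rule exE)
  then have B: "countable (B k) \<and> kfun (B k) (F k)" if "k < m" for k using that by simp
  \<comment> \<open>Countable, as the extraction of indiscernible sequences requires, and containing
    0, so that the truncated coordinates of an assignment count as parameters.\<close>
  define A where "A = insert 0 (A0 \<union> (\<Union>k<m. B k))"
  have A: "countable A" unfolding A_def using A0(1) B by auto
  have PA: "D A P" by (rule D_mono[OF A0(2)]) (auto simp: A_def)
  have FA: "kfun A (F k)" if "k < m" for k by (rule kfun_mono[of "B k"]) (use B that in \<open>auto simp: A_def\<close>)
  define V where "V e \<longleftrightarrow> P (trunc n e) \<and> (\<forall>j\<in>{..<n}. \<forall>k\<in>{..<m}. \<exists>s. joint {..<n} e (partial_quotient (F k) j) s)" for e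
  have DV: "D A V"
    unfolding V_def[abs_def] using FA by (intro D_conj D_trunc[OF PA] D_finite_all D_joint finite_lessThan) auto
  \<comment> \<open>The interior of \<open>V\<close>. A generic point satisfying \<open>P\<close>
    satisfies \<open>V\<close>, and what holds at a generic point holds near it.\<close>
  define W where "W e \<longleftrightarrow> (\<exists>d. d \<noteq> 0 \<and> (\<forall>x. near {..<n} d e x \<longrightarrow> V x))" for e
  have DW: "D A W"
  proof -
    have "kfun A (\<lambda>e. if i \<in> {..<n} then e (2 * i) else e (Suc (Suc (2 * i))))" for i :: nat
      by (intro kfun_if D_const kfun_var)
    have "kfun A (\<lambda>e. if i \<in> {..<n} then e (2 * i) else e (Suc (2 * Suc i)))" for i :: nat
      by (intro kfun_if D_const kfun_var)
    from D_subst[OF DV, of "\<lambda>i e. if i \<in> {..<n} then e (2 * i) else e (Suc (2 * Suc i))", OF this]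
    show ?thesis
      unfolding W_def[abs_def] by (intro D_ex D_conj D_not D_eq D_all_near kfun_var kfun_0 finite_lessThan)
  qed
  have generic: "W e" if "SG A {..<n} e" "P (trunc n e)" for e
  proof -
    have "V e" unfolding V_def using that joint_partial_quotient[OF that(1) _ FA char] by auto
    from eventually_generic[OF that(1) DV this] show ?thesis unfolding W_def eventually_nhd .
  qed
  have WV: "V e" if "W e" for e using that near_refl unfolding W_def by blast
  define U0 where "U0 = {x \<in> carrier_vec n. W (assign x (\<lambda>_. 0))}"
  have near_assign: "near {..<n} d (assign x (\<lambda>_. 0)) (assign y (\<lambda>_. 0)) \<longleftrightarrow> (\<forall>i<n. v d < v (y $ i - x $ i))"
    if "x \<in> carrier_vec n" "y \<in> carrier_vec n" for d x y
    using that unfolding near_def by (auto simp: assign_def)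
  show ?thesis
  proof (intro exI[of _ U0] conjI ballI)
    show "U0 \<subseteq> U"
    proof
      fix x assume "x \<in> U0"
      then have x: "x \<in> carrier_vec n" "W (assign x (\<lambda>_. 0))" unfolding U0_def by auto
      then have "P (trunc n (assign x (\<lambda>_. 0)))" using WV unfolding V_def by blast
      then show "x \<in> U" unfolding P(2) using x(1) by (simp add: trunc_assign)
    qed
    show "definable M n U0" unfolding U0_def by (rule D_definable[OF DW])
    show "open_vec v n U0"
    proof (rule open_vecI)
      show "U0 \<subseteq> carrier_vec n" unfolding U0_def by blast
      fix x assume "x \<in> U0"
      then have x: "x \<in> carrier_vec n" "W (assign x (\<lambda>_. 0))" unfolding U0_def by auto
      then obtain d where d: "d \<noteq> 0" "\<And>y. near {..<n} d (assign x (\<lambda>_. 0)) y \<Longrightarrow> V y" unfolding W_def by blast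
      have "y \<in> U0" if y: "y \<in> carrier_vec n" "\<forall>i<n. v d < v (y $ i - x $ i)" for y
      proof -
        have n: "near {..<n} d (assign x (\<lambda>_. 0)) (assign y (\<lambda>_. 0))" using near_assign x(1) y by blast
        have "near {..<n} d (assign x (\<lambda>_. 0)) z" if z: "near {..<n} d (assign y (\<lambda>_. 0)) z" for z
          using n z v_trans_less unfolding near_def by (metis (no_types, lifting))
        then have "W (assign y (\<lambda>_. 0))" unfolding W_def using d by blast
        then show ?thesis unfolding U0_def using y(1) by simp
      qed
      with d(1) show "\<exists>d. d \<noteq> 0 \<and> (\<forall>y\<in>carrier_vec n. (\<forall>i<n. v d < v (y $ i - x $ i)) \<longrightarrow> y \<in> U0)" by blast
    qed
    show "strictly_differentiable_at v n m U f a" if a: "a \<in> U0" for a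
    proof -
      let ?a = "assign a (\<lambda>_. 0)"
      have ac: "a \<in> carrier_vec n" and "V ?a" using a WV unfolding U0_def by auto
      then have "\<exists>s. \<forall>k\<in>{..<m}. \<forall>j\<in>{..<n}. joint {..<n} ?a (partial_quotient (F k) j) (s k j)"
        unfolding V_def by (intro bchoice ballI) blast
      then obtain s where s: "\<And>k j. k < m \<Longrightarrow> j < n \<Longrightarrow> joint {..<n} ?a (partial_quotient (F k) j) (s k j)" by blast
      define L where "L x = vec m (\<lambda>k. \<Sum>j<n. s k j * x $ j)" for x
      have "linear_vec_map n m L"
        unfolding linear_vec_map_def L_def
        by (auto simp: sum.distrib distrib_left sum_distrib_left mult_ac intro!: eq_vecI sum.cong)
      moreover have "\<exists>\<delta>. \<forall>x\<in>U. \<forall>y\<in>U. x \<noteq> y \<and> Fin \<delta> < val_vec v (x - a) \<and> Fin \<delta> < val_vec v (y - a) \<longrightarrow>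
           Fin \<gamma> < val_vec v (f x - f y - L (x - y)) - val_vec v (x - y)" for \<gamma>
      proof -
        obtain c where c: "c \<noteq> 0" "v c = Fin \<gamma>" by (rule v_surj)
        define good where "good k d \<longleftrightarrow> (\<forall>x y w. near {..<n} d ?a x \<longrightarrow> near {..<n} d ?a y \<longrightarrow> w \<noteq> 0 \<longrightarrow>
          (\<forall>i<n. v w \<le> v (x i - y i)) \<longrightarrow> v (c * w) < v (F k x - F k y - (\<Sum>j<n. s k j * (x j - y j))))" for k d
        have good_mono: "good k d'" if "good k d" "v d \<le> v d'" for k d d'
          using that near_mono unfolding good_def by blast
        have "\<exists>d. d \<noteq> 0 \<and> (\<forall>k<l. good k d)" if "l \<le> m" for l
          using that
        proof (induction l)
          case 0
          then show ?case by (intro exI[of _ 1]) simp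
        next
          case (Suc l)
          then obtain d where d: "d \<noteq> 0" "\<forall>k<l. good k d" by auto
          obtain d1 where d1: "d1 \<noteq> 0" "good l d1"
            using increment_bound[of n ?a "F l" "s l" c] s c(1) Suc.prems unfolding good_def by auto
          obtain d2 where "d2 \<noteq> 0" "v d \<le> v d2" "v d1 \<le> v d2" using v_max_ex d(1) d1(1) by blast
          then show ?case using d(2) d1(2) good_mono by (intro exI[of _ d2]) (auto simp: less_Suc_eq)
        qed
        then obtain d where d: "d \<noteq> 0" "\<And>k. k < m \<Longrightarrow> good k d" by blast
        obtain \<delta> where \<delta>: "v d = Fin \<delta>" using d(1) by (rule v_cases)
        have "Fin \<gamma> < val_vec v (f x - f y - L (x - y)) - val_vec v (x - y)"
          if xy: "x \<in> U" "y \<in> U" "x \<noteq> y" "Fin \<delta> < val_vec v (x - a)" "Fin \<delta> < val_vec v (y - a)" for x y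
        proof -
          have xc: "x \<in> carrier_vec n" "y \<in> carrier_vec n" using xy unfolding P(2) by auto
          have fc: "f x \<in> carrier_vec m" "f y \<in> carrier_vec m" using f xy(1,2) unfolding definable_map_def by auto
          let ?x = "assign x (\<lambda>_. 0)" and ?y = "assign y (\<lambda>_. 0)"
          have nx: "near {..<n} d ?a ?x" "near {..<n} d ?a ?y"
            using xy(4,5) ac xc unfolding near_assign[OF ac xc(1)] near_assign[OF ac xc(2)] less_val_vec_iff \<delta> by auto
          have vecx: "vec n ?x = x" "vec n ?y = y" using xc by (auto simp: assign_def)
          have F: "F k ?x = f x $ k" "F k ?y = f y $ k" for k
            using xy(1,2) xc unfolding F_def P(2) vecx by (auto simp: trunc_assign)
          have "x - y \<noteq> 0\<^sub>v n"
          proof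
            assume *: "x - y = 0\<^sub>v n"
            have "x $ i = y $ i" if "i < n" for i
            proof -
              have "(x - y) $ i = 0" using * that by simp
              then show ?thesis using xc that by simp
            qed
            then show False using xc xy(3) by (auto intro: eq_vecI)
          qed
          moreover have "x - y \<in> carrier_vec n" using xc by simp
          \<comment> \<open>\<open>w\<close> has the valuation of \<open>x - y\<close>, so that the
            required bound can be stated with \<open>v (c * w)\<close>, without differences in the
            value group.\<close>
          ultimately obtain w where w: "w \<noteq> 0" "val_vec v (x - y) = v w" "\<forall>i<n. v w \<le> v ((x - y) $ i)"
            using val_vec_attained by blast
          obtain \<beta> where \<beta>: "v w = Fin \<beta>" using w(1) by (rule v_cases)
          have cw: "v (c * w) = Fin (\<gamma> + \<beta>)" using c(2) \<beta> by (simp add: v_mult)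
          have "Fin (\<gamma> + \<beta>) < val_vec v (f x - f y - L (x - y))"
            unfolding less_val_vec_iff
          proof (intro allI impI)
            fix k assume "k < dim_vec (f x - f y - L (x - y))"
            then have k: "k < m" by (simp add: L_def)
            have "v (c * w) < v (F k ?x - F k ?y - (\<Sum>j<n. s k j * (?x j - ?y j)))"
              by (rule d(2)[OF k, unfolded good_def, rule_format, OF nx w(1)]) (use w(3) xc in \<open>simp add: assign_def\<close>)
            also have "(\<Sum>j<n. s k j * (?x j - ?y j)) = L (x - y) $ k"
              using xc k by (auto simp: L_def assign_def intro!: sum.cong)
            also have "F k ?x - F k ?y - L (x - y) $ k = (f x - f y - L (x - y)) $ k"
              unfolding F using fc k by (simp add: L_def)
            finally show "Fin (\<gamma> + \<beta>) < v ((f x - f y - L (x - y)) $ k)" unfolding cw .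
          qed
          then show ?thesis unfolding w(2) \<beta>
            by (cases "val_vec v (f x - f y - L (x - y))") (auto simp: less_diff_eq)
        qed
        then show ?thesis by blast
      qed
      ultimately show ?thesis unfolding strictly_differentiable_at_def by blast
    qed
    show "dp_rank M (U - U0) < ereal (real n)"
    proof -
      have "k < n" if ict: "ict_pattern M (U - U0) k" for k
      proof (rule ccontr)
        assume "\<not> k < n"
        then have kn: "n \<le> k" by simp
        obtain \<phi> b where \<phi>: "\<forall>\<alpha><k. wf_fm M (\<phi> \<alpha>)"
          and pat: "\<forall>\<eta> :: nat \<Rightarrow> nat. \<exists>x\<in>U - U0. \<forall>\<alpha><k. \<forall>i. sat M (assign x (b \<alpha> i)) (\<phi> \<alpha>) \<longleftrightarrow> i = \<eta> \<alpha>"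
          using ict unfolding ict_pattern_def by (elim exE conjE) (rule that)
        define Y where "Y e \<longleftrightarrow> P (trunc n e) \<and> \<not> W (trunc n e)" for e
        define \<Phi> where "\<Phi> \<alpha> x b = sat M (\<lambda>i. if i < n then x i else b i) (\<phi> \<alpha>)" for \<alpha> and x b :: "nat \<Rightarrow> 'a"
        show False
        proof (rule no_pattern_algebraic[OF A, of Y n \<Phi> b])
          show "D A Y" unfolding Y_def[abs_def] by (intro D_conj D_not D_trunc PA DW)
          show "D A (\<lambda>e. \<Phi> \<alpha> (\<lambda>i. e (2 * i)) (\<lambda>i. e (Suc (2 * i))))" if "\<alpha> < n" for \<alpha>
          proof -
            have "wf_fm M (\<phi> \<alpha>)" using \<phi> that kn by simp
            from D_rename[OF D_sat[OF this], of A "\<lambda>i. if i < n then 2 * i else Suc (2 * i)"]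
            show ?thesis unfolding \<Phi>_def by (simp add: if_distrib cong: if_cong)
          qed
          show "\<Phi> \<alpha> x b = \<Phi> \<alpha> x' b" if "\<And>i. i < n \<Longrightarrow> x i = x' i" for \<alpha> x x' b
          proof -
            have "(\<lambda>i. if i < n then x i else b i) = (\<lambda>i. if i < n then x' i else b i)" using that by auto
            then show ?thesis unfolding \<Phi>_def by simp
          qed
          show "\<exists>x. Y x \<and> (\<forall>\<alpha><n. \<forall>i. \<Phi> \<alpha> x (b \<alpha> i) \<longleftrightarrow> i = \<eta> \<alpha>)" for \<eta>
          proof -
            obtain x where x: "x \<in> U - U0" "\<forall>\<alpha><k. \<forall>i. sat M (assign x (b \<alpha> i)) (\<phi> \<alpha>) \<longleftrightarrow> i = \<eta> \<alpha>"
              using pat by blast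
            then have xc: "x \<in> carrier_vec n" unfolding P(2) by blast
            have "Y (assign x (\<lambda>_. 0))" using x(1) xc unfolding Y_def P(2) U0_def by (simp add: trunc_assign)
            moreover have "(\<lambda>i. if i < n then assign x (\<lambda>_. 0) i else b i) = assign x b" for b
              using xc by (auto simp: assign_def)
            ultimately show ?thesis using x(2) kn unfolding \<Phi>_def by (intro exI[of _ "assign x (\<lambda>_. 0)"]) auto
          qed
          fix e assume e: "Y e"
          show "\<exists>i<n. e i \<in> acl (A \<union> e ` ({..<n} - {i}))"
          proof (rule ccontr)
            assume no: "\<not> ?thesis"
            have img: "trunc n e ` ({..<n} - {i}) = e ` ({..<n} - {i})" for i by (auto simp: trunc_def)
            have "SG A {..<n} (trunc n e)"
              unfolding SG_def img using no by (auto simp: trunc_def A_def)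
            moreover have "trunc n (trunc n e) = trunc n e" by (auto simp: trunc_def)
            ultimately have "W (trunc n e)" using e by (intro generic) (simp_all add: Y_def)
            then show False using e unfolding Y_def by blast
          qed
        qed
      qed
      \<comment> \<open>For \<open>n = 0\<close> there is no pattern at all; the supremum is then
        minus infinity, and the bound \<open>- 1\<close> still holds.\<close>
      then have "dp_rank M (U - U0) \<le> ereal (real n - 1)"
        unfolding dp_rank_def by (intro Sup_least) fastforce
      also have "\<dots> < ereal (real n)" by simp
      finally show ?thesis .
    qed
  qed
qed

end

theorem theorem9p4:
  fixes M :: "('f, 'r, 'a::alg_closed_field) fo_structure"
    and v :: "'a \<Rightarrow> 'g::linordered_ab_group_add extended"
    and t :: 'f
    and n m :: nat
    and U :: "'a vec set"
    and f :: "'a vec \<Rightarrow> 'a vec"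
  assumes "acvf_expansion M v"
    and "C_minimal M v"
    and "monster_model M"
    and "farity M t = 0" and "0 < v (fint M t [])"
    and "CHAR('a) = 0"
    and "definably_complete M v"
    and "definable M n U" and "open_vec v n U"
    and "definable_map M n m U f"
  shows "\<exists>U\<^sub>0 \<subseteq> U. definable M n U\<^sub>0 \<and> open_vec v n U\<^sub>0 \<and>
           (\<forall>a\<in>U\<^sub>0. strictly_differentiable_at v n m U f a) \<and>
           dp_rank M (U - U\<^sub>0) < ereal (real n)"
proof -
  have val: "valuation v" using assms(1) unfolding acvf_expansion_def by blast
  have val: "v x = Pinf \<longleftrightarrow> x = 0" "v (x * y) = v x + v y" "v x \<noteq> Minf" for x y
  proof -
    show "v x = Pinf \<longleftrightarrow> x = 0" "v (x * y) = v x + v y" using val unfolding valuation_def by blast+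
    have "v x \<in> insert Pinf (range Fin)" using val unfolding valuation_def by blast
    then show "v x \<noteq> Minf" by auto
  qed
  obtain x where x: "x \<noteq> 0" "v x \<noteq> 0"
    using assms(1) unfolding acvf_expansion_def nontrivial_valuation_def by blast
  have "\<exists>\<pi>. \<pi> \<noteq> 0 \<and> 0 < v \<pi>"
  proof (cases "0 < v x")
    case True
    with x(1) show ?thesis by blast
  next
    case False
    obtain \<alpha> \<beta> \<gamma> where \<gamma>: "v x = Fin \<gamma>" "v (1 / x) = Fin \<beta>" "v 1 = Fin \<alpha>"
      using val(1)[of x] val(1)[of "1 / x"] val(1)[of 1] val(3)[of x] val(3)[of "1 / x"] val(3)[of 1] x(1)
      by (cases "v x"; cases "v (1 / x)"; cases "v 1") auto
    have "Fin (\<alpha> + \<alpha>) = Fin \<alpha>" using val(2)[of 1 1] \<gamma>(3) by simp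
    moreover have "Fin (\<gamma> + \<beta>) = Fin \<alpha>" using val(2)[of x "1 / x"] \<gamma> x(1) by simp
    moreover have "\<gamma> < 0" using False x(2) \<gamma>(1) by (auto simp: zero_extended_def)
    ultimately have "0 < \<beta>" by (metis add.right_neutral add_cancel_left_left add_less_cancel_left extended.inject)
    with \<gamma>(2) x(1) show ?thesis by (intro exI[of _ "1 / x"]) (simp add: zero_extended_def)
  qed
  then obtain \<pi> where \<pi>: "\<pi> \<noteq> 0" "0 < v \<pi>" by blast
  interpret complete_acvf M \<pi> v
    using assms(1-3,7) \<pi> by unfold_locales
  show ?thesis using generically_strictly_differentiable[OF assms(6,8,10)] .
qed

end
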